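(* Let $K$ be a totally real quartic number field with fundamental discriminant. If $L$ is a tamely ramified number field such that there exists an isomorphism of quadratic modules $$(O_K^0,\mathrm{tr}_{K/\mathbb{Q}})\cong(O_L^0,\mathrm{tr}_{L/\mathbb{Q}}),$$ then $K\cong L$.
   Context: For a number field $K$, $O_K$ is its ring of integers and $O_K^0:=\{x\in O_K:\mathrm{tr}_{K/\mathbb{Q}}(x)=0\}$. The pair $(O_K^0,\mathrm{tr}_{K/\mathbb{Q}})$ denotes the quadratic $\mathbb{Z}$-module obtained by restricting the trace pairing $(x,y)\mapsto \mathrm{tr}_{K/\mathbb{Q}}(xy)$ to $O_K^0$. An isomorphism (isometry) of quadratic $\mathbb{Z}$-modules is an isomorphism of $\mathbb{Z}$-modules preserving the bilinear forms. An integer $D$ is a fundamental discriminant if either $D\equiv 1\pmod 4$ and $D$ is square free, or $D=4m$ with $m$ square free and $m\equiv 2,3\pmod 4$; a number field has fundamental discriminant if its (absolute) discriminant is a fundamental discriminant. A number field is tamely ramified if no rational prime ramifies wildly in it. *)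

theory Defs
  imports
    "HOL-Computational_Algebra.Computational_Algebra"
    "HOL-Algebra.Ideal_Product"
    "HOL-Algebra.QuotRing"
    "Jordan_Normal_Form.Determinant"
begin

text \<open>
  A number field is a subset \<open>K\<close> of some type of class \<open>field_char_0\<close> that is a subfield of
  finite degree over the rationals. The ambient type is arbitrary, so subfields of \<open>complex\<close>
  and abstract fields (\<open>K = UNIV\<close>) are both instances.
\<close>

definition ring_on :: "'a::comm_ring_1 set \<Rightarrow> 'a ring" where
  "ring_on S = \<lparr>carrier = S, monoid.mult = (*), one = 1, ring.zero = 0, add = (+)\<rparr>"

global_interpretation rat_vs: vector_space "\<lambda>(q::rat) (x::'a::field_char_0). of_rat q * x"
  by unfold_locales (simp_all add: algebra_simps of_rat_add of_rat_mult)

global_interpretation int_mod: Modules.module "\<lambda>(n::int) (x::'a::field_char_0). of_int n * x"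
  by unfold_locales (simp_all add: algebra_simps)

definition rat_basis :: "'a::field_char_0 set \<Rightarrow> 'a set \<Rightarrow> bool" where
  "rat_basis K B \<longleftrightarrow> finite B \<and> rat_vs.independent B \<and> rat_vs.span B = K"

definition number_field :: "'a::field_char_0 set \<Rightarrow> bool" where
  "number_field K \<longleftrightarrow> Ring.field (ring_on K) \<and> (\<exists>B. rat_basis K B)"

definition degree_over_rat :: "'a::field_char_0 set \<Rightarrow> nat" where
  "degree_over_rat K = rat_vs.dim K"

text \<open>
  The trace of the \<open>\<rat>\<close>-linear map \<open>y \<mapsto> x * y\<close> on \<open>K\<close>, read off from its matrix
  in a basis; its value does not depend on the basis chosen.
\<close>

definition field_trace :: "'a::field_char_0 set \<Rightarrow> 'a \<Rightarrow> rat" where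
  "field_trace K x =
     (let B = (SOME B. rat_basis K B) in \<Sum>b\<in>B. rat_vs.representation B (x * b) b)"

definition integers_of :: "'a::field_char_0 set \<Rightarrow> 'a set" where
  "integers_of K = {x \<in> K. algebraic_int x}"

definition trace_zero_integers :: "'a::field_char_0 set \<Rightarrow> 'a set" where
  "trace_zero_integers K = {x \<in> integers_of K. field_trace K x = 0}"

definition trace_form :: "'a::field_char_0 set \<Rightarrow> 'a \<Rightarrow> 'a \<Rightarrow> rat" where
  "trace_form K x y = field_trace K (x * y)"

definition isometric ::
  "'a::ab_group_add set \<Rightarrow> ('a \<Rightarrow> 'a \<Rightarrow> rat) \<Rightarrow> 'b::ab_group_add set \<Rightarrow> ('b \<Rightarrow> 'b \<Rightarrow> rat) \<Rightarrow> bool" where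
  "isometric M b N c \<longleftrightarrow>
     (\<exists>\<phi>. bij_betw \<phi> M N \<and>
          (\<forall>x\<in>M. \<forall>y\<in>M. \<phi> (x + y) = \<phi> x + \<phi> y) \<and>
          (\<forall>x\<in>M. \<forall>y\<in>M. c (\<phi> x) (\<phi> y) = b x y))"

definition integral_basis :: "'a::field_char_0 set \<Rightarrow> 'a list \<Rightarrow> bool" where
  "integral_basis K bs \<longleftrightarrow>
     distinct bs \<and> int_mod.independent (set bs) \<and> int_mod.span (set bs) = integers_of K"

text \<open>
  The determinant below is an integer independent of the integral basis, so \<open>THE\<close> is
  well defined for every number field.
\<close>

definition field_discriminant :: "'a::field_char_0 set \<Rightarrow> int" where
  "field_discriminant K =
     (THE d. \<exists>bs. integral_basis K bs \<and>
        of_int d = det (mat (length bs) (length bs) (\<lambda>(i, j). trace_form K (bs ! i) (bs ! j))))"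

definition fundamental_discriminant :: "int \<Rightarrow> bool" where
  "fundamental_discriminant D \<longleftrightarrow>
     (D mod 4 = 1 \<and> squarefree D) \<or>
     (\<exists>m. D = 4 * m \<and> squarefree m \<and> m mod 4 \<in> {2, 3})"

definition totally_real :: "'a::field_char_0 set \<Rightarrow> bool" where
  "totally_real K \<longleftrightarrow>
     (\<forall>\<sigma> \<in> Ring.ring_hom (ring_on K) (ring_on (UNIV :: complex set)). \<sigma> ` K \<subseteq> \<real>)"

text \<open>
  The exponent of the prime ideal \<open>P\<close> in the factorisation of the principal ideal generated
  by \<open>p\<close> in the ring of integers of \<open>K\<close>.
\<close>

definition ramification_index :: "'a::field_char_0 set \<Rightarrow> 'a set \<Rightarrow> nat \<Rightarrow> nat" where
  "ramification_index K P p =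
     (let R = ring_on (integers_of K) in
      GREATEST e. \<exists>J. ideal J R \<and> PIdl\<^bsub>R\<^esub> (of_nat p) = (P [^]\<^bsub>ideals_set R\<^esub> e) \<cdot>\<^bsub>R\<^esub> J)"

text \<open>
  Residue fields of number fields are finite, hence perfect, so wild ramification at \<open>P\<close> only
  means that the residue characteristic divides the ramification index.
\<close>

definition tamely_ramified :: "'a::field_char_0 set \<Rightarrow> bool" where
  "tamely_ramified K \<longleftrightarrow>
     (\<forall>(p::nat) P. prime p \<longrightarrow> primeideal P (ring_on (integers_of K)) \<longrightarrow> of_nat p \<in> P \<longrightarrow>
            \<not> p dvd ramification_index K P p)"

end

theory Submission
  imports Defs "Jordan_Normal_Form.Schur_Decomposition" "HOL-Library.Z2"
begin

text \<open>
  Since \<open>K\<close> is totally real its trace form is positive definite, and an isometry of the trace zero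
  lattices extends, by sending 1 to 1, to a rational isometry \<open>\<Phi>\<close> from \<open>K\<close> onto \<open>L\<close>; in particular \<open>L\<close> has degree 4 and a positive definite trace form as well. The isometry
  \<open>\<Psi> x = tr x / 2 - \<Phi> x\<close> extends the negative of the given one. The claim is that one of \<open>\<Phi>\<close> and
  \<open>\<Psi>\<close> is multiplicative.

  The multiplication of a field is encoded in the trilinear form \<open>T (x, y, z) = tr (x * y * z)\<close>, and
  \<open>\<Phi>\<close> is multiplicative as soon as \<open>T' (x, y, z) = tr (\<Phi> x * \<Phi> y * \<Phi> z)\<close> equals \<open>T\<close>. The trace
  form induces a positive definite pairing of trilinear forms, for which \<open>T\<close> and \<open>T'\<close> both have norm
  4, the degree. Hence the pairing \<open>S\<close> of \<open>T\<close> and \<open>T'\<close> is at most 4, with equality only for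
  \<open>T = T'\<close> (\<open>pairing_le\<close>). Passing from \<open>\<Phi>\<close> to \<open>\<Psi>\<close> replaces \<open>S\<close> by \<open>5 - S\<close>
  (\<open>pairing_reflected\<close>), so \<open>S\<close> lies between 1 and 4.

  Suppose now that \<open>\<Phi>\<close> maps the integers of \<open>K\<close> onto those of \<open>L\<close> and that the discriminant \<open>D\<close> is
  squarefree. A priori \<open>S\<close> has denominator a power of \<open>D\<close>, because dual bases occur in the pairing, but
  the dual lattice is cyclic modulo the integers, and if \<open>z\<close> is \<open>D\<close> times a generator, \<open>T\<close> and \<open>T'\<close> are
  divisible by \<open>D\<close> at every triple of integers containing \<open>z\<close>. This makes \<open>S\<close>
  an integer. Modulo 3 a symmetric triple sum depends on its diagonal only, and
  \<open>tr (x ^ 3) = tr x\<close> modulo 3; so \<open>S\<close> is congruent to the norm 4 of \<open>T\<close>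
  (\<open>pairing_integral\<close>). Therefore \<open>S\<close> is 4 or 1, and \<open>\<Phi>\<close> or \<open>\<Psi>\<close> is a ring isomorphism.

  It remains to see that the rings of integers correspond and that \<open>D\<close> is odd. In both fields there is an
  integer \<open>f\<close> of trace 1: for \<open>K\<close> because of the shape of \<open>D\<close>, for \<open>L\<close> by tameness at 2. The
  integers are generated by \<open>f\<close> and the trace zero lattice, and the vector \<open>1 - 4 * f\<close> of that lattice
  pairs with the lattice in multiples of 4. For \<open>D\<close> congruent to 1 modulo 4 this determines the
  vector modulo 4 up to sign, so one of \<open>\<Phi>\<close> and \<open>\<Psi>\<close> respects the integers (\<open>alignment\<close>).
  If \<open>D = 4 * m\<close>, tameness of \<open>L\<close> makes the norms of certain vectors divisible by 4, and the Gram
  determinant then shows that \<open>m\<close> is a square modulo 4, contrary to the definition of a fundamental discriminant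
  (\<open>even_discriminant\<close>).

  Tameness enters through a single consequence: if all traces from the ideal generated by an integer \<open>u\<close> are
  even, then \<open>u\<close> is nilpotent modulo 2. Otherwise some prime \<open>P\<close> above 2 does not contain \<open>u\<close>; its
  ramification index is odd, and the trace form modulo 2 would have to be nonzero on the component of the
  ring at \<open>P\<close> (\<open>odd_ramification\<close>).
\<close>


section \<open>Algebraic integers\<close>

lemma monic_root_algebraic_int:
  fixes x :: "'a::field_char_0"
  assumes "monic p" "poly (map_poly of_int p) x = 0"
  shows "algebraic_int x"
  unfolding algebraic_int_altdef_ipoly using assms by auto

lemma row_eigen_root_char_poly:
  fixes y :: "'a::field" and c :: "nat \<Rightarrow> 'a"
  assumes M: "M \<in> carrier_mat n n"
    and ev: "\<And>j. j < n \<Longrightarrow> y * c j = (\<Sum>i<n. M $$ (i,j) * c i)"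
    and nz: "i0 < n" "c i0 \<noteq> 0"
  shows "poly (char_poly M) y = 0"
proof -
  let ?A = "transpose_mat M"
  have A: "?A \<in> carrier_mat n n" using M by simp
  have "eigenvector ?A (vec n c) y"
    unfolding eigenvector_def
  proof (intro conjI)
    show "vec n c \<in> carrier_vec (dim_row ?A)" using M by simp
    show "vec n c \<noteq> 0\<^sub>v (dim_row ?A)"
    proof
      assume "vec n c = 0\<^sub>v (dim_row ?A)"
      then have "vec n c $ i0 = 0\<^sub>v n $ i0" using M by simp
      then show False using nz by simp
    qed
    show "?A *\<^sub>v vec n c = y \<cdot>\<^sub>v vec n c"
    proof (rule eq_vecI)
      fix j assume "j < dim_vec (y \<cdot>\<^sub>v vec n c)"
      then have j: "j < n" by simp
      show "(?A *\<^sub>v vec n c) $ j = (y \<cdot>\<^sub>v vec n c) $ j"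
        using M j ev[OF j] by (simp add: scalar_prod_def atLeast0LessThan)
    qed (use M in simp)
  qed
  then have "eigenvalue ?A y" unfolding eigenvalue_def by blast
  then show ?thesis using eigenvalue_root_char_poly[OF A] char_poly_transpose_mat[OF M] by simp
qed

text \<open>The determinant trick: \<open>y\<close> is a root of the characteristic polynomial of the integer
  matrix by which it acts on the generators \<open>S\<close>.\<close>

lemma stable_algebraic_int:
  fixes y :: "'a::field_char_0"
  assumes S: "finite S" "s0 \<in> S" "s0 \<noteq> 0"
    and st: "\<And>s. s \<in> S \<Longrightarrow> y * s \<in> int_mod.span S"
  shows "algebraic_int y"
proof -
  obtain f :: "nat \<Rightarrow> 'a" and n where f: "bij_betw f {..<n} S"
    using ex_bij_betw_nat_finite[OF S(1)] by (auto simp: atLeast0LessThan)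
  have "\<exists>u. y * s = (\<Sum>v\<in>S. of_int (u v) * v)" if "s \<in> S" for s
    using st[OF that] unfolding int_mod.span_finite[OF S(1)] by auto
  then obtain u where u: "\<And>s. s \<in> S \<Longrightarrow> y * s = (\<Sum>v\<in>S. of_int (u s v) * v)" by metis
  define M where "M = mat n n (\<lambda>(i,j). u (f j) (f i))"
  have M: "M \<in> carrier_mat n n" unfolding M_def by simp
  have ev: "y * f j = (\<Sum>i<n. map_mat of_int M $$ (i,j) * f i)" if j: "j < n" for j
  proof -
    have "f j \<in> S" using f j by (auto simp: bij_betw_def)
    then have "y * f j = (\<Sum>v\<in>S. of_int (u (f j) v) * v)" by (rule u)
    also have "\<dots> = (\<Sum>i<n. of_int (u (f j) (f i)) * f i)"
      by (rule sum.reindex_bij_betw[OF f, symmetric])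
    finally show ?thesis using j by (simp add: M_def)
  qed
  obtain i0 where i0: "i0 < n" "f i0 = s0" using f S(2) by (auto simp: bij_betw_def)
  have "poly (char_poly (map_mat of_int M)) y = 0"
    by (rule row_eigen_root_char_poly[of _ n, OF _ ev i0(1)]) (use M i0 S in auto)
  then have "poly (map_poly of_int (char_poly M)) y = 0"
    by (simp add: of_int_hom.char_poly_hom[OF M])
  then show ?thesis using degree_monic_char_poly[OF M] monic_root_algebraic_int by blast
qed

lemma int_span_mult:
  fixes y :: "'a::field_char_0"
  assumes "x \<in> int_mod.span S" "\<And>s. s \<in> S \<Longrightarrow> y * s \<in> int_mod.span T"
  shows "y * x \<in> int_mod.span T"
  using assms(1)
proof (induction rule: int_mod.span_induct_alt)
  case base then show ?case by (simp add: int_mod.span_zero)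
next
  case (step c s z)
  have "y * (of_int c * s + z) = of_int c * (y * s) + y * z" by (simp add: algebra_simps)
  then show ?case using step assms(2) by (simp add: int_mod.span_add int_mod.span_scale)
qed

text \<open>A monic equation of degree \<open>n\<close> expresses the \<open>n\<close>-th power by the lower ones; by the determinant trick this
  is all that closure under sums and products needs.\<close>

lemma algebraic_int_power_span:
  fixes x :: "'a::field_char_0"
  assumes "algebraic_int x"
  obtains n where "n > 0" "x ^ n \<in> int_mod.span ((\<lambda>i. x ^ i) ` {..<n})"
proof -
  obtain p where p: "poly (map_poly of_int p) x = 0" "lead_coeff p = 1"
    using assms unfolding algebraic_int_altdef_ipoly by auto
  let ?n = "degree p"
  have "0 = (\<Sum>i\<le>?n. of_int (coeff p i) * x ^ i)"
    using p(1) by (simp add: poly_altdef)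
  also have "\<dots> = x ^ ?n + (\<Sum>i<?n. of_int (coeff p i) * x ^ i)"
    using p(2) by (simp add: lessThan_Suc_atMost[symmetric])
  finally have "x ^ ?n = (\<Sum>i<?n. of_int (- coeff p i) * x ^ i)"
    by (simp add: sum_negf eq_neg_iff_add_eq_0)
  moreover have "\<dots> \<in> int_mod.span ((\<lambda>i. x ^ i) ` {..<?n})"
    by (intro int_mod.span_sum int_mod.span_scale int_mod.span_base) auto
  ultimately have "x ^ ?n \<in> int_mod.span ((\<lambda>i. x ^ i) ` {..<?n})" by simp
  moreover have "?n > 0"
  proof (rule ccontr)
    assume "\<not> ?n > 0"
    then obtain c where "p = [:c:]" using degree_eq_zeroE by blast
    then show False using p by simp
  qed
  ultimately show ?thesis using that by blast
qed

lemma algebraic_int_add_mult: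
  fixes x y :: "'a::field_char_0"
  assumes "algebraic_int x" "algebraic_int y"
  shows "algebraic_int (x + y)" "algebraic_int (x * y)"
proof -
  obtain n where n: "n > 0" "x ^ n \<in> int_mod.span ((\<lambda>i. x ^ i) ` {..<n})"
    using algebraic_int_power_span[OF assms(1)] by blast
  obtain m where m: "m > 0" "y ^ m \<in> int_mod.span ((\<lambda>i. y ^ i) ` {..<m})"
    using algebraic_int_power_span[OF assms(2)] by blast
  define S where "S = (\<lambda>(i,j). x ^ i * y ^ j) ` ({..<n} \<times> {..<m})"
  have inS: "x ^ i * y ^ j \<in> S" if "i < n" "j < m" for i j
    unfolding S_def using that by (auto intro!: image_eqI[where x="(i,j)"])
  have xS: "x * s \<in> int_mod.span S" if "s \<in> S" for s
  proof -
    from that obtain i j where ij: "s = x ^ i * y ^ j" "i < n" "j < m" unfolding S_def by auto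
    show ?thesis
    proof (cases "Suc i < n")
      case True
      have e: "x * s = x ^ Suc i * y ^ j" using ij by simp
      show ?thesis unfolding e using True ij inS by (intro int_mod.span_base) blast
    next
      case False
      then have "Suc i = n" using ij by simp
      then have e: "x * s = y ^ j * x ^ n" using ij by (auto simp: ac_simps)
      show ?thesis unfolding e
      proof (rule int_span_mult[OF n(2)])
        fix r assume "r \<in> (\<lambda>i. x ^ i) ` {..<n}"
        then obtain k where k: "k < n" "r = x ^ k" by auto
        then have "y ^ j * r = x ^ k * y ^ j" by (simp only: mult.commute)
        then show "y ^ j * r \<in> int_mod.span S" using inS[OF k(1) ij(3)] int_mod.span_base by metis
      qed
    qed
  qed
  have yS: "y * s \<in> int_mod.span S" if "s \<in> S" for s
  proof -
    from that obtain i j where ij: "s = x ^ i * y ^ j" "i < n" "j < m" unfolding S_def by auto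
    show ?thesis
    proof (cases "Suc j < m")
      case True
      have e: "y * s = x ^ i * y ^ Suc j" using ij by simp
      show ?thesis unfolding e using True ij inS by (intro int_mod.span_base) blast
    next
      case False
      then have "Suc j = m" using ij by simp
      then have e: "y * s = x ^ i * y ^ m" using ij by (auto simp: ac_simps)
      show ?thesis unfolding e
        by (rule int_span_mult[OF m(2)]) (use inS ij in \<open>auto intro!: int_mod.span_base\<close>)
    qed
  qed
  have fin: "finite S" and one: "1 \<in> S" "1 \<noteq> (0::'a)"
    using inS[of 0 0] n(1) m(1) unfolding S_def by auto
  show "algebraic_int (x + y)"
    by (rule stable_algebraic_int[OF fin one]) (simp add: xS yS int_mod.span_add distrib_right)
  show "algebraic_int (x * y)"
  proof (rule stable_algebraic_int[OF fin one])
    fix s assume "s \<in> S"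
    then have "x * (y * s) \<in> int_mod.span S" using int_span_mult[OF yS xS] by blast
    then show "x * y * s \<in> int_mod.span S" by (simp add: mult.assoc)
  qed
qed

lemma algebraic_int_sum_list:
  fixes xs :: "'a::field_char_0 list"
  shows "(\<And>x. x \<in> set xs \<Longrightarrow> algebraic_int x) \<Longrightarrow> algebraic_int (sum_list xs)"
proof (induction xs)
  case (Cons a xs)
  then show ?case using algebraic_int_add_mult(1)[of a "sum_list xs"] by simp
qed simp

section \<open>Number fields and the trace\<close>

locale numfield =
  fixes K :: "'a::field_char_0 set"
  assumes nf: "number_field K"
begin

definition B :: "'a set" where "B = (SOME B. rat_basis K B)"

lemma B: "finite B" "rat_vs.independent B" "rat_vs.span B = K"
proof -
  have "rat_basis K B" unfolding B_def using nf unfolding number_field_def by (metis someI_ex)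
  then show "finite B" "rat_vs.independent B" "rat_vs.span B = K" unfolding rat_basis_def by auto
qed

lemma fieldK: "Ring.field (ring_on K)" using nf unfolding number_field_def by simp

lemma K_add [intro]: "x \<in> K \<Longrightarrow> y \<in> K \<Longrightarrow> x + y \<in> K"
  using rat_vs.span_add[of x B y] B by simp
lemma K_0 [simp, intro]: "0 \<in> K" using rat_vs.span_zero B by metis
lemma K_scale [intro]: "x \<in> K \<Longrightarrow> of_rat q * x \<in> K"
  using rat_vs.span_scale[of x B] B by simp
lemma K_minus [intro]: "x \<in> K \<Longrightarrow> - x \<in> K"
  using rat_vs.span_neg[of x B] B by simp
lemma K_diff [intro]: "x \<in> K \<Longrightarrow> y \<in> K \<Longrightarrow> x - y \<in> K"
  using rat_vs.span_diff[of x B y] B by simp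
lemma K_sum [intro]: "(\<And>i. i \<in> A \<Longrightarrow> f i \<in> K) \<Longrightarrow> sum f A \<in> K"
  by (induction A rule: infinite_finite_induct) auto

lemma K_mult [intro]: "x \<in> K \<Longrightarrow> y \<in> K \<Longrightarrow> x * y \<in> K"
proof -
  interpret F: Ring.field "ring_on K" by (rule fieldK)
  show "x \<in> K \<Longrightarrow> y \<in> K \<Longrightarrow> x * y \<in> K" using F.m_closed by (simp add: ring_on_def)
qed

lemma K_1 [simp, intro]: "1 \<in> K"
proof -
  interpret F: Ring.field "ring_on K" by (rule fieldK)
  show ?thesis using F.one_closed by (simp add: ring_on_def)
qed

lemma K_rat [simp, intro]: "of_rat q \<in> K" using K_scale[OF K_1, of q] by simp
lemma K_int [simp, intro]: "of_int q \<in> K" using K_rat[of "of_int q"] by simp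
lemma K_nat [simp, intro]: "of_nat q \<in> K" using K_rat[of "of_nat q"] by simp
lemma K_numeral [simp, intro]: "numeral q \<in> K" using K_nat[of "numeral q"] by simp
lemma K_pow [intro]: "x \<in> K \<Longrightarrow> x ^ n \<in> K" by (induction n) auto

lemma K_inverse [intro]: assumes "x \<in> K" shows "inverse x \<in> K"
proof (cases "x = 0")
  case False
  interpret F: Ring.field "ring_on K" by (rule fieldK)
  have "x \<in> Units (ring_on K)" using F.field_Units False assms by (simp add: ring_on_def)
  then obtain y where "y \<in> K" "x * y = 1" unfolding Units_def by (auto simp: ring_on_def mult.commute)
  then show ?thesis using False by (metis inverse_unique)
qed (use assms in simp)

lemma K_divide [intro]: "x \<in> K \<Longrightarrow> y \<in> K \<Longrightarrow> x / y \<in> K"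
  unfolding divide_inverse by blast

definition rep :: "'a \<Rightarrow> 'a \<Rightarrow> rat" where "rep = rat_vs.representation B"

lemma rep_sum: "x \<in> K \<Longrightarrow> x = (\<Sum>b\<in>B. of_rat (rep x b) * b)"
  using rat_vs.sum_representation_eq[of B x B] B unfolding rep_def by auto
lemma rep_add: "x \<in> K \<Longrightarrow> y \<in> K \<Longrightarrow> rep (x + y) b = rep x b + rep y b"
  using rat_vs.representation_add[of B y x] B unfolding rep_def by auto
lemma rep_scale: "x \<in> K \<Longrightarrow> rep (of_rat q * x) b = q * rep x b"
  using rat_vs.representation_scale[of B x q] B unfolding rep_def by auto
lemma rep_basis: "a \<in> B \<Longrightarrow> rep a b = (if b = a then 1 else 0)"
  using rat_vs.representation_basis[of B a] B unfolding rep_def by auto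

abbreviation tr :: "'a \<Rightarrow> rat" where "tr \<equiv> field_trace K"

lemma tr_rep: "tr x = (\<Sum>b\<in>B. rep (x * b) b)"
  unfolding field_trace_def rep_def B_def Let_def by simp

lemma B_in_K [intro]: "b \<in> B \<Longrightarrow> b \<in> K" using B rat_vs.span_base by metis

lemma tr_add: "x \<in> K \<Longrightarrow> y \<in> K \<Longrightarrow> tr (x + y) = tr x + tr y"
  unfolding tr_rep by (auto simp: distrib_right rep_add K_mult B_in_K sum.distrib intro!: sum.cong)
lemma tr_scale: "x \<in> K \<Longrightarrow> tr (of_rat q * x) = q * tr x"
  unfolding tr_rep sum_distrib_left by (auto simp: mult.assoc rep_scale K_mult B_in_K intro!: sum.cong)
lemma tr_0: "tr 0 = 0" using tr_scale[of 0 0] by simp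
lemma tr_minus: "x \<in> K \<Longrightarrow> tr (- x) = - tr x" using tr_scale[of x "-1"] by simp
lemma tr_diff: "x \<in> K \<Longrightarrow> y \<in> K \<Longrightarrow> tr (x - y) = tr x - tr y"
  using tr_add[of x "- y"] tr_minus[of y] by auto
lemma tr_int_mult: "x \<in> K \<Longrightarrow> tr (of_int q * x) = of_int q * tr x" using tr_scale[of x "of_int q"] by simp
lemma tr_sum: "(\<And>i. i \<in> A \<Longrightarrow> f i \<in> K) \<Longrightarrow> tr (sum f A) = (\<Sum>i\<in>A. tr (f i))"
  by (induction A rule: infinite_finite_induct) (auto simp: tr_0 tr_add K_sum)
lemma tr_1: "tr 1 = of_nat (card B)"
  unfolding tr_rep by (simp add: rep_basis)
lemma tr_rat: "tr (of_rat q) = q * of_nat (card B)" using tr_scale[OF K_1, of q] tr_1 by simp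

lemma card_B: "card B = degree_over_rat K"
  unfolding degree_over_rat_def using rat_vs.dim_eq_card[of B K] B by (metis rat_vs.span_span)

lemma card_B_pos: "card B > 0"
proof (rule ccontr)
  assume "\<not> card B > 0"
  then have "B = {}" using B by simp
  then have "K = {0}" using B by auto
  then show False using K_1 by simp
qed


lemma rep_sum_dist: "(\<And>i. i \<in> A \<Longrightarrow> f i \<in> K) \<Longrightarrow> rep (sum f A) b = (\<Sum>i\<in>A. rep (f i) b)"
proof (induction A rule: infinite_finite_induct)
  case (insert a F)
  then show ?case by (simp add: rep_add K_sum)
qed (use rep_scale[of 0 0] in auto)

definition rational_linear :: "('a \<Rightarrow> 'c::field_char_0) \<Rightarrow> bool" where
  "rational_linear f \<longleftrightarrow> (\<forall>y\<in>K. \<forall>z\<in>K. f (y + z) = f y + f z) \<and> (\<forall>q. \<forall>y\<in>K. f (of_rat q * y) = of_rat q * f y)"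

lemma rational_linear_sum:
  assumes "rational_linear f" "\<And>i. i \<in> A \<Longrightarrow> g i \<in> K"
  shows "f (sum g A) = (\<Sum>i\<in>A. f (g i))"
proof -
  have 0: "f 0 = 0" using assms(1) unfolding rational_linear_def by (metis K_0 mult_zero_left of_rat_0)
  show ?thesis using assms(2)
  proof (induction A rule: infinite_finite_induct)
    case (insert a F)
    then have "f (g a + sum g F) = f (g a) + f (sum g F)"
      using assms(1) K_sum[of F g] unfolding rational_linear_def by auto
    then show ?case using insert by simp
  qed (auto simp: 0)
qed

text \<open>Row eigenvectors of the multiplication matrix, seen as functionals. They replace the embeddings of \<open>K\<close> into
  the complex numbers wherever multiplicativity is not at stake.\<close>

definition eigen_functional :: "'a \<Rightarrow> complex \<Rightarrow> ('a \<Rightarrow> complex) \<Rightarrow> bool" where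
  "eigen_functional x a f \<longleftrightarrow> rational_linear f \<and> (\<exists>y\<in>K. f y \<noteq> 0) \<and> (\<forall>y\<in>K. f (x * y) = a * f y)"

definition bl :: "'a list" where "bl = (SOME bs. set bs = B \<and> distinct bs)"

lemma bl: "set bl = B" "distinct bl" "length bl = card B"
proof -
  have "set bl = B \<and> distinct bl" unfolding bl_def using finite_distinct_list[OF B(1)] by (metis (mono_tags, lifting) someI_ex)
  then show "set bl = B" "distinct bl" "length bl = card B" by (auto dest: distinct_card)
qed

lemma bl_nth [simp]: "i < card B \<Longrightarrow> bl ! i \<in> B" using bl by (metis nth_mem)

lemma sum_B: "(\<Sum>b\<in>B. g b) = (\<Sum>i<card B. g (bl ! i))"
  using sum.reindex_bij_betw[of "nth bl" "{..<card B}" B g] bij_betw_nth[OF bl(2)] bl by simp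

definition mulmat :: "'a \<Rightarrow> rat mat" where
  "mulmat x = mat (card B) (card B) (\<lambda>(i,j). rep (x * bl ! j) (bl ! i))"

lemma mulmat_carrier [simp]: "mulmat x \<in> carrier_mat (card B) (card B)"
  unfolding mulmat_def by simp

lemma mulmat_dim [simp]: "dim_row (mulmat x) = card B" "dim_col (mulmat x) = card B"
  unfolding mulmat_def by simp_all

lemma mulmat_mult:
  assumes "x \<in> K" "y \<in> K" shows "mulmat (x * y) = mulmat x * mulmat y"
proof (rule eq_matI)
  fix i j assume "i < dim_row (mulmat x * mulmat y)" "j < dim_col (mulmat x * mulmat y)"
  then have ij: "i < card B" "j < card B" by (auto simp: mulmat_def)
  have K: "bl ! k \<in> K" if "k < card B" for k using that by auto
  have "y * bl ! j = (\<Sum>k<card B. of_rat (rep (y * bl ! j) (bl ! k)) * bl ! k)"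
    using rep_sum[of "y * bl ! j"] K[OF ij(2)] assms by (auto simp: sum_B)
  then have "x * y * bl ! j = (\<Sum>k<card B. of_rat (rep (y * bl ! j) (bl ! k)) * (x * bl ! k))"
    by (metis (no_types, lifting) mult.assoc mult.left_commute sum.cong sum_distrib_left)
  then have "rep (x * y * bl ! j) (bl ! i) = (\<Sum>k<card B. rep (of_rat (rep (y * bl ! j) (bl ! k)) * (x * bl ! k)) (bl ! i))"
    using rep_sum_dist[of "{..<card B}" "\<lambda>k. of_rat (rep (y * bl ! j) (bl ! k)) * (x * bl ! k)"] assms K
    by (simp add: K_scale K_mult)
  also have "\<dots> = (\<Sum>k<card B. rep (x * bl ! k) (bl ! i) * rep (y * bl ! j) (bl ! k))"
    using assms K by (intro sum.cong) (auto simp: rep_scale K_mult)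
  finally show "mulmat (x * y) $$ (i,j) = (mulmat x * mulmat y) $$ (i,j)"
    using ij by (simp add: mulmat_def scalar_prod_def atLeast0LessThan)
qed (auto simp: mulmat_def)

lemma mulmat_pow: "x \<in> K \<Longrightarrow> mulmat (x ^ k) = mulmat x ^\<^sub>m k"
proof (induction k)
  case 0
  have "rep (bl ! j) (bl ! i) = (if i = j then 1 else 0)" if "i < card B" "j < card B" for i j
    using that bl by (simp add: rep_basis nth_eq_iff_index_eq)
  then show ?case by (auto simp: mulmat_def intro!: eq_matI)
next
  case (Suc k)
  then show ?case using mulmat_mult[of "x ^ k" x] by (simp add: K_pow mult.commute)
qed

lemma tr_mulmat: "tr x = (\<Sum>i<card B. mulmat x $$ (i,i))"
  unfolding tr_rep sum_B by (simp add: mulmat_def)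

end

lemma matrix_trace_comm:
  fixes A :: "'a::comm_ring_1 mat"
  assumes "A \<in> carrier_mat n n" "C \<in> carrier_mat n n"
  shows "(\<Sum>i<n. (A * C) $$ (i,i)) = (\<Sum>i<n. (C * A) $$ (i,i))"
proof -
  have "(\<Sum>i<n. (A * C) $$ (i,i)) = (\<Sum>i<n. \<Sum>k<n. A $$ (i,k) * C $$ (k,i))"
    using assms by (auto simp: scalar_prod_def atLeast0LessThan)
  also have "\<dots> = (\<Sum>k<n. \<Sum>i<n. C $$ (k,i) * A $$ (i,k))"
    by (subst sum.swap) (simp add: mult.commute)
  also have "\<dots> = (\<Sum>i<n. (C * A) $$ (i,i))"
    using assms by (auto simp: scalar_prod_def atLeast0LessThan)
  finally show ?thesis .
qed

lemma upper_triangular_power_diag: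
  fixes U :: "'a::comm_ring_1 mat"
  assumes U: "U \<in> carrier_mat n n" "upper_triangular U"
  shows "upper_triangular (U ^\<^sub>m k) \<and> (\<forall>i<n. (U ^\<^sub>m k) $$ (i,i) = (U $$ (i,i)) ^ k)"
proof (induction k)
  case 0 then show ?case using U by auto
next
  case (Suc k)
  let ?V = "U ^\<^sub>m k"
  have V: "?V \<in> carrier_mat n n" using U by simp
  have ent: "(?V * U) $$ (i,j) = (\<Sum>l<n. ?V $$ (i,l) * U $$ (l,j))" if "i < n" "j < n" for i j
    using that U V by (auto simp: scalar_prod_def atLeast0LessThan)
  have z: "?V $$ (i,l) * U $$ (l,j) = 0" if "i < n" "l < n" "l < i \<or> j < l" for i j l
    using that upper_triangularD[of ?V l i] upper_triangularD[of U j l] Suc U V by auto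
  have 1: "(?V * U) $$ (i,j) = 0" if "j < i" "i < n" for i j
    using that by (subst ent) (auto intro!: sum.neutral z)
  have 2: "(?V * U) $$ (i,i) = ?V $$ (i,i) * U $$ (i,i)" if "i < n" for i
  proof -
    have "(\<Sum>l\<in>{..<n} - {i}. ?V $$ (i,l) * U $$ (l,i)) = 0"
      using that by (intro sum.neutral ballI z) auto
    then show ?thesis using that by (simp add: ent sum.remove[of "{..<n}" i])
  qed
  show ?case using Suc 1 2 U V by (auto intro!: upper_triangularI simp: mult.commute)
qed

lemma complex_matrix_trace_powers:
  fixes A :: "complex mat"
  assumes A: "A \<in> carrier_mat n n"
  obtains as where "char_poly A = (\<Prod>a\<leftarrow>as. [:- a, 1:])" "length as = n"
    "\<And>k. (\<Sum>i<n. (A ^\<^sub>m k) $$ (i,i)) = (\<Sum>a\<leftarrow>as. a ^ k)"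
proof -
  obtain as where as: "char_poly A = (\<Prod>a\<leftarrow>as. [:- a, 1:])" "length as = n"
    using char_poly_factorized[OF A] by blast
  obtain U P Q where "schur_decomposition A as = (U,P,Q)" by (metis prod_cases3)
  from schur_decomposition[OF A as(1) this]
  have w: "similar_mat_wit A U P Q" and U: "upper_triangular U" "diag_mat U = as" by auto
  note wd = similar_mat_witD2[OF A w]
  have "(\<Sum>i<n. (A ^\<^sub>m k) $$ (i,i)) = (\<Sum>a\<leftarrow>as. a ^ k)" for k
  proof -
    let ?V = "U ^\<^sub>m k"
    have V: "?V \<in> carrier_mat n n" using wd by simp
    have "A ^\<^sub>m k = P * ?V * Q" by (rule similar_mat_wit_pow_id[OF w])
    then have "(\<Sum>i<n. (A ^\<^sub>m k) $$ (i,i)) = (\<Sum>i<n. (P * ?V * Q) $$ (i,i))" by simp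
    also have "\<dots> = (\<Sum>i<n. (Q * (P * ?V)) $$ (i,i))"
      using wd V by (intro matrix_trace_comm) auto
    also have "Q * (P * ?V) = ?V" using wd V by (simp flip: assoc_mult_mat[of Q n n P n ?V n])
    also have "(\<Sum>i<n. ?V $$ (i,i)) = (\<Sum>i<n. (U $$ (i,i)) ^ k)"
      using upper_triangular_power_diag[of U n k] wd U by simp
    also have "\<dots> = (\<Sum>a\<leftarrow>as. a ^ k)"
      unfolding U(2)[symmetric] using wd
      by (simp add: diag_mat_def interv_sum_list_conv_sum_set_nat atLeast0LessThan comp_def)
    finally show ?thesis .
  qed
  with as show ?thesis by (intro that) auto
qed

context numfield
begin

text \<open>Read off from a complex triangularisation of the matrix of multiplication by \<open>x\<close>; the polynomial
  is its characteristic polynomial, and \<open>x\<close> is an eigenvalue with the basis itself as row eigenvector.\<close>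

lemma eigenvalues:
  assumes x: "x \<in> K"
  obtains as :: "complex list" and q :: "rat poly" where
    "length as = card B" "map_poly of_rat q = (\<Prod>a\<leftarrow>as. [:- a, 1:])"
    "poly (map_poly of_rat q) x = 0"
    "\<And>k. of_rat (tr (x ^ k)) = (\<Sum>a\<leftarrow>as. a ^ k)"
    "\<And>a. a \<in> set as \<Longrightarrow> \<exists>f. eigen_functional x a f"
proof -
  let ?n = "card B"
  let ?M = "mulmat x"
  let ?A = "map_mat of_rat ?M :: complex mat"
  have A: "?A \<in> carrier_mat ?n ?n" by simp
  obtain as where as: "char_poly ?A = (\<Prod>a\<leftarrow>as. [:- a, 1:])" "length as = ?n"
    "\<And>k. (\<Sum>i<?n. (?A ^\<^sub>m k) $$ (i,i)) = (\<Sum>a\<leftarrow>as. a ^ k)"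
    using complex_matrix_trace_powers[OF A] by blast
  have K: "bl ! k \<in> K" if "k < ?n" for k using that by auto
  have ex: "x * bl ! j = (\<Sum>i<?n. of_rat (?M $$ (i,j)) * bl ! i)" if j: "j < ?n" for j
  proof -
    have "x * bl ! j = (\<Sum>b\<in>B. of_rat (rep (x * bl ! j) b) * b)"
      by (rule rep_sum) (use x K j in auto)
    then show ?thesis unfolding sum_B using j by (simp add: mulmat_def)
  qed
  have hom: "of_rat (tr (x ^ k)) = (\<Sum>a\<leftarrow>as. a ^ k)" for k
  proof -
    have V: "?M ^\<^sub>m k \<in> carrier_mat ?n ?n" by simp
    have ent: "map_mat of_rat W $$ (i,i) = (of_rat (W $$ (i,i)) :: complex)" if "W \<in> carrier_mat ?n ?n" "i < ?n" for W i
      using that by auto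
    have "of_rat (tr (x ^ k)) = (\<Sum>i<?n. (map_mat of_rat (?M ^\<^sub>m k)) $$ (i,i) :: complex)"
      unfolding tr_mulmat mulmat_pow[OF x] of_rat_sum using ent[OF V] by simp
    also have "map_mat of_rat (?M ^\<^sub>m k) = (?A ^\<^sub>m k)" by (rule of_rat_hom.mat_hom_pow[OF mulmat_carrier])
    finally show ?thesis using as(3) by simp
  qed
  have q: "map_poly of_rat (char_poly ?M) = (\<Prod>a\<leftarrow>as. [:- a, 1:])"
    using as(1) of_rat_hom.char_poly_hom[OF mulmat_carrier] by metis
  obtain i0 where i0: "i0 < ?n" "bl ! i0 \<noteq> 0"
  proof -
    have "0 \<notin> B" using B rat_vs.dependent_zero by metis
    then show ?thesis using that[of 0] card_B_pos bl_nth[of 0] by metis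
  qed
  have root: "poly (map_poly of_rat (char_poly ?M)) x = 0"
    unfolding of_rat_hom.char_poly_hom[OF mulmat_carrier, symmetric]
  proof (rule row_eigen_root_char_poly[of _ ?n x "\<lambda>i. bl ! i" i0])
    fix j assume j: "j < ?n"
    have "map_mat of_rat ?M $$ (i,j) = (of_rat (?M $$ (i,j)) :: 'a)" if "i < ?n" for i
      using that j mulmat_carrier[of x] by auto
    then show "x * bl ! j = (\<Sum>i<?n. map_mat of_rat ?M $$ (i,j) * bl ! i)" using ex[OF j] by simp
  qed (use i0 in auto)
  have efun: "\<exists>f. eigen_functional x a f" if a: "a \<in> set as" for a
  proof -
    let ?At = "transpose_mat ?A"
    have At: "?At \<in> carrier_mat ?n ?n" by simp
    have "poly (char_poly ?At) a = 0"
      unfolding char_poly_transpose_mat[OF A] as(1) using a by (induction as) auto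
    then obtain v where v: "eigenvector ?At v a"
      using eigenvalue_root_char_poly[OF At] unfolding eigenvalue_def by blast
    then have vn: "v \<in> carrier_vec ?n" "v \<noteq> 0\<^sub>v ?n" and ev: "?At *\<^sub>v v = a \<cdot>\<^sub>v v"
      unfolding eigenvector_def using At by auto
    have evj: "(\<Sum>i<?n. of_rat (?M $$ (i,j)) * vec_index v i) = a * vec_index v j" if j: "j < ?n" for j
    proof -
      have "(\<Sum>i<?n. of_rat (?M $$ (i,j)) * vec_index v i) = (\<Sum>i<?n. vec_index (row ?At j) i * vec_index v i)"
        by (intro sum.cong) (use j in auto)
      also have "\<dots> = row ?At j \<bullet> v" using vn unfolding scalar_prod_def by (simp add: atLeast0LessThan)
      also have "\<dots> = vec_index (?At *\<^sub>v v) j" by (rule index_mult_mat_vec[symmetric]) (use j in simp)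
      also have "\<dots> = a * vec_index v j" unfolding ev using vn j by simp
      finally show ?thesis .
    qed
    define f where "f y = (\<Sum>i<?n. of_rat (rep y (bl ! i)) * vec_index v i)" for y
    have lin: "rational_linear f" unfolding rational_linear_def
    proof (intro conjI ballI allI)
      fix y z assume "y \<in> K" "z \<in> K"
      then show "f (y + z) = f y + f z"
        by (simp add: f_def rep_add of_rat_add distrib_right sum.distrib)
    next
      fix c y assume "y \<in> K"
      then show "f (of_rat c * y) = of_rat c * f y"
        unfolding f_def sum_distrib_left by (intro sum.cong) (simp_all add: rep_scale of_rat_mult)
    qed
    have fb: "f (bl ! j) = vec_index v j" if "j < ?n" for j
    proof -
      have "f (bl ! j) = (\<Sum>i<?n. if i = j then vec_index v j else 0)"
        unfolding f_def using that bl by (intro sum.cong) (auto simp: rep_basis nth_eq_iff_index_eq)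
      then show ?thesis using that by simp
    qed
    have fx: "f (x * bl ! j) = a * f (bl ! j)" if j: "j < ?n" for j
    proof -
      have "f (x * bl ! j) = (\<Sum>i<?n. f (of_rat (?M $$ (i,j)) * bl ! i))"
        unfolding ex[OF j] by (rule rational_linear_sum[OF lin]) (use K in auto)
      also have "\<dots> = (\<Sum>i<?n. of_rat (?M $$ (i,j)) * vec_index v i)"
        using lin K fb unfolding rational_linear_def by (intro sum.cong) auto
      finally show ?thesis using evj[OF j] fb[OF j] by simp
    qed
    have "f (x * y) = a * f y" if y: "y \<in> K" for y
    proof -
      have ye: "y = (\<Sum>i<?n. of_rat (rep y (bl ! i)) * bl ! i)" using rep_sum[OF y] by (simp add: sum_B)
      have "x * y = (\<Sum>i<?n. of_rat (rep y (bl ! i)) * (x * bl ! i))"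
        by (subst ye) (simp add: sum_distrib_left mult.left_commute)
      then have "f (x * y) = (\<Sum>i<?n. f (of_rat (rep y (bl ! i)) * (x * bl ! i)))"
        using rational_linear_sum[OF lin, of "{..<?n}" "\<lambda>i. of_rat (rep y (bl ! i)) * (x * bl ! i)"] x K by auto
      also have "\<dots> = (\<Sum>i<?n. of_rat (rep y (bl ! i)) * (a * f (bl ! i)))"
        using lin K x fx unfolding rational_linear_def by (intro sum.cong) (auto simp: K_mult)
      also have "\<dots> = a * f y"
        using fb by (simp add: f_def[of y] sum_distrib_left mult.left_commute)
      finally show ?thesis .
    qed
    moreover have "\<exists>y\<in>K. f y \<noteq> 0"
    proof -
      obtain j where "j < ?n" "vec_index v j \<noteq> 0" using vn by (metis eq_vecI carrier_vecD index_zero_vec)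
      then show ?thesis using fb K by metis
    qed
    ultimately show ?thesis using lin unfolding eigen_functional_def by blast
  qed
  show ?thesis using that[OF as(2) q root hom efun] by blast
qed

end

lemma int_independent_iff:
  fixes T :: "'a::field_char_0 set"
  assumes "finite T"
  shows "int_mod.independent T \<longleftrightarrow> (\<forall>u. (\<Sum>v\<in>T. of_int (u v) * v) = 0 \<longrightarrow> (\<forall>v\<in>T. u v = 0))"
  using int_mod.dependent_finite[OF assms] by auto

lemma int_independent_insert:
  fixes T :: "'a::field_char_0 set"
  assumes T: "finite T" "h \<notin> T"
  shows "int_mod.independent (insert h T) \<longleftrightarrow>
    int_mod.independent T \<and> (\<forall>n. of_int n * h \<in> int_mod.span T \<longrightarrow> n = 0)" (is "?l \<longleftrightarrow> ?r")
proof
  assume l: ?l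
  have "n = 0" if n: "of_int n * h \<in> int_mod.span T" for n
  proof -
    obtain u where u: "of_int n * h = (\<Sum>v\<in>T. of_int (u v) * v)"
      using n unfolding int_mod.span_finite[OF T(1)] by auto
    define w where "w v = (if v = h then - n else u v)" for v
    have "(\<Sum>v\<in>T. of_int (w v) * v) = (\<Sum>v\<in>T. of_int (u v) * v)"
      using T by (intro sum.cong) (auto simp: w_def)
    then have "(\<Sum>v\<in>insert h T. of_int (w v) * v) = 0" using T u by (simp add: w_def)
    then have "w h = 0" using l T int_independent_iff[of "insert h T"] by blast
    then show ?thesis by (simp add: w_def)
  qed
  moreover have "int_mod.independent T" using int_mod.independent_mono[OF l] by blast
  ultimately show ?r by blast
next
  assume r: ?r
  have "\<forall>v\<in>insert h T. u v = 0" if u: "(\<Sum>v\<in>insert h T. of_int (u v) * v) = 0" for u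
  proof -
    have e: "of_int (u h) * h + (\<Sum>v\<in>T. of_int (u v) * v) = 0" using u T by simp
    then have "of_int (u h) * h = - (\<Sum>v\<in>T. of_int (u v) * v)" by (simp add: eq_neg_iff_add_eq_0)
    also have "\<dots> \<in> int_mod.span T"
      by (intro int_mod.span_neg int_mod.span_sum int_mod.span_scale int_mod.span_base)
    finally have "u h = 0" using r by blast
    then show ?thesis using e r int_independent_iff[OF T(1)] by auto
  qed
  then show ?l using int_independent_iff[of "insert h T"] T by blast
qed

text \<open>Subgroups of finitely generated free abelian groups are free: split off the last
  coordinate, whose values on the subgroup form an ideal of the integers.\<close>

lemma subgroup_basis:
  fixes H :: "'a::field_char_0 set"
  assumes "finite S" "int_mod.independent S" "H \<subseteq> int_mod.span S"
    and "0 \<in> H" "\<And>x y. x \<in> H \<Longrightarrow> y \<in> H \<Longrightarrow> x - y \<in> H"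
  shows "\<exists>T. finite T \<and> int_mod.independent T \<and> int_mod.span T = H"
  using assms
proof (induction S arbitrary: H rule: finite_induct)
  case empty
  then have "H = {0}" by auto
  then show ?case by (intro exI[of _ "{}"]) (simp add: int_mod.independent_empty)
next
  case (insert b S)
  have ind: "int_mod.independent S" and bS: "\<And>n. of_int n * b \<in> int_mod.span S \<Longrightarrow> n = 0"
    using insert.prems(1) int_independent_insert[OF insert.hyps] by auto
  define H' where "H' = H \<inter> int_mod.span S"
  obtain T where T: "finite T" "int_mod.independent T" "int_mod.span T = H'"
    using insert.IH[OF ind, of H'] insert.prems unfolding H'_def
    by (auto simp: int_mod.span_zero int_mod.span_diff)
  have Hneg: "- x \<in> H" if "x \<in> H" for x using insert.prems(4)[OF insert.prems(3) that] by simp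
  have Hadd: "x + y \<in> H" if "x \<in> H" "y \<in> H" for x y using insert.prems(4)[OF that(1) Hneg[OF that(2)]] by simp
  have Hint: "of_int n * x \<in> H" if x: "x \<in> H" for n x
  proof (induction n rule: int_induct[of _ 0])
    case base then show ?case using insert.prems(3) by simp
  next
    case (step1 i) then show ?case using Hadd[OF _ x] by (simp add: distrib_right)
  next
    case (step2 i) then show ?case using insert.prems(4)[OF _ x] by (simp add: left_diff_distrib)
  qed
  define C where "C = {c. \<exists>h\<in>H. h - of_int c * b \<in> int_mod.span S}"
  have allC: "\<exists>c\<in>C. h - of_int c * b \<in> int_mod.span S" if "h \<in> H" for h
  proof -
    have "h \<in> int_mod.span (insert b S)" using that insert.prems(2) by blast
    then obtain c where c: "h - of_int c * b \<in> int_mod.span S" unfolding int_mod.span_insert by blast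
    then have "c \<in> C" unfolding C_def using that by blast
    then show ?thesis using c by blast
  qed
  show ?case
  proof (cases "C \<subseteq> {0}")
    case True
    have "H \<subseteq> int_mod.span S"
    proof
      fix h assume "h \<in> H"
      then obtain c where "c \<in> C" "h - of_int c * b \<in> int_mod.span S" using allC by blast
      then show "h \<in> int_mod.span S" using True by auto
    qed
    then have "H' = H" unfolding H'_def by blast
    then show ?thesis using T by blast
  next
    case False
    have Cneg: "- c \<in> C" if cC: "c \<in> C" for c
    proof -
      obtain h where h: "h \<in> H" "h - of_int c * b \<in> int_mod.span S" using cC unfolding C_def by blast
      have "- h - of_int (- c) * b = - (h - of_int c * b)" by simp
      then have "- h - of_int (- c) * b \<in> int_mod.span S" using int_mod.span_neg[OF h(2)] by metis
      then show ?thesis using Hneg[OF h(1)] unfolding C_def by blast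
    qed
    from False obtain c0 where "c0 \<in> C" "c0 \<noteq> 0" by auto
    then have "\<exists>k>0. int k \<in> C" using Cneg[of c0]
      by (intro exI[of _ "nat \<bar>c0\<bar>"]) (auto simp: abs_if)
    define k where "k = (LEAST k. k > 0 \<and> int k \<in> C)"
    have k: "k > 0" "int k \<in> C"
      using LeastI_ex[OF \<open>\<exists>k>0. int k \<in> C\<close>] unfolding k_def by auto
    have kmin: "k \<le> j" if "j > 0" "int j \<in> C" for j
      unfolding k_def using that by (intro Least_le) blast
    obtain g where g: "g \<in> H" "g - of_int (int k) * b \<in> int_mod.span S" using k unfolding C_def by blast
    have gT: "n = 0" if "of_int n * g \<in> int_mod.span T" for n
    proof -
      have "of_int n * g \<in> int_mod.span S" using that T(3) unfolding H'_def by blast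
      moreover have "of_int n * (g - of_int (int k) * b) \<in> int_mod.span S" using int_mod.span_scale[OF g(2)] .
      ultimately have "of_int n * g - of_int n * (g - of_int (int k) * b) \<in> int_mod.span S"
        by (rule int_mod.span_diff)
      then have "of_int (n * int k) * b \<in> int_mod.span S" by (simp add: algebra_simps)
      then show ?thesis using bS k by fastforce
    qed
    have "g \<notin> T" using gT[of 1] int_mod.span_base[of g T] by auto
    then have indT: "int_mod.independent (insert g T)" using int_independent_insert[OF T(1)] T gT by blast
    have "int_mod.span (insert g T) = H"
    proof
      show "int_mod.span (insert g T) \<subseteq> H"
      proof
        fix x assume "x \<in> int_mod.span (insert g T)"
        then obtain n where "x - of_int n * g \<in> H'" unfolding int_mod.span_insert T(3) by auto
        then have "x - of_int n * g \<in> H" unfolding H'_def by blast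
        from Hadd[OF this Hint[OF g(1), of n]] show "x \<in> H" by simp
      qed
      show "H \<subseteq> int_mod.span (insert g T)"
      proof
        fix h assume h: "h \<in> H"
        obtain c where c: "h - of_int c * b \<in> int_mod.span S" using allC[OF h] by blast
        define q where "q = c div int k"
        have r: "c mod int k = c - q * int k" unfolding q_def by (simp add: minus_div_mult_eq_mod)
        have hH: "h - of_int q * g \<in> H" using insert.prems(4)[OF h Hint[OF g(1)]] .
        have "(h - of_int c * b) - of_int q * (g - of_int (int k) * b) \<in> int_mod.span S"
          by (rule int_mod.span_diff[OF c int_mod.span_scale[OF g(2)]])
        then have s: "(h - of_int q * g) - of_int (c mod int k) * b \<in> int_mod.span S"
          unfolding r by (simp add: algebra_simps)
        then have "c mod int k \<in> C" using hH unfolding C_def by blast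
        have pm: "0 \<le> c mod int k" "c mod int k < int k" using k(1) by simp_all
        have "c mod int k = 0"
        proof (rule ccontr)
          assume "c mod int k \<noteq> 0"
          then have "k \<le> nat (c mod int k)" using pm \<open>c mod int k \<in> C\<close> by (intro kmin) auto
          then show False using pm by linarith
        qed
        then have "h - of_int q * g \<in> H'" using s hH unfolding H'_def by simp
        then show "h \<in> int_mod.span (insert g T)" unfolding int_mod.span_insert T(3) by blast
      qed
    qed
    then show ?thesis using indT T(1) by blast
  qed
qed

lemma common_denominator:
  fixes A :: "rat set"
  assumes "finite A"
  shows "\<exists>N::int. N > 0 \<and> (\<forall>a\<in>A. of_int N * a \<in> \<int>)"
  using assms
proof (induction A rule: finite_induct)
  case empty then show ?case by (intro exI[of _ 1]) auto
next
  case (insert a A)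
  then obtain N where N: "N > 0" "\<forall>a\<in>A. of_int N * a \<in> \<int>" by blast
  obtain p q where pq: "a = of_int p / of_int q" "q > 0" using quotient_of_div quotient_of_denom_pos by (metis prod.collapse)
  have "of_int (N * q) * x \<in> \<int>" if x: "x \<in> insert a A" for x
  proof (cases "x = a")
    case True
    then have "of_int (N * q) * x = of_int (N * p)" using pq by simp
    then show ?thesis by (metis Ints_of_int)
  next
    case False
    then have "of_int N * x \<in> \<int>" using x N by blast
    then have "of_int q * (of_int N * x) \<in> \<int>" by (rule Ints_mult[OF Ints_of_int])
    then show ?thesis by (simp add: mult.commute mult.left_commute)
  qed
  then show ?case using N(1) pq(2) by (intro exI[of _ "N * q"]) auto
qed

context numfield
begin

abbreviation OK :: "'a set" where "OK \<equiv> integers_of K"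

lemma O_iff: "x \<in> OK \<longleftrightarrow> x \<in> K \<and> algebraic_int x" unfolding integers_of_def by simp
lemma O_K [dest]: "x \<in> OK \<Longrightarrow> x \<in> K" unfolding O_iff by simp
lemma O_add [intro]: "x \<in> OK \<Longrightarrow> y \<in> OK \<Longrightarrow> x + y \<in> OK" unfolding O_iff using algebraic_int_add_mult by auto
lemma O_mult [intro]: "x \<in> OK \<Longrightarrow> y \<in> OK \<Longrightarrow> x * y \<in> OK" unfolding O_iff using algebraic_int_add_mult by auto
lemma O_minus [intro]: "x \<in> OK \<Longrightarrow> - x \<in> OK" unfolding O_iff by auto
lemma O_diff [intro]: "x \<in> OK \<Longrightarrow> y \<in> OK \<Longrightarrow> x - y \<in> OK" using O_add[of x "- y"] by auto
lemma O_int [simp, intro]: "of_int n \<in> OK" unfolding O_iff by auto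
lemma O_01 [simp, intro]: "0 \<in> OK" "1 \<in> OK" unfolding O_iff by auto
lemma O_numeral [simp, intro]: "numeral n \<in> OK" unfolding O_iff by auto
lemma O_pow [intro]: "x \<in> OK \<Longrightarrow> x ^ n \<in> OK" by (induction n) auto
lemma O_sum [intro]: "(\<And>i. i \<in> A \<Longrightarrow> f i \<in> OK) \<Longrightarrow> sum f A \<in> OK"
  by (induction A rule: infinite_finite_induct) auto

lemma K_rational_O: "of_rat q \<in> OK \<Longrightarrow> q \<in> \<int>"
proof -
  assume "of_rat q \<in> OK"
  then have "algebraic_int (of_rat q :: 'a)" unfolding O_iff by simp
  then have "of_rat q \<in> (\<int> :: 'a set)" by (rule rational_algebraic_int_is_int) simp
  then show "q \<in> \<int>" by (metis Ints_cases Ints_of_int of_rat_eq_iff of_rat_of_int_eq)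
qed

text \<open>The functional turns the monic equation of \<open>x\<close> into the same equation for the eigenvalue.\<close>

lemma eigenvalue_algebraic_int:
  assumes x: "x \<in> OK" and f: "eigen_functional x a f"
  shows "algebraic_int a"
proof -
  note e = f[unfolded eigen_functional_def]
  note f = e[THEN conjunct1] e[THEN conjunct2, THEN conjunct1] e[THEN conjunct2, THEN conjunct2]
  obtain p where p: "poly (map_poly of_int p) x = 0" "lead_coeff p = 1"
    using x unfolding O_iff algebraic_int_altdef_ipoly by auto
  from f(2) obtain y where y: "y \<in> K" "f y \<noteq> 0" by blast
  have xk: "f (x ^ k * y) = a ^ k * f y" for k
  proof (induction k)
    case (Suc k)
    have "f (x * (x ^ k * y)) = a * f (x ^ k * y)" using f(3) x y by blast
    then show ?case using Suc by (simp add: mult.assoc)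
  qed simp
  have "0 = f (poly (map_poly of_int p) x * y)"
    using p(1) f(1) unfolding rational_linear_def by (metis K_0 mult_zero_left of_rat_0)
  also have "poly (map_poly of_int p) x * y = (\<Sum>k\<le>degree p. of_rat (of_int (coeff p k)) * (x ^ k * y))"
    by (simp add: poly_altdef sum_distrib_right mult.assoc)
  also have "f \<dots> = (\<Sum>k\<le>degree p. f (of_rat (of_int (coeff p k)) * (x ^ k * y)))"
    using x y by (intro rational_linear_sum[OF f(1)]) auto
  also have "\<dots> = (\<Sum>k\<le>degree p. of_int (coeff p k) * a ^ k * f y)"
  proof (intro sum.cong refl)
    fix k
    have "x ^ k * y \<in> K" using x y by blast
    then have "f (of_rat (of_int (coeff p k)) * (x ^ k * y)) = of_rat (of_int (coeff p k)) * f (x ^ k * y)"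
      using f(1) unfolding rational_linear_def by blast
    then show "f (of_rat (of_int (coeff p k)) * (x ^ k * y)) = of_int (coeff p k) * a ^ k * f y"
      by (simp add: xk)
  qed
  also have "\<dots> = poly (map_poly of_int p) a * f y" by (simp add: poly_altdef sum_distrib_right)
  finally show ?thesis using y p monic_root_algebraic_int by auto
qed

text \<open>The trace is the sum of the eigenvalues of multiplication, which are roots of the same monic
  integer polynomials as \<open>x\<close>.\<close>

lemma tr_Ints:
  assumes x: "x \<in> OK" shows "tr x \<in> \<int>"
proof -
  obtain as where as: "\<And>k. of_rat (tr (x ^ k)) = (\<Sum>a\<leftarrow>as. a ^ k)"
    "\<And>a. a \<in> set as \<Longrightarrow> \<exists>f. eigen_functional x a f"
    using eigenvalues[of x] x by (metis O_K)
  have alg: "algebraic_int a" if "a \<in> set as" for a using as(2)[OF that] eigenvalue_algebraic_int[OF x] by blast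
  have "algebraic_int (of_rat (tr x) :: complex)"
    using as(1)[of 1] algebraic_int_sum_list[of as] alg by simp
  then have "of_rat (tr x) \<in> (\<int> :: complex set)" by (rule rational_algebraic_int_is_int) simp
  then show ?thesis by (metis Ints_cases Ints_of_int of_rat_eq_iff of_rat_of_int_eq)
qed

lemma integer_multiple:
  assumes x: "x \<in> K"
  shows "\<exists>N::int. N > 0 \<and> of_int N * x \<in> OK"
proof -
  obtain N where N: "N > 0" "\<forall>a \<in> (\<lambda>(b,c). rep (x * b) c) ` (B \<times> B). of_int N * a \<in> \<int>"
    using common_denominator[of "(\<lambda>(b,c). rep (x * b) c) ` (B \<times> B)"] B by auto
  obtain b0 where b0: "b0 \<in> B" "b0 \<noteq> 0"
    using card_B_pos B rat_vs.dependent_zero by (metis all_not_in_conv card.empty less_irrefl)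
  have "algebraic_int (of_int N * x)"
  proof (rule stable_algebraic_int[OF B(1) b0])
    fix b assume b: "b \<in> B"
    have "\<forall>c\<in>B. \<exists>m. of_int N * rep (x * b) c = of_int m" using N b by (auto elim!: Ints_cases)
    then obtain m where m: "\<And>c. c \<in> B \<Longrightarrow> of_int N * rep (x * b) c = of_int (m c)" by metis
    have "of_int N * x * b = of_int N * (\<Sum>c\<in>B. of_rat (rep (x * b) c) * c)"
      using rep_sum[of "x * b"] x b by (simp add: K_mult B_in_K mult.assoc)
    also have "\<dots> = (\<Sum>c\<in>B. of_rat (of_int N * rep (x * b) c) * c)"
      by (simp add: sum_distrib_left of_rat_mult mult.assoc)
    also have "\<dots> = (\<Sum>c\<in>B. of_int (m c) * c)" using m by simp
    also have "\<dots> \<in> int_mod.span B" by (intro int_mod.span_sum int_mod.span_scale int_mod.span_base)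
    finally show "of_int N * x * b \<in> int_mod.span B" .
  qed
  then show ?thesis using N x by (intro exI[of _ N]) (auto simp: O_iff)
qed

lemma nondegenerate:
  assumes "x \<in> K" "\<And>y. y \<in> K \<Longrightarrow> tr (x * y) = 0" shows "x = 0"
proof (rule ccontr)
  assume "x \<noteq> 0"
  then have "tr (x * inverse x) = of_nat (card B)" using tr_1 by simp
  then show False using assms card_B_pos by (metis K_inverse less_irrefl of_nat_0_eq_iff)
qed

section \<open>Totally real fields have positive definite trace form\<close>

text \<open>Commuting maps have a common eigenvector. The minimal equation of \<open>b\<close> splits over the complex numbers, so some
  partial product of its linear factors, applied to \<open>g\<close>, is nonzero and killed by the next factor.\<close>

lemma common_eigen_extend:
  assumes g: "rational_linear g" "y0 \<in> K" "g y0 \<noteq> (0::complex)"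
    and b: "b \<in> K"
  shows "\<exists>h. rational_linear h \<and> (\<exists>y\<in>K. h y \<noteq> 0) \<and> (\<exists>c. \<forall>y\<in>K. h (b * y) = c * h y) \<and>
    (\<forall>s\<in>K. \<forall>a. (\<forall>y\<in>K. g (s * y) = a * g y) \<longrightarrow> (\<forall>y\<in>K. h (s * y) = a * h y))"
proof -
  obtain as :: "complex list" and q :: "rat poly" where
    as: "length as = card B" "map_poly of_rat q = (\<Prod>a\<leftarrow>as. [:- a, 1:])"
    "poly (map_poly of_rat q) b = 0" using eigenvalues[OF b] by metis
  let ?n = "card B"
  define act where "act p y = (\<Sum>k\<le>?n. coeff p k * g (b ^ k * y))" for p y
  define P where "P j = (\<Prod>a\<leftarrow>rev (take j as). [:- a, 1:])" for j
  have degP: "degree (P j) \<le> j" for j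
    unfolding P_def using degree_linear_factors[of uminus "rev (take j as)"] by simp
  have lin: "rational_linear (act p)" for p
  proof -
    have "act p (y + z) = act p y + act p z" if "y \<in> K" "z \<in> K" for y z
    proof -
      have "g (b ^ k * (y + z)) = g (b ^ k * y) + g (b ^ k * z)" for k
        using g(1) that b unfolding rational_linear_def by (metis K_mult K_pow distrib_left)
      then show ?thesis unfolding act_def by (simp add: distrib_left sum.distrib)
    qed
    moreover have "act p (of_rat c * y) = of_rat c * act p y" if "y \<in> K" for y c
    proof -
      have "g (b ^ k * (of_rat c * y)) = of_rat c * g (b ^ k * y)" for k
        using g(1) that b unfolding rational_linear_def by (metis K_mult K_pow mult.left_commute)
      then show ?thesis unfolding act_def by (simp add: sum_distrib_left mult.left_commute)
    qed
    ultimately show ?thesis unfolding rational_linear_def by blast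
  qed
  have eig: "act p (s * y) = a * act p y" if "s \<in> K" "\<forall>y\<in>K. g (s * y) = a * g y" "y \<in> K" for p s a y
  proof -
    have "g (b ^ k * (s * y)) = a * g (b ^ k * y)" for k
      using that b by (metis K_mult K_pow mult.left_commute)
    then show ?thesis unfolding act_def by (simp add: sum_distrib_left mult.left_commute)
  qed
  have step: "act (P (Suc j)) y = act (P j) (b * y) - as ! j * act (P j) y" if j: "j < ?n" for j y
  proof -
    have "take (Suc j) as = take j as @ [as ! j]" using j as(1) by (simp add: take_Suc_conv_app_nth)
    then have "P (Suc j) = pCons 0 (P j) - Polynomial.smult (as ! j) (P j)" unfolding P_def by simp
    then have "act (P (Suc j)) y = (\<Sum>k\<le>?n. coeff (pCons 0 (P j)) k * g (b ^ k * y)) - as ! j * act (P j) y"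
      unfolding act_def by (simp add: left_diff_distrib sum_subtractf sum_distrib_left mult.assoc)
    also have "(\<Sum>k\<le>?n. coeff (pCons 0 (P j)) k * g (b ^ k * y)) = act (P j) (b * y)"
    proof -
      obtain m where m: "?n = Suc m" using j by (cases ?n) auto
      have "coeff (P j) (Suc m) = 0" using degP[of j] j m by (intro coeff_eq_0) simp
      then have "act (P j) (b * y) = (\<Sum>k\<le>m. coeff (P j) k * g (b ^ k * (b * y)))"
        unfolding act_def m by simp
      also have "\<dots> = (\<Sum>k\<le>Suc m. coeff (pCons 0 (P j)) k * g (b ^ k * y))"
        unfolding sum.atMost_Suc_shift by (simp add: ac_simps)
      finally show ?thesis using m by simp
    qed
    finally show ?thesis .
  qed
  have P0: "act (P 0) y = g y" for y
  proof -
    have "act (P 0) y = (\<Sum>k\<le>?n. if k = 0 then g y else 0)" unfolding act_def P_def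
      by (intro sum.cong) auto
    then show ?thesis by simp
  qed
  have Pn: "act (P ?n) y = 0" if y: "y \<in> K" for y
  proof -
    have "prod_list (map (\<lambda>a. [:- a, 1:]) (rev as)) = prod_list (map (\<lambda>a. [:- a, 1:]) as)"
      by (metis (no_types) prod_mset_prod_list mset_rev mset_map)
    then have pq: "P ?n = map_poly of_rat q" using as unfolding P_def by simp
    have dq: "degree q \<le> ?n" using degP[of ?n] unfolding pq by simp
    have "0 = g (poly (map_poly of_rat q) b * y)"
      using as(3) g(1) unfolding rational_linear_def by (metis K_0 mult_zero_left of_rat_0)
    also have "poly (map_poly of_rat q) b = (\<Sum>k\<le>?n. of_rat (coeff q k) * b ^ k)"
      using dq unfolding poly_altdef
      by (intro sum.mono_neutral_cong_left) (auto simp: coeff_eq_0)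
    also have "\<dots> * y = (\<Sum>k\<le>?n. of_rat (coeff q k) * (b ^ k * y))"
      by (simp add: sum_distrib_right mult.assoc)
    also have "g \<dots> = (\<Sum>k\<le>?n. g (of_rat (coeff q k) * (b ^ k * y)))"
      using b y by (intro rational_linear_sum[OF g(1)]) auto
    also have "\<dots> = act (P ?n) y" unfolding act_def pq
    proof (intro sum.cong refl)
      fix k
      have "b ^ k * y \<in> K" using b y by blast
      then show "g (of_rat (coeff q k) * (b ^ k * y)) = coeff (map_poly of_rat q) k * g (b ^ k * y)"
        using g(1) unfolding rational_linear_def by simp
    qed
    finally show ?thesis by simp
  qed
  define j where "j = (LEAST j. \<forall>y\<in>K. act (P j) y = 0)"
  have j: "\<forall>y\<in>K. act (P j) y = 0" and jmin: "\<And>i. i < j \<Longrightarrow> \<exists>y\<in>K. act (P i) y \<noteq> 0"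
    using LeastI[of "\<lambda>j. \<forall>y\<in>K. act (P j) y = 0" ?n] Pn not_less_Least unfolding j_def by blast+
  have "j \<noteq> 0" using j P0 g by metis
  then obtain i where i: "j = Suc i" by (cases j) auto
  have "j \<le> ?n" unfolding j_def using Pn by (intro Least_le) blast
  then have "i < ?n" using i by simp
  then have "act (P i) (b * y) = as ! i * act (P i) y" if "y \<in> K" for y
    using step[of i y] j i that by auto
  then show ?thesis using lin eig jmin[of i] i by (intro exI[of _ "act (P i)"]) blast
qed

text \<open>A common eigenfunctional of a generating set is one of all elements, and its eigenvalue is then a ring
  homomorphism. This realises every eigenvalue as a conjugate.\<close>

lemma extend_to_hom:
  assumes x: "x \<in> K" and f: "eigen_functional x a f"
  obtains \<sigma> where "\<sigma> \<in> Ring.ring_hom (ring_on K) (ring_on (UNIV :: complex set))" "\<sigma> x = a"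
proof -
  have "\<exists>h. rational_linear h \<and> (\<exists>y\<in>K. h y \<noteq> (0::complex)) \<and>
     (\<forall>s\<in>insert x S. \<exists>c. \<forall>y\<in>K. h (s * y) = c * h y) \<and> (\<forall>y\<in>K. h (x * y) = a * h y)"
    if "finite S" "S \<subseteq> K" for S using that
  proof (induction S rule: finite_induct)
    case empty then show ?case using f unfolding eigen_functional_def by blast
  next
    case (insert b S)
    then obtain g where g: "rational_linear g" "\<exists>y\<in>K. g y \<noteq> 0"
      "\<forall>s\<in>insert x S. \<exists>c. \<forall>y\<in>K. g (s * y) = c * g y" "\<forall>y\<in>K. g (x * y) = a * g y" by blast
    then obtain y0 where y0: "y0 \<in> K" "g y0 \<noteq> 0" by blast
    obtain h where h: "rational_linear h" "\<exists>y\<in>K. h y \<noteq> 0" "\<exists>c. \<forall>y\<in>K. h (b * y) = c * h y"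
      "\<forall>s\<in>K. \<forall>a. (\<forall>y\<in>K. g (s * y) = a * g y) \<longrightarrow> (\<forall>y\<in>K. h (s * y) = a * h y)"
      using common_eigen_extend[OF g(1) y0, of b] insert.prems by blast
    have "\<exists>c. \<forall>y\<in>K. h (s * y) = c * h y" if "s \<in> insert x (insert b S)" for s
    proof (cases "s = b")
      case True then show ?thesis using h(3) by blast
    next
      case False
      then have "s \<in> insert x S" "s \<in> K" using that insert.prems x by auto
      then show ?thesis using h(4) g(3) by blast
    qed
    then have all: "\<forall>s\<in>insert x (insert b S). \<exists>c. \<forall>y\<in>K. h (s * y) = c * h y" by blast
    have "\<forall>y\<in>K. h (x * y) = a * h y" using h(4) x g(4) by blast
    then show ?case using h(1,2) all by (intro exI[of _ h] conjI)
  qed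
  from this[OF B(1)] obtain h where h: "rational_linear h" "\<exists>y\<in>K. h y \<noteq> (0::complex)"
     "\<forall>s\<in>insert x B. \<exists>c. \<forall>y\<in>K. h (s * y) = c * h y" "\<forall>y\<in>K. h (x * y) = a * h y"
    using B_in_K by (metis (no_types, lifting) subsetI)
  have ev: "\<exists>c. \<forall>y\<in>K. h (s * y) = c * h y" if s: "s \<in> K" for s
  proof -
    from bchoice[OF h(3)] obtain e where e: "\<And>b y. b \<in> B \<Longrightarrow> y \<in> K \<Longrightarrow> h (b * y) = e b * h y" by blast
    have "h (s * y) = (\<Sum>b\<in>B. of_rat (rep s b) * e b) * h y" if y: "y \<in> K" for y
    proof -
      have "s * y = (\<Sum>b\<in>B. of_rat (rep s b) * (b * y))"
        by (subst rep_sum[OF s]) (simp add: sum_distrib_right mult.assoc)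
      then have "h (s * y) = (\<Sum>b\<in>B. h (of_rat (rep s b) * (b * y)))"
        using rational_linear_sum[OF h(1), of B "\<lambda>b. of_rat (rep s b) * (b * y)"] y by auto
      also have "\<dots> = (\<Sum>b\<in>B. of_rat (rep s b) * (e b * h y))"
        using h(1) e y B_in_K K_mult unfolding rational_linear_def by (intro sum.cong) auto
      finally show ?thesis by (simp add: sum_distrib_right mult.assoc)
    qed
    then show ?thesis by blast
  qed
  have h1: "h 1 \<noteq> 0"
  proof
    assume 0: "h 1 = 0"
    have "h y = 0" if "y \<in> K" for y using ev[OF that] 0 K_1 by (metis mult.right_neutral mult_zero_right)
    then show False using h(2) by blast
  qed
  define \<sigma> where "\<sigma> s = h s / h 1" for s
  have hs: "h (s * y) = \<sigma> s * h y" if s: "s \<in> K" and "y \<in> K" for s y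
  proof -
    obtain c where c: "\<forall>y\<in>K. h (s * y) = c * h y" using ev[OF s] by blast
    then have "h s = c * h 1" using K_1 by (metis mult.right_neutral)
    then have "\<sigma> s = c" using h1 by (simp add: \<sigma>_def)
    then show ?thesis using c that by simp
  qed
  have "\<sigma> \<in> Ring.ring_hom (ring_on K) (ring_on (UNIV :: complex set))"
    unfolding Ring.ring_hom_def ring_on_def using h1 hs h(1)
    by (auto simp: \<sigma>_def rational_linear_def add_divide_distrib)
  moreover have "\<sigma> x = a"
    using hs[OF x K_1] h(4) h1 K_1 by (metis mult_right_cancel)
  ultimately show ?thesis using that by blast
qed

text \<open>The trace of the square is the sum of the squares of the eigenvalues, which are real as values of embeddings.\<close>

lemma totally_real_positive:
  assumes tot: "totally_real K" and x: "x \<in> K" "x \<noteq> 0"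
  shows "tr (x * x) > 0"
proof -
  obtain as :: "complex list" and q :: "rat poly" where
    as: "length as = card B" "map_poly of_rat q = (\<Prod>a\<leftarrow>as. [:- a, 1:])"
    "poly (map_poly of_rat q) x = 0" "\<And>k. of_rat (tr (x ^ k)) = (\<Sum>a\<leftarrow>as. a ^ k)"
    "\<And>a. a \<in> set as \<Longrightarrow> \<exists>f. eigen_functional x a f" using eigenvalues[OF x(1)] by metis
  have real: "a \<in> \<real>" if a: "a \<in> set as" for a
  proof -
    obtain f where "eigen_functional x a f" using as(5)[OF a] by blast
    then obtain \<sigma> where "\<sigma> \<in> Ring.ring_hom (ring_on K) (ring_on (UNIV :: complex set))" "\<sigma> x = a"
      using extend_to_hom[OF x(1)] by blast
    then show ?thesis using tot x unfolding totally_real_def by blast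
  qed
  have sq: "(\<Sum>a\<leftarrow>as. a ^ 2) = of_real (\<Sum>a\<leftarrow>as. (Re a) ^ 2)"
  proof -
    have "a ^ 2 = of_real ((Re a) ^ 2)" if "a \<in> set as" for a
      using real[OF that] by (metis of_real_Re of_real_power)
    then have "(\<Sum>a\<leftarrow>as. a ^ 2) = (\<Sum>a\<leftarrow>as. of_real ((Re a) ^ 2))"
      by (metis (mono_tags, lifting) map_cong)
    then show ?thesis by (simp add: of_real_hom.hom_sum_list comp_def)
  qed
  have t: "of_rat (tr (x * x)) = (\<Sum>a\<leftarrow>as. (Re a) ^ 2)"
  proof -
    have cr: "complex_of_rat r = of_real (of_rat r)" for r
    proof (cases r)
      case (Fract p q)
      then show ?thesis by (simp add: Fract_of_int_quotient of_rat_divide)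
    qed
    have "complex_of_real (of_rat (tr (x * x))) = of_real (\<Sum>a\<leftarrow>as. (Re a) ^ 2)"
      using as(4)[of 2] sq unfolding cr power2_eq_square by simp
    then show ?thesis by (simp only: of_real_eq_iff)
  qed
  have nn: "(\<Sum>a\<leftarrow>as. (Re a) ^ 2) \<ge> 0" by (rule sum_list_nonneg) auto
  have "(\<Sum>a\<leftarrow>as. (Re a) ^ 2) \<noteq> 0"
  proof
    assume "(\<Sum>a\<leftarrow>as. (Re a) ^ 2) = 0"
    moreover have "\<And>r. r \<in> set (map (\<lambda>a. (Re a) ^ 2) as) \<Longrightarrow> 0 \<le> r" by auto
    ultimately have "\<forall>r\<in>set (map (\<lambda>a. (Re a) ^ 2) as). r = 0" using sum_list_nonneg_eq_0_iff by blast
    then have "\<forall>a\<in>set as. Re a = 0" by simp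
    then have "\<forall>a\<in>set as. a = 0" using real by (metis of_real_0 of_real_Re)
    then have "as = replicate (card B) 0" using as(1) by (metis replicate_eqI)
    then have "map_poly of_rat q = (monom 1 (card B) :: complex poly)" using as(2) by (simp add: monom_altdef)
    also have "\<dots> = map_poly of_rat (monom 1 (card B))" by (simp add: map_poly_monom)
    finally have "coeff (map_poly of_rat q :: complex poly) k = coeff (map_poly of_rat (monom 1 (card B))) k" for k by simp
    then have "complex_of_rat (coeff q k) = complex_of_rat (coeff (monom 1 (card B)) k)" for k
      by (simp only: coeff_map_poly of_rat_0)
    then have "q = monom 1 (card B)" by (intro poly_eqI) (simp only: of_rat_eq_iff)
    then have "x ^ card B = 0" using as(3) by (simp add: poly_monom)
    then show False using x by simp
  qed
  then have "real_of_rat (tr (x * x)) > 0" using t nn by simp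
  then show ?thesis by simp
qed

end

section \<open>Fields with positive definite trace form\<close>

locale posfield = numfield +
  assumes pos: "x \<in> K \<Longrightarrow> x \<noteq> 0 \<Longrightarrow> field_trace K (x * x) > 0"
begin

definition orthogonal_set :: "'a set \<Rightarrow> bool" where
  "orthogonal_set C \<longleftrightarrow> finite C \<and> C \<subseteq> K \<and> 0 \<notin> C \<and> (\<forall>c\<in>C. \<forall>d\<in>C. c \<noteq> d \<longrightarrow> tr (c * d) = 0)"

lemma orthogonal_setD:
  assumes "orthogonal_set C"
  shows "finite C" "c \<in> C \<Longrightarrow> c \<in> K" "c \<in> C \<Longrightarrow> c \<noteq> 0" "c \<in> C \<Longrightarrow> d \<in> C \<Longrightarrow> c \<noteq> d \<Longrightarrow> tr (c * d) = 0"
    "c \<in> C \<Longrightarrow> tr (c * c) > 0"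
proof -
  show 1: "finite C" "c \<in> C \<Longrightarrow> c \<in> K" "c \<in> C \<Longrightarrow> c \<noteq> 0" "c \<in> C \<Longrightarrow> d \<in> C \<Longrightarrow> c \<noteq> d \<Longrightarrow> tr (c * d) = 0"
    using assms unfolding orthogonal_set_def by blast+
  show "c \<in> C \<Longrightarrow> tr (c * c) > 0" using 1 pos by blast
qed

lemma orthogonal_sum:
  assumes C: "orthogonal_set C" and d: "d \<in> C"
  shows "(\<Sum>c\<in>C. u c * tr (c * d)) = u d * tr (d * d)"
proof -
  have "(\<Sum>c\<in>C. u c * tr (c * d)) = u d * tr (d * d) + (\<Sum>c\<in>C - {d}. u c * tr (c * d))"
    using orthogonal_setD(1)[OF C] d by (rule sum.remove)
  also have "(\<Sum>c\<in>C - {d}. u c * tr (c * d)) = 0"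
    using orthogonal_setD(4)[OF C _ d] by (intro sum.neutral) auto
  finally show ?thesis by simp
qed

lemma tr_lincomb:
  assumes "\<And>i. i \<in> I \<Longrightarrow> b i \<in> K" "y \<in> K"
  shows "tr ((\<Sum>i\<in>I. of_rat (q i) * b i) * y) = (\<Sum>i\<in>I. q i * tr (b i * y))"
proof -
  have "(\<Sum>i\<in>I. of_rat (q i) * b i) * y = (\<Sum>i\<in>I. of_rat (q i) * (b i * y))"
    by (simp only: sum_distrib_right mult.assoc)
  also have "tr \<dots> = (\<Sum>i\<in>I. tr (of_rat (q i) * (b i * y)))"
    by (rule tr_sum) (use assms in blast)
  also have "\<dots> = (\<Sum>i\<in>I. q i * tr (b i * y))"
    by (intro sum.cong refl tr_scale) (use assms in blast)
  finally show ?thesis .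
qed

lemma orthogonal_spanning_set:
  assumes "finite S" "S \<subseteq> K"
  shows "\<exists>C. orthogonal_set C \<and> rat_vs.span C = rat_vs.span S"
  using assms
proof (induction S rule: finite_induct)
  case empty then show ?case by (intro exI[of _ "{}"]) (simp add: orthogonal_set_def)
next
  case (insert a S)
  then obtain C where oC: "orthogonal_set C" and CS: "rat_vs.span C = rat_vs.span S" by auto
  note C = orthogonal_setD[OF oC]
  have aK: "a \<in> K" using insert.prems by simp
  define p where "p = (\<Sum>c\<in>C. of_rat (tr (a * c) / tr (c * c)) * c)"
  define a' where "a' = a - p"
  have pK: "p \<in> K" unfolding p_def by (intro K_sum K_scale C)
  have a'K: "a' \<in> K" unfolding a'_def using aK pK by blast
  have pS: "p \<in> rat_vs.span C" unfolding p_def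
    by (intro rat_vs.span_sum rat_vs.span_scale rat_vs.span_base)
  have orth: "tr (a' * d) = 0" if d: "d \<in> C" for d
  proof -
    have dK: "d \<in> K" by (rule C(2)[OF d])
    have "tr (p * d) = (\<Sum>c\<in>C. tr (a * c) / tr (c * c) * tr (c * d))"
      unfolding p_def by (rule tr_lincomb[OF C(2) dK])
    also have "\<dots> = tr (a * d)" unfolding orthogonal_sum[OF oC d] using C(5)[OF d] by simp
    finally show ?thesis unfolding a'_def using aK pK dK by (simp add: left_diff_distrib tr_diff K_mult)
  qed
  have s1: "rat_vs.span (insert a' C) = rat_vs.span (insert a S)"
  proof -
    have sub: "rat_vs.span C \<subseteq> rat_vs.span (insert a S)" "rat_vs.span C \<subseteq> rat_vs.span (insert a' C)"
      using rat_vs.span_mono[of S "insert a S"] rat_vs.span_mono[of C "insert a' C"] unfolding CS by auto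
    have "a' \<in> rat_vs.span (insert a S)" unfolding a'_def
      using pS sub by (intro rat_vs.span_diff rat_vs.span_base[of a]) auto
    moreover have "C \<subseteq> rat_vs.span (insert a S)" using sub(1) rat_vs.span_superset by blast
    ultimately have 1: "rat_vs.span (insert a' C) \<subseteq> rat_vs.span (insert a S)"
      by (intro rat_vs.span_minimal rat_vs.subspace_span) auto
    have "a' + p \<in> rat_vs.span (insert a' C)"
      using pS sub by (intro rat_vs.span_add rat_vs.span_base[of a']) auto
    then have "a \<in> rat_vs.span (insert a' C)" unfolding a'_def by simp
    moreover have "S \<subseteq> rat_vs.span (insert a' C)" using sub(2) CS rat_vs.span_superset by blast
    ultimately have 2: "rat_vs.span (insert a S) \<subseteq> rat_vs.span (insert a' C)"
      by (intro rat_vs.span_minimal rat_vs.subspace_span) auto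
    from 1 2 show ?thesis by simp
  qed
  show ?case
  proof (cases "a' = 0")
    case True
    then have "rat_vs.span (insert a' C) = rat_vs.span C"
      by (simp add: rat_vs.span_insert_0)
    then show ?thesis using oC s1 by metis
  next
    case False
    have "tr (c * a') = 0" if "c \<in> C" for c using orth[OF that] by (simp add: mult.commute)
    then have "orthogonal_set (insert a' C)"
      using oC False orth a'K unfolding orthogonal_set_def by simp
    then show ?thesis using s1 by blast
  qed
qed

text \<open>A frame is a generating family together with a dual family. Its members may be
  linearly dependent, which makes it stable under orthogonal projection.\<close>

definition frame :: "'i set \<Rightarrow> ('i \<Rightarrow> 'a) \<Rightarrow> ('i \<Rightarrow> 'a) \<Rightarrow> bool" where
  "frame I b d \<longleftrightarrow> finite I \<and> (\<forall>i\<in>I. b i \<in> K \<and> d i \<in> K) \<and>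
     (\<forall>x\<in>K. x = (\<Sum>i\<in>I. of_rat (tr (x * d i)) * b i))"

lemma frameD:
  assumes "frame I b d"
  shows "finite I" "i \<in> I \<Longrightarrow> b i \<in> K" "i \<in> I \<Longrightarrow> d i \<in> K"
    "x \<in> K \<Longrightarrow> x = (\<Sum>i\<in>I. of_rat (tr (x * d i)) * b i)"
  using assms unfolding frame_def by blast+

lemma parseval:
  assumes "frame I b d" "x \<in> K" "y \<in> K"
  shows "(\<Sum>i\<in>I. tr (x * d i) * tr (y * b i)) = tr (x * y)"
proof -
  have "tr (x * y) = (\<Sum>i\<in>I. tr (x * d i) * tr (b i * y))"
    by (subst frameD(4)[OF assms(1,2)]) (use assms frameD in \<open>auto intro!: tr_lincomb\<close>)
  then show ?thesis by (simp add: mult.commute)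
qed

lemma frame_swap:
  assumes "frame I b d" shows "frame I d b"
  unfolding frame_def
proof (intro conjI ballI)
  fix y assume y: "y \<in> K"
  let ?s = "\<Sum>i\<in>I. of_rat (tr (y * b i)) * d i"
  note f = frameD[OF assms]
  have sK: "?s \<in> K" using f by auto
  have "tr ((y - ?s) * x) = 0" if x: "x \<in> K" for x
  proof -
    have "tr (?s * x) = (\<Sum>i\<in>I. tr (y * b i) * tr (d i * x))" using f x by (intro tr_lincomb) auto
    also have "\<dots> = (\<Sum>i\<in>I. tr (x * d i) * tr (y * b i))" by (simp add: mult.commute)
    also have "\<dots> = tr (y * x)" using parseval[OF assms x y] by (simp add: mult.commute)
    finally show ?thesis using sK x y by (simp add: left_diff_distrib tr_diff K_mult)
  qed
  then have "y - ?s = 0" using sK y by (intro nondegenerate) auto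
  then show "y = ?s" by simp
qed (use frameD[OF assms] in auto)

lemma rational_linear_lincomb:
  fixes f :: "'a \<Rightarrow> rat"
  assumes "rational_linear f" "\<And>i. i \<in> I \<Longrightarrow> b i \<in> K"
  shows "f (\<Sum>i\<in>I. of_rat (q i) * b i) = (\<Sum>i\<in>I. q i * f (b i))"
proof -
  have "f (\<Sum>i\<in>I. of_rat (q i) * b i) = (\<Sum>i\<in>I. f (of_rat (q i) * b i))"
    using assms by (intro rational_linear_sum) auto
  also have "\<dots> = (\<Sum>i\<in>I. q i * f (b i))"
    using assms unfolding rational_linear_def by (intro sum.cong) auto
  finally show ?thesis .
qed

text \<open>The Casimir tensor of the form does not depend on the frame; all sums over frames below are evaluated by this.\<close>

lemma frame_casimir:
  fixes f :: "'a \<Rightarrow> 'a \<Rightarrow> rat"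
  assumes F: "frame I b d" "frame J c e"
    and lin: "\<And>x. x \<in> K \<Longrightarrow> rational_linear (f x)" "\<And>y. y \<in> K \<Longrightarrow> rational_linear (\<lambda>x. f x y)"
  shows "(\<Sum>i\<in>I. f (b i) (d i)) = (\<Sum>j\<in>J. f (c j) (e j))"
proof -
  note f1 = frameD[OF F(1)] and f2 = frameD[OF F(2)] and f1' = frameD[OF frame_swap[OF F(1)]]
  have "(\<Sum>i\<in>I. f (b i) (d i)) = (\<Sum>i\<in>I. \<Sum>j\<in>J. tr (b i * e j) * f (c j) (d i))"
  proof (intro sum.cong refl)
    fix i assume i: "i \<in> I"
    have "f (b i) (d i) = f (\<Sum>j\<in>J. of_rat (tr (b i * e j)) * c j) (d i)"
      using f2(4)[of "b i"] f1(2)[OF i] by simp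
    also have "\<dots> = (\<Sum>j\<in>J. tr (b i * e j) * f (c j) (d i))"
      using f1(3)[OF i] f2 by (intro rational_linear_lincomb[of "\<lambda>x. f x (d i)"] lin)
    finally show "f (b i) (d i) = (\<Sum>j\<in>J. tr (b i * e j) * f (c j) (d i))" .
  qed
  also have "\<dots> = (\<Sum>j\<in>J. \<Sum>i\<in>I. tr (b i * e j) * f (c j) (d i))" by (rule sum.swap)
  also have "\<dots> = (\<Sum>j\<in>J. f (c j) (e j))"
  proof (intro sum.cong refl)
    fix j assume j: "j \<in> J"
    have "f (c j) (e j) = f (c j) (\<Sum>i\<in>I. of_rat (tr (e j * b i)) * d i)"
      using f1'(4)[of "e j"] f2(3)[OF j] by simp
    also have "\<dots> = (\<Sum>i\<in>I. tr (e j * b i) * f (c j) (d i))"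
      using f2(2)[OF j] f1 by (intro rational_linear_lincomb[of "f (c j)"] lin)
    finally show "(\<Sum>i\<in>I. tr (b i * e j) * f (c j) (d i)) = f (c j) (e j)" by (simp add: mult.commute)
  qed
  finally show ?thesis .
qed

lemma rational_linear_tr: "y \<in> K \<Longrightarrow> rational_linear (\<lambda>x. tr (x * y))"
  unfolding rational_linear_def
proof (intro conjI ballI allI)
  fix u v assume "y \<in> K" "u \<in> K" "v \<in> K"
  then show "tr ((u + v) * y) = tr (u * y) + tr (v * y)"
    unfolding distrib_right by (intro tr_add K_mult)
next
  fix q u assume "y \<in> K" "u \<in> K"
  then have "tr (of_rat q * (u * y)) = q * tr (u * y)" by (intro tr_scale K_mult)
  then show "tr (of_rat q * u * y) = of_rat q * tr (u * y)" by (simp add: mult.assoc)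
qed

lemma orthogonal_frame:
  assumes oC: "orthogonal_set C" and x: "x \<in> rat_vs.span C"
  shows "x = (\<Sum>c\<in>C. of_rat (tr (x * (of_rat (1 / tr (c * c)) * c))) * c)"
proof -
  note C = orthogonal_setD[OF oC]
  obtain u where u: "x = (\<Sum>c\<in>C. of_rat (u c) * c)" using x unfolding rat_vs.span_finite[OF C(1)] by auto
  have "tr (x * (of_rat (1 / tr (d * d)) * d)) = u d" if d: "d \<in> C" for d
  proof -
    have "tr (x * d) = (\<Sum>c\<in>C. u c * tr (c * d))" unfolding u by (rule tr_lincomb[OF C(2) C(2)[OF d]])
    then have e: "tr (x * d) = u d * tr (d * d)" using orthogonal_sum[OF oC d] by simp
    have xK: "x \<in> K" unfolding u by (intro K_sum K_scale C)
    have "tr (of_rat (1 / tr (d * d)) * (x * d)) = 1 / tr (d * d) * tr (x * d)"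
      by (intro tr_scale K_mult xK C d)
    then show ?thesis using e C(5)[OF d] by (simp add: mult.left_commute)
  qed
  then have "(\<Sum>c\<in>C. of_rat (tr (x * (of_rat (1 / tr (c * c)) * c))) * c) = (\<Sum>c\<in>C. of_rat (u c) * c)"
    by (intro sum.cong refl) simp
  then show ?thesis using u by simp
qed

lemma orthogonal_basis:
  obtains C where "orthogonal_set C" "frame C (\<lambda>c. c) (\<lambda>c. of_rat (1 / tr (c * c)) * c)"
proof -
  have "B \<subseteq> K" using B_in_K by blast
  then obtain C where oC: "orthogonal_set C" and s: "rat_vs.span C = K"
    using orthogonal_spanning_set[OF B(1)] B(3) by auto
  have "frame C (\<lambda>c. c) (\<lambda>c. of_rat (1 / tr (c * c)) * c)"
    unfolding frame_def
  proof (intro conjI ballI)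
    fix x assume "x \<in> K"
    then show "x = (\<Sum>c\<in>C. of_rat (tr (x * (of_rat (1 / tr (c * c)) * c))) * c)"
      by (intro orthogonal_frame[OF oC]) (simp add: s)
  qed (use orthogonal_setD[OF oC] in \<open>auto intro: K_scale\<close>)
  with oC show ?thesis by (rule that)
qed

lemma tr_frame:
  assumes F: "frame I b d" and x: "x \<in> K"
  shows "tr x = (\<Sum>i\<in>I. tr (x * b i * d i))"
proof -
  obtain C where C: "frame C (\<lambda>c. c) (\<lambda>c. of_rat (1 / tr (c * c)) * c)" using orthogonal_basis .
  note fC = frameD[OF C]
  define e where "e \<beta> = (\<Sum>c\<in>C. of_rat (rep c \<beta>) * (of_rat (1 / tr (c * c)) * c))" for \<beta>
  have eK: "e \<beta> \<in> K" for \<beta> unfolding e_def using fC by auto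
  have re: "rep y \<beta> = tr (y * e \<beta>)" if y: "y \<in> K" for y \<beta>
  proof -
    have lin: "rational_linear (\<lambda>y. rep y \<beta>)" unfolding rational_linear_def by (auto simp: rep_add rep_scale)
    have "tr (y * e \<beta>) = tr (e \<beta> * y)" by (simp add: mult.commute)
    also have "\<dots> = (\<Sum>c\<in>C. rep c \<beta> * tr (of_rat (1 / tr (c * c)) * c * y))"
      unfolding e_def using fC y by (intro tr_lincomb) auto
    also have "\<dots> = (\<Sum>c\<in>C. tr (y * (of_rat (1 / tr (c * c)) * c)) * rep c \<beta>)"
      by (simp only: mult.commute)
    also have "\<dots> = rep (\<Sum>c\<in>C. of_rat (tr (y * (of_rat (1 / tr (c * c)) * c))) * c) \<beta>"
      using fC by (intro rational_linear_lincomb[OF lin, symmetric])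
    finally show ?thesis using fC(4)[OF y] by simp
  qed
  have "frame B (\<lambda>\<beta>. \<beta>) e"
    unfolding frame_def using B(1) eK B_in_K rep_sum re by auto
  moreover have "tr x = (\<Sum>\<beta>\<in>B. tr (x * \<beta> * e \<beta>))"
    by (subst tr_rep, intro sum.cong refl re K_mult x B_in_K)
  moreover have "rational_linear (\<lambda>v. tr (x * u * v))" "rational_linear (\<lambda>u. tr (x * u * v))"
    if "u \<in> K" "v \<in> K" for u v
  proof -
    have "(\<lambda>v. tr (x * u * v)) = (\<lambda>v. tr (v * (x * u)))" "(\<lambda>u. tr (x * u * v)) = (\<lambda>u. tr (u * (x * v)))"
      by (simp_all only: ac_simps)
    then show "rational_linear (\<lambda>v. tr (x * u * v))" "rational_linear (\<lambda>u. tr (x * u * v))"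
      using rational_linear_tr[OF K_mult[OF x that(1)]] rational_linear_tr[OF K_mult[OF x that(2)]] by metis+
  qed
  ultimately show ?thesis
    using frame_casimir[OF F, of B "\<lambda>\<beta>. \<beta>" e "\<lambda>u v. tr (x * u * v)"] by (metis K_0)
qed

lemma orthogonal_int_independent:
  assumes oC: "orthogonal_set C"
  shows "int_mod.independent C"
proof -
  note C = orthogonal_setD[OF oC]
  show ?thesis unfolding int_independent_iff[OF C(1)]
  proof (intro allI impI ballI)
    fix u d assume u: "(\<Sum>v\<in>C. of_int (u v) * v) = 0" and d: "d \<in> C"
    have "0 = tr ((\<Sum>v\<in>C. of_rat (of_int (u v)) * v) * d)" using u tr_0 by simp
    also have "\<dots> = (\<Sum>c\<in>C. of_int (u c) * tr (c * d))" by (rule tr_lincomb[OF C(2) C(2)[OF d]])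
    also have "\<dots> = of_int (u d) * tr (d * d)" by (rule orthogonal_sum[OF oC d])
    finally show "u d = 0" using C(5)[OF d] by simp
  qed
qed

text \<open>Integers have integral coordinates in a basis dual to an orthogonal basis of integers.\<close>

lemma integer_subgroup_basis:
  assumes H: "H \<subseteq> OK" "0 \<in> H" "\<And>x y. x \<in> H \<Longrightarrow> y \<in> H \<Longrightarrow> x - y \<in> H"
  shows "\<exists>T. finite T \<and> int_mod.independent T \<and> int_mod.span T = H"
proof -
  obtain C where oC: "orthogonal_set C" and fC: "frame C (\<lambda>c. c) (\<lambda>c. of_rat (1 / tr (c * c)) * c)"
    using orthogonal_basis .
  note C = orthogonal_setD[OF oC]
  have "\<forall>c\<in>C. \<exists>N::int. N > 0 \<and> of_int N * c \<in> OK" using integer_multiple C(2) by blast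
  from bchoice[OF this] obtain N :: "'a \<Rightarrow> int"
    where N: "\<And>c. c \<in> C \<Longrightarrow> N c > 0" "\<And>c. c \<in> C \<Longrightarrow> of_int (N c) * c \<in> OK" by blast
  define s where "s c = of_rat (1 / (of_int (N c) * tr (c * c))) * c" for c
  have tc: "tr (c * c) > 0" "c \<in> K" "c \<noteq> 0" if "c \<in> C" for c using C(2,3,5)[OF that] by auto
  have s0: "s c \<noteq> 0" "s c \<in> K" if "c \<in> C" for c
  proof -
    show "s c \<in> K" unfolding s_def by (rule K_scale[OF tc(2)[OF that]])
    have "of_int (N c) * tr (c * c) \<noteq> 0" using tc(1)[OF that] N(1)[OF that] by simp
    then show "s c \<noteq> 0" unfolding s_def using tc(3)[OF that] by simp
  qed
  have so: "tr (s c * s d) = 0" if cd: "c \<in> C" "d \<in> C" "c \<noteq> d" for c d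
  proof -
    have "s c * s d = of_rat (1 / (of_int (N c) * tr (c * c)) * (1 / (of_int (N d) * tr (d * d)))) * (c * d)"
      unfolding s_def by (simp only: of_rat_mult ac_simps)
    then show ?thesis using tr_scale[of "c * d"] C(4)[OF cd] tc(2)[OF cd(1)] tc(2)[OF cd(2)] by (simp only: K_mult mult_zero_right)
  qed
  have "orthogonal_set (s ` C)" unfolding orthogonal_set_def
  proof (intro conjI ballI impI)
    fix u v assume "u \<in> s ` C" "v \<in> s ` C" "u \<noteq> v"
    then show "tr (u * v) = 0" using so by (metis imageE)
  qed (use C(1) s0 in auto)
  then have ind: "int_mod.independent (s ` C)" by (rule orthogonal_int_independent)
  have "OK \<subseteq> int_mod.span (s ` C)"
  proof
    fix x assume x: "x \<in> OK"
    have "of_rat (tr (x * (of_rat (1 / tr (c * c)) * c))) * c \<in> int_mod.span (s ` C)" if c: "c \<in> C" for c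
    proof -
      have "tr (x * (of_int (N c) * c)) \<in> \<int>" by (rule tr_Ints) (use x N c in blast)
      then obtain m where m: "tr (x * (of_int (N c) * c)) = of_int m" by (auto elim: Ints_cases)
      have "tr (x * (of_int (N c) * c)) = of_int (N c) * tr (x * c)"
        by (subst mult.left_commute) (rule tr_int_mult[OF K_mult[OF O_K[OF x] tc(2)[OF c]]])
      then have m': "of_int (N c) * tr (x * c) = of_int m" using m by simp
      have "tr (x * (of_rat (1 / tr (c * c)) * c)) = 1 / tr (c * c) * tr (x * c)"
        by (subst mult.left_commute) (rule tr_scale[OF K_mult[OF O_K[OF x] tc(2)[OF c]]])
      also have "\<dots> = of_int m * (1 / (of_int (N c) * tr (c * c)))"
        unfolding m'[symmetric] using N(1)[OF c] tc[OF c] by simp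
      finally have "of_rat (tr (x * (of_rat (1 / tr (c * c)) * c))) * c = of_int m * s c"
        unfolding s_def by (simp only: of_rat_mult of_rat_of_int_eq mult.assoc)
      moreover have "of_int m * s c \<in> int_mod.span (s ` C)"
        using c by (intro int_mod.span_scale int_mod.span_base) blast
      ultimately show ?thesis by simp
    qed
    then have "(\<Sum>c\<in>C. of_rat (tr (x * (of_rat (1 / tr (c * c)) * c))) * c) \<in> int_mod.span (s ` C)"
      by (rule int_mod.span_sum)
    then show "x \<in> int_mod.span (s ` C)" by (subst frameD(4)[OF fC O_K[OF x]])
  qed
  then have "H \<subseteq> int_mod.span (s ` C)" using H(1) by blast
  then show ?thesis using subgroup_basis[OF _ ind, of H] C(1) H(2,3) by blast
qed

subsection \<open>The pairing of trilinear forms\<close>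

definition trilinear :: "('a \<Rightarrow> 'a \<Rightarrow> 'a \<Rightarrow> rat) \<Rightarrow> bool" where
  "trilinear T \<longleftrightarrow> (\<forall>x\<in>K. \<forall>y\<in>K. rational_linear (T x y) \<and> rational_linear (\<lambda>z. T x z y) \<and> rational_linear (\<lambda>z. T z x y))"

lemma trilinearD:
  assumes "trilinear T" "x \<in> K" "y \<in> K"
  shows "rational_linear (T x y)" "rational_linear (\<lambda>z. T x z y)" "rational_linear (\<lambda>z. T z x y)"
  using assms unfolding trilinear_def by blast+

definition pairing :: "'i set \<Rightarrow> ('i \<Rightarrow> 'a) \<Rightarrow> ('i \<Rightarrow> 'a) \<Rightarrow> ('a \<Rightarrow> 'a \<Rightarrow> 'a \<Rightarrow> rat) \<Rightarrow> ('a \<Rightarrow> 'a \<Rightarrow> 'a \<Rightarrow> rat) \<Rightarrow> rat" where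
  "pairing I b d T U = (\<Sum>i\<in>I. \<Sum>j\<in>I. \<Sum>k\<in>I. T (b i) (b j) (b k) * U (d i) (d j) (d k))"

lemma rational_linear_mult_const:
  fixes f :: "'a \<Rightarrow> rat"
  assumes "rational_linear f"
  shows "rational_linear (\<lambda>x. f x * c)" "rational_linear (\<lambda>x. c * f x)"
proof -
  have a: "f (u + v) = f u + f v" if "u \<in> K" "v \<in> K" for u v
    using assms that unfolding rational_linear_def by blast
  have m: "f (of_rat q * u) = of_rat q * f u" if "u \<in> K" for q u
    using assms that unfolding rational_linear_def by blast
  show "rational_linear (\<lambda>x. f x * c)" unfolding rational_linear_def
  proof (intro conjI ballI allI)
    fix u v assume "u \<in> K" "v \<in> K" then show "f (u + v) * c = f u * c + f v * c" by (simp only: a distrib_right)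
  next
    fix q u assume "u \<in> K" then show "f (of_rat q * u) * c = of_rat q * (f u * c)" by (simp only: m mult.assoc)
  qed
  then show "rational_linear (\<lambda>x. c * f x)" by (simp only: mult.commute)
qed

lemma rational_linear_sum_fun:
  fixes f :: "'i \<Rightarrow> 'a \<Rightarrow> rat"
  assumes "\<And>i. i \<in> I \<Longrightarrow> rational_linear (f i)"
  shows "rational_linear (\<lambda>x. \<Sum>i\<in>I. f i x)"
  unfolding rational_linear_def
proof (intro conjI ballI allI)
  fix u v assume "u \<in> K" "v \<in> K"
  then show "(\<Sum>i\<in>I. f i (u + v)) = (\<Sum>i\<in>I. f i u) + (\<Sum>i\<in>I. f i v)"
    using assms unfolding sum.distrib[symmetric] rational_linear_def by (intro sum.cong refl) blast
next
  fix q u assume "u \<in> K"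
  then show "(\<Sum>i\<in>I. f i (of_rat q * u)) = of_rat q * (\<Sum>i\<in>I. f i u)"
    using assms unfolding sum_distrib_left rational_linear_def by (intro sum.cong refl) blast
qed

lemma pairing_independent:
  assumes T: "trilinear T" and U: "trilinear U" and F: "frame I b d" "frame J c e"
  shows "pairing I b d T U = pairing J c e T U"
proof -
  note f1 = frameD[OF F(1)] and f2 = frameD[OF F(2)]
  note f1 = f1(1-3) and f2 = f2(1-3)
  note t1 = trilinearD[OF T] and u1 = trilinearD[OF U]
  have "pairing I b d T U = (\<Sum>i\<in>I. \<Sum>j\<in>I. \<Sum>k\<in>J. T (b i) (b j) (c k) * U (d i) (d j) (e k))"
    unfolding pairing_def
  proof (intro sum.cong refl)
    fix i j assume ij: "i \<in> I" "j \<in> I"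
    show "(\<Sum>k\<in>I. T (b i) (b j) (b k) * U (d i) (d j) (d k)) = (\<Sum>k\<in>J. T (b i) (b j) (c k) * U (d i) (d j) (e k))"
      by (rule frame_casimir[OF F, of "\<lambda>x y. T (b i) (b j) x * U (d i) (d j) y"])
        (intro rational_linear_mult_const t1 u1 f1 f2 ij; assumption?)+
  qed
  also have "\<dots> = (\<Sum>i\<in>I. \<Sum>j\<in>J. \<Sum>k\<in>J. T (b i) (c j) (c k) * U (d i) (e j) (e k))"
  proof (intro sum.cong refl)
    fix i assume i: "i \<in> I"
    show "(\<Sum>j\<in>I. \<Sum>k\<in>J. T (b i) (b j) (c k) * U (d i) (d j) (e k)) = (\<Sum>j\<in>J. \<Sum>k\<in>J. T (b i) (c j) (c k) * U (d i) (e j) (e k))"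
      by (rule frame_casimir[OF F, of "\<lambda>x y. \<Sum>k\<in>J. T (b i) x (c k) * U (d i) y (e k)"])
        (intro rational_linear_sum_fun rational_linear_mult_const t1 u1 f1 f2 i; assumption?)+
  qed
  also have "\<dots> = pairing J c e T U"
    unfolding pairing_def
    by (rule frame_casimir[OF F, of "\<lambda>x y. \<Sum>j\<in>J. \<Sum>k\<in>J. T x (c j) (c k) * U y (e j) (e k)"])
      (intro rational_linear_sum_fun rational_linear_mult_const t1 u1 f1 f2; assumption?)+
  finally show ?thesis .
qed

lemma trilinear_tr: "trilinear (\<lambda>x y z. tr (x * y * z))"
proof -
  have "rational_linear (\<lambda>z. tr (x * y * z))" "rational_linear (\<lambda>z. tr (x * z * y))" "rational_linear (\<lambda>z. tr (z * x * y))"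
    if "x \<in> K" "y \<in> K" for x y
  proof -
    have "(\<lambda>z. tr (x * y * z)) = (\<lambda>z. tr (z * (x * y)))" "(\<lambda>z. tr (x * z * y)) = (\<lambda>z. tr (z * (x * y)))"
      "(\<lambda>z. tr (z * x * y)) = (\<lambda>z. tr (z * (x * y)))" by (simp_all only: ac_simps)
    then show "rational_linear (\<lambda>z. tr (x * y * z))" "rational_linear (\<lambda>z. tr (x * z * y))" "rational_linear (\<lambda>z. tr (z * x * y))"
      using rational_linear_tr[OF K_mult[OF that]] by metis+
  qed
  then show ?thesis unfolding trilinear_def by blast
qed

text \<open>Contracting one index is Parseval; the remaining two contractions each evaluate a trace.\<close>

lemma pairing_tr_tr:
  assumes F: "frame I b d"
  shows "pairing I b d (\<lambda>x y z. tr (x * y * z)) (\<lambda>x y z. tr (x * y * z)) = tr 1"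
proof -
  note f = frameD(1-3)[OF F]
  have "pairing I b d (\<lambda>x y z. tr (x * y * z)) (\<lambda>x y z. tr (x * y * z)) =
      (\<Sum>i\<in>I. \<Sum>j\<in>I. tr ((b i * d i) * b j * d j))"
    unfolding pairing_def
  proof (intro sum.cong refl)
    fix i j assume ij: "i \<in> I" "j \<in> I"
    have "(\<Sum>k\<in>I. tr (b i * b j * b k) * tr (d i * d j * d k)) = (\<Sum>k\<in>I. tr (d i * d j * d k) * tr (b i * b j * b k))"
      by (simp only: mult.commute)
    also have "\<dots> = tr ((d i * d j) * (b i * b j))" using ij f by (intro parseval[OF F]) auto
    finally show "(\<Sum>k\<in>I. tr (b i * b j * b k) * tr (d i * d j * d k)) = tr ((b i * d i) * b j * d j)"
      by (simp only: ac_simps)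
  qed
  also have "\<dots> = (\<Sum>i\<in>I. tr (1 * b i * d i))"
    unfolding mult_1 by (intro sum.cong refl tr_frame[OF F, symmetric] K_mult f)
  also have "\<dots> = tr 1" by (rule tr_frame[OF F, symmetric]) simp
  finally show ?thesis .
qed

text \<open>In an orthogonal basis the pairing is a sum of products with positive weights, so the difference of two forms
  of equal norm has norm a sum of weighted squares.\<close>

lemma pairing_le:
  assumes T: "trilinear T" and U: "trilinear U" and F: "frame I b d"
    and n: "pairing I b d T T = n" "pairing I b d U U = n"
  shows "pairing I b d T U \<le> n"
    "pairing I b d T U = n \<Longrightarrow> x \<in> K \<Longrightarrow> y \<in> K \<Longrightarrow> z \<in> K \<Longrightarrow> T x y z = U x y z"
proof -
  obtain C where oC: "orthogonal_set C" and fC: "frame C (\<lambda>c. c) (\<lambda>c. of_rat (1 / tr (c * c)) * c)"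
    using orthogonal_basis .
  note C = orthogonal_setD[OF oC]
  define w where "w i j k = (1 / tr (i * i)) * (1 / tr (j * j)) * (1 / tr (k * k))" for i j k
  have w: "w i j k > 0" if "i \<in> C" "j \<in> C" "k \<in> C" for i j k
    unfolding w_def using C(5) that by simp
  have P: "pairing I b d X Y = (\<Sum>i\<in>C. \<Sum>j\<in>C. \<Sum>k\<in>C. w i j k * (X i j k * Y i j k))"
    if X: "trilinear X" and Y: "trilinear Y" for X Y
  proof -
    have sc: "Y (of_rat p * i) (of_rat q * j) (of_rat r * k) = p * q * r * Y i j k"
      if "i \<in> K" "j \<in> K" "k \<in> K" for p q r i j k
    proof -
      have sc1: "f (of_rat p * v) = p * f v" if "rational_linear f" "v \<in> K" for f :: "'a \<Rightarrow> rat" and p v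
        using that unfolding rational_linear_def by simp
      have "Y (of_rat p * i) (of_rat q * j) (of_rat r * k) = p * Y i (of_rat q * j) (of_rat r * k)"
        by (rule sc1[OF trilinearD(3)[OF Y]]) (use that in blast)+
      also have "Y i (of_rat q * j) (of_rat r * k) = q * Y i j (of_rat r * k)"
        by (rule sc1[OF trilinearD(2)[OF Y]]) (use that in blast)+
      also have "Y i j (of_rat r * k) = r * Y i j k"
        by (rule sc1[OF trilinearD(1)[OF Y]]) (use that in blast)+
      finally show ?thesis by simp
    qed
    have "pairing I b d X Y = pairing C (\<lambda>c. c) (\<lambda>c. of_rat (1 / tr (c * c)) * c) X Y"
      by (rule pairing_independent[OF X Y F fC])
    also have "\<dots> = (\<Sum>i\<in>C. \<Sum>j\<in>C. \<Sum>k\<in>C. w i j k * (X i j k * Y i j k))"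
      unfolding pairing_def by (intro sum.cong refl) (simp add: sc[OF C(2) C(2) C(2)] w_def)
    finally show ?thesis .
  qed
  let ?d = "\<lambda>i j k. w i j k * (T i j k - U i j k)\<^sup>2"
  have e: "2 * n - 2 * pairing I b d T U = (\<Sum>i\<in>C. \<Sum>j\<in>C. \<Sum>k\<in>C. ?d i j k)"
  proof -
    have "2 * n - 2 * pairing I b d T U = pairing I b d T T + pairing I b d U U - 2 * pairing I b d T U" using n by simp
    also have "\<dots> = (\<Sum>i\<in>C. \<Sum>j\<in>C. \<Sum>k\<in>C. w i j k * (T i j k * T i j k) + w i j k * (U i j k * U i j k) - 2 * (w i j k * (T i j k * U i j k)))"
      unfolding P[OF T T] P[OF U U] P[OF T U] by (simp only: sum.distrib sum_subtractf sum_distrib_left)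
    finally show ?thesis by (simp add: power2_eq_square algebra_simps)
  qed
  have nn: "?d i j k \<ge> 0" if "i \<in> C" "j \<in> C" "k \<in> C" for i j k using w[OF that] by simp
  have "(\<Sum>i\<in>C. \<Sum>j\<in>C. \<Sum>k\<in>C. ?d i j k) \<ge> 0" using nn by (intro sum_nonneg)
  then show "pairing I b d T U \<le> n" using e by simp
  assume eq: "pairing I b d T U = n" and xyz: "x \<in> K" "y \<in> K" "z \<in> K"
  have z1: "T i j k = U i j k" if ijk: "i \<in> C" "j \<in> C" "k \<in> C" for i j k
  proof -
    have n1: "(\<Sum>k\<in>C. ?d i j k) \<ge> 0" if "i \<in> C" "j \<in> C" for i j using nn[OF that] by (rule sum_nonneg)
    have n2: "(\<Sum>j\<in>C. \<Sum>k\<in>C. ?d i j k) \<ge> 0" if "i \<in> C" for i using n1[OF that] by (rule sum_nonneg)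
    have "(\<Sum>i\<in>C. \<Sum>j\<in>C. \<Sum>k\<in>C. ?d i j k) = 0" using e eq by simp
    then have "(\<Sum>j\<in>C. \<Sum>k\<in>C. ?d i j k) = 0" using sum_nonneg_eq_0_iff[OF C(1), of "\<lambda>i. \<Sum>j\<in>C. \<Sum>k\<in>C. ?d i j k"] n2 ijk(1) by blast
    then have "(\<Sum>k\<in>C. ?d i j k) = 0" using sum_nonneg_eq_0_iff[OF C(1), of "\<lambda>j. \<Sum>k\<in>C. ?d i j k"] n1[OF ijk(1)] ijk(2) by blast
    then have "?d i j k = 0" using sum_nonneg_eq_0_iff[OF C(1), of "?d i j"] nn[OF ijk(1,2)] ijk(3) by blast
    then show ?thesis using w[OF ijk] by simp
  qed
  have ext: "f v = g v" if "rational_linear f" "rational_linear g" "v \<in> K" "\<And>c. c \<in> C \<Longrightarrow> f c = g c" for f g :: "'a \<Rightarrow> rat" and v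
  proof -
    have "f v = f (\<Sum>c\<in>C. of_rat (tr (v * (of_rat (1 / tr (c * c)) * c))) * c)"
      using frameD(4)[OF fC that(3)] by simp
    also have "\<dots> = (\<Sum>c\<in>C. tr (v * (of_rat (1 / tr (c * c)) * c)) * f c)"
      by (rule rational_linear_lincomb[OF that(1) C(2)])
    also have "\<dots> = (\<Sum>c\<in>C. tr (v * (of_rat (1 / tr (c * c)) * c)) * g c)"
      using that(4) by (intro sum.cong refl) simp
    also have "\<dots> = g (\<Sum>c\<in>C. of_rat (tr (v * (of_rat (1 / tr (c * c)) * c))) * c)"
      by (rule rational_linear_lincomb[OF that(2) C(2), symmetric])
    also have "\<dots> = g v" using frameD(4)[OF fC that(3)] by simp
    finally show ?thesis .
  qed
  have 2: "T i j z = U i j z" if "i \<in> C" "j \<in> C" for i j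
    by (rule ext[of "T i j" "U i j"]) (use that C(2) z1 xyz in \<open>blast intro: trilinearD[OF T] trilinearD[OF U]\<close>)+
  have 3: "T i y z = U i y z" if "i \<in> C" for i
    by (rule ext[of "\<lambda>y. T i y z" "\<lambda>y. U i y z"]) (use that C(2) 2 xyz in \<open>blast intro: trilinearD[OF T] trilinearD[OF U]\<close>)+
  show "T x y z = U x y z"
    by (rule ext[of "\<lambda>x. T x y z" "\<lambda>x. U x y z"]) (use C(2) 3 xyz in \<open>blast intro: trilinearD[OF T] trilinearD[OF U]\<close>)+
qed

end

section \<open>Adjugate matrices\<close>

lemma adj_mat_sum:
  fixes G :: "'a::comm_ring_1 mat"
  assumes G: "G \<in> carrier_mat n n" and "k < n" "i < n"
  shows "(\<Sum>j<n. G $$ (k,j) * adj_mat G $$ (j,i)) = (if k = i then det G else 0)"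
proof -
  have "(G * adj_mat G) $$ (k,i) = (det G \<cdot>\<^sub>m 1\<^sub>m n) $$ (k,i)" using adj_mat(2)[OF G] by simp
  then show ?thesis using assms adj_mat(1)[OF G] by (simp add: scalar_prod_def atLeast0LessThan)
qed

lemma det_adj_mat_int:
  fixes G :: "int mat"
  assumes G: "G \<in> carrier_mat n n" and D: "det G \<noteq> 0"
  shows "det (adj_mat G) * det G = det G ^ n"
proof -
  have "det G * det (adj_mat G) = det (det G \<cdot>\<^sub>m 1\<^sub>m n)"
    using det_mult[OF G adj_mat(1)[OF G]] adj_mat(2)[OF G] by simp
  then show ?thesis using det_smult[of "det G" "1\<^sub>m n"] by (simp add: mult.commute)
qed

text \<open>The minors of size two of the adjugate are divisible by the determinant. Both Cramer steps
  below evaluate determinants of integer matrices, which gives the divisibility.\<close>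

lemma adj_minor_dvd:
  fixes G :: "int mat"
  assumes G: "G \<in> carrier_mat n n" and D: "det G \<noteq> 0"
    and i: "i < n" and a: "a < n" and c: "c < n" and nz: "adj_mat G $$ (i,i) \<noteq> 0"
  shows "det G dvd adj_mat G $$ (i,i) * adj_mat G $$ (a,c) - adj_mat G $$ (a,i) * adj_mat G $$ (i,c)"
proof (cases "a = i")
  case False
  let ?h = "\<lambda>j k. adj_mat G $$ (j,k)"
  let ?R = "map_mat rat_of_int"
  define A where "A = replace_col G (unit_vec n i) i"
  define A2 where "A2 = replace_col A (unit_vec n c) a"
  have A: "A \<in> carrier_mat n n" and A2: "A2 \<in> carrier_mat n n"
    using G unfolding A_def A2_def replace_col_def by auto
  have RG: "?R G \<in> carrier_mat n n" and RA: "?R A \<in> carrier_mat n n" using G A by auto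
  have detR: "det (?R M) = of_int (det M)" if "M \<in> carrier_mat n n" for M
    by (rule of_int_hom.hom_det)
  define v where "v k = vec n (\<lambda>j. of_int (?h j k) / of_int (det G) :: rat)" for k
  have vc: "v k \<in> carrier_vec n" for k unfolding v_def by simp
  have Gv: "?R G *\<^sub>v v k = unit_vec n k" if k: "k < n" for k
  proof (rule eq_vecI)
    fix j assume "j < dim_vec (unit_vec n k :: rat vec)"
    then have j: "j < n" by simp
    have "vec_index (?R G *\<^sub>v v k) j = (\<Sum>l<n. of_int (G $$ (j,l)) * (of_int (?h l k) / of_int (det G)))"
      using G j unfolding v_def by (simp add: scalar_prod_def atLeast0LessThan)
    also have "\<dots> = of_int (\<Sum>l<n. G $$ (j,l) * ?h l k) / of_int (det G)"
      by (simp add: sum_divide_distrib)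
    also have "\<dots> = (if j = k then 1 else 0)" unfolding adj_mat_sum[OF G j k] using D by simp
    finally show "vec_index (?R G *\<^sub>v v k) j = vec_index (unit_vec n k) j" using j k by simp
  qed (use G in simp)
  have "?R A = replace_col (?R G) (?R G *\<^sub>v v i) i"
    unfolding Gv[OF i] A_def replace_col_def using G i by (intro eq_matI) auto
  then have "det (?R A) = vec_index (v i) i * det (?R G)" using cramer_lemma_mat[OF RG vc i] by simp
  then have detA: "rat_of_int (det A) = of_int (?h i i)"
    using D i detR[OF A] detR[OF G] by (simp add: v_def)
  define \<kappa> where "\<kappa> = (of_int (?h i c) / of_int (?h i i) :: rat)"
  define y where "y = v c - \<kappa> \<cdot>\<^sub>v v i"
  have yc: "y \<in> carrier_vec n" unfolding y_def using vc by auto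
  have yi: "vec_index y i = 0" unfolding y_def \<kappa>_def v_def using i nz D by simp
  define w where "w = y + \<kappa> \<cdot>\<^sub>v unit_vec n i"
  have wc: "w \<in> carrier_vec n" unfolding w_def using yc by auto
  have Aw: "?R A *\<^sub>v w = unit_vec n c"
  proof (rule eq_vecI)
    fix j assume "j < dim_vec (unit_vec n c :: rat vec)"
    then have j: "j < n" by simp
    have Aij: "?R A $$ (j,l) = (if l = i then (if j = i then 1 else 0) else of_int (G $$ (j,l)))" if "l < n" for l
      unfolding A_def replace_col_def using G j that i by simp
    have "vec_index (?R A *\<^sub>v w) j = (\<Sum>l<n. ?R A $$ (j,l) * vec_index w l)"
      using A j wc by (simp add: scalar_prod_def atLeast0LessThan)
    also have "\<dots> = (\<Sum>l<n. of_int (G $$ (j,l)) * vec_index y l + (if l = i then (if j = i then \<kappa> else 0) else 0))"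
      using yi yc i j by (intro sum.cong refl) (auto simp: Aij w_def)
    also have "\<dots> = (\<Sum>l<n. of_int (G $$ (j,l)) * vec_index y l) + (if j = i then \<kappa> else 0)"
      using i by (simp add: sum.distrib)
    also have "(\<Sum>l<n. of_int (G $$ (j,l)) * vec_index y l) = vec_index (?R G *\<^sub>v y) j"
      using G j yc by (simp add: scalar_prod_def atLeast0LessThan)
    also have "?R G *\<^sub>v y = unit_vec n c - \<kappa> \<cdot>\<^sub>v unit_vec n i"
      unfolding y_def using mult_minus_distrib_mat_vec[OF RG vc, of "\<kappa> \<cdot>\<^sub>v v i"] vc
        mult_mat_vec[OF RG vc] Gv[OF i] Gv[OF c] by simp
    finally show "vec_index (?R A *\<^sub>v w) j = vec_index (unit_vec n c) j" using j i c by auto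
  qed (use A in simp)
  have "?R A2 = replace_col (?R A) (?R A *\<^sub>v w) a"
    unfolding Aw A2_def replace_col_def using A a c by (intro eq_matI) auto
  then have "det (?R A2) = vec_index w a * det (?R A)" using cramer_lemma_mat[OF RA wc a] by simp
  then have "rat_of_int (det A2) = vec_index w a * of_int (?h i i)"
    using detR[OF A] detR[OF A2] detA by simp
  also have "vec_index w a = (of_int (?h a c) - \<kappa> * of_int (?h a i)) / of_int (det G)"
    unfolding w_def y_def v_def using a i c False by (simp add: diff_divide_distrib)
  finally have "rat_of_int (det A2) * of_int (det G) = (of_int (?h a c) - \<kappa> * of_int (?h a i)) * of_int (?h i i)"
    using D by simp
  also have "\<dots> = of_int (?h i i) * of_int (?h a c) - of_int (?h a i) * of_int (?h i c)"
    unfolding \<kappa>_def using nz by (simp add: left_diff_distrib)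
  finally have "rat_of_int (det A2 * det G) = of_int (?h i i * ?h a c - ?h a i * ?h i c)" by simp
  then have "det A2 * det G = ?h i i * ?h a c - ?h a i * ?h i c" by (simp only: of_int_eq_iff)
  then show ?thesis by (metis dvd_triv_right)
qed simp

section \<open>Integral bases and the discriminant\<close>

context posfield
begin

definition spans :: "nat \<Rightarrow> (nat \<Rightarrow> 'a) \<Rightarrow> bool" where
  "spans n b \<longleftrightarrow> (\<forall>i<n. b i \<in> OK) \<and> (\<forall>x\<in>OK. \<exists>c::nat \<Rightarrow> int. x = (\<Sum>i<n. of_int (c i) * b i))"

lemma spansD:
  assumes "spans n b"
  shows "i < n \<Longrightarrow> b i \<in> OK" "i < n \<Longrightarrow> b i \<in> K" "x \<in> OK \<Longrightarrow> \<exists>c::nat \<Rightarrow> int. x = (\<Sum>i<n. of_int (c i) * b i)"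
  using assms unfolding spans_def by blast+

definition gram :: "nat \<Rightarrow> (nat \<Rightarrow> 'a) \<Rightarrow> rat mat" where
  "gram n b = mat n n (\<lambda>(i,j). tr (b i * b j))"

definition int_gram :: "nat \<Rightarrow> (nat \<Rightarrow> 'a) \<Rightarrow> int mat" where
  "int_gram n b = mat n n (\<lambda>(i,j). \<lfloor>tr (b i * b j)\<rfloor>)"

lemma int_gram:
  assumes "\<And>i. i < n \<Longrightarrow> b i \<in> OK"
  shows "int_gram n b \<in> carrier_mat n n" "map_mat of_int (int_gram n b) = gram n b"
    "det (gram n b) = of_int (det (int_gram n b))"
    "i < n \<Longrightarrow> j < n \<Longrightarrow> of_int (int_gram n b $$ (i,j)) = tr (b i * b j)"
proof -
  show 1: "int_gram n b \<in> carrier_mat n n" unfolding int_gram_def by simp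
  have t: "of_int \<lfloor>tr (b i * b j)\<rfloor> = tr (b i * b j)" if "i < n" "j < n" for i j
    using tr_Ints[OF O_mult[OF assms[OF that(1)] assms[OF that(2)]]] by (metis Ints_cases floor_of_int)
  show 2: "map_mat of_int (int_gram n b) = gram n b"
    unfolding int_gram_def gram_def using t by (intro eq_matI) auto
  show "det (gram n b) = of_int (det (int_gram n b))" unfolding 2[symmetric] by simp
  show "i < n \<Longrightarrow> j < n \<Longrightarrow> of_int (int_gram n b $$ (i,j)) = tr (b i * b j)" for i j
    unfolding int_gram_def using t by simp
qed

lemma tr_int_lincomb:
  assumes "\<And>i. i \<in> I \<Longrightarrow> b i \<in> K" "y \<in> K"
  shows "tr ((\<Sum>i\<in>I. of_int (c i) * b i) * y) = (\<Sum>i\<in>I. of_int (c i) * tr (b i * y))"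
  using tr_lincomb[OF assms, of I "\<lambda>i. i" "\<lambda>i. of_int (c i)"] by simp

text \<open>The Gram matrix transforms by congruence, whence the square of the determinant.\<close>

lemma gram_change:
  assumes b: "\<And>i. i < n \<Longrightarrow> b i \<in> K"
    and b': "\<And>j. j < n \<Longrightarrow> b' j = (\<Sum>i<n. of_int (U j i) * b i)"
  shows "det (gram n b') = of_int (det (mat n n (\<lambda>(i,j). U i j))) ^ 2 * det (gram n b)"
proof -
  let ?U = "mat n n (\<lambda>(i,j). U i j)"
  let ?V = "map_mat rat_of_int ?U"
  have V: "?V \<in> carrier_mat n n" and g: "gram n b \<in> carrier_mat n n" unfolding gram_def by auto
  have "gram n b' = ?V * gram n b * transpose_mat ?V"
  proof (rule eq_matI)
    fix i j assume "i < dim_row (?V * gram n b * transpose_mat ?V)" "j < dim_col (?V * gram n b * transpose_mat ?V)"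
    then have ij: "i < n" "j < n" by auto
    have b'K: "b' j \<in> K" unfolding b'[OF ij(2)] by (intro K_sum K_mult K_int b) auto
    have "tr (b' i * b' j) = (\<Sum>k<n. of_int (U i k) * tr (b k * b' j))"
      by (subst b'[OF ij(1)]) (rule tr_int_lincomb, use b b'K in auto)
    also have "\<dots> = (\<Sum>k<n. of_int (U i k) * (\<Sum>l<n. of_int (U j l) * tr (b k * b l)))"
    proof (intro sum.cong refl arg_cong2[of _ _ _ _ "(*)"])
      fix k assume k: "k \<in> {..<n}"
      have "tr (b' j * b k) = (\<Sum>l<n. of_int (U j l) * tr (b l * b k))"
        unfolding b'[OF ij(2)] by (rule tr_int_lincomb) (use b k in auto)
      then show "tr (b k * b' j) = (\<Sum>l<n. of_int (U j l) * tr (b k * b l))" by (simp add: mult.commute)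
    qed
    also have "\<dots> = (\<Sum>l<n. (\<Sum>k<n. of_int (U i k) * tr (b k * b l)) * of_int (U j l))"
      unfolding sum_distrib_left sum_distrib_right by (subst sum.swap) (simp only: ac_simps)
    also have "\<dots> = (?V * gram n b * transpose_mat ?V) $$ (i,j)"
      using ij by (simp add: scalar_prod_def atLeast0LessThan gram_def)
    finally show "gram n b' $$ (i,j) = (?V * gram n b * transpose_mat ?V) $$ (i,j)" using ij by (simp add: gram_def)
  qed (auto simp: gram_def)
  then have "det (gram n b') = det ?V * det (gram n b) * det (transpose_mat ?V)"
    using det_mult[OF mult_carrier_mat[OF V g], of "transpose_mat ?V"] det_mult[OF V g] V by simp
  also have "det (transpose_mat ?V) = det ?V" by (rule det_transpose[OF V])
  also have "det ?V = of_int (det ?U)" by simp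
  finally show ?thesis by (simp add: power2_eq_square)
qed

lemma gram_det_unique:
  assumes b: "spans n b" and c: "spans n c"
  shows "det (gram n b) = det (gram n c)"
proof -
  note sb = spansD[OF b] and sc = spansD[OF c]
  have "\<forall>j\<in>{..<n}. \<exists>u::nat \<Rightarrow> int. c j = (\<Sum>i<n. of_int (u i) * b i)" using sb(3)[OF sc(1)] by simp
  from bchoice[OF this] obtain U :: "nat \<Rightarrow> nat \<Rightarrow> int"
    where U: "\<And>j. j < n \<Longrightarrow> c j = (\<Sum>i<n. of_int (U j i) * b i)" by (metis lessThan_iff)
  have "\<forall>j\<in>{..<n}. \<exists>u::nat \<Rightarrow> int. b j = (\<Sum>i<n. of_int (u i) * c i)" using sc(3)[OF sb(1)] by simp
  from bchoice[OF this] obtain V :: "nat \<Rightarrow> nat \<Rightarrow> int"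
    where V: "\<And>j. j < n \<Longrightarrow> b j = (\<Sum>i<n. of_int (V j i) * c i)" by (metis lessThan_iff)
  let ?u = "det (mat n n (\<lambda>(i,j). U i j))" and ?v = "det (mat n n (\<lambda>(i,j). V i j))"
  let ?B = "det (int_gram n b)" and ?C = "det (int_gram n c)"
  have c1: "det (gram n c) = of_int ?u ^ 2 * det (gram n b)" by (rule gram_change[OF sb(2) U])
  have c2: "det (gram n b) = of_int ?v ^ 2 * det (gram n c)" by (rule gram_change[OF sc(2) V])
  have gb: "det (gram n b) = of_int ?B" by (rule int_gram(3)) (rule sb(1))
  have gc: "det (gram n c) = of_int ?C" by (rule int_gram(3)) (rule sc(1))
  have "rat_of_int ?C = of_int (?u ^ 2 * ?B)"
    using c1 unfolding gb gc by (simp only: of_int_mult of_int_power)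
  moreover have "rat_of_int ?B = of_int (?v ^ 2 * ?C)"
    using c2 unfolding gb gc by (simp only: of_int_mult of_int_power)
  ultimately have e: "?C = ?u ^ 2 * ?B" "?B = ?v ^ 2 * ?C" by (simp_all only: of_int_eq_iff)
  have "?C = ?B"
  proof (cases "?B = 0")
    case False
    have "?B = (?v * ?u) ^ 2 * ?B" using e by (metis mult.assoc power_mult_distrib)
    then have "(?v * ?u) ^ 2 = 1" using False by simp
    then have "?u * (?v * ?v * ?u) = 1" by (simp only: power2_eq_square ac_simps)
    then have "?u dvd 1" by (intro dvdI[of _ _ "?v * ?v * ?u"]) simp
    then have "\<bar>?u\<bar> = 1" by (simp only: zdvd1_eq)
    then have "?u ^ 2 = 1" by (metis power2_abs power_one)
    then show ?thesis unfolding e(1) by (simp only: mult_1)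
  next
    case True
    then show ?thesis unfolding e(1) by (simp only: mult_zero_right)
  qed
  then show ?thesis unfolding gb gc by simp
qed

lemma int_independent_rational:
  assumes T: "finite T" "int_mod.independent T"
  shows "rat_vs.independent T"
proof -
  have "\<forall>v\<in>T. q v = 0" if q: "(\<Sum>v\<in>T. of_rat (q v) * v) = 0" for q
  proof -
    obtain N where N: "N > 0" "\<forall>a\<in>q ` T. of_int N * a \<in> \<int>" using common_denominator[of "q ` T"] T by auto
    then have "\<forall>v\<in>T. \<exists>m. of_int N * q v = of_int m" by (auto elim: Ints_cases)
    from bchoice[OF this] obtain m where m: "\<forall>v\<in>T. of_int N * q v = of_int (m v)" by blast
    have "(\<Sum>v\<in>T. of_int (m v) * v) = (\<Sum>v\<in>T. of_rat (of_int N * q v) * v)"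
      using m by (intro sum.cong refl) (metis of_rat_of_int_eq)
    also have "\<dots> = of_int N * (\<Sum>v\<in>T. of_rat (q v) * v)"
      by (simp only: of_rat_mult of_rat_of_int_eq sum_distrib_left mult.assoc)
    finally have "\<forall>v\<in>T. m v = 0" using q T int_independent_iff[OF T(1)] by simp
    then show ?thesis using m N(1) by auto
  qed
  then show ?thesis using rat_vs.dependent_finite[OF T(1)] by auto
qed

lemma integral_basis_length:
  assumes bs: "integral_basis K bs" shows "length bs = card B"
proof -
  have d: "distinct bs" "int_mod.independent (set bs)" "int_mod.span (set bs) = OK"
    using bs unfolding integral_basis_def by auto
  have ind: "rat_vs.independent (set bs)" using d by (intro int_independent_rational) auto
  have "K \<subseteq> rat_vs.span (set bs)"
  proof
    fix x assume "x \<in> K"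
    then obtain N where N: "N > (0::int)" "of_int N * x \<in> OK" using integer_multiple by blast
    then obtain u where u: "of_int N * x = (\<Sum>v\<in>set bs. of_int (u v) * v)"
      unfolding d(3)[symmetric] int_mod.span_finite[OF finite_set] by auto
    have "(\<Sum>v\<in>set bs. of_rat (of_int (u v)) * v) \<in> rat_vs.span (set bs)"
      by (intro rat_vs.span_sum rat_vs.span_scale rat_vs.span_base)
    then have "of_rat (1 / of_int N) * (of_int N * x) \<in> rat_vs.span (set bs)"
      unfolding u by (intro rat_vs.span_scale) simp
    moreover have "of_rat (1 / of_int N) * (of_int N * x) = x" using N(1) by (simp add: of_rat_divide)
    ultimately show "x \<in> rat_vs.span (set bs)" by simp
  qed
  moreover have "set bs \<subseteq> K" using d(3) int_mod.span_superset[of "set bs"] by blast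
  ultimately have "card (set bs) = rat_vs.dim K" using ind rat_vs.dim_unique[of "set bs" K "card (set bs)"] by simp
  then show ?thesis using d(1) card_B unfolding degree_over_rat_def by (simp add: distinct_card)
qed

lemma int_span_list:
  fixes bs :: "'a list"
  assumes "distinct bs" "x \<in> int_mod.span (set bs)"
  shows "\<exists>c::nat \<Rightarrow> int. x = (\<Sum>i<length bs. of_int (c i) * bs ! i)"
proof -
  obtain u where "x = (\<Sum>v\<in>set bs. of_int (u v) * v)"
    using assms(2) unfolding int_mod.span_finite[OF finite_set] by auto
  also have "\<dots> = (\<Sum>i<length bs. of_int (u (bs ! i)) * bs ! i)"
    using sum.reindex_bij_betw[OF bij_betw_nth[OF assms(1) refl refl], of "\<lambda>v. of_int (u v) * v"] by simp
  finally show ?thesis by (intro exI[of _ "\<lambda>i. u (bs ! i)"])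
qed

lemma integral_basis_spans:
  assumes bs: "integral_basis K bs" shows "spans (card B) (\<lambda>i. bs ! i)"
proof -
  have d: "distinct bs" "int_mod.span (set bs) = OK" using bs unfolding integral_basis_def by auto
  then show ?thesis unfolding spans_def integral_basis_length[OF bs, symmetric]
    using int_span_list[OF d(1)] int_mod.span_superset[of "set bs"] by (metis nth_mem subsetD)
qed

lemma discriminant_gram:
  assumes b: "spans (card B) b"
  shows "of_int (field_discriminant K) = det (gram (card B) b)"
proof -
  have "0 \<in> OK" "\<And>x y. x \<in> OK \<Longrightarrow> y \<in> OK \<Longrightarrow> x - y \<in> OK" by auto
  then obtain T where T: "finite T" "int_mod.independent T" "int_mod.span T = OK"
    using integer_subgroup_basis[of OK] by blast
  obtain bs where bs: "set bs = T" "distinct bs" using finite_distinct_list[OF T(1)] by blast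
  have ib: "integral_basis K bs" unfolding integral_basis_def using bs T by simp
  have g: "det (mat (length bs) (length bs) (\<lambda>(i, j). trace_form K (bs ! i) (bs ! j))) = det (gram (card B) b)"
    if bs: "integral_basis K bs" for bs
    using gram_det_unique[OF integral_basis_spans[OF bs] b] integral_basis_length[OF bs]
    unfolding gram_def trace_form_def by simp
  have "\<exists>d. of_int d = det (gram (card B) b)" using int_gram(3)[of "card B" b] spansD(1)[OF b] by metis
  then obtain d where d: "of_int d = det (gram (card B) b)" by blast
  have "field_discriminant K = d" unfolding field_discriminant_def
  proof (rule the_equality)
    show "\<exists>bs. integral_basis K bs \<and> rat_of_int d = det (mat (length bs) (length bs) (\<lambda>(i, j). trace_form K (bs ! i) (bs ! j)))"
      using ib g[OF ib] d by metis
    show "d' = d" if "\<exists>bs. integral_basis K bs \<and> rat_of_int d' = det (mat (length bs) (length bs) (\<lambda>(i, j). trace_form K (bs ! i) (bs ! j)))" for d'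
      using that g d by (metis of_int_eq_iff)
  qed
  then show ?thesis using d by simp
qed

end

section \<open>Integrality of the pairing\<close>

(* These module laws orient products of coercions against the ring normalisation rules. *)
declare int_mod.scale_scale [simp del] rat_vs.scale_scale [simp del]

lemma symmetric_sum_Suc:
  fixes F :: "nat \<Rightarrow> nat \<Rightarrow> nat \<Rightarrow> 'a::comm_ring_1"
  assumes s1: "\<And>i j k. F i j k = F j i k" and s2: "\<And>i j k. F i j k = F i k j"
  shows "(\<Sum>i<Suc n. \<Sum>j<Suc n. \<Sum>k<Suc n. F i j k) =
    (\<Sum>i<n. \<Sum>j<n. \<Sum>k<n. F i j k) + 3 * (\<Sum>i<n. \<Sum>j<n. F i j n) + 3 * (\<Sum>i<n. F i n n) + F n n n"
proof -
  have a: "(\<Sum>i<n. \<Sum>j<n. F i n j) = (\<Sum>i<n. \<Sum>j<n. F i j n)" by (simp only: s2[of _ n])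
  have b: "(\<Sum>i<n. \<Sum>j<n. F n i j) = (\<Sum>i<n. \<Sum>j<n. F i j n)" by (simp only: s1[of n] s2[of _ n])
  have c: "(\<Sum>i<n. F n i n) = (\<Sum>i<n. F i n n)" by (simp only: s1[of n])
  have d: "(\<Sum>i<n. F n n i) = (\<Sum>i<n. F i n n)" by (subst s2, subst s1) (rule refl)
  show ?thesis by (simp only: sum.lessThan_Suc sum.distrib a b c d) simp
qed

lemma symmetric_sum_mod_3:
  fixes F :: "nat \<Rightarrow> nat \<Rightarrow> nat \<Rightarrow> int"
  assumes s1: "\<And>i j k. F i j k = F j i k" and s2: "\<And>i j k. F i j k = F i k j"
    and d: "\<And>i. i < n \<Longrightarrow> 3 dvd F i i i"
  shows "3 dvd (\<Sum>i<n. \<Sum>j<n. \<Sum>k<n. F i j k)"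
  using d
proof (induction n)
  case (Suc n)
  then have "3 dvd (\<Sum>i<n. \<Sum>j<n. \<Sum>k<n. F i j k)" "3 dvd F n n n" by auto
  then show ?case unfolding symmetric_sum_Suc[OF s1 s2] by (intro dvd_add) auto
qed simp

lemma projection_coefficient:
  fixes A B C D \<eta> h :: rat
  assumes "D * A = D * \<eta> * B - h * C" "D \<noteq> 0" "\<eta> \<noteq> 0"
  shows "1 / \<eta> * A = B - C / (D * \<eta>) * h"
proof -
  have "A = (D * \<eta> * B - h * C) / D" using assms by (simp add: field_simps)
  then show ?thesis using assms(2,3) by (simp add: field_simps)
qed

lemma coefficient_identities:
  fixes D \<eta> s t Q T U :: rat
  assumes D: "D \<noteq> 0" "\<eta> \<noteq> 0"
  shows "t = 1 / \<eta> * s + 1 / (D * \<eta>) * Q \<Longrightarrow> Q / D = \<eta> * t - s"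
    "T * (1 / \<eta> * (1 / \<eta>) * (1 / \<eta>) * U) = T * U / \<eta> ^ 3"
    "T * (1 / \<eta> * (1 / \<eta>) * (1 / (D * \<eta>)) * U) = D * ((T / D) * (U / D)) / \<eta> ^ 3"
    "T * (1 / \<eta> * (1 / (D * \<eta>)) * (1 / (D * \<eta>)) * U) = (T / D) * (U / D) / \<eta> ^ 3"
    "T * (1 / (D * \<eta>) * (1 / (D * \<eta>)) * (1 / (D * \<eta>)) * U) = D * ((T / D / D) * (U / D / D)) / \<eta> ^ 3"
proof -
  assume "t = 1 / \<eta> * s + 1 / (D * \<eta>) * Q"
  then show "Q / D = \<eta> * t - s" using D by (simp add: distrib_left)
qed (use D in \<open>simp_all add: power3_eq_cube\<close>)

lemma difference_by_3:
  fixes NT NU :: rat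
  shows "(NT + 3 * of_int P' + of_int (3 * D1 * Q') - (NU + 3 * of_int P + of_int (3 * D1 * Q))) / 3 =
    (NT - NU) / 3 + of_int (P' - P + D1 * (Q' - Q))"
  by (simp add: field_simps)

context posfield
begin

text \<open>The properties of the trilinear trace form that survive its transport along an
  isometry of rings of integers.\<close>

definition trace_like :: "('a \<Rightarrow> 'a \<Rightarrow> 'a \<Rightarrow> rat) \<Rightarrow> bool" where
  "trace_like U \<longleftrightarrow> trilinear U \<and> (\<forall>x y z. U x y z = U y x z \<and> U x y z = U x z y) \<and>
     (\<forall>x\<in>OK. \<forall>y\<in>OK. \<forall>z\<in>OK. U x y z \<in> \<int>) \<and>
     (\<forall>x\<in>OK. (U x x x - tr x) / 3 \<in> \<int>) \<and>
     (\<forall>D::int. \<forall>z\<in>OK. (\<forall>w\<in>OK. tr (z * w) / of_int D \<in> \<int>) \<longrightarrow> (\<forall>x\<in>OK. \<forall>y\<in>OK. U z x y / of_int D \<in> \<int>)) \<and>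
     (\<forall>n b d. \<forall>x\<in>K. frame {..<n::nat} b d \<longrightarrow> (\<Sum>i<n. U x (b i) (d i)) = tr x)"

lemma trace_likeD:
  assumes "trace_like U"
  shows "trilinear U" "U x y z = U y x z" "U x y z = U x z y"
    "x \<in> OK \<Longrightarrow> y \<in> OK \<Longrightarrow> z \<in> OK \<Longrightarrow> U x y z \<in> \<int>"
    "x \<in> OK \<Longrightarrow> (U x x x - tr x) / 3 \<in> \<int>"
    "z \<in> OK \<Longrightarrow> (\<And>w. w \<in> OK \<Longrightarrow> tr (z * w) / of_int D \<in> \<int>) \<Longrightarrow> x \<in> OK \<Longrightarrow> y \<in> OK \<Longrightarrow> U z x y / of_int D \<in> \<int>"
    "x \<in> K \<Longrightarrow> frame {..<n::nat} b d \<Longrightarrow> (\<Sum>i<n. U x (b i) (d i)) = tr x"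
proof -
  note c1 = assms[unfolded trace_like_def, THEN conjunct1] and r1 = assms[unfolded trace_like_def, THEN conjunct2]
  note c2 = r1[THEN conjunct1] and r2 = r1[THEN conjunct2]
  note c3 = r2[THEN conjunct1] and r3 = r2[THEN conjunct2]
  note c4 = r3[THEN conjunct1] and r4 = r3[THEN conjunct2]
  note c5 = r4[THEN conjunct1] and c6 = r4[THEN conjunct2]
  show "trilinear U" by (rule c1)
  show "U x y z = U y x z" "U x y z = U x z y" using c2 by blast+
  show "x \<in> OK \<Longrightarrow> y \<in> OK \<Longrightarrow> z \<in> OK \<Longrightarrow> U x y z \<in> \<int>" using c3 by blast
  show "x \<in> OK \<Longrightarrow> (U x x x - tr x) / 3 \<in> \<int>" using c4 by blast
  show "z \<in> OK \<Longrightarrow> (\<And>w. w \<in> OK \<Longrightarrow> tr (z * w) / of_int D \<in> \<int>) \<Longrightarrow> x \<in> OK \<Longrightarrow> y \<in> OK \<Longrightarrow> U z x y / of_int D \<in> \<int>"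
    using c5 by blast
  show "x \<in> K \<Longrightarrow> frame {..<n::nat} b d \<Longrightarrow> (\<Sum>i<n. U x (b i) (d i)) = tr x" using c6 by blast
qed

lemma trilinear_scale:
  assumes Y: "trilinear Y" and K: "x \<in> K" "y \<in> K" "z \<in> K"
  shows "Y (of_rat p * x) (of_rat q * y) (of_rat r * z) = p * q * r * Y x y z"
proof -
  have sc1: "f (of_rat p * v) = p * f v" if "rational_linear f" "v \<in> K" for f :: "'a \<Rightarrow> rat" and p v
  proof -
    have "f (of_rat p * v) = of_rat p * f v" using that unfolding rational_linear_def by blast
    then show ?thesis by simp
  qed
  have K': "of_rat q * y \<in> K" "of_rat r * z \<in> K" using K by blast+
  have "Y (of_rat p * x) (of_rat q * y) (of_rat r * z) = p * Y x (of_rat q * y) (of_rat r * z)"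
    by (rule sc1[OF trilinearD(3)[OF Y K'] K(1)])
  also have "Y x (of_rat q * y) (of_rat r * z) = q * Y x y (of_rat r * z)"
    by (rule sc1[OF trilinearD(2)[OF Y K(1) K'(2)] K(2)])
  also have "Y x y (of_rat r * z) = r * Y x y z"
    by (rule sc1[OF trilinearD(1)[OF Y K(1,2)] K(3)])
  finally show ?thesis by (simp only: mult.assoc)
qed

text \<open>Contraction of integral tensors is determined modulo 3 by the cubes, because the orbits of the
  cyclic rotation of three indices have length 3 off the diagonal.\<close>

lemma contraction_mod_3:
  fixes b e :: "nat \<Rightarrow> 'a"
  assumes T: "trace_like T" and U: "trace_like U"
    and b: "\<And>i. i < n \<Longrightarrow> b i \<in> OK" and e: "\<And>i. i < n \<Longrightarrow> e i \<in> OK"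
  shows "((\<Sum>i<n. \<Sum>j<n. \<Sum>k<n. T (b i) (b j) (b k) * T (e i) (e j) (e k)) -
      (\<Sum>i<n. \<Sum>j<n. \<Sum>k<n. T (b i) (b j) (b k) * U (e i) (e j) (e k))) / 3 \<in> \<int>"
proof -
  note t = trace_likeD[OF T] and u = trace_likeD[OF U]
  define F :: "nat \<Rightarrow> nat \<Rightarrow> nat \<Rightarrow> int" where "F i j k = \<lfloor>T (b i) (b j) (b k) * (T (e i) (e j) (e k) - U (e i) (e j) (e k))\<rfloor>" for i j k
  have F: "of_int (F i j k) = T (b i) (b j) (b k) * (T (e i) (e j) (e k) - U (e i) (e j) (e k))"
    if "i < n" "j < n" "k < n" for i j k
  proof -
    have "T (b i) (b j) (b k) * (T (e i) (e j) (e k) - U (e i) (e j) (e k)) \<in> \<int>"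
      using that b e by (intro Ints_mult Ints_diff t(4) u(4)) auto
    then show ?thesis unfolding F_def by (metis Ints_cases floor_of_int)
  qed
  have s1: "F i j k = F j i k" for i j k
    unfolding F_def using t(2)[of "b i" "b j"] t(2)[of "e i" "e j"] u(2)[of "e i" "e j"] by simp
  have s2: "F i j k = F i k j" for i j k
    unfolding F_def using t(3)[of "b i" "b j"] t(3)[of "e i" "e j"] u(3)[of "e i" "e j"] by simp
  have d: "3 dvd F i i i" if i: "i < n" for i
  proof -
    let ?x = "e i"
    have "T (b i) (b i) (b i) * ((T ?x ?x ?x - tr ?x) / 3 - (U ?x ?x ?x - tr ?x) / 3) \<in> \<int>"
      using b[OF i] e[OF i] by (intro Ints_mult Ints_diff t(4,5) u(5)) auto
    then obtain m where "T (b i) (b i) (b i) * ((T ?x ?x ?x - tr ?x) / 3 - (U ?x ?x ?x - tr ?x) / 3) = of_int m"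
      by (auto elim: Ints_cases)
    then have "of_int (F i i i) = (of_int (3 * m) :: rat)" unfolding F[OF i i i] by (simp add: field_simps)
    then have "F i i i = 3 * m" by (simp only: of_int_eq_iff)
    then show ?thesis by simp
  qed
  have "3 dvd (\<Sum>i<n. \<Sum>j<n. \<Sum>k<n. F i j k)" by (rule symmetric_sum_mod_3[of F, OF s1 s2 d])
  then obtain m where m: "(\<Sum>i<n. \<Sum>j<n. \<Sum>k<n. F i j k) = 3 * m" by (elim dvdE)
  have "(\<Sum>i<n. \<Sum>j<n. \<Sum>k<n. T (b i) (b j) (b k) * T (e i) (e j) (e k)) -
      (\<Sum>i<n. \<Sum>j<n. \<Sum>k<n. T (b i) (b j) (b k) * U (e i) (e j) (e k)) = (\<Sum>i<n. \<Sum>j<n. \<Sum>k<n. of_int (F i j k))"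
    using F by (simp add: sum_subtractf[symmetric] right_diff_distrib)
  also have "\<dots> = of_int (3 * m)" unfolding m[symmetric] by (simp only: of_int_sum)
  finally show ?thesis by simp
qed

text \<open>Cramer: the dual basis has coordinates in the adjugate Gram matrix divided by the discriminant.\<close>

lemma integral_dual_basis:
  assumes b: "spans n b" and D: "D = det (int_gram n b)" "D \<noteq> 0"
    and h: "h = (\<lambda>j i. adj_mat (int_gram n b) $$ (j,i))"
  shows "\<exists>d. frame {..<n} b d \<and> (\<forall>i<n. of_int D * d i = (\<Sum>j<n. of_int (h j i) * b j)) \<and>
    (\<forall>i<n. \<forall>k<n. tr (b k * d i) = (if k = i then 1 else 0)) \<and>
    (\<forall>i<n. \<forall>k<n. tr (d k * d i) = of_int (h k i) / of_int D) \<and> (\<forall>i<n. d i \<in> K)"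
proof -
  note sb = spansD[OF b]
  have G: "int_gram n b \<in> carrier_mat n n" by (rule int_gram(1)) (rule sb(1))
  have Ge: "of_int (int_gram n b $$ (i,j)) = tr (b i * b j)" if "i < n" "j < n" for i j
    by (rule int_gram(4)[OF sb(1) that])
  define d where "d i = (\<Sum>j<n. of_rat (of_int (h j i) / of_int D) * b j)" for i
  have dK: "d i \<in> K" for i unfolding d_def by (intro K_sum K_scale sb(2)) simp
  have dy: "tr (d i * y) = (\<Sum>j<n. of_int (h j i) / of_int D * tr (b j * y))" if "y \<in> K" for i y
    unfolding d_def by (rule tr_lincomb) (use sb(2) that in auto)
  have dual: "tr (b k * d i) = (if k = i then 1 else 0)" if ik: "i < n" "k < n" for i k
  proof -
    have "tr (b k * d i) = (\<Sum>j<n. of_int (h j i) / of_int D * tr (b j * b k))"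
      using dy[OF sb(2)[OF ik(2)], of i] by (simp add: mult.commute)
    also have "\<dots> = (\<Sum>j<n. of_int (int_gram n b $$ (k,j) * h j i) / of_int D)"
    proof (intro sum.cong refl)
      fix j assume "j \<in> {..<n}"
      then have "tr (b j * b k) = of_int (int_gram n b $$ (k,j))" using Ge[of k j] ik by (simp add: mult.commute)
      then show "of_int (h j i) / of_int D * tr (b j * b k) = of_int (int_gram n b $$ (k,j) * h j i) / of_int D" by simp
    qed
    also have "\<dots> = of_int (\<Sum>j<n. int_gram n b $$ (k,j) * h j i) / of_int D"
      by (simp add: sum_divide_distrib)
    also have "\<dots> = (if k = i then 1 else 0)"
      unfolding h adj_mat_sum[OF G ik(2,1)] D(1)[symmetric] using D(2) by simp
    finally show ?thesis .
  qed
  have dd: "tr (d k * d i) = of_int (h k i) / of_int D" if ik: "i < n" "k < n" for i k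
  proof -
    have "tr (d i * d k) = (\<Sum>j<n. of_int (h j i) / of_int D * tr (b j * d k))" by (rule dy[OF dK])
    also have "\<dots> = (\<Sum>j<n. if j = k then of_int (h k i) / of_int D else 0)"
      using dual ik by (intro sum.cong) auto
    finally show ?thesis using ik by (simp add: mult.commute)
  qed
  have fr: "frame {..<n} b d"
    unfolding frame_def
  proof (intro conjI ballI)
    fix x assume x: "x \<in> K"
    obtain N where N: "N > (0::int)" "of_int N * x \<in> OK" using integer_multiple[OF x] by blast
    obtain c :: "nat \<Rightarrow> int" where c: "of_int N * x = (\<Sum>i<n. of_int (c i) * b i)" using sb(3)[OF N(2)] by blast
    have N0: "of_int N \<noteq> (0::'a)" using N by simp
    have cd: "of_int N * tr (x * d i) = of_int (c i)" if i: "i < n" for i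
    proof -
      have "of_int N * tr (x * d i) = tr (of_int N * x * d i)"
        unfolding mult.assoc by (rule tr_int_mult[symmetric]) (use x dK in auto)
      also have "\<dots> = (\<Sum>j<n. of_int (c j) * tr (b j * d i))"
        unfolding c by (rule tr_int_lincomb) (use sb(2) dK in auto)
      also have "\<dots> = (\<Sum>j<n. if j = i then of_int (c i) else 0)"
        using dual i by (intro sum.cong) auto
      finally show ?thesis using i by simp
    qed
    have "of_int N * (\<Sum>i<n. of_rat (tr (x * d i)) * b i) = (\<Sum>i<n. of_rat (of_int N * tr (x * d i)) * b i)"
      by (simp only: sum_distrib_left of_rat_mult of_rat_of_int_eq mult.assoc)
    also have "\<dots> = of_int N * x" unfolding c using cd by (intro sum.cong) auto
    finally show "x = (\<Sum>i<n. of_rat (tr (x * d i)) * b i)" using N0 by simp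
  qed (use dK sb(2) in auto)
  have "of_int D * d i = (\<Sum>j<n. of_int (h j i) * b j)" for i
  proof -
    have "of_rat (of_int (h j i) / of_int D) = (of_int (h j i) / of_int D :: 'a)" for j
      by (simp add: of_rat_divide)
    then have "of_int D * d i = (\<Sum>j<n. of_int D * (of_int (h j i) / of_int D * b j))"
      unfolding d_def sum_distrib_left by simp
    also have "\<dots> = (\<Sum>j<n. of_int (h j i) * b j)" using D(2) by (intro sum.cong refl) simp
    finally show ?thesis .
  qed
  then show ?thesis using fr dual dd dK by (intro exI[of _ d] conjI allI impI)
qed

text \<open>Frame reduction at primes not dividing \<open>\<eta>\<close>. Let \<open>z = D * d i\<close>, which is integral. Since the minors of size two of the
  adjugate are divisible by \<open>D\<close>, every dual vector \<open>d k\<close> is \<open>1 / \<eta>\<close> times an integer plus a multiple of \<open>z / (D * \<eta>)\<close>. In the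
  expanded pairing the divisibility of \<open>T\<close> and \<open>U\<close> at arguments \<open>z\<close> outweighs the denominators: the terms with one or three
  arguments \<open>z\<close> even keep a factor \<open>D\<close>, and those with two come in threes by symmetry.\<close>

lemma pairing_local:
  assumes T: "trace_like T"
    and b: "spans n b" and D: "D = det (int_gram n b)" "D \<noteq> 0" and i: "i < n"
  defines "\<eta> \<equiv> adj_mat (int_gram n b) $$ (i,i)"
  assumes nz: "\<eta> \<noteq> 0" and F: "frame I c c'"
  shows "\<exists>e. (\<forall>j<n. e j \<in> OK) \<and> (\<forall>U. trace_like U \<longrightarrow> (\<exists>P Q. of_int \<eta> ^ 3 * pairing I c c' T U =
       (\<Sum>j<n. \<Sum>k<n. \<Sum>l<n. T (b j) (b k) (b l) * U (e j) (e k) (e l)) + 3 * of_int P + of_int (D * Q)))"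
proof -
  note sb = spansD[OF b]
  define h where "h = (\<lambda>j i. adj_mat (int_gram n b) $$ (j,i))"
  have G: "int_gram n b \<in> carrier_mat n n" by (rule int_gram(1)) (rule sb(1))
  from integral_dual_basis[OF b D h_def] obtain d where d': "frame {..<n} b d"
    "\<forall>i<n. of_int D * d i = (\<Sum>j<n. of_int (h j i) * b j)"
    "\<forall>i<n. \<forall>k<n. tr (b k * d i) = (if k = i then 1 else 0)"
    "\<forall>i<n. \<forall>k<n. tr (d k * d i) = of_int (h k i) / of_int D" "\<forall>i<n. d i \<in> K"
    by (elim exE conjE)
  note d = d'(1) d'(2-5)[rule_format]
  have \<eta>h: "\<eta> = h i i" unfolding \<eta>_def h_def by simp
  define z where "z = of_int D * d i"
  have zO: "z \<in> OK" unfolding z_def d(2)[OF i] by (intro O_sum O_mult O_int sb(1)) simp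
  have zK: "z \<in> K" using zO by blast
  have D0: "of_int D \<noteq> (0::'a)" "of_int D \<noteq> (0::rat)" "of_int \<eta> \<noteq> (0::'a)" "of_int \<eta> \<noteq> (0::rat)" using D nz by auto
  have zw: "tr (z * w) / of_int D \<in> \<int>" if w: "w \<in> OK" for w
  proof -
    obtain c :: "nat \<Rightarrow> int" where c: "w = (\<Sum>i<n. of_int (c i) * b i)" using sb(3)[OF w] by blast
    have "tr (w * d i) = (\<Sum>j<n. of_int (c j) * tr (b j * d i))"
      unfolding c by (rule tr_int_lincomb) (use sb(2) d(5)[OF i] in auto)
    also have "\<dots> = of_int (\<Sum>j<n. c j * (if j = i then 1 else 0))"
      unfolding of_int_sum using d(3)[OF i] by (intro sum.cong) auto
    finally have "tr (w * d i) \<in> \<int>" by (metis Ints_of_int)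
    moreover have "tr (z * w) = of_int D * tr (w * d i)"
      unfolding z_def mult.assoc mult.commute[of "d i" w] by (rule tr_int_mult) (use w d(5)[OF i] in auto)
    ultimately show ?thesis using D0 by simp
  qed
  have zh: "tr (d k * z) = of_int (h k i)" if k: "k < n" for k
  proof -
    have "tr (d k * z) = of_int D * tr (d k * d i)"
      unfolding z_def mult.left_commute[of "d k"] by (rule tr_int_mult) (use d(5) i k in auto)
    then show ?thesis using d(4)[OF i k] D0 by simp
  qed
  have zz: "tr (z * z) = of_int D * of_int \<eta>"
  proof -
    have "tr (z * z) = of_int D * tr (d i * z)"
      by (subst z_def) (unfold mult.assoc, rule tr_int_mult, use d(5) i zK in auto)
    then show ?thesis using zh[OF i] \<eta>h by simp
  qed
  have hsym: "h j k = h k j" if "j < n" "k < n" for j k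
  proof -
    have "rat_of_int (h j k) / of_int D = of_int (h k j) / of_int D"
      using d(4)[OF that] d(4)[OF that(2,1)] by (simp add: mult.commute)
    then show ?thesis using D0 by simp
  qed
  have "\<exists>m. \<eta> * h a c - h a i * h c i = D * m" if ac: "a < n" "c < n" for a c
  proof -
    have "D dvd \<eta> * h a c - h a i * h i c"
      using adj_minor_dvd[OF G, of i a c] D i ac nz unfolding h_def \<eta>_def by auto
    then show ?thesis using hsym[OF i ac(2)] by (auto elim: dvdE)
  qed
  then have "\<exists>m. \<forall>a<n. \<forall>c<n. \<eta> * h a c - h a i * h c i = D * m a c" by metis
  then obtain m where m: "\<And>a c. a < n \<Longrightarrow> c < n \<Longrightarrow> \<eta> * h a c - h a i * h c i = D * m a c" by blast
  define e where "e a = (\<Sum>c<n. of_int (m a c) * b c)" for a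
  have eO: "e a \<in> OK" if "a < n" for a unfolding e_def by (intro O_sum O_mult O_int sb(1)) simp
  have eK: "e a \<in> K" if "a < n" for a using eO[OF that] by blast
  have e_eq: "of_int D * e a = of_int D * (of_int \<eta> * d a) - of_int (h a i) * z" if a: "a < n" for a
  proof -
    have "of_int D * e a = (\<Sum>c<n. of_int (D * m a c) * b c)"
      unfolding e_def sum_distrib_left by (simp only: of_int_mult mult.assoc)
    also have "\<dots> = (\<Sum>c<n. of_int \<eta> * (of_int (h c a) * b c) - of_int (h a i) * (of_int (h c i) * b c))"
    proof (intro sum.cong refl)
      fix c assume "c \<in> {..<n}"
      then have c: "c < n" by simp
      have "of_int (D * m a c) = (of_int \<eta> * of_int (h c a) - of_int (h a i) * of_int (h c i) :: 'a)"
        unfolding m[OF a c, symmetric] hsym[OF a c] by simp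
      then show "of_int (D * m a c) * b c = of_int \<eta> * (of_int (h c a) * b c) - of_int (h a i) * (of_int (h c i) * b c)"
        by (simp only: left_diff_distrib mult.assoc)
    qed
    also have "\<dots> = of_int \<eta> * (of_int D * d a) - of_int (h a i) * z"
      unfolding sum_subtractf sum_distrib_left[symmetric] d(2)[OF a] z_def d(2)[OF i] by simp
    finally show ?thesis by (simp only: mult.left_commute)
  qed
  define B' where "B' k = (if k < n then b k else z)" for k
  define D' where "D' k = (if k < n then of_rat (1 / of_int \<eta>) * e k else of_rat (1 / (of_int D * of_int \<eta>)) * z)" for k
  have fr: "frame {..<Suc n} B' D'"
    unfolding frame_def
  proof (intro conjI ballI)
    fix x assume x: "x \<in> K"
    have c1: "of_rat (tr (x * D' k)) * B' k = of_rat (tr (x * d k)) * b k - of_rat (tr (x * z) / (of_int D * of_int \<eta>)) * (of_int (h k i) * b k)" if k: "k < n" for k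
    proof -
      have "of_int D * tr (x * e k) = tr (x * (of_int D * e k))"
        unfolding mult.left_commute[of x] by (rule tr_int_mult[symmetric]) (use x eK[OF k] in auto)
      also have "x * (of_int D * e k) = of_int (D * \<eta>) * (x * d k) - of_int (h k i) * (x * z)"
        unfolding e_eq[OF k] right_diff_distrib of_int_mult by (simp only: ac_simps)
      also have "tr \<dots> = of_int (D * \<eta>) * tr (x * d k) - of_int (h k i) * tr (x * z)"
      proof -
        have "tr (of_int (D * \<eta>) * (x * d k)) = of_int (D * \<eta>) * tr (x * d k)"
          by (rule tr_int_mult) (intro K_mult x d(5)[OF k])
        moreover have "tr (of_int (h k i) * (x * z)) = of_int (h k i) * tr (x * z)"
          by (rule tr_int_mult) (intro K_mult x zK)
        moreover have "tr (of_int (D * \<eta>) * (x * d k) - of_int (h k i) * (x * z)) =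
            tr (of_int (D * \<eta>) * (x * d k)) - tr (of_int (h k i) * (x * z))"
          by (rule tr_diff) (intro K_mult K_int x zK d(5)[OF k])+
        ultimately show ?thesis by (simp only:)
      qed
      finally have s: "of_int D * tr (x * e k) = of_int (D * \<eta>) * tr (x * d k) - of_int (h k i) * tr (x * z)" .
      have "tr (x * D' k) = 1 / of_int \<eta> * tr (x * e k)"
      proof -
        have "D' k = of_rat (1 / of_int \<eta>) * e k" using k by (simp only: D'_def if_True)
        then show ?thesis by (simp only: mult.left_commute[of x] tr_scale[OF K_mult[OF x eK[OF k]]])
      qed
      also have "\<dots> = tr (x * d k) - tr (x * z) / (of_int D * of_int \<eta>) * of_int (h k i)"
        using s unfolding of_int_mult by (rule projection_coefficient[OF _ D0(2,4)])
      finally have t: "tr (x * D' k) = tr (x * d k) - tr (x * z) / (of_int D * of_int \<eta>) * of_int (h k i)" .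
      show ?thesis unfolding t of_rat_diff B'_def using k
        by (simp only: if_True left_diff_distrib of_rat_mult of_rat_of_int_eq mult.assoc)
    qed
    have c2: "of_rat (tr (x * D' n)) * B' n = of_rat (tr (x * z) / (of_int D * of_int \<eta>)) * z"
    proof -
      have "tr (x * D' n) = 1 / (of_int D * of_int \<eta>) * tr (x * z)"
        by (simp only: D'_def less_irrefl if_False mult.left_commute[of x] tr_scale[OF K_mult[OF x zK]])
      then show ?thesis unfolding B'_def by simp
    qed
    have "(\<Sum>k<Suc n. of_rat (tr (x * D' k)) * B' k) =
        (\<Sum>k<n. of_rat (tr (x * d k)) * b k - of_rat (tr (x * z) / (of_int D * of_int \<eta>)) * (of_int (h k i) * b k)) +
        of_rat (tr (x * z) / (of_int D * of_int \<eta>)) * z"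
      unfolding sum.lessThan_Suc c2 using c1 by (intro arg_cong2[of _ _ _ _ "(+)"] sum.cong refl) auto
    also have "\<dots> = x"
      unfolding sum_subtractf sum_distrib_left[symmetric] frameD(4)[OF d(1) x, symmetric] d(2)[OF i, symmetric] z_def[symmetric] by simp
    finally show "x = (\<Sum>k<Suc n. of_rat (tr (x * D' k)) * B' k)" by simp
  qed (use sb(2) zK eK in \<open>auto simp: B'_def D'_def intro: K_scale\<close>)
  have main: "\<exists>P Q. of_int \<eta> ^ 3 * pairing I c c' T U =
       (\<Sum>j<n. \<Sum>k<n. \<Sum>l<n. T (b j) (b k) (b l) * U (e j) (e k) (e l)) + 3 * of_int P + of_int (D * Q)"
    if U: "trace_like U" for U
  proof -
    note t = trace_likeD[OF T] and u = trace_likeD[OF U]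
    have z1: "V z x y / of_int D \<in> \<int>" if V: "trace_like V" and "x \<in> OK" "y \<in> OK" for V x y
      by (rule trace_likeD(6)[OF V zO zw that(2,3)])
    have z3: "V z z z / of_int D / of_int D \<in> \<int>" if V: "trace_like V" for V
    proof -
      note v = trace_likeD[OF V]
      have "tr z = (\<Sum>k<Suc n. V z (B' k) (D' k))" by (rule v(7)[OF zK fr, symmetric])
      also have "\<dots> = (\<Sum>k<n. 1 / of_int \<eta> * V z (b k) (e k)) + 1 / (of_int D * of_int \<eta>) * V z z z"
      proof -
        have s1: "V z (B' k) (D' k) = 1 / of_int \<eta> * V z (b k) (e k)" if "k \<in> {..<n}" for k
        proof -
          have k: "k < n" using that by simp
          show ?thesis using trilinear_scale[OF v(1) zK sb(2)[OF k] eK[OF k], of 1 1 "1 / of_int \<eta>"]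
            by (simp only: of_rat_1 mult_1 B'_def D'_def k if_True)
        qed
        have s2: "V z (B' n) (D' n) = 1 / (of_int D * of_int \<eta>) * V z z z"
          using trilinear_scale[OF v(1) zK zK zK, of 1 1 "1 / (of_int D * of_int \<eta>)"]
          by (simp only: of_rat_1 mult_1 B'_def D'_def less_irrefl if_False)
        show ?thesis by (simp only: sum.lessThan_Suc s2 sum.cong[OF refl s1])
      qed
      finally have "V z z z / of_int D = of_int \<eta> * tr z - (\<Sum>k<n. V z (b k) (e k))"
        unfolding sum_distrib_left[symmetric] by (rule coefficient_identities(1)[OF D0(2,4)])
      then have "V z z z / of_int D / of_int D = of_int \<eta> * (tr (z * 1) / of_int D) - (\<Sum>k<n. V z (b k) (e k) / of_int D)"
        by (simp add: diff_divide_distrib sum_divide_distrib)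
      also have "\<dots> \<in> \<int>"
        by (intro Ints_diff Ints_mult Ints_sum Ints_of_int zw z1[OF V] eO sb(1)) auto
      finally show ?thesis .
    qed
    have "pairing I c c' T U = pairing {..<Suc n} B' D' T U"
      by (rule pairing_independent[OF t(1) u(1) F fr])
    also have "\<dots> = (\<Sum>j<n. \<Sum>k<n. \<Sum>l<n. T (B' j) (B' k) (B' l) * U (D' j) (D' k) (D' l)) +
        3 * (\<Sum>j<n. \<Sum>k<n. T (B' j) (B' k) (B' n) * U (D' j) (D' k) (D' n)) +
        3 * (\<Sum>j<n. T (B' j) (B' n) (B' n) * U (D' j) (D' n) (D' n)) +
        T (B' n) (B' n) (B' n) * U (D' n) (D' n) (D' n)"
      unfolding pairing_def
    proof (rule symmetric_sum_Suc)
      show "T (B' i) (B' j) (B' k) * U (D' i) (D' j) (D' k) = T (B' j) (B' i) (B' k) * U (D' j) (D' i) (D' k)" for i j k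
        using t(2)[of "B' i" "B' j"] u(2)[of "D' i" "D' j"] by simp
      show "T (B' i) (B' j) (B' k) * U (D' i) (D' j) (D' k) = T (B' i) (B' k) (B' j) * U (D' i) (D' k) (D' j)" for i j k
        using t(3)[of "B' i" "B' j"] u(3)[of "D' i" "D' j"] by simp
    qed
    finally have S: "pairing I c c' T U = \<dots>" .
    let ?E = "of_int \<eta> :: rat" and ?D = "of_int D :: rat"
    have p1: "T (B' j) (B' k) (B' l) * U (D' j) (D' k) (D' l) = T (b j) (b k) (b l) * U (e j) (e k) (e l) / ?E ^ 3"
      if "j < n" "k < n" "l < n" for j k l
      by (simp only: B'_def D'_def that if_True trilinear_scale[OF u(1) eK[OF that(1)] eK[OF that(2)] eK[OF that(3)]]
          coefficient_identities(2)[OF D0(2,4)])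
    have p2: "T (B' j) (B' k) (B' n) * U (D' j) (D' k) (D' n) = ?D * ((T z (b j) (b k) / ?D) * (U z (e j) (e k) / ?D)) / ?E ^ 3"
      if "j < n" "k < n" for j k
    proof -
      have r: "T (b j) (b k) z = T z (b j) (b k)" "U (e j) (e k) z = U z (e j) (e k)"
        using t(3)[of "b j" "b k" z] t(2)[of "b j" z "b k"] u(3)[of "e j" "e k" z] u(2)[of "e j" z "e k"] by metis+
      show ?thesis
        by (simp only: B'_def D'_def that less_irrefl if_True if_False trilinear_scale[OF u(1) eK[OF that(1)] eK[OF that(2)] zK]
          coefficient_identities(3)[OF D0(2,4)] r)
    qed
    have p3: "T (B' j) (B' n) (B' n) * U (D' j) (D' n) (D' n) = ((T z z (b j) / ?D) * (U z z (e j) / ?D)) / ?E ^ 3"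
      if "j < n" for j
    proof -
      have r: "T (b j) z z = T z z (b j)" "U (e j) z z = U z z (e j)"
        using t(2)[of "b j" z z] t(3)[of z "b j" z] u(2)[of "e j" z z] u(3)[of z "e j" z] by metis+
      show ?thesis
        by (simp only: B'_def D'_def that less_irrefl if_True if_False trilinear_scale[OF u(1) eK[OF that(1)] zK zK]
          coefficient_identities(4)[OF D0(2,4)] r)
    qed
    have p4: "T (B' n) (B' n) (B' n) * U (D' n) (D' n) (D' n) = ?D * ((T z z z / ?D / ?D) * (U z z z / ?D / ?D)) / ?E ^ 3"
      by (simp only: B'_def D'_def less_irrefl if_False trilinear_scale[OF u(1) zK zK zK] coefficient_identities(5)[OF D0(2,4)])
    define X where "X = (\<Sum>j<n. \<Sum>k<n. (T z (b j) (b k) / ?D) * (U z (e j) (e k) / ?D))"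
    define Y where "Y = (\<Sum>j<n. (T z z (b j) / ?D) * (U z z (e j) / ?D))"
    define Z where "Z = (T z z z / ?D / ?D) * (U z z z / ?D / ?D)"
    have "X \<in> \<int>" unfolding X_def by (intro Ints_sum Ints_mult z1 T U eO sb(1)) auto
    moreover have "Y \<in> \<int>" unfolding Y_def by (intro Ints_sum Ints_mult z1 T U eO sb(1) zO) auto
    moreover have "Z \<in> \<int>" unfolding Z_def by (intro Ints_mult z3 T U)
    ultimately obtain X' Y' Z' where XYZ: "X = of_int X'" "Y = of_int Y'" "Z = of_int Z'" by (metis Ints_cases)
    have q2: "(\<Sum>j<n. \<Sum>k<n. T (B' j) (B' k) (B' n) * U (D' j) (D' k) (D' n)) = ?D * X / ?E ^ 3"
      unfolding X_def sum_distrib_left sum_divide_distrib using p2 by (intro sum.cong refl) auto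
    have q3: "(\<Sum>j<n. T (B' j) (B' n) (B' n) * U (D' j) (D' n) (D' n)) = Y / ?E ^ 3"
      unfolding Y_def sum_divide_distrib using p3 by (intro sum.cong refl) auto
    have q1: "(\<Sum>j<n. \<Sum>k<n. \<Sum>l<n. T (B' j) (B' k) (B' l) * U (D' j) (D' k) (D' l)) =
        (\<Sum>j<n. \<Sum>k<n. \<Sum>l<n. T (b j) (b k) (b l) * U (e j) (e k) (e l)) / ?E ^ 3"
      unfolding sum_divide_distrib using p1 by (intro sum.cong refl) auto
    define N where "N = (\<Sum>j<n. \<Sum>k<n. \<Sum>l<n. T (b j) (b k) (b l) * U (e j) (e k) (e l))"
    have "pairing I c c' T U = (N + 3 * (?D * X) + 3 * Y + ?D * Z) / ?E ^ 3"
      unfolding S q1 q2 q3 p4 Z_def[symmetric] N_def[symmetric] by (simp add: add_divide_distrib)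
    then have "?E ^ 3 * pairing I c c' T U = N + 3 * (?D * X) + 3 * Y + ?D * Z" using D0 by simp
    also have "\<dots> = N + 3 * of_int Y' + of_int (D * (3 * X' + Z'))"
      unfolding XYZ by (simp add: distrib_left)
    finally have "?E ^ 3 * pairing I c c' T U = N + 3 * of_int Y' + of_int (D * (3 * X' + Z'))" .
    then show ?thesis unfolding N_def by blast
  qed
  then show ?thesis using eO by (intro exI[of _ e]) simp
qed

text \<open>For squarefree \<open>D\<close> every prime \<open>p\<close> dividing \<open>D\<close> misses some diagonal entry of the adjugate, as otherwise \<open>p\<close> would divide all
  entries by the divisibility of the minors, and \<open>p ^ 4\<close> the determinant \<open>D ^ 3\<close> of the adjugate. The local statement for that
  entry removes \<open>p\<close> from the denominator.\<close>

lemma pairing_integral: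
  assumes T: "trace_like T" and U: "trace_like U"
    and b: "spans n b" and D: "D = det (int_gram n b)" "D \<noteq> 0" and sf: "squarefree D" and n4: "n = 4"
    and F: "frame I c c'"
  shows "pairing I c c' T U \<in> \<int>"
    "pairing I c c' T T \<in> \<int> \<Longrightarrow> (pairing I c c' T T - pairing I c c' T U) / 3 \<in> \<int>"
proof -
  note sb = spansD[OF b]
  have G: "int_gram n b \<in> carrier_mat n n" by (rule int_gram(1)) (rule sb(1))
  define h where "h = (\<lambda>j i. adj_mat (int_gram n b) $$ (j,i))"
  from integral_dual_basis[OF b D h_def] obtain d where d': "frame {..<n} b d"
    "\<forall>i<n. of_int D * d i = (\<Sum>j<n. of_int (h j i) * b j)"
    "\<forall>i<n. \<forall>k<n. tr (b k * d i) = (if k = i then 1 else 0)"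
    "\<forall>i<n. \<forall>k<n. tr (d k * d i) = of_int (h k i) / of_int D" "\<forall>i<n. d i \<in> K"
    by (elim exE conjE)
  note d = d'(1) d'(2-5)[rule_format]
  have D0: "of_int D \<noteq> (0::'a)" "of_int D \<noteq> (0::rat)" using D by auto
  note t = trace_likeD[OF T] and u = trace_likeD[OF U]
  have ints: "(\<Sum>j<n. \<Sum>k<n. \<Sum>l<n. T (b j) (b k) (b l) * V (e j) (e k) (e l)) \<in> \<int>"
    if "trace_like V" "\<And>j. j < n \<Longrightarrow> e j \<in> OK" for V e
    using that sb(1) by (intro Ints_sum Ints_mult t(4) trace_likeD(4)[OF that(1)]) auto
  have hnz: "h i i \<noteq> 0" if i: "i < n" for i
  proof -
    have "d i \<noteq> 0" using d(3)[OF i i] tr_0 by auto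
    then have "tr (d i * d i) > 0" using pos d(5)[OF i] by blast
    then show ?thesis using d(4)[OF i i] by auto
  qed
  define E where "E i = of_int D * d i" for i
  have EO: "E i \<in> OK" if "i < n" for i
    unfolding E_def d(2)[OF that] by (intro O_sum O_mult O_int sb(1)) simp
  have glob: "of_int D ^ 3 * pairing I c c' T V = (\<Sum>j<n. \<Sum>k<n. \<Sum>l<n. T (b j) (b k) (b l) * V (E j) (E k) (E l))"
    if V: "trace_like V" for V
  proof -
    have p: "pairing I c c' T V = pairing {..<n} b d T V"
      by (rule pairing_independent[OF t(1) trace_likeD(1)[OF V] F d(1)])
    have v: "V (E j) (E k) (E l) = of_int D ^ 3 * V (d j) (d k) (d l)" if "j < n" "k < n" "l < n" for j k l
      using trilinear_scale[OF trace_likeD(1)[OF V] d(5)[OF that(1)] d(5)[OF that(2)] d(5)[OF that(3)], of "of_int D" "of_int D" "of_int D"]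
      unfolding E_def of_rat_of_int_eq power3_eq_cube .
    show ?thesis unfolding p unfolding pairing_def sum_distrib_left
      by (intro sum.cong refl) (simp add: v mult.left_commute)
  qed
  have loc: "\<exists>\<eta>. \<not> int p dvd \<eta> \<and> of_int \<eta> ^ 3 * pairing I c c' T U \<in> \<int> \<and>
      (p = 3 \<longrightarrow> of_int \<eta> ^ 3 * (pairing I c c' T T - pairing I c c' T U) / 3 \<in> \<int>)"
    if p: "prime p" "int p dvd D" for p :: nat
  proof -
    have "\<exists>i<n. \<not> int p dvd h i i"
    proof (rule ccontr)
      assume "\<not> (\<exists>i<n. \<not> int p dvd h i i)"
      then have a: "int p dvd h i i" if "i < n" for i using that by blast
      have pp: "prime (int p)" using p by simp
      have all: "int p dvd h i j" if "i < n" "j < n" for i j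
      proof -
        have "D dvd h i i * h j j - h j i * h i j"
          using adj_minor_dvd[OF G, of i j j] D hnz that unfolding h_def by auto
        then have "int p dvd h i i * h j j - h j i * h i j" using p(2) dvd_trans by blast
        moreover have "int p dvd h i i * h j j" using a that by simp
        ultimately have "int p dvd h j i * h i j" by (metis dvd_diff_commute dvd_minus_iff minus_diff_eq diff_add_cancel dvd_add_right_iff)
        moreover have "h j i = h i j"
          using d(4)[OF that] d(4)[OF that(2,1)] D0 by (simp add: mult.commute)
        ultimately show ?thesis using pp by (simp add: prime_dvd_mult_iff)
      qed
      define H where "H = mat n n (\<lambda>(i,j). h i j div int p)"
      have "adj_mat (int_gram n b) = int p \<cdot>\<^sub>m H"
        using adj_mat(1)[OF G] all unfolding H_def h_def by (intro eq_matI) auto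
      then have dh: "det (adj_mat (int_gram n b)) = int p ^ 4 * det H" using n4 unfolding H_def by simp
      then have "int p ^ 4 * det H * D = D ^ 4" using det_adj_mat_int[OF G] D n4 by simp
      then have "int p ^ 4 * det H = D ^ 3" using D(2) by (simp add: power4_eq_xxxx power3_eq_cube)
      obtain D1 where D1: "D = int p * D1" using p(2) by (elim dvdE)
      have "int p ^ 3 * (int p * det H) = int p ^ 3 * D1 ^ 3"
        using \<open>int p ^ 4 * det H = D ^ 3\<close> unfolding D1 by (simp add: power_mult_distrib power4_eq_xxxx power3_eq_cube mult.assoc)
      moreover have "int p ^ 3 \<noteq> 0" using prime_gt_0_nat[OF p(1)] by simp
      ultimately have "int p * det H = D1 ^ 3" using mult_left_cancel by blast
      then have "int p dvd D1 ^ 3" by (metis dvd_triv_left)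
      then have "int p dvd D1" using pp prime_dvd_power by blast
      then have "int p ^ 2 dvd D" unfolding D1 power2_eq_square by simp
      then have "is_unit (int p)" using sf unfolding squarefree_def by blast
      then show False using pp not_prime_unit by blast
    qed
    then obtain i where i: "i < n" "\<not> int p dvd h i i" by blast
    from pairing_local[OF T b D i(1) _ F] hnz[OF i(1)] obtain e where e: "\<forall>j<n. e j \<in> OK"
      "\<forall>U. trace_like U \<longrightarrow> (\<exists>P Q. of_int (h i i) ^ 3 * pairing I c c' T U =
       (\<Sum>j<n. \<Sum>k<n. \<Sum>l<n. T (b j) (b k) (b l) * U (e j) (e k) (e l)) + 3 * of_int P + of_int (D * Q))"
      unfolding h_def by auto
    define \<eta> where "\<eta> = h i i"
    define N where "N V = (\<Sum>j<n. \<Sum>k<n. \<Sum>l<n. T (b j) (b k) (b l) * V (e j) (e k) (e l))" for V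
    obtain P Q where PQ: "of_int \<eta> ^ 3 * pairing I c c' T U = N U + 3 * of_int P + of_int (D * Q)"
      using e(2) U unfolding \<eta>_def N_def by blast
    obtain P' Q' where PQ': "of_int \<eta> ^ 3 * pairing I c c' T T = N T + 3 * of_int P' + of_int (D * Q')"
      using e(2) T unfolding \<eta>_def N_def by blast
    have "N U \<in> \<int>" unfolding N_def using ints[OF U] e(1) by blast
    then have 1: "of_int \<eta> ^ 3 * pairing I c c' T U \<in> \<int>" unfolding PQ by (intro Ints_add Ints_mult) auto
    have 2: "of_int \<eta> ^ 3 * (pairing I c c' T T - pairing I c c' T U) / 3 \<in> \<int>" if "p = 3"
    proof -
      have "3 dvd D" using p(2) that by simp
      then obtain D1 where D1: "D = 3 * D1" by (elim dvdE)
      have "(N T - N U) / 3 \<in> \<int>" unfolding N_def by (rule contraction_mod_3[OF T U sb(1)]) (use e(1) in auto)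
      then have "(N T - N U) / 3 + of_int (P' - P + D1 * (Q' - Q)) \<in> \<int>" by (rule Ints_add) simp
      moreover have "of_int \<eta> ^ 3 * (pairing I c c' T T - pairing I c c' T U) / 3 = (N T - N U) / 3 + of_int (P' - P + D1 * (Q' - Q))"
        unfolding right_diff_distrib[of "of_int \<eta> ^ 3"] PQ PQ' unfolding D1 by (rule difference_by_3)
      ultimately show ?thesis by (simp only:)
    qed
    show ?thesis using i(2) 1 2 unfolding \<eta>_def by blast
  qed
  let ?S = "pairing I c c' T U"
  have gU: "of_int D ^ 3 * ?S \<in> \<int>" unfolding glob[OF U] by (rule ints[OF U EO])
  obtain a q where aq: "quotient_of ?S = (a, q)" by (cases "quotient_of ?S")
  have q: "q > 0" "coprime a q" "?S = of_int a / of_int q"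
    using quotient_of_denom_pos[OF aq] quotient_of_coprime[OF aq] quotient_of_div[OF aq] by auto
  have qd: "q dvd x ^ 3" if "of_int x ^ 3 * ?S \<in> \<int>" for x :: int
  proof -
    obtain y where "of_int x ^ 3 * ?S = of_int y" using \<open>of_int x ^ 3 * ?S \<in> \<int>\<close> by (auto elim: Ints_cases)
    then have "rat_of_int (x ^ 3 * a) = of_int (y * q)" unfolding q(3) using q(1) by (simp add: field_simps)
    then have "x ^ 3 * a = y * q" by (simp only: of_int_eq_iff)
    then have "q dvd x ^ 3 * a" by simp
    then show ?thesis using q(2) by (simp add: coprime_dvd_mult_left_iff coprime_commute)
  qed
  have "q = 1"
  proof (rule ccontr)
    assume "q \<noteq> 1"
    then have "nat q \<noteq> 1" using q(1) by linarith
    then obtain p where p: "prime p" "p dvd nat q" using prime_factor_nat by blast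
    then have pq: "int p dvd q" using q(1) by (metis int_dvd_int_iff int_nat_eq less_imp_le)
    have "int p dvd D ^ 3" using qd[OF gU] pq dvd_trans by blast
    then have pD: "int p dvd D" using p(1) by (simp add: prime_dvd_power_iff)
    obtain \<eta> where \<eta>: "\<not> int p dvd \<eta>" "of_int \<eta> ^ 3 * ?S \<in> \<int>" using loc[OF p(1) pD] by blast
    have "int p dvd \<eta> ^ 3" using qd[OF \<eta>(2)] pq dvd_trans by blast
    then show False using \<eta>(1) p(1) by (simp add: prime_dvd_power_iff)
  qed
  then have S: "?S = of_int a" using q(3) by simp
  then show "?S \<in> \<int>" by simp
  have TT: "pairing I c c' T T \<in> \<int> \<Longrightarrow> (pairing I c c' T T - ?S) / 3 \<in> \<int>"
  proof -
    assume "pairing I c c' T T \<in> \<int>"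
    then obtain m where m: "pairing I c c' T T = of_int m" by (auto elim: Ints_cases)
    have "\<exists>x::int. \<not> 3 dvd x \<and> of_int x ^ 3 * (pairing I c c' T T - ?S) / 3 \<in> \<int>"
    proof (cases "3 dvd D")
      case True
      then show ?thesis using loc[of 3] by auto
    next
      case False
      have "of_int D ^ 3 * (pairing I c c' T T - ?S) / 3 \<in> \<int>"
        unfolding right_diff_distrib glob[OF T] glob[OF U] by (rule contraction_mod_3[OF T U sb(1) EO])
      then show ?thesis using False by blast
    qed
    then obtain x y where x: "\<not> 3 dvd x" "of_int x ^ 3 * (pairing I c c' T T - ?S) / 3 = of_int y" by (auto elim: Ints_cases)
    then have "rat_of_int (x ^ 3 * (m - a)) = of_int (3 * y)" unfolding m S by simp
    then have "x ^ 3 * (m - a) = 3 * y" by (simp only: of_int_eq_iff)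
    then have "3 dvd x ^ 3 * (m - a)" by simp
    moreover have p3: "prime (3::int)" by simp
    ultimately have "3 dvd m - a" using x(1) by (metis prime_dvd_mult_iff prime_dvd_power)
    then obtain y' where "m - a = 3 * y'" by (elim dvdE)
    then have "pairing I c c' T T - ?S = 3 * of_int y'" unfolding m S by (metis of_int_diff of_int_mult of_int_numeral)
    then show ?thesis by simp
  qed
  then show "pairing I c c' T T \<in> \<int> \<Longrightarrow> (pairing I c c' T T - ?S) / 3 \<in> \<int>" .
qed

end

section \<open>Quartic fields\<close>

locale quartic = posfield +
  assumes quartic: "card (numfield.B K) = 4"
begin

text \<open>Vieta and Newton for the four eigenvalues; the elementary symmetric functions are rational algebraic integers.\<close>

lemma newton:
  assumes x: "x \<in> OK"
  obtains e1 e2 e3 e4 :: int where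
    "x ^ 4 - of_int e1 * x ^ 3 + of_int e2 * x ^ 2 - of_int e3 * x + of_int e4 = 0"
    "tr x = of_int e1" "tr (x ^ 2) = of_int (e1 ^ 2 - 2 * e2)"
    "tr (x ^ 3) = of_int (e1 ^ 3 - 3 * e1 * e2 + 3 * e3)"
proof -
  obtain as :: "complex list" and q :: "rat poly" where
    as: "length as = card B" "map_poly of_rat q = (\<Prod>a\<leftarrow>as. [:- a, 1:])"
    "poly (map_poly of_rat q) x = 0" "\<And>k. of_rat (tr (x ^ k)) = (\<Sum>a\<leftarrow>as. a ^ k)"
    "\<And>a. a \<in> set as \<Longrightarrow> \<exists>f. eigen_functional x a f" using eigenvalues[OF O_K[OF x]] by metis
  have "length as = Suc (Suc (Suc (Suc 0)))" using as(1) quartic by simp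
  then obtain a b c d where abcd: "as = [a, b, c, d]" unfolding length_Suc_conv length_0_conv by blast
  have alg: "algebraic_int y" if "y \<in> {a, b, c, d}" for y
  proof -
    have "y \<in> set as" using that abcd by simp
    then show ?thesis using as(5) eigenvalue_algebraic_int[OF x] by blast
  qed
  define p1 where "p1 = a + b + c + d"
  define p2 where "p2 = a * b + a * c + a * d + b * c + b * d + c * d"
  define p3 where "p3 = a * b * c + a * b * d + a * c * d + b * c * d"
  define p4 where "p4 = a * b * c * d"
  have Q: "map_poly of_rat q = [:p4, - p3, p2, - p1, 1:]"
    unfolding as(2) abcd p1_def p2_def p3_def p4_def by (simp add: algebra_simps)
  have co: "of_rat (coeff q k) = coeff [:p4, - p3, p2, - p1, 1:] k" for k
    unfolding Q[symmetric] by simp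
  have int: "\<exists>m. r = of_int m" if "of_rat r = y" "algebraic_int y" for r and y :: complex
  proof -
    have "algebraic_int (of_rat r :: complex)" using that by simp
    then have "of_rat r \<in> (\<int> :: complex set)" by (rule rational_algebraic_int_is_int) simp
    then show ?thesis by (metis Ints_cases of_rat_eq_iff of_rat_of_int_eq)
  qed
  note alg_intros = algebraic_int_add_mult alg
  have "algebraic_int p1" "algebraic_int p2" "algebraic_int p3" "algebraic_int p4"
    unfolding p1_def p2_def p3_def p4_def by (intro alg_intros; simp)+
  moreover have "of_rat (- coeff q 3) = p1" "of_rat (coeff q 2) = p2" "of_rat (- coeff q 1) = p3" "of_rat (coeff q 0) = p4"
    using co[of 0] co[of 1] co[of 2] co[of 3] by (simp_all add: numeral_eq_Suc of_rat_minus)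
  ultimately obtain e1 e2 e3 e4 where e: "- coeff q 3 = of_int e1" "coeff q 2 = of_int e2" "- coeff q 1 = of_int e3" "coeff q 0 = of_int e4"
    using int by metis
  have pe: "p1 = of_int e1" "p2 = of_int e2" "p3 = of_int e3" "p4 = of_int e4"
    using \<open>of_rat (- coeff q 3) = p1\<close> \<open>of_rat (coeff q 2) = p2\<close> \<open>of_rat (- coeff q 1) = p3\<close> \<open>of_rat (coeff q 0) = p4\<close>
    unfolding e by simp_all
  have q: "q = [:of_int e4, - of_int e3, of_int e2, - of_int e1, 1:]"
  proof (rule poly_eqI)
    fix k
    have "of_rat (coeff q k) = complex_of_rat (coeff [:of_int e4, - of_int e3, of_int e2, - of_int e1, 1:] k)"
      unfolding co pe by (simp add: coeff_pCons of_rat_minus split: nat.split)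
    then show "coeff q k = coeff [:of_int e4, - of_int e3, of_int e2, - of_int e1, 1:] k" by (simp only: of_rat_eq_iff)
  qed
  have "of_int e4 + x * (- of_int e3 + x * (of_int e2 + x * (- of_int e1 + x))) = 0"
    using as(3) unfolding q by (simp add: map_poly_pCons of_rat_minus)
  moreover have "x ^ 4 - E1 * x ^ 3 + E2 * x ^ 2 - E3 * x + E4 = E4 + x * (- E3 + x * (E2 + x * (- E1 + x)))" for E1 E2 E3 E4
    by (simp add: power4_eq_xxxx power3_eq_cube power2_eq_square algebra_simps)
  ultimately have r: "x ^ 4 - of_int e1 * x ^ 3 + of_int e2 * x ^ 2 - of_int e3 * x + of_int e4 = 0" by (simp only:)
  have cr: "r = of_int m" if "complex_of_rat r = of_int m" for r m using that by (metis of_rat_eq_iff of_rat_of_int_eq)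
  have t1: "tr x = of_int e1" using as(4)[of 1] pe(1) unfolding abcd p1_def by (intro cr) (simp add: add.assoc)
  have "complex_of_rat (tr (x ^ 2)) = p1 ^ 2 - 2 * p2"
    using as(4)[of 2] unfolding abcd p1_def p2_def by (simp add: power2_eq_square algebra_simps)
  then have t2: "tr (x ^ 2) = of_int (e1 ^ 2 - 2 * e2)" unfolding pe by (intro cr) simp
  have "complex_of_rat (tr (x ^ 3)) = p1 ^ 3 - 3 * p1 * p2 + 3 * p3"
    using as(4)[of 3] unfolding abcd p1_def p2_def p3_def by (simp add: power3_eq_cube algebra_simps)
  then have t3: "tr (x ^ 3) = of_int (e1 ^ 3 - 3 * e1 * e2 + 3 * e3)" unfolding pe by (intro cr) simp
  show ?thesis by (rule that[OF r t1 t2 t3])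
qed

lemma tr_cube_mod_3:
  assumes x: "x \<in> OK" shows "(tr (x * x * x) - tr x) / 3 \<in> \<int>"
proof -
  obtain e1 e2 e3 e4 where e: "tr x = of_int e1" "tr (x ^ 3) = of_int (e1 ^ 3 - 3 * e1 * e2 + 3 * e3)"
    using newton[OF x] by metis
  have "3 dvd e1 ^ 3 - e1"
  proof -
    have "e1 ^ 3 - e1 = (e1 - 1) * e1 * (e1 + 1)" by (simp add: power3_eq_cube algebra_simps)
    moreover have "3 dvd (e1 - 1) \<or> 3 dvd e1 \<or> 3 dvd (e1 + 1)" by presburger
    ultimately show ?thesis by auto
  qed
  then obtain m where m: "e1 ^ 3 - e1 = 3 * m" by (elim dvdE)
  have "tr (x * x * x) - tr x = of_int (e1 ^ 3 - e1 - 3 * e1 * e2 + 3 * e3)"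
    using e by (simp add: power3_eq_cube)
  also have "e1 ^ 3 - e1 - 3 * e1 * e2 + 3 * e3 = 3 * (m - e1 * e2 + e3)" unfolding m by (simp add: algebra_simps)
  finally have "(tr (x * x * x) - tr x) / 3 = of_int (m - e1 * e2 + e3)"
    by (simp only: of_int_mult of_int_numeral nonzero_mult_div_cancel_left[of "3::rat"] zero_neq_numeral[symmetric] not_False_eq_True)
  then show ?thesis by (metis Ints_of_int)
qed

lemma trace_like_tr: "trace_like (\<lambda>x y z. tr (x * y * z))"
  unfolding trace_like_def
proof (intro conjI allI ballI impI)
  show "trilinear (\<lambda>x y z. tr (x * y * z))" by (rule trilinear_tr)
  show "tr (x * y * z) = tr (y * x * z)" "tr (x * y * z) = tr (x * z * y)" for x y z by (simp_all only: ac_simps)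
  show "tr (x * y * z) \<in> \<int>" if "x \<in> OK" "y \<in> OK" "z \<in> OK" for x y z using that by (intro tr_Ints O_mult)
  show "(tr (x * x * x) - tr x) / 3 \<in> \<int>" if "x \<in> OK" for x by (rule tr_cube_mod_3[OF that])
  show "tr (z * x * y) / of_int D \<in> \<int>" if "\<forall>w\<in>OK. tr (z * w) / of_int D \<in> \<int>" "x \<in> OK" "y \<in> OK" for z x y D
    using that(1)[rule_format, OF O_mult[OF that(2,3)]] by (simp only: mult.assoc)
  show "(\<Sum>i<n. tr (x * b i * d i)) = tr x" if "x \<in> K" "frame {..<n::nat} b d" for x n b d
    by (rule tr_frame[OF that(2,1), symmetric])
qed

end

context posfield
begin

lemma exists_spans: "\<exists>b. spans (card B) b"
proof -
  have "0 \<in> OK" "\<And>x y. x \<in> OK \<Longrightarrow> y \<in> OK \<Longrightarrow> x - y \<in> OK" by auto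
  then obtain T where T: "finite T" "int_mod.independent T" "int_mod.span T = OK"
    using integer_subgroup_basis[of OK] by blast
  obtain bs where bs: "set bs = T" "distinct bs" using finite_distinct_list[OF T(1)] by blast
  have "integral_basis K bs" unfolding integral_basis_def using bs T by simp
  then show ?thesis using integral_basis_spans by blast
qed

lemma gram_det_nonzero:
  assumes b: "spans (card B) b"
  shows "det (int_gram (card B) b) \<noteq> 0"
proof
  assume "det (int_gram (card B) b) = 0"
  moreover have "det (gram (card B) b) = of_int (det (int_gram (card B) b))"
    by (rule int_gram(3)) (rule spansD(1)[OF b])
  ultimately have 0: "det (gram (card B) b) = 0" by simp
  obtain C where oC: "orthogonal_set C" and fC: "frame C (\<lambda>c. c) (\<lambda>c. of_rat (1 / tr (c * c)) * c)"
    using orthogonal_basis .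
  note C = orthogonal_setD[OF oC]
  have "tr 1 = (\<Sum>c\<in>C. tr (1 * c * (of_rat (1 / tr (c * c)) * c)))" by (rule tr_frame[OF fC K_1])
  also have "\<dots> = (\<Sum>c\<in>C. 1)"
  proof (intro sum.cong refl)
    fix c assume c: "c \<in> C"
    have "1 * c * (of_rat (1 / tr (c * c)) * c) = of_rat (1 / tr (c * c)) * (c * c)" by (simp only: mult_1 mult.left_commute)
    then have "tr (1 * c * (of_rat (1 / tr (c * c)) * c)) = 1 / tr (c * c) * tr (c * c)"
      using tr_scale[OF K_mult[OF C(2) C(2)], OF c c] by (simp only:)
    then show "tr (1 * c * (of_rat (1 / tr (c * c)) * c)) = 1" using C(5)[OF c] by simp
  qed
  finally have "rat_of_nat (card B) = of_nat (card C)" using tr_1 by simp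
  then have cc: "card C = card B" by simp
  obtain f where f: "bij_betw f {..<card B} C"
    using ex_bij_betw_nat_finite[OF C(1)] cc by (auto simp: atLeast0LessThan)
  have fC': "f i \<in> C" if "i < card B" for i using f that by (auto simp: bij_betw_def)
  have "\<forall>c\<in>C. \<exists>N::int. N > 0 \<and> of_int N * c \<in> OK" using integer_multiple C(2) by blast
  from bchoice[OF this] obtain N :: "'a \<Rightarrow> int"
    where N: "\<And>c. c \<in> C \<Longrightarrow> N c > 0" "\<And>c. c \<in> C \<Longrightarrow> of_int (N c) * c \<in> OK" by blast
  define c where "c i = of_int (N (f i)) * f i" for i
  have cO: "c i \<in> OK" if "i < card B" for i unfolding c_def by (rule N(2)[OF fC'[OF that]])
  have "\<forall>i\<in>{..<card B}. \<exists>u::nat \<Rightarrow> int. c i = (\<Sum>j<card B. of_int (u j) * b j)"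
    using spansD(3)[OF b cO] by simp
  from bchoice[OF this] obtain U :: "nat \<Rightarrow> nat \<Rightarrow> int"
    where U: "\<And>i. i < card B \<Longrightarrow> c i = (\<Sum>j<card B. of_int (U i j) * b j)" by (metis lessThan_iff)
  have "det (gram (card B) c) = of_int (det (mat (card B) (card B) (\<lambda>(i,j). U i j))) ^ 2 * det (gram (card B) b)"
    by (rule gram_change[OF spansD(2)[OF b] U])
  then have z: "det (gram (card B) c) = 0" using 0 by simp
  have e: "tr (c i * c j) = of_int (N (f i)) * of_int (N (f j)) * tr (f i * f j)" if "i < card B" "j < card B" for i j
  proof -
    have "c i * c j = of_int (N (f i)) * (of_int (N (f j)) * (f i * f j))" unfolding c_def by (simp only: ac_simps)
    then show ?thesis using C(2)[OF fC'[OF that(1)]] C(2)[OF fC'[OF that(2)]]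
      by (simp add: tr_int_mult K_mult)
  qed
  have "upper_triangular (gram (card B) c)"
  proof
    fix i j assume ij: "j < i" "i < dim_row (gram (card B) c)"
    then have ij': "i < card B" "j < card B" unfolding gram_def by auto
    have "f i \<noteq> f j" using inj_onD[OF bij_betw_imp_inj_on[OF f], of i j] ij' ij(1) by auto
    then show "gram (card B) c $$ (i,j) = 0"
      using e[OF ij'] C(4)[OF fC' fC', OF ij'] ij' by (simp add: gram_def)
  qed
  moreover have "gram (card B) c \<in> carrier_mat (card B) (card B)" unfolding gram_def by simp
  ultimately have "det (gram (card B) c) = prod_list (diag_mat (gram (card B) c))"
    by (rule det_upper_triangular)
  moreover have "0 \<notin> set (diag_mat (gram (card B) c))"
  proof
    assume "0 \<in> set (diag_mat (gram (card B) c))"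
    then obtain i where i: "i < card B" "tr (c i * c i) = 0" unfolding diag_mat_def gram_def by auto
    then show False using e[OF i(1) i(1)] C(5)[OF fC'[OF i(1)]] N(1)[OF fC'[OF i(1)]] by simp
  qed
  ultimately show False using z by (simp add: prod_list_zero_iff)
qed

end

section \<open>Reduction modulo 2\<close>

context quartic
begin

definition ib :: "nat \<Rightarrow> 'a" where "ib = (SOME b. spans 4 b)"
definition db :: "nat \<Rightarrow> 'a" where
  "db = (SOME d. frame {..<4} ib d \<and> (\<forall>i<4. \<forall>k<4. tr (ib k * d i) = (if k = i then 1 else 0)))"

lemma ib: "spans 4 ib"
  unfolding ib_def using exists_spans unfolding quartic by (rule someI_ex)

lemma db: "frame {..<4} ib db" "i < 4 \<Longrightarrow> k < 4 \<Longrightarrow> tr (ib k * db i) = (if k = i then 1 else 0)"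
proof -
  have "det (int_gram 4 ib) \<noteq> 0" using gram_det_nonzero[of ib] ib unfolding quartic by blast
  from integral_dual_basis[OF ib refl this refl]
  have "\<exists>d. frame {..<4} ib d \<and> (\<forall>i<4. \<forall>k<4. tr (ib k * d i) = (if k = i then 1 else 0))" by blast
  then have "frame {..<4} ib db \<and> (\<forall>i<4. \<forall>k<4. tr (ib k * db i) = (if k = i then 1 else 0))"
    unfolding db_def by (rule someI_ex)
  then show "frame {..<4} ib db" "i < 4 \<Longrightarrow> k < 4 \<Longrightarrow> tr (ib k * db i) = (if k = i then 1 else 0)" by blast+
qed

lemma ib_OK: "i < 4 \<Longrightarrow> ib i \<in> OK" using spansD(1)[OF ib] .
lemma db_K: "i < 4 \<Longrightarrow> db i \<in> K" using frameD(3)[OF db(1)] by simp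

definition coord :: "'a \<Rightarrow> nat \<Rightarrow> int" where "coord x i = \<lfloor>tr (x * db i)\<rfloor>"

lemma coord:
  assumes x: "x \<in> OK"
  shows "i < 4 \<Longrightarrow> of_int (coord x i) = tr (x * db i)" "x = (\<Sum>i<4. of_int (coord x i) * ib i)"
proof -
  obtain c :: "nat \<Rightarrow> int" where c: "x = (\<Sum>i<4. of_int (c i) * ib i)" using spansD(3)[OF ib x] by blast
  have t: "tr (x * db i) = of_int (c i)" if i: "i < 4" for i
  proof -
    have "tr (x * db i) = (\<Sum>j<4. of_int (c j) * tr (ib j * db i))"
      unfolding c by (rule tr_int_lincomb) (use ib_OK db_K i in auto)
    also have "\<dots> = (\<Sum>j<4. if j = i then of_int (c i) else 0)"
      using db(2)[OF i] by (intro sum.cong refl) simp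
    finally show ?thesis using i by simp
  qed
  show 1: "i < 4 \<Longrightarrow> of_int (coord x i) = tr (x * db i)" for i unfolding coord_def t by simp
  have "coord x i = c i" if "i < 4" for i using 1[OF that] t[OF that] by simp
  then show "x = (\<Sum>i<4. of_int (coord x i) * ib i)" using c by simp
qed

text \<open>Divisibility by 2 in the integers; the quotient ring itself is never formed.\<close>

definition ev :: "'a \<Rightarrow> bool" where "ev x \<longleftrightarrow> x / 2 \<in> OK"

lemma ev_OK: "ev x \<Longrightarrow> x \<in> OK" unfolding ev_def using O_mult[OF O_numeral, of "x / 2" "num.Bit0 num.One"] by simp
lemma ev_add: "ev x \<Longrightarrow> ev y \<Longrightarrow> ev (x + y)" unfolding ev_def add_divide_distrib by (rule O_add)
lemma ev_diff: "ev x \<Longrightarrow> ev y \<Longrightarrow> ev (x - y)" unfolding ev_def diff_divide_distrib by (rule O_diff)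
lemma ev_minus: "ev x \<Longrightarrow> ev (- x)" unfolding ev_def by (metis O_minus minus_divide_left)
lemma ev_mult: "ev x \<Longrightarrow> y \<in> OK \<Longrightarrow> ev (x * y)" unfolding ev_def times_divide_eq_left[symmetric] by (rule O_mult)
lemma ev_mult2: "y \<in> OK \<Longrightarrow> ev x \<Longrightarrow> ev (y * x)" using ev_mult[of x y] by (simp only: mult.commute)
lemma ev_2: "y \<in> OK \<Longrightarrow> ev (2 * y)" unfolding ev_def by simp
lemma ev_0: "ev 0" unfolding ev_def by simp
lemma not_ev_1: "\<not> ev 1"
proof
  assume "ev 1"
  then have "of_rat (1 / 2) \<in> OK" unfolding ev_def by (simp add: of_rat_divide)
  then have "(1 / 2 :: rat) \<in> \<int>" by (rule K_rational_O)
  then obtain n where n: "(1 / 2 :: rat) = of_int n" by (auto elim: Ints_cases)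
  then have "1 = (2 * of_int n :: rat)" by simp
  then have "1 = 2 * n" by (metis of_int_1 of_int_mult of_int_numeral of_int_eq_iff)
  then show False by presburger
qed

lemma ev_coord:
  assumes x: "ev x" and i: "i < 4" shows "even (coord x i)"
proof -
  have "x / 2 \<in> OK" using x unfolding ev_def .
  then have "tr (x / 2 * db i) = of_int (coord (x / 2) i)" using coord(1) i by simp
  moreover have "tr (of_int 2 * (x / 2 * db i)) = of_int 2 * tr (x / 2 * db i)"
    by (rule tr_int_mult) (use \<open>x / 2 \<in> OK\<close> db_K[OF i] in blast)
  ultimately have "tr (x * db i) = of_int (2 * coord (x / 2) i)" by simp
  then have "coord x i = 2 * coord (x / 2) i" using coord(1)[OF ev_OK[OF x] i] by (simp only: of_int_eq_iff)
  then show ?thesis by simp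
qed

definition res :: "'a \<Rightarrow> nat set" where "res x = {i. i < 4 \<and> odd (coord x i)}"

lemma finite_res: "finite (range res)"
  by (rule finite_subset[of _ "Pow {..<4}"]) (auto simp: res_def)

lemma res_eq:
  assumes "x \<in> OK" "y \<in> OK" "res x = res y" shows "ev (x - y)"
proof -
  have e: "ev (of_int (coord x i - coord y i) * ib i)" if i: "i \<in> {..<4}" for i
  proof -
    have "even (coord x i - coord y i)" using assms(3) i unfolding res_def by auto
    then obtain m where "coord x i - coord y i = 2 * m" by (elim evenE)
    then have "of_int (coord x i - coord y i) * ib i = 2 * (of_int m * ib i)" by simp
    then show ?thesis using ev_2[OF O_mult[OF O_int ib_OK]] i by (metis lessThan_iff)
  qed
  have "x - y = (\<Sum>i<4. of_int (coord x i) * ib i) - (\<Sum>i<4. of_int (coord y i) * ib i)"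
    using coord(2)[OF assms(1)] coord(2)[OF assms(2)] by simp
  also have "\<dots> = (\<Sum>i<4. of_int (coord x i - coord y i) * ib i)"
    by (simp only: sum_subtractf[symmetric] of_int_diff left_diff_distrib)
  finally have "x - y = \<dots>" .
  moreover have "ev (\<Sum>i\<in>A. of_int (coord x i - coord y i) * ib i)" if "A \<subseteq> {..<4}" for A
    using that e by (induction A rule: infinite_finite_induct) (auto intro: ev_0 ev_add)
  ultimately show ?thesis by simp
qed

text \<open>The integers modulo 2 form a finite ring.\<close>

lemma power_repeats:
  assumes x: "x \<in> OK"
  obtains i t where "t > 0" "ev (x ^ (i + t) - x ^ i)"
proof -
  have "\<not> inj (\<lambda>i::nat. res (x ^ i))"
  proof
    assume "inj (\<lambda>i::nat. res (x ^ i))"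
    moreover have "finite (range (\<lambda>i::nat. res (x ^ i)))" by (rule finite_subset[OF _ finite_res]) auto
    ultimately show False using finite_imageD infinite_UNIV_nat by blast
  qed
  then obtain i j where ij: "i \<noteq> j" "res (x ^ i) = res (x ^ j)" unfolding inj_def by blast
  have "\<exists>i t. t > 0 \<and> ev (x ^ (i + t) - x ^ i)"
  proof (cases "i < j")
    case True
    then show ?thesis using res_eq[of "x ^ j" "x ^ i"] x ij by (intro exI[of _ i] exI[of _ "j - i"]) auto
  next
    case False
    then show ?thesis using res_eq[of "x ^ i" "x ^ j"] x ij by (intro exI[of _ j] exI[of _ "i - j"]) auto
  qed
  then show ?thesis using that by blast
qed

lemma power_idempotent:
  assumes x: "x \<in> OK"
  obtains k where "k > 0" "ev (x ^ k * x ^ k - x ^ k)"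
proof -
  obtain i t where it: "t > 0" "ev (x ^ (i + t) - x ^ i)" using power_repeats[OF x] by blast
  have 1: "ev (x ^ (m + t) - x ^ m)" if "i \<le> m" for m
  proof -
    have "x ^ (m - i) * (x ^ (i + t) - x ^ i) = x ^ (m + t) - x ^ m"
      using that by (simp add: right_diff_distrib power_add[symmetric])
    then show ?thesis using ev_mult2[OF O_pow[OF x] it(2), of "m - i"] by simp
  qed
  have 2: "ev (x ^ (m + t * l) - x ^ m)" if "i \<le> m" for m l
  proof (induction l)
    case 0 then show ?case by (simp add: ev_0)
  next
    case (Suc l)
    have "ev ((x ^ (m + t * l + t) - x ^ (m + t * l)) + (x ^ (m + t * l) - x ^ m))"
      using Suc 1[of "m + t * l"] that by (intro ev_add) auto
    then show ?case by (simp add: ac_simps)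
  qed
  let ?k = "t * (i + 1)"
  have "i + 1 \<le> ?k" using it(1) by (cases t) auto
  then have "ev (x ^ (?k + ?k) - x ^ ?k)" using 2[of ?k "i + 1"] by simp
  then show ?thesis using that[of ?k] it(1) by (simp add: power_add)
qed

end

text \<open>A prime ideal above 2 that is locally principal: \<open>t\<close> lies in the inverse ideal and \<open>\<pi>\<close> is a
  uniformizer, since \<open>t * \<pi>\<close> is a unit at the prime.\<close>

locale local_prime = quartic +
  fixes P :: "'a set" and t \<pi> :: 'a
  assumes P_OK: "x \<in> P \<Longrightarrow> x \<in> OK"
    and P_add: "x \<in> P \<Longrightarrow> y \<in> P \<Longrightarrow> x + y \<in> P"
    and P_mult: "x \<in> P \<Longrightarrow> y \<in> OK \<Longrightarrow> x * y \<in> P"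
    and P_2: "2 \<in> P" and P_1: "1 \<notin> P"
    and P_prime: "x \<in> OK \<Longrightarrow> y \<in> OK \<Longrightarrow> x * y \<in> P \<Longrightarrow> x \<in> P \<or> y \<in> P"
    and t_K: "t \<in> K" and \<pi>_P: "\<pi> \<in> P" and t_P: "x \<in> P \<Longrightarrow> t * x \<in> OK"
    and s_P: "t * \<pi> \<notin> P"

context quartic
begin

text \<open>Take an idempotent power \<open>\<epsilon>\<close> of \<open>u\<close> modulo 2 and an element \<open>y\<close> of its component with annihilator modulo 2 as large as
  possible; that annihilator is a prime ideal \<open>P\<close>. The element \<open>y / 2\<close> maps \<open>P\<close> into the integers, but not into \<open>P\<close>, since
  otherwise it would be integral by the determinant trick. This makes \<open>P\<close> invertible at itself.\<close>

lemma exists_local_prime: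
  assumes u: "u \<in> OK" "\<And>N. \<not> ev (u ^ N)"
  shows "\<exists>P t \<pi>. local_prime K P t \<pi> \<and> u \<notin> P"
proof -
  obtain k where k: "k > 0" "ev (u ^ k * u ^ k - u ^ k)" using power_idempotent[OF u(1)] by blast
  define \<epsilon> where "\<epsilon> = u ^ k"
  have \<epsilon>: "\<epsilon> \<in> OK" "\<not> ev \<epsilon>" "ev (\<epsilon> * \<epsilon> - \<epsilon>)" using k u unfolding \<epsilon>_def by auto
  define Y where "Y = {y \<in> OK. ev (\<epsilon> * y - y) \<and> \<not> ev y}"
  define Ann where "Ann y = {x \<in> OK. ev (x * y)}" for y
  have fin: "finite (res ` A)" for A by (rule finite_subset[OF _ finite_res]) auto
  have bnd: "card (res ` Ann y) \<le> card (range res)" for y by (rule card_mono[OF finite_res]) auto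
  have "\<epsilon> \<in> Y" unfolding Y_def using \<epsilon> by simp
  then have "\<exists>y. y \<in> Y \<and> (\<forall>y'. y' \<in> Y \<longrightarrow> card (res ` Ann y') \<le> card (res ` Ann y))"
    by (rule ex_has_greatest_nat[of _ _ _ "Suc (card (range res))"]) (simp add: bnd less_Suc_eq_le)
  then obtain y where y: "y \<in> Y" "\<And>y'. y' \<in> Y \<Longrightarrow> card (res ` Ann y') \<le> card (res ` Ann y)" by blast
  have yO: "y \<in> OK" and ye: "ev (\<epsilon> * y - y)" and ny: "\<not> ev y" using y(1) unfolding Y_def by auto
  define P where "P = Ann y"
  have PO: "x \<in> OK" if "x \<in> P" for x using that unfolding P_def Ann_def by simp
  have Pe: "x \<in> P \<longleftrightarrow> ev (x * y)" if "x \<in> OK" for x using that unfolding P_def Ann_def by simp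
  have Padd: "x + z \<in> P" if "x \<in> P" "z \<in> P" for x z
    using that unfolding P_def Ann_def by (auto simp: distrib_right intro: ev_add)
  have Pmult: "x * z \<in> P" if "x \<in> P" "z \<in> OK" for x z
  proof -
    have "ev (x * y)" using that(1) PO Pe by blast
    then have "ev (x * y * z)" using that(2) by (rule ev_mult)
    then have "ev (x * z * y)" by (simp only: ac_simps)
    then show ?thesis using that PO Pe[of "x * z"] by auto
  qed
  have P2: "2 \<in> P" using ev_2[OF yO] Pe[of 2] by simp
  have P1: "1 \<notin> P" using ny Pe[of 1] by simp
  have Pprime: "x1 \<in> P \<or> x2 \<in> P" if x: "x1 \<in> OK" "x2 \<in> OK" "x1 * x2 \<in> P" for x1 x2
  proof (cases "x2 \<in> P")
    case False
    have e12: "ev (x1 * (x2 * y))" using x(3) Pe[of "x1 * x2"] x(1,2) by (auto simp: mult.assoc)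
    have "\<epsilon> * (x2 * y) - x2 * y = x2 * (\<epsilon> * y - y)" by (simp add: algebra_simps)
    then have "ev (\<epsilon> * (x2 * y) - x2 * y)" using ev_mult2[OF x(2) ye] by simp
    then have "x2 * y \<in> Y" unfolding Y_def using False Pe[OF x(2)] x(2) yO by auto
    then have le: "card (res ` Ann (x2 * y)) \<le> card (res ` Ann y)" by (rule y(2))
    have sub: "Ann y \<subseteq> Ann (x2 * y)"
    proof
      fix x assume "x \<in> Ann y"
      then have "x \<in> OK" "ev (x2 * (x * y))" unfolding Ann_def using ev_mult2[OF x(2)] by auto
      then show "x \<in> Ann (x2 * y)" unfolding Ann_def by (simp add: mult.left_commute)
    qed
    have "res ` Ann y = res ` Ann (x2 * y)"
      by (rule card_seteq[OF fin image_mono[OF sub] le])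
    moreover have "x1 \<in> Ann (x2 * y)" unfolding Ann_def using x(1) e12 by simp
    ultimately obtain r where r: "r \<in> Ann y" "res x1 = res r" by blast
    have rO: "r \<in> OK" "ev (r * y)" using r(1) unfolding Ann_def by auto
    have "ev ((x1 - r) * y)" using res_eq[OF x(1) rO(1) r(2)] yO by (rule ev_mult)
    then have "ev ((x1 - r) * y + r * y)" using rO(2) by (rule ev_add)
    then show ?thesis using Pe[OF x(1)] by (simp add: left_diff_distrib)
  qed simp
  have Ppow: "x ^ i \<notin> P" if "x \<in> OK" "x \<notin> P" for x i
  proof (induction i)
    case (Suc i) then show ?case using Pprime[OF that(1) O_pow[OF that(1)], of i] that(2) by auto
  qed (simp add: P1)
  have "\<epsilon> \<notin> P"
  proof
    assume "\<epsilon> \<in> P"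
    then have "ev (\<epsilon> * y)" using Pe[OF \<epsilon>(1)] by blast
    then have "ev (\<epsilon> * y - (\<epsilon> * y - y))" using ye by (rule ev_diff)
    moreover have "\<epsilon> * y - (\<epsilon> * y - y) = y" by simp
    ultimately show False using ny by (simp only:)
  qed
  then have uP: "u \<notin> P" using Pmult[of u "u ^ (k - 1)"] u(1) k(1) unfolding \<epsilon>_def by (cases k) auto
  define y' where "y' = y / 2"
  have y'K: "y' \<in> K" unfolding y'_def using yO by blast
  have y'P: "y' * x \<in> OK" if "x \<in> P" for x
  proof -
    have "ev (x * y)" using that PO Pe by blast
    then show ?thesis unfolding ev_def y'_def by (simp add: mult.commute)
  qed
  have "\<exists>x0\<in>P. y' * x0 \<notin> P"
  proof (rule ccontr)
    assume "\<not> (\<exists>x0\<in>P. y' * x0 \<notin> P)"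
    then have st: "y' * x \<in> P" if "x \<in> P" for x using that by blast
    have "0 \<in> P" using Pe[of 0] ev_0 by simp
    moreover have "x - z \<in> P" if "x \<in> P" "z \<in> P" for x z
      using Padd[OF that(1) Pmult[OF that(2), of "- 1"]] by auto
    ultimately obtain T where T: "finite T" "int_mod.span T = P"
      using integer_subgroup_basis[of P] PO by blast
    have "\<exists>s0\<in>T. s0 \<noteq> 0"
    proof (rule ccontr)
      assume "\<not> (\<exists>s0\<in>T. s0 \<noteq> 0)"
      then have "T \<subseteq> {0}" by blast
      then have "int_mod.span T \<subseteq> {0}" by (rule int_mod.span_minimal[OF _ int_mod.subspace_single_0])
      then show False using P2 T(2) by auto
    qed
    then obtain s0 where s0: "s0 \<in> T" "s0 \<noteq> 0" by blast
    have "algebraic_int y'"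
    proof (rule stable_algebraic_int[OF T(1) s0])
      fix s assume "s \<in> T"
      then have "s \<in> P" using T(2) int_mod.span_base by blast
      then show "y' * s \<in> int_mod.span T" using st T(2) by simp
    qed
    then have "y' \<in> OK" using y'K O_iff by blast
    then show False using ny unfolding ev_def y'_def by simp
  qed
  then obtain x0 where x0: "x0 \<in> P" "y' * x0 \<notin> P" by blast
  define x where "x = y' * x0"
  have xO: "x \<in> OK" "x \<notin> P" unfolding x_def using x0 y'P by auto
  obtain i l where il: "l > 0" "ev (x ^ (i + l) - x ^ i)" using power_repeats[OF xO(1)] by blast
  have evP: "z \<in> P" if "ev z" for z using Pe[OF ev_OK[OF that]] ev_mult[OF that yO] by blast
  have "x ^ i * (x ^ l - 1) \<in> P" using evP[OF il(2)] by (simp add: power_add right_diff_distrib)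
  then have l1: "x ^ l - 1 \<in> P" using Pprime[of "x ^ i" "x ^ l - 1"] Ppow[OF xO, of i] xO(1) by auto
  define w where "w = x ^ (l - 1)"
  have wO: "w \<in> OK" unfolding w_def using xO(1) by blast
  have wx: "w * x - 1 \<in> P" using l1 il(1) unfolding w_def by (cases l) (auto simp: mult.commute)
  define t where "t = w * y'"
  have "t * x0 \<notin> P"
  proof
    assume "t * x0 \<in> P"
    then have "w * x \<in> P" unfolding t_def x_def by (simp only: mult.assoc)
    moreover have "(w * x - 1) * (- 1) \<in> P" by (rule Pmult[OF wx]) auto
    ultimately have "w * x + (w * x - 1) * (- 1) \<in> P" by (rule Padd)
    moreover have "w * x + (w * x - 1) * (- 1) = 1" by simp
    ultimately show False using P1 by (simp only:)
  qed
  moreover have "t * z \<in> OK" if "z \<in> P" for z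
    unfolding t_def mult.assoc by (intro O_mult wO y'P that)
  moreover have "t \<in> K" unfolding t_def using wO y'K by blast
  ultimately have "local_prime K P t x0"
    using PO Padd Pmult P2 P1 Pprime x0(1) by unfold_locales auto
  then show ?thesis using uP by blast
qed

end

section \<open>Ramification above 2\<close>

context quartic
begin

lemma ring_on_simps: "carrier (ring_on OK) = OK" "x \<otimes>\<^bsub>ring_on OK\<^esub> y = x * y" "x \<oplus>\<^bsub>ring_on OK\<^esub> y = x + y"
  "\<one>\<^bsub>ring_on OK\<^esub> = 1" "\<zero>\<^bsub>ring_on OK\<^esub> = 0"
  unfolding ring_on_def by simp_all

lemma cring_OK: "cring (ring_on OK)"
proof (rule cringI)
  show "abelian_group (ring_on OK)"
  proof (rule abelian_groupI)
    show "\<exists>y\<in>carrier (ring_on OK). y \<oplus>\<^bsub>ring_on OK\<^esub> x = \<zero>\<^bsub>ring_on OK\<^esub>" if "x \<in> carrier (ring_on OK)" for x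
      using that by (intro bexI[of _ "- x"]) (auto simp: ring_on_simps)
  qed (auto simp: ring_on_simps)
  show "comm_monoid (ring_on OK)" by (rule comm_monoidI) (auto simp: ring_on_simps)
qed (auto simp: ring_on_simps algebra_simps)

lemma ideal_OK_I:
  assumes I: "I \<subseteq> OK" "0 \<in> I" "\<And>x y. x \<in> I \<Longrightarrow> y \<in> I \<Longrightarrow> x + y \<in> I" "\<And>x y. x \<in> I \<Longrightarrow> y \<in> OK \<Longrightarrow> x * y \<in> I"
  shows "ideal I (ring_on OK)"
proof (rule idealI)
  interpret R: cring "ring_on OK" by (rule cring_OK)
  show "ring (ring_on OK)" by (rule R.ring_axioms)
  show "subgroup I (add_monoid (ring_on OK))"
  proof (rule subgroup.intro)
    show "I \<subseteq> carrier (add_monoid (ring_on OK))" using I(1) by (simp add: ring_on_simps)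
    show "x \<otimes>\<^bsub>add_monoid (ring_on OK)\<^esub> y \<in> I" if "x \<in> I" "y \<in> I" for x y using I(3)[OF that] by (simp add: ring_on_simps)
    show "\<one>\<^bsub>add_monoid (ring_on OK)\<^esub> \<in> I" using I(2) by (simp add: ring_on_simps)
    show "inv\<^bsub>add_monoid (ring_on OK)\<^esub> x \<in> I" if x: "x \<in> I" for x
    proof -
      have "x \<in> OK" using x I(1) by blast
      then have "\<ominus>\<^bsub>ring_on OK\<^esub> x = - x"
        by (intro R.minus_equality) (auto simp: ring_on_simps)
      then show ?thesis using I(4)[OF x, of "- 1"] unfolding a_inv_def by auto
    qed
  qed
  show "x \<otimes>\<^bsub>ring_on OK\<^esub> a \<in> I" "a \<otimes>\<^bsub>ring_on OK\<^esub> x \<in> I" if "a \<in> I" "x \<in> carrier (ring_on OK)" for a x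
    using I(4)[OF that(1), of x] that(2) by (auto simp: ring_on_simps mult.commute)
qed

end

context local_prime
begin

lemma P_0: "0 \<in> P" using P_mult[OF P_2, of 0] by auto
lemma P_diff: "x \<in> P \<Longrightarrow> y \<in> P \<Longrightarrow> x - y \<in> P" using P_add[of x "y * (- 1)"] P_mult[of y "- 1"] by auto
lemma P_pow: "x \<in> OK \<Longrightarrow> x \<notin> P \<Longrightarrow> x ^ i \<notin> P"
proof (induction i)
  case (Suc i) then show ?case using P_prime[of x "x ^ i"] by auto
qed (simp add: P_1)
lemma P_prod: "x \<in> OK \<Longrightarrow> y \<in> OK \<Longrightarrow> x \<notin> P \<Longrightarrow> y \<notin> P \<Longrightarrow> x * y \<notin> P" using P_prime by blast
lemma P_pow_in: "x \<in> OK \<Longrightarrow> x ^ i \<in> P \<Longrightarrow> x \<in> P" using P_pow by blast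
lemma ev_P: "ev x \<Longrightarrow> x \<in> P" using P_mult[OF P_2, of "x / 2"] unfolding ev_def by simp

abbreviation s :: 'a where "s \<equiv> t * \<pi>"
lemma \<pi>_OK: "\<pi> \<in> OK" by (rule P_OK[OF \<pi>_P])
lemma s_OK: "s \<in> OK" by (rule t_P[OF \<pi>_P])

lemma s_pow: "t ^ k * \<pi> ^ k = s ^ k" by (simp only: power_mult_distrib)

text \<open>The residue ring at \<open>P\<close> is a finite domain.\<close>

lemma local_inverse:
  assumes x: "x \<in> OK" "x \<notin> P"
  obtains w where "w \<in> OK" "1 - x * w \<in> P"
proof -
  obtain i l where il: "l > 0" "ev (x ^ (i + l) - x ^ i)" using power_repeats[OF x(1)] by blast
  have "x ^ i * (1 - x ^ l) = - (x ^ (i + l) - x ^ i)" by (simp add: power_add right_diff_distrib)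
  then have "x ^ i * (1 - x ^ l) \<in> P" using ev_P[OF ev_minus[OF il(2)]] by simp
  then have "1 - x ^ l \<in> P" using P_prime[of "x ^ i" "1 - x ^ l"] P_pow[OF x, of i] x(1) by auto
  moreover have "x ^ l = x * x ^ (l - 1)" using il(1) by (cases l) auto
  ultimately show ?thesis using that[of "x ^ (l - 1)"] x(1) by auto
qed

text \<open>The normalised valuation of 2 at \<open>P\<close>: the factor \<open>t\<close> removes one power of the prime.\<close>

definition e :: nat where "e = (LEAST k. t ^ k * 2 \<notin> P)"
definition a :: 'a where "a = t ^ e * 2"

text \<open>If all \<open>t ^ k * 2\<close> were in \<open>P\<close>, a repetition of powers of \<open>\<pi>\<close> modulo 2 would cancel against the unit \<open>t * \<pi>\<close>.\<close>

lemma a_not_P: "a \<notin> P"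
proof -
  have "\<exists>k. t ^ k * 2 \<notin> P"
  proof (rule ccontr)
    assume "\<not> (\<exists>k. t ^ k * 2 \<notin> P)"
    then have all: "t ^ k * 2 \<in> P" for k by blast
    obtain i l where il: "l > 0" "ev (\<pi> ^ (i + l) - \<pi> ^ i)" using power_repeats[OF \<pi>_OK] by blast
    define c where "c = \<pi> ^ l - 1"
    have "\<pi> ^ l \<in> P" using il(1) P_mult[OF \<pi>_P O_pow[OF \<pi>_OK], of "l - 1"] by (cases l) auto
    then have c: "c \<notin> P" "c \<in> OK" unfolding c_def using P_diff[of "\<pi> ^ l" "\<pi> ^ l - 1"] P_1 \<pi>_OK by auto
    have pc: "\<pi> ^ i * c = \<pi> ^ (i + l) - \<pi> ^ i" unfolding c_def by (simp add: power_add right_diff_distrib)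
    then have o: "(\<pi> ^ i * c) / 2 \<in> OK" using il(2) unfolding ev_def by simp
    have "t ^ i * 2 * ((\<pi> ^ i * c) / 2) \<in> P" by (rule P_mult[OF all o])
    moreover have "t ^ i * 2 * ((\<pi> ^ i * c) / 2) = (t ^ i * \<pi> ^ i) * c" by simp
    ultimately have "s ^ i * c \<in> P" by (simp only: s_pow)
    then show False using P_prod[OF O_pow[OF s_OK] c(2) P_pow[OF s_OK s_P] c(1)] by blast
  qed
  then show ?thesis unfolding a_def e_def by (rule LeastI_ex)
qed

lemma below_e: "k < e \<Longrightarrow> t ^ k * 2 \<in> P" unfolding e_def using not_less_Least by blast

lemma e_pos: "e > 0" using a_not_P P_2 unfolding a_def by (cases e) auto

lemma a_OK: "a \<in> OK"
proof -
  obtain m where m: "e = Suc m" using e_pos by (cases e) auto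
  have "t * (t ^ m * 2) \<in> OK" using below_e[of m] m by (intro t_P) simp
  then show ?thesis unfolding a_def m by (simp add: mult.assoc)
qed

lemma a_\<pi>: "\<pi> ^ e * a = 2 * s ^ e" unfolding a_def s_pow[symmetric] by (simp only: ac_simps)

lemma above_e:
  assumes "t ^ k * 2 \<in> OK" shows "k \<le> e"
proof (rule ccontr)
  assume "\<not> k \<le> e"
  then obtain l where l: "k = e + l" "l > 0" using less_imp_add_positive[of e k] by auto
  have "\<pi> ^ l * (t ^ k * 2) \<in> P"
  proof -
    have "\<pi> * \<pi> ^ (l - 1) \<in> P" by (rule P_mult[OF \<pi>_P O_pow[OF \<pi>_OK]])
    then have "\<pi> ^ l \<in> P" using l(2) by (cases l) auto
    then show ?thesis using assms by (rule P_mult)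
  qed
  moreover have "\<pi> ^ l * (t ^ k * 2) = s ^ l * a"
    unfolding a_def l(1) power_add s_pow[of l, symmetric] by (simp only: ac_simps)
  ultimately show False using P_prod[OF O_pow[OF s_OK] a_OK P_pow[OF s_OK s_P] a_not_P] by simp
qed

lemma valuation_bound:
  assumes c: "c \<in> OK" "c \<notin> P" "ev (\<pi> ^ k * c)" shows "e \<le> k"
proof (rule ccontr)
  assume "\<not> e \<le> k"
  then have "t ^ k * 2 \<in> P" by (intro below_e) simp
  moreover have "(\<pi> ^ k * c) / 2 \<in> OK" using c(3) unfolding ev_def .
  ultimately have "t ^ k * 2 * ((\<pi> ^ k * c) / 2) \<in> P" by (rule P_mult)
  moreover have "t ^ k * 2 * ((\<pi> ^ k * c) / 2) = (t ^ k * \<pi> ^ k) * c" by simp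
  ultimately have "s ^ k * c \<in> P" by (simp only: s_pow)
  then show False using P_prod[OF O_pow[OF s_OK] c(1) P_pow[OF s_OK s_P] c(2)] by blast
qed

abbreviation Ppow :: "nat \<Rightarrow> 'a set" where "Ppow k \<equiv> P [^]\<^bsub>ideals_set (ring_on OK)\<^esub> k"

lemma Ppow_rec: "Ppow 0 = OK" "Ppow (Suc k) = Ppow k \<cdot>\<^bsub>ring_on OK\<^esub> P"
  unfolding nat_pow_def ideals_set_def by (simp_all add: ring_on_simps)

lemma Ppow_t: "x \<in> Ppow k \<Longrightarrow> x \<in> OK \<and> t ^ k * x \<in> OK"
proof (induction k arbitrary: x)
  case 0 then show ?case unfolding Ppow_rec(1) by simp
next
  case (Suc k)
  from Suc.prems have "x \<in> Ppow k \<cdot>\<^bsub>ring_on OK\<^esub> P" unfolding Ppow_rec .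
  then show ?case
  proof (induction x rule: ideal_prod.induct)
    case (prod i j)
    have eq: "t ^ Suc k * (i * j) = (t ^ k * i) * (t * j)" by (simp only: power_Suc ac_simps)
    have "t ^ Suc k * (i * j) \<in> OK"
      unfolding eq by (rule O_mult[OF conjunct2[OF Suc.IH[OF prod(1)]] t_P[OF prod(2)]])
    moreover have "i * j \<in> OK" using Suc.IH[OF prod(1)] P_OK[OF prod(2)] by blast
    ultimately show ?case by (simp only: ring_on_simps)
  next
    case (sum x y) then show ?case by (auto simp: ring_on_simps distrib_left)
  qed
qed

lemma pow_in_Ppow: "x \<in> P \<Longrightarrow> x ^ k \<in> Ppow k"
proof (induction k)
  case (Suc k)
  then have "x ^ k \<otimes>\<^bsub>ring_on OK\<^esub> x \<in> Ppow k \<cdot>\<^bsub>ring_on OK\<^esub> P" by (intro ideal_prod.prod)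
  then show ?case unfolding Ppow_rec by (simp add: ring_on_simps mult.commute)
qed (simp only: Ppow_rec(1) power_0 O_01)

lemma ideal_P: "ideal P (ring_on OK)"
  by (rule ideal_OK_I) (use P_OK P_0 P_add P_mult in auto)

lemma primeideal_P: "primeideal P (ring_on OK)"
proof (rule primeidealI[OF ideal_P cring_OK])
  show "carrier (ring_on OK) \<noteq> P" using P_1 by (auto simp: ring_on_simps)
qed (use P_prime in \<open>auto simp: ring_on_simps\<close>)

lemma one_minus_pow:
  assumes "y \<in> OK" shows "\<exists>g\<in>OK. (1 - y) ^ n = 1 - y * g"
proof (induction n)
  case 0 show ?case by (intro bexI[of _ 0]) auto
next
  case (Suc n)
  then obtain g where g: "g \<in> OK" "(1 - y) ^ n = 1 - y * g" by blast
  have "(1 - y) ^ Suc n = 1 - y * (1 + g - y * g)" unfolding power_Suc g(2) by (simp add: algebra_simps)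
  then show ?case using g(1) assms by (intro bexI[of _ "1 + g - y * g"]) auto
qed

text \<open>The complementary ideal is the quotient of \<open>(2)\<close> by the power of \<open>P\<close>. The product is all of \<open>(2)\<close> because the unit
  \<open>(t * \<pi>) ^ e\<close> generates, together with the power of \<open>P\<close>, the whole ring.\<close>

lemma ramification_index_eq: "ramification_index K P 2 = e"
proof -
  let ?R = "ring_on OK"
  have two: "PIdl\<^bsub>?R\<^esub> (of_nat 2) = {x * 2 | x. x \<in> OK}"
    unfolding cgenideal_def by (simp add: ring_on_simps)
  define J where "J = {x \<in> OK. \<forall>p\<in>Ppow e. ev (x * p)}"
  have idJ: "ideal J ?R"
  proof (rule ideal_OK_I)
    show "x * y \<in> J" if xy: "x \<in> J" "y \<in> OK" for x y
    proof -
      have "ev (x * y * p)" if "p \<in> Ppow e" for p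
      proof -
        have "ev (x * p)" using xy(1) that unfolding J_def by blast
        then have "ev (x * p * y)" using xy(2) by (rule ev_mult)
        then show ?thesis by (simp only: ac_simps)
      qed
      then show ?thesis using xy unfolding J_def by auto
    qed
  qed (auto simp: J_def ev_0 distrib_right intro: ev_add)
  have Jm: "x * y \<in> J" if "x \<in> J" "y \<in> OK" for x y
    using ideal.I_r_closed[OF idJ that(1), of y] that(2) by (simp add: ring_on_simps)
  have aJ: "a \<in> J"
  proof -
    have "ev (a * p)" if "p \<in> Ppow e" for p
    proof -
      have "a * p = 2 * (t ^ e * p)" unfolding a_def by (simp only: ac_simps)
      then show ?thesis using ev_2[OF conjunct2[OF Ppow_t[OF that]]] by (simp only:)
    qed
    then show ?thesis unfolding J_def using a_OK by blast
  qed
  have J2: "2 \<in> J" unfolding J_def using Ppow_t ev_2 by auto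
  have eq: "PIdl\<^bsub>?R\<^esub> (of_nat 2) = Ppow e \<cdot>\<^bsub>?R\<^esub> J"
  proof
    show "PIdl\<^bsub>?R\<^esub> (of_nat 2) \<subseteq> Ppow e \<cdot>\<^bsub>?R\<^esub> J"
    proof
      fix y assume "y \<in> PIdl\<^bsub>?R\<^esub> (of_nat 2)"
      then obtain x where x: "y = x * 2" "x \<in> OK" unfolding two by blast
      let ?S = "s ^ e"
      obtain w where w: "w \<in> OK" "1 - ?S * w \<in> P"
        using local_inverse[OF O_pow[OF s_OK] P_pow[OF s_OK s_P]] by blast
      obtain g where g: "g \<in> OK" "(1 - ?S * w) ^ e = 1 - ?S * w * g"
        using one_minus_pow[of "?S * w" e] w(1) s_OK by blast
      have p1: "\<pi> ^ e \<otimes>\<^bsub>?R\<^esub> (a * (w * g * x)) \<in> Ppow e \<cdot>\<^bsub>?R\<^esub> J"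
        by (intro ideal_prod.prod pow_in_Ppow \<pi>_P Jm aJ O_mult w g x)
      have p2: "(1 - ?S * w) ^ e \<otimes>\<^bsub>?R\<^esub> (2 * x) \<in> Ppow e \<cdot>\<^bsub>?R\<^esub> J"
        by (intro ideal_prod.prod pow_in_Ppow Jm J2 w x)
      have "y = \<pi> ^ e * (a * (w * g * x)) + (1 - ?S * w) ^ e * (2 * x)"
      proof -
        have "\<pi> ^ e * (a * (w * g * x)) = 2 * ?S * (w * g * x)" by (simp only: mult.assoc[symmetric] a_\<pi>)
        then show ?thesis unfolding g(2) x(1) by (simp only: left_diff_distrib) (simp add: ac_simps)
      qed
      then show "y \<in> Ppow e \<cdot>\<^bsub>?R\<^esub> J" using ideal_prod.sum[OF p1 p2] by (simp only: ring_on_simps)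
    qed
    show "Ppow e \<cdot>\<^bsub>?R\<^esub> J \<subseteq> PIdl\<^bsub>?R\<^esub> (of_nat 2)"
    proof
      fix y assume "y \<in> Ppow e \<cdot>\<^bsub>?R\<^esub> J"
      then have "ev y"
      proof (induction y rule: ideal_prod.induct)
        case (prod i j)
        then have "ev (j * i)" unfolding J_def by blast
        then show ?case by (simp add: ring_on_simps mult.commute)
      next
        case (sum x y) then show ?case by (simp add: ring_on_simps ev_add)
      qed
      then show "y \<in> PIdl\<^bsub>?R\<^esub> (of_nat 2)" unfolding two ev_def by (intro CollectI exI[of _ "y / 2"]) simp
    qed
  qed
  have "(GREATEST e. \<exists>J. ideal J ?R \<and> PIdl\<^bsub>?R\<^esub> (of_nat 2) = Ppow e \<cdot>\<^bsub>?R\<^esub> J) = e"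
  proof (rule Greatest_equality)
    show "\<exists>J. ideal J ?R \<and> PIdl\<^bsub>?R\<^esub> (of_nat 2) = Ppow e \<cdot>\<^bsub>?R\<^esub> J" using idJ eq by blast
    show "k \<le> e" if k: "\<exists>J. ideal J ?R \<and> PIdl\<^bsub>?R\<^esub> (of_nat 2) = Ppow k \<cdot>\<^bsub>?R\<^esub> J" for k
    proof -
      obtain J' where J': "ideal J' ?R" "PIdl\<^bsub>?R\<^esub> (of_nat 2) = Ppow k \<cdot>\<^bsub>?R\<^esub> J'" using k by blast
      have "2 \<in> PIdl\<^bsub>?R\<^esub> (of_nat 2)" unfolding two by (intro CollectI exI[of _ 1]) simp
      then have "2 \<in> Ppow k \<cdot>\<^bsub>?R\<^esub> J'" using J'(2) by simp
      moreover have "t ^ k * y \<in> OK" if "y \<in> Ppow k \<cdot>\<^bsub>?R\<^esub> J'" for y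
        using that
      proof (induction y rule: ideal_prod.induct)
        case (prod i j)
        have "j \<in> OK" using ideal.Icarr[OF J'(1) prod(2)] by (simp add: ring_on_simps)
        then have "t ^ k * i * j \<in> OK" using Ppow_t[OF prod(1)] by blast
        then show ?case by (simp add: ring_on_simps mult.assoc)
      next
        case (sum x y) then show ?case by (auto simp: ring_on_simps distrib_left)
      qed
      ultimately show ?thesis by (intro above_e)
    qed
  qed
  then show ?thesis unfolding ramification_index_def Let_def .
qed

lemma tame_odd:
  assumes "tamely_ramified K" shows "odd e"
proof -
  have "prime (2::nat)" "of_nat 2 \<in> P" using P_2 by simp_all
  then show ?thesis using assms primeideal_P ramification_index_eq unfolding tamely_ramified_def by metis
qed

end

context quartic
begin

text \<open>The radical of the trace form modulo 2.\<close>

definition even_trace :: "'a \<Rightarrow> bool" where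
  "even_trace x \<longleftrightarrow> x \<in> OK \<and> (\<forall>w\<in>OK. tr (x * w) / 2 \<in> \<int>)"

lemma even_trace_mult: "even_trace x \<Longrightarrow> y \<in> OK \<Longrightarrow> even_trace (x * y)"
  unfolding even_trace_def by (auto simp: mult.assoc)

lemma even_trace_int:
  assumes "even_trace x" "w \<in> OK" "tr (x * w) = of_int n" shows "even n"
proof -
  have "of_int n / 2 \<in> (\<int> :: rat set)" using assms unfolding even_trace_def by metis
  then obtain m where "of_int n / 2 = (of_int m :: rat)" by (auto elim: Ints_cases)
  then have "rat_of_int n = of_int (2 * m)" by simp
  then have "n = 2 * m" by (simp only: of_int_eq_iff)
  then show ?thesis by simp
qed

text \<open>If the trace form vanishes modulo 2 on the ideal of \<open>x\<close>, Newton's identities make the odd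
  coefficients of the characteristic polynomial even.\<close>

lemma even_trace_quartic:
  assumes x: "even_trace x"
  obtains c d where "c \<in> {0, 1}" "d \<in> {0, 1}" "ev (x ^ 4 + c * x ^ 2 + d)"
proof -
  have xO: "x \<in> OK" using x unfolding even_trace_def by blast
  obtain e1 e2 e3 e4 :: int where n: "x ^ 4 - of_int e1 * x ^ 3 + of_int e2 * x ^ 2 - of_int e3 * x + of_int e4 = 0"
    "tr x = of_int e1" "tr (x ^ 3) = of_int (e1 ^ 3 - 3 * e1 * e2 + 3 * e3)"
    using newton[OF xO] by metis
  have "even e1" using even_trace_int[OF x O_01(2), of e1] n(2) by simp
  then obtain m1 where m1: "e1 = 2 * m1" by (elim evenE)
  have "even (e1 ^ 3 - 3 * e1 * e2 + 3 * e3)"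
  proof (rule even_trace_int[OF x O_pow[OF xO, of 2]])
    have "x * x ^ 2 = x ^ 3" by (simp only: power3_eq_cube power2_eq_square mult.assoc)
    then show "tr (x * x ^ 2) = of_int (e1 ^ 3 - 3 * e1 * e2 + 3 * e3)" using n(3) by (simp only:)
  qed
  then have "even e3" using m1 by simp
  then obtain m3 where m3: "e3 = 2 * m3" by (elim evenE)
  define m2 where "m2 = e2 div 2"
  define m4 where "m4 = e4 div 2"
  have e24: "e2 = 2 * m2 + e2 mod 2" "e4 = 2 * m4 + e4 mod 2" unfolding m2_def m4_def by simp_all
  have "x ^ 4 + of_int (e2 mod 2) * x ^ 2 + of_int (e4 mod 2) =
    2 * (of_int m1 * x ^ 3 + of_int m3 * x - of_int m2 * x ^ 2 - of_int m4)"
  proof -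
    have "of_int e2 = 2 * of_int m2 + (of_int (e2 mod 2) :: 'a)" "of_int e4 = 2 * of_int m4 + (of_int (e4 mod 2) :: 'a)"
      by (subst e24(1), simp) (subst e24(2), simp)
    then show ?thesis using n(1) unfolding m1 m3 by (simp add: algebra_simps)
  qed
  moreover have "of_int m1 * x ^ 3 + of_int m3 * x - of_int m2 * x ^ 2 - of_int m4 \<in> OK"
    by (intro O_diff O_add O_mult O_int O_pow xO)
  ultimately have "ev (x ^ 4 + of_int (e2 mod 2) * x ^ 2 + of_int (e4 mod 2))" using ev_2 by metis
  moreover have "of_int (n mod 2) \<in> {0, 1::'a}" for n :: int
    by (cases "even n") (auto simp: odd_iff_mod_2_eq_one)
  ultimately show ?thesis using that by blast
qed

subsection \<open>The norm modulo 2\<close>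

definition norm_mat :: "'a \<Rightarrow> int mat" where "norm_mat x = mat 4 4 (\<lambda>(i,j). coord (x * ib j) i)"
definition nm :: "'a \<Rightarrow> int" where "nm x = det (norm_mat x)"

lemma norm_mat_carrier: "norm_mat x \<in> carrier_mat 4 4" unfolding norm_mat_def by simp

lemma nm_mult:
  assumes x: "x \<in> OK" and y: "y \<in> OK" shows "nm (x * y) = nm x * nm y"
proof -
  have "norm_mat (x * y) = norm_mat x * norm_mat y"
  proof (rule eq_matI)
    fix i j assume "i < dim_row (norm_mat x * norm_mat y)" "j < dim_col (norm_mat x * norm_mat y)"
    then have ij: "i < 4" "j < 4" by (auto simp: norm_mat_def)
    have "rat_of_int (coord (x * y * ib j) i) = tr ((y * ib j) * (x * db i))"
      using coord(1)[of "x * y * ib j" i] x y ij ib_OK[OF ij(2)] by (simp add: O_mult ac_simps)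
    also have "\<dots> = (\<Sum>k<4. tr ((y * ib j) * db k) * tr ((x * db i) * ib k))"
      by (rule parseval[OF db(1), symmetric]) (use x y ij ib_OK db_K in blast)+
    also have "\<dots> = (\<Sum>k<4. of_int (coord (y * ib j) k) * of_int (coord (x * ib k) i))"
    proof (intro sum.cong refl arg_cong2[of _ _ _ _ "(*)"])
      fix k :: nat assume "k \<in> {..<4}"
      then have k: "k < 4" by simp
      show "tr ((y * ib j) * db k) = of_int (coord (y * ib j) k)"
        by (rule coord(1)[OF O_mult[OF y ib_OK[OF ij(2)]] k, symmetric])
      show "tr ((x * db i) * ib k) = of_int (coord (x * ib k) i)"
        using coord(1)[OF O_mult[OF x ib_OK[OF k]] ij(1)] by (simp add: ac_simps)
    qed
    also have "\<dots> = of_int (\<Sum>k<4. coord (x * ib k) i * coord (y * ib j) k)"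
      by (simp add: mult.commute)
    finally have "coord (x * y * ib j) i = (\<Sum>k<4. coord (x * ib k) i * coord (y * ib j) k)"
      by (simp only: of_int_eq_iff)
    then show "norm_mat (x * y) $$ (i,j) = (norm_mat x * norm_mat y) $$ (i,j)"
      using ij by (simp add: norm_mat_def scalar_prod_def atLeast0LessThan)
  qed (auto simp: norm_mat_def)
  then show ?thesis unfolding nm_def by (simp add: det_mult[OF norm_mat_carrier norm_mat_carrier])
qed

lemma coord_ib: "i < 4 \<Longrightarrow> j < 4 \<Longrightarrow> coord (ib j) i = (if j = i then 1 else 0)"
proof -
  assume ij: "i < 4" "j < 4"
  have "rat_of_int (coord (ib j) i) = (if j = i then 1 else 0)"
    using coord(1)[OF ib_OK[OF ij(2)] ij(1)] db(2)[OF ij] by simp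
  then have "rat_of_int (coord (ib j) i) = of_int (if j = i then 1 else 0)" by simp
  then show ?thesis by (simp only: of_int_eq_iff)
qed

lemma coord_double:
  assumes x: "x \<in> OK" and i: "i < 4" shows "coord (2 * x) i = 2 * coord x i"
proof -
  have "tr (of_int 2 * (x * db i)) = of_int 2 * tr (x * db i)" by (rule tr_int_mult) (use x db_K[OF i] in blast)
  then have "rat_of_int (coord (2 * x) i) = of_int (2 * coord x i)"
    using coord(1)[of "2 * x" i] coord(1)[OF x i] x i by (simp add: O_mult mult.assoc)
  then show ?thesis by (simp only: of_int_eq_iff)
qed

lemma coord_diff:
  assumes x: "x \<in> OK" "y \<in> OK" and i: "i < 4" shows "coord (x - y) i = coord x i - coord y i"
proof -
  have "tr (x * db i - y * db i) = tr (x * db i) - tr (y * db i)" by (rule tr_diff) (use x db_K[OF i] in blast)+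
  then have "rat_of_int (coord (x - y) i) = of_int (coord x i - coord y i)"
    using coord(1)[of "x - y" i] coord(1)[OF x(1) i] coord(1)[OF x(2) i] x i by (simp add: O_diff left_diff_distrib)
  then show ?thesis by (simp only: of_int_eq_iff)
qed

lemma nm_2: "nm 2 = 16"
proof -
  have "norm_mat 2 = 2 \<cdot>\<^sub>m 1\<^sub>m 4"
    unfolding norm_mat_def by (intro eq_matI) (auto simp: coord_double ib_OK coord_ib)
  then show ?thesis unfolding nm_def by simp
qed

text \<open>An element congruent to 1 modulo 2 acts by a matrix congruent to the identity.\<close>

lemma nm_odd:
  assumes "ev (1 - x)" "x \<in> OK" shows "odd (nm x)"
proof -
  have o: "(1 - x) / 2 \<in> OK" (is "?o \<in> OK") using assms(1) unfolding ev_def .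
  have two: "(2::bit) = 0" by simp
  have "map_mat of_int (norm_mat x) = (1\<^sub>m 4 :: bit mat)"
  proof (rule eq_matI)
    fix i j assume "i < dim_row (1\<^sub>m 4 :: bit mat)" "j < dim_col (1\<^sub>m 4 :: bit mat)"
    then have ij: "i < 4" "j < 4" by auto
    have oj: "?o * ib j \<in> OK" using o ib_OK[OF ij(2)] by blast
    have "x * ib j = ib j - 2 * (?o * ib j)" by (simp add: field_simps)
    then have "coord (x * ib j) i = (if j = i then 1 else 0) - 2 * coord (?o * ib j) i"
      using coord_diff[OF ib_OK[OF ij(2)] O_mult[OF O_numeral[of "num.Bit0 num.One"] oj] ij(1)] coord_double[OF oj ij(1)] coord_ib[OF ij]
      by (simp only:)
    then have "(of_int (coord (x * ib j) i) :: bit) = (if j = i then 1 else 0)"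
      by (simp add: two)
    then show "map_mat of_int (norm_mat x) $$ (i,j) = (1\<^sub>m 4 :: bit mat) $$ (i,j)"
      using ij by (simp add: norm_mat_def)
  qed (auto simp: norm_mat_def)
  then have "(of_int (nm x) :: bit) = 1"
    unfolding nm_def by (metis of_int_hom.hom_det det_one)
  then show ?thesis by (metis evenE of_int_mult of_int_numeral two mult_zero_left zero_neq_one)
qed

end

context local_prime
begin

text \<open>For odd ramification index the ideal of elements with even traces lies in the prime. Otherwise it
  contains an idempotent \<open>z\<close> modulo 2 projecting to the component at the prime. If \<open>z\<close> is not 1, the quartic relation
  for the multiples of \<open>z\<close> loses its constant term; this excludes ramification index 3 or more and, in the unramified
  case, leaves the residue field with two elements, so that \<open>z\<close> has odd trace. If \<open>z\<close> is 1, the prime is the only one: the norm of 2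
  is the product of an odd number and the ramification index many norms of \<open>\<pi>\<close>, which excludes index 3 or more, and in the unramified
  case every element of the residue field of 16 elements would be 0, 1 or a root of \<open>w ^ 2 + w + 1\<close>.\<close>

lemma odd_ramification:
  assumes odd: "odd e" and u: "even_trace u" shows "u \<in> P"
proof (rule ccontr)
  assume uP: "u \<notin> P"
  have uO: "u \<in> OK" using u unfolding even_trace_def by blast
  have uaP: "u * a \<notin> P" by (rule P_prod[OF uO a_OK uP a_not_P])
  obtain k where k: "k > 0" "ev ((u * a) ^ k * (u * a) ^ k - (u * a) ^ k)"
    using power_idempotent[OF O_mult[OF uO a_OK]] by blast
  define z where "z = (u * a) ^ k"
  define z' where "z' = (u * a) ^ (k - 1) * u"
  have z'O: "z' \<in> OK" unfolding z'_def using uO a_OK by blast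
  have zz': "z = z' * a" unfolding z_def z'_def using k(1) by (cases k) (auto simp: ac_simps)
  have zO: "z \<in> OK" unfolding zz' using z'O a_OK by blast
  have zP: "z \<notin> P" unfolding z_def by (rule P_pow[OF O_mult[OF uO a_OK] uaP])
  have zz: "ev (z * z - z)" using k(2) unfolding z_def .
  have zI: "even_trace z"
  proof -
    have "z = u * ((u * a) ^ (k - 1) * a)" unfolding zz' z'_def by (simp only: ac_simps)
    then show ?thesis using even_trace_mult[OF u, of "(u * a) ^ (k - 1) * a"] uO a_OK by auto
  qed
  have zx: "ev (z * x)" if "x \<in> P" "e = 1" for x
  proof -
    have "z * x = 2 * (z' * (t * x))" unfolding zz' a_def \<open>e = 1\<close> by simp
    then show ?thesis using ev_2[OF O_mult[OF z'O t_P[OF that(1)]]] by (simp only:)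
  qed
  have e3: "e = 1 \<or> e \<ge> 3" using odd by (cases e rule: nat.exhaust) presburger+
  show False
  proof (cases "ev (1 - z)")
    case False
    \<comment> \<open>The constant term of the quartic relation is annihilated by \<open>1 - z\<close>, hence it vanishes.\<close>
    have B: "\<exists>c\<in>{0, 1}. ev (z * (w ^ 4 + c * w ^ 2))" if w: "w \<in> OK" for w
    proof -
      obtain c d where cd: "c \<in> {0, 1}" "d \<in> {0, 1}" "ev ((z * w) ^ 4 + c * (z * w) ^ 2 + d)"
        using even_trace_quartic[OF even_trace_mult[OF zI w]] by blast
      have cO: "c \<in> OK" "d \<in> OK" using cd by auto
      define A where "A = w ^ 4 + c * w ^ 2"
      have AO: "A \<in> OK" unfolding A_def using w cO by blast
      define M where "M = (z * z + z + 1) * w ^ 4 + c * w ^ 2"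
      have MO: "M \<in> OK" unfolding M_def using w cO zO by (intro O_add O_mult O_pow) auto
      have "(z * w) ^ 4 + c * (z * w) ^ 2 + d = (z * z - z) * M + (z * A + d)"
        unfolding M_def A_def by (simp add: power4_eq_xxxx power2_eq_square algebra_simps)
      then have "ev ((z * z - z) * M + (z * A + d) - (z * z - z) * M)"
        using cd(3) ev_mult[OF zz MO] by (metis ev_diff)
      then have zA: "ev (z * A + d)" by simp
      have "d = 0"
      proof (rule ccontr)
        assume "d \<noteq> 0"
        then have d1: "d = 1" using cd(2) by simp
        have "ev ((z * A + d) * (1 - z))" using zA zO by (intro ev_mult) auto
        then have "ev ((z * A + d) * (1 - z) + (z * z - z) * A)" using ev_mult[OF zz AO] by (rule ev_add)
        moreover have "(z * A + d) * (1 - z) + (z * z - z) * A = 1 - z" unfolding d1 by (simp add: algebra_simps)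
        ultimately show False using False by simp
      qed
      then show ?thesis using zA cd(1) unfolding A_def by auto
    qed
    show False
    proof (cases "e = 1")
      case False
      then have e3: "e \<ge> 3" using e3 by simp
      define w where "w = 1 + \<pi>"
      have wO: "w \<in> OK" unfolding w_def using \<pi>_OK by blast
      have wP: "w \<notin> P" unfolding w_def using P_diff[of "1 + \<pi>" \<pi>] \<pi>_P P_1 by auto
      obtain c where c: "c \<in> {0, 1}" "ev (z * (w ^ 4 + c * w ^ 2))" using B[OF wO] by blast
      show False
      proof (cases "c = 0")
        case True
        then have "z * w ^ 4 \<in> P" using ev_P[OF c(2)] by simp
        then show False using P_prod[OF zO O_pow[OF wO] zP P_pow[OF wO wP]] by blast
      next
        case False
        then have c1: "c = 1" using c(1) by simp
        define M where "M = z * w ^ 2 * (1 + \<pi>)"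
        have MO: "M \<in> OK" unfolding M_def using zO wO \<pi>_OK by blast
        have "z * (w ^ 4 + c * w ^ 2) = \<pi> ^ 2 * (z * w ^ 2) + 2 * M"
          unfolding M_def c1 by (simp add: w_def power4_eq_xxxx power2_eq_square algebra_simps)
        then have "ev (\<pi> ^ 2 * (z * w ^ 2) + 2 * M - 2 * M)"
          using c(2) ev_2[OF MO] by (metis ev_diff)
        then have "e \<le> 2"
          using valuation_bound[of "z * w ^ 2" 2] P_prod[OF zO O_pow[OF wO] zP P_pow[OF wO wP]] zO wO by auto
        then show False using e3 by simp
      qed
    next
      case True
      have two: "w \<in> P \<or> w + 1 \<in> P" if w: "w \<in> OK" for w
      proof (rule ccontr)
        assume "\<not> (w \<in> P \<or> w + 1 \<in> P)"
        then have n: "w \<notin> P" "w + 1 \<notin> P" by auto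
        have w1: "w + 1 \<in> OK" using w by blast
        obtain c where c: "c \<in> {0, 1}" "ev (z * (w ^ 4 + c * w ^ 2))" using B[OF w] by blast
        show False
        proof (cases "c = 0")
          case True
          then have "z * w ^ 4 \<in> P" using ev_P[OF c(2)] by simp
          then show False using P_prod[OF zO O_pow[OF w] zP P_pow[OF w n(1)]] by blast
        next
          case False
          then have c1: "c = 1" using c(1) by simp
          define M where "M = z * w ^ 3"
          have MO: "M \<in> OK" unfolding M_def using zO w by blast
          have "z * (w ^ 4 + c * w ^ 2) + 2 * M = z * w ^ 2 * (w + 1) ^ 2"
            unfolding M_def c1 by (simp add: power4_eq_xxxx power3_eq_cube power2_eq_square algebra_simps)
          then have "ev (z * w ^ 2 * (w + 1) ^ 2)" using ev_add[OF c(2) ev_2[OF MO]] by simp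
          then show False
            using ev_P P_prod[OF O_mult[OF zO O_pow[OF w]] O_pow[OF w1] P_prod[OF zO O_pow[OF w] zP P_pow[OF w n(1)]] P_pow[OF w1 n(2)]]
            by blast
        qed
      qed
      have "\<exists>n::int. \<exists>q\<in>OK. z * ib j = of_int n * z + 2 * q" if j: "j < 4" for j
      proof (cases "ib j \<in> P")
        case True
        then have "ev (z * ib j)" using zx \<open>e = 1\<close> by blast
        then show ?thesis unfolding ev_def by (intro exI[of _ 0] bexI[of _ "z * ib j / 2"]) auto
      next
        case False
        then have "ib j + 1 \<in> P" using two[OF ib_OK[OF j]] by blast
        then have "ev (z * (ib j + 1))" using zx \<open>e = 1\<close> by blast
        then show ?thesis unfolding ev_def by (intro exI[of _ "- 1"] bexI[of _ "z * (ib j + 1) / 2"]) (auto simp: field_simps)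
      qed
      then have "\<forall>j\<in>{..<4}. \<exists>n::int. \<exists>q. q \<in> OK \<and> z * ib j = of_int n * z + 2 * q" by blast
      from bchoice[OF this] obtain n where "\<forall>j\<in>{..<4}. \<exists>q. q \<in> OK \<and> z * ib j = of_int (n j :: int) * z + 2 * q" by blast
      from bchoice[OF this] obtain q where q: "\<And>j. j < 4 \<Longrightarrow> q j \<in> OK" "\<And>j. j < 4 \<Longrightarrow> z * ib j = of_int (n j) * z + 2 * q j"
        by auto
      define X where "X = (\<Sum>j<4. coord z j * n j)"
      define Q where "Q = (\<Sum>j<4. of_int (coord z j) * q j)"
      have QO: "Q \<in> OK" unfolding Q_def by (intro O_sum O_mult O_int q(1)) simp
      have "z * z = (\<Sum>j<4. of_int (coord z j) * (z * ib j))"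
        by (subst (2) coord(2)[OF zO]) (simp only: sum_distrib_left mult.left_commute)
      also have "\<dots> = (\<Sum>j<4. of_int (coord z j * n j) * z + 2 * (of_int (coord z j) * q j))"
        using q(2) by (intro sum.cong refl) (simp add: algebra_simps)
      also have "\<dots> = of_int X * z + 2 * Q"
        unfolding X_def Q_def sum.distrib of_int_sum sum_distrib_right sum_distrib_left ..
      finally have zzX: "z * z = of_int X * z + 2 * Q" .
      have "odd X"
      proof
        assume "even X"
        then obtain Y where Y: "X = 2 * Y" by (elim evenE)
        have "ev (2 * (of_int Y * z + Q) - (z * z - z))" by (rule ev_diff[OF ev_2 zz]) (use QO zO in blast)
        moreover have "2 * (of_int Y * z + Q) - (z * z - z) = z" unfolding zzX Y by (simp add: algebra_simps)
        ultimately have "ev z" by (simp only:)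
        then show False using zP ev_P by blast
      qed
      have "tr z = (\<Sum>j<4. tr (z * ib j * db j))" by (rule tr_frame[OF db(1)]) (use zO in blast)
      also have "\<dots> = (\<Sum>j<4. of_int (n j * coord z j + 2 * coord (q j) j))"
      proof (intro sum.cong refl)
        fix j :: nat assume "j \<in> {..<4}"
        then have j: "j < 4" by simp
        have "z * ib j * db j = of_int (n j) * (z * db j) + of_int 2 * (q j * db j)"
          unfolding q(2)[OF j] by (simp add: algebra_simps)
        moreover have "tr (of_int (n j) * (z * db j) + of_int 2 * (q j * db j)) = tr (of_int (n j) * (z * db j)) + tr (of_int 2 * (q j * db j))"
          using zO q(1)[OF j] db_K[OF j] by (intro tr_add K_mult K_int) auto
        moreover have "tr (of_int (n j) * (z * db j)) = of_int (n j) * tr (z * db j)"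
          using zO db_K[OF j] by (intro tr_int_mult) auto
        moreover have "tr (of_int 2 * (q j * db j)) = of_int 2 * tr (q j * db j)"
          using q(1)[OF j] db_K[OF j] by (intro tr_int_mult) auto
        ultimately show "tr (z * ib j * db j) = of_int (n j * coord z j + 2 * coord (q j) j)"
          using coord(1)[OF zO j] coord(1)[OF q(1)[OF j] j] by simp
      qed
      also have "\<dots> = of_int (X + 2 * (\<Sum>j<4. coord (q j) j))"
        unfolding X_def by (simp add: sum.distrib sum_distrib_left mult.commute)
      finally have "tr (z * 1) = of_int (X + 2 * (\<Sum>j<4. coord (q j) j))" by simp
      then have "even (X + 2 * (\<Sum>j<4. coord (q j) j))" by (rule even_trace_int[OF zI O_01(2)])
      then show False using \<open>odd X\<close> by simp
    qed
  next
    case True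
    have all: "even_trace w" if w: "w \<in> OK" for w
      unfolding even_trace_def
    proof (intro conjI ballI w)
      fix x assume x: "x \<in> OK"
      have o: "(1 - z) / 2 \<in> OK" using True unfolding ev_def .
      have "w * x = z * (w * x) + of_int 2 * ((1 - z) / 2 * (w * x))" by (simp add: field_simps)
      then have "tr (w * x) = tr (z * (w * x)) + tr (of_int 2 * ((1 - z) / 2 * (w * x)))"
        using tr_add[of "z * (w * x)" "of_int 2 * ((1 - z) / 2 * (w * x))"] zO w x o by auto
      also have "tr (of_int 2 * ((1 - z) / 2 * (w * x))) = of_int 2 * tr ((1 - z) / 2 * (w * x))"
        using w x o by (intro tr_int_mult) blast
      finally have "tr (w * x) / 2 = tr (z * (w * x)) / 2 + tr ((1 - z) / 2 * (w * x))" by simp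
      also have "\<dots> \<in> \<int>"
      proof (rule Ints_add)
        show "tr (z * (w * x)) / 2 \<in> \<int>" using zI O_mult[OF w x] unfolding even_trace_def by blast
        show "tr ((1 - z) / 2 * (w * x)) \<in> \<int>" by (rule tr_Ints[OF O_mult[OF o O_mult[OF w x]]])
      qed
      finally show "tr (w * x) / 2 \<in> \<int>" .
    qed
    have red: "ev x" if "ev (z * x)" "x \<in> OK" for x
    proof -
      have "ev (z * x + (1 - z) * x)" by (intro ev_add that(1) ev_mult[OF True that(2)])
      then show ?thesis by (simp add: algebra_simps)
    qed
    show False
    proof (cases "e = 1")
      case True
      have Pev: "ev x" if "x \<in> P" for x using red[OF zx[OF that True] P_OK[OF that]] .
      have three: "w \<in> P \<or> w + 1 \<in> P \<or> w ^ 2 + w + 1 \<in> P" if w: "w \<in> OK" for w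
      proof -
        obtain c d where cd: "c \<in> {0, 1}" "d \<in> {0, 1}" "ev (w ^ 4 + c * w ^ 2 + d)"
          using even_trace_quartic[OF all[OF w]] by blast
        have cO: "c \<in> OK" "d \<in> OK" using cd by auto
        define M where "M = c * w ^ 3 + d * w ^ 2 + c * d * w"
        have MO: "M \<in> OK" unfolding M_def using w cO by (intro O_add O_mult O_pow) auto
        have cc: "c * c = c" "d * d = d" using cd by auto
        have "(w ^ 2 + c * w + d) ^ 2 = w ^ 4 + c * c * w ^ 2 + d * d + 2 * M"
          unfolding M_def power2_eq_square power4_eq_xxxx power3_eq_cube by (simp add: algebra_simps)
        then have "(w ^ 2 + c * w + d) ^ 2 = w ^ 4 + c * w ^ 2 + d + 2 * M" by (simp only: cc)
        then have sq: "(w ^ 2 + c * w + d) ^ 2 \<in> P" using ev_P[OF ev_add[OF cd(3) ev_2[OF MO]]] by (simp only:)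
        have "w ^ 2 + c * w + d \<in> OK" by (intro O_add O_mult O_pow w cO)
        then have f: "w ^ 2 + c * w + d \<in> P" using sq by (rule P_pow_in)
        have f1: "w + 1 \<in> P" if "w ^ 2 + 1 \<in> P"
        proof -
          have "w ^ 2 + 1 + 2 * w \<in> P" using that P_mult[OF P_2 w] by (rule P_add)
          moreover have "w ^ 2 + 1 + 2 * w = (w + 1) ^ 2" by (simp add: power2_eq_square algebra_simps)
          ultimately have sq: "(w + 1) ^ 2 \<in> P" by (simp only:)
          have "w + 1 \<in> OK" using w by blast
          then show ?thesis using sq by (rule P_pow_in)
        qed
        have f2: "w \<in> P \<or> w + 1 \<in> P" if "w ^ 2 + w \<in> P"
        proof (rule P_prime[OF w])
          show "w + 1 \<in> OK" using w by blast
          have "w * (w + 1) = w ^ 2 + w" by (simp add: power2_eq_square distrib_left)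
          then show "w * (w + 1) \<in> P" using that by (simp only:)
        qed
        consider "c = 0" "d = 0" | "c = 0" "d = 1" | "c = 1" "d = 0" | "c = 1" "d = 1" using cd(1,2) by blast
        then show ?thesis
        proof cases
          case 1 then show ?thesis using f P_pow_in[OF w, of 2] by simp
        next
          case 2 then show ?thesis using f f1 by simp
        next
          case 3
          then have "w \<in> P \<or> w + 1 \<in> P" using f by (intro f2) simp
          then show ?thesis by blast
        next
          case 4 then show ?thesis using f by simp
        qed
      qed
      have nib: "ib i \<notin> P" if "i < 4" for i using ev_coord[OF Pev that] coord_ib[OF that that] by fastforce
      have nij: "ib i - ib j \<notin> P" if "i < 4" "j < 4" "i \<noteq> j" for i j
        using ev_coord[OF Pev that(1)] coord_diff[OF ib_OK[OF that(1)] ib_OK[OF that(2)] that(1)]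
          coord_ib[OF that(1,1)] coord_ib[OF that(1,2)] that(3) by fastforce
      define c1 where "c1 i \<longleftrightarrow> ib i + 1 \<in> P" for i
      define c2 where "c2 i \<longleftrightarrow> (ib i) ^ 2 + ib i + 1 \<in> P" for i
      have D: "c1 i \<or> c2 i" if "i < 4" for i
        using three[OF ib_OK[OF that]] nib[OF that] unfolding c1_def c2_def by blast
      have A: "\<not> (c1 i \<and> c1 j)" if "i < 4" "j < 4" "i \<noteq> j" for i j
        using nij[OF that] P_diff[of "ib i + 1" "ib j + 1"] unfolding c1_def by auto
      have S: "ib i + ib j + 1 \<in> P" if ij: "i < 4" "j < 4" "i \<noteq> j" and "c2 i" "c2 j" for i j
      proof -
        have "((ib i) ^ 2 + ib i + 1) - ((ib j) ^ 2 + ib j + 1) \<in> P" using that(4,5) unfolding c2_def by (rule P_diff)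
        moreover have "((ib i) ^ 2 + ib i + 1) - ((ib j) ^ 2 + ib j + 1) = (ib i - ib j) * (ib i + ib j + 1)"
          by (simp add: power2_eq_square algebra_simps)
        ultimately have "(ib i - ib j) * (ib i + ib j + 1) \<in> P" by simp
        then show ?thesis using P_prime[of "ib i - ib j" "ib i + ib j + 1"] nij[OF ij] ib_OK[OF ij(1)] ib_OK[OF ij(2)] by auto
      qed
      have C: "\<not> (c2 i \<and> c2 j \<and> c2 k)" if "i < 4" "j < 4" "k < 4" "i \<noteq> j" "i \<noteq> k" "j \<noteq> k" for i j k
      proof
        assume "c2 i \<and> c2 j \<and> c2 k"
        then have "(ib i + ib j + 1) - (ib i + ib k + 1) \<in> P" using S that by (intro P_diff) auto
        then show False using nij[OF that(2,3,6)] by simp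
      qed
      show False using D[of 0] D[of 1] D[of 2] D[of 3] A[of 0 1] A[of 0 2] A[of 0 3] A[of 1 2] A[of 1 3] A[of 2 3]
          C[of 0 1 2] C[of 0 1 3] C[of 0 2 3] C[of 1 2 3] by auto
    next
      case False
      then have e3: "e \<ge> 3" using e3 by simp
      have nodd: "odd (nm x)" if x: "x \<in> OK" "x \<notin> P" for x
      proof -
        obtain w where w: "w \<in> OK" "1 - x * w \<in> P" using local_inverse[OF x] by blast
        obtain g where g: "g \<in> OK" "(1 - x * w) ^ e = 1 - x * w * g" using one_minus_pow[of "x * w" e] w(1) x(1) by blast
        have "z * (1 - x * w) ^ e = 2 * (z' * (t ^ e * (1 - x * w) ^ e))" unfolding zz' a_def by (simp only: ac_simps)
        moreover have "t ^ e * (1 - x * w) ^ e \<in> OK" using Ppow_t[OF pow_in_Ppow[OF w(2)]] by blast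
        ultimately have evz: "ev (z * (1 - x * w) ^ e)" using ev_2[OF O_mult[OF z'O]] by (simp only:)
        have "(1 - x * w) ^ e \<in> OK" using w x by blast
        then have "ev ((1 - x * w) ^ e)" by (rule red[OF evz])
        then have "ev (1 - x * (w * g))" unfolding g(2) by (simp only: mult.assoc)
        moreover have wg: "w * g \<in> OK" using w(1) g(1) by blast
        ultimately have "odd (nm (x * (w * g)))" using O_mult[OF x(1)] by (intro nm_odd)
        then show ?thesis using nm_mult[OF x(1) wg] by simp
      qed
      have npow: "nm (x ^ k) = nm x ^ k" if "x \<in> OK" for x k
      proof (induction k)
        case 0
        have "norm_mat 1 = 1\<^sub>m 4" unfolding norm_mat_def by (intro eq_matI) (auto simp: coord_ib)
        then show ?case unfolding nm_def by simp
      next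
        case (Suc k) then show ?case using nm_mult[OF that O_pow[OF that], of k] by simp
      qed
      define \<nu> where "\<nu> = nm \<pi>"
      have eqn: "\<nu> ^ e * nm a = 16 * nm (s ^ e)"
        using nm_mult[OF O_pow[OF \<pi>_OK] a_OK, of e] nm_mult[OF O_numeral[of "num.Bit0 num.One"] O_pow[OF s_OK], of e]
        by (simp only: a_\<pi> \<nu>_def nm_2 npow[OF \<pi>_OK])
      have oa: "odd (nm a)" by (rule nodd[OF a_OK a_not_P])
      have os: "odd (nm (s ^ e))" by (rule nodd[OF O_pow[OF s_OK] P_pow[OF s_OK s_P]])
      define X Y where "X = nm (s ^ e)" and "Y = nm a"
      have eqn: "\<nu> ^ e * Y = 16 * X" and oa: "odd Y" and os: "odd X" using eqn oa os unfolding X_def Y_def .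
      have "even (\<nu> ^ e * Y)" unfolding eqn by simp
      then have "even \<nu>" using oa by simp
      then obtain \<mu> where \<mu>: "\<nu> = 2 * \<mu>" by (elim evenE)
      have eqn2: "2 ^ e * (\<mu> ^ e * Y) = 16 * X" using eqn unfolding \<mu> by (simp add: power_mult_distrib)
      show False
      proof (cases "e = 3")
        case True
        have h: "\<mu> ^ 3 * Y = 2 * X" using eqn2 unfolding True by (simp add: mult.commute)
        then have "even (\<mu> ^ 3 * Y)" by simp
        then have "even \<mu>" using oa by simp
        then obtain m where "\<mu> = 2 * m" by (elim evenE)
        then have "X = 2 * (2 * m ^ 3 * Y)" using h by (simp add: power_mult_distrib ac_simps)
        then show False using os by simp
      next
        case False
        then have "e \<ge> 5" using e3 odd by presburger
        then obtain l where l: "e = 5 + l" using le_Suc_ex by blast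
        have "16 * (2 * (2 ^ l * (\<mu> ^ e * Y))) = 16 * X" unfolding eqn2[symmetric] by (simp add: l power_add ac_simps)
        then have "X = 2 * (2 ^ l * (\<mu> ^ e * Y))" by (simp add: ac_simps)
        then show False using os by simp
      qed
    qed
  qed
qed

end

context quartic
begin

lemma tame_even_trace_nilpotent:
  assumes tame: "tamely_ramified K" and u: "even_trace u"
  shows "\<exists>N. ev (u ^ N)"
proof (rule ccontr)
  assume "\<not> (\<exists>N. ev (u ^ N))"
  moreover have "u \<in> OK" using u unfolding even_trace_def by blast
  ultimately obtain P t \<pi> where "local_prime K P t \<pi>" "u \<notin> P" using exists_local_prime[of u] by blast
  then show False
    using local_prime.odd_ramification[OF _ local_prime.tame_odd[OF _ tame] u] by blast
qed

lemma tame_odd_trace: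
  assumes tame: "tamely_ramified K" shows "\<not> even_trace 1"
  using tame_even_trace_nilpotent[OF tame, of 1] not_ev_1 by auto

text \<open>The second coefficient of the characteristic polynomial of \<open>u\<close> is congruent modulo 2 to that
  of its square, hence even for elements nilpotent modulo 2.\<close>

lemma tame_trace_square:
  assumes tame: "tamely_ramified K" and u: "even_trace u" and tr0: "tr u = 0"
  shows "tr (u * u) / 4 \<in> \<int>"
proof -
  define E where "E x = (tr x ^ 2 - tr (x ^ 2)) / 2" for x
  have uO: "u \<in> OK" using u unfolding even_trace_def by blast
  have step: "\<exists>k l. E x = of_int k \<and> E (x ^ 2) = of_int l \<and> (even k \<longleftrightarrow> even l)" if x: "even_trace x" for x
  proof -
    have xO: "x \<in> OK" using x unfolding even_trace_def by blast
    obtain e1 e2 e3 e4 :: int where n: "x ^ 4 - of_int e1 * x ^ 3 + of_int e2 * x ^ 2 - of_int e3 * x + of_int e4 = 0"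
      "tr x = of_int e1" "tr (x ^ 2) = of_int (e1 ^ 2 - 2 * e2)" "tr (x ^ 3) = of_int (e1 ^ 3 - 3 * e1 * e2 + 3 * e3)"
      using newton[OF xO] by metis
    have x4: "x ^ 4 = of_int e1 * x ^ 3 - of_int e2 * x ^ 2 + of_int e3 * x - of_int e4 * 1" using n(1) by (simp add: algebra_simps)
    have xK: "x \<in> K" using xO by blast
    have k: "of_int e1 * x ^ 3 \<in> K" "of_int e2 * x ^ 2 \<in> K" "of_int e3 * x \<in> K" "of_int e4 * 1 \<in> K" using xK by auto
    have "tr (x ^ 4) = tr (of_int e1 * x ^ 3) - tr (of_int e2 * x ^ 2) + tr (of_int e3 * x) - tr (of_int e4 * 1)"
      unfolding x4 using tr_diff[OF K_add[OF K_diff[OF k(1,2)] k(3)] k(4)] tr_add[OF K_diff[OF k(1,2)] k(3)] tr_diff[OF k(1,2)] by (simp only:)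
    also have "\<dots> = of_int e1 * tr (x ^ 3) - of_int e2 * tr (x ^ 2) + of_int e3 * tr x - of_int e4 * tr 1"
      using tr_int_mult[OF K_pow[OF xK]] tr_int_mult[OF xK] tr_int_mult[OF K_1] by (simp only:)
    finally have t4: "tr (x ^ 4) = of_int (e1 * (e1 ^ 3 - 3 * e1 * e2 + 3 * e3) - e2 * (e1 ^ 2 - 2 * e2) + e3 * e1 - 4 * e4)"
      unfolding n tr_1 quartic by simp
    have x22: "(x ^ 2) ^ 2 = x ^ 4" by simp
    have E1: "E x = of_int e2" unfolding E_def n(2,3) by simp
    have E2: "E (x ^ 2) = of_int (e2 ^ 2 - 2 * e1 * e3 + 2 * e4)"
    proof -
      have "2 * E (x ^ 2) = of_int ((e1 ^ 2 - 2 * e2) ^ 2 - (e1 * (e1 ^ 3 - 3 * e1 * e2 + 3 * e3) - e2 * (e1 ^ 2 - 2 * e2) + e3 * e1 - 4 * e4))"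
        unfolding E_def x22 t4 n(3) by simp
      also have "(e1 ^ 2 - 2 * e2) ^ 2 - (e1 * (e1 ^ 3 - 3 * e1 * e2 + 3 * e3) - e2 * (e1 ^ 2 - 2 * e2) + e3 * e1 - 4 * e4) =
          2 * (e2 ^ 2 - 2 * e1 * e3 + 2 * e4)"
        by (simp add: power2_eq_square power3_eq_cube algebra_simps)
      finally show ?thesis by simp
    qed
    show ?thesis using E1 E2 by (intro exI[of _ e2] exI[of _ "e2 ^ 2 - 2 * e1 * e3 + 2 * e4"]) simp
  qed
  have pw: "even_trace (u ^ (2 ^ i))" for i
  proof (induction i)
    case (Suc i)
    have "u ^ 2 ^ Suc i = u ^ 2 ^ i * u ^ 2 ^ i" by (simp add: power_add[symmetric] mult_2)
    then show ?case using even_trace_mult[OF Suc, of "u ^ 2 ^ i"] uO by auto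
  qed (use u in simp)
  have all: "\<exists>k l. E u = of_int k \<and> E (u ^ (2 ^ i)) = of_int l \<and> (even k \<longleftrightarrow> even l)" for i
  proof (induction i)
    case 0 then show ?case using step[OF u] by auto
  next
    case (Suc i)
    obtain k l where kl: "E u = of_int k" "E (u ^ (2 ^ i)) = of_int l" "even k \<longleftrightarrow> even l" using Suc by blast
    obtain k' l' where kl': "E (u ^ (2 ^ i)) = of_int k'" "E ((u ^ (2 ^ i)) ^ 2) = of_int l'" "even k' \<longleftrightarrow> even l'" using step[OF pw] by blast
    have "k' = l" using kl(2) kl'(1) by simp
    moreover have "(u ^ (2 ^ i)) ^ 2 = u ^ (2 ^ Suc i)" by (simp add: power_mult[symmetric] mult.commute)
    ultimately show ?case using kl kl' by metis
  qed
  obtain N where N: "ev (u ^ N)" using tame_even_trace_nilpotent[OF tame u] by blast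
  have "N \<le> 2 ^ N" using less_exp[of N] by simp
  then have "u ^ (2 ^ N) = u ^ N * u ^ (2 ^ N - N)" by (simp add: power_add[symmetric])
  then have "ev (u ^ (2 ^ N))" using ev_mult[OF N O_pow[OF uO]] by simp
  then have o: "u ^ (2 ^ N) / 2 \<in> OK" (is "?o \<in> OK") unfolding ev_def .
  have v: "u ^ (2 ^ N) = of_int 2 * ?o" by simp
  have sq: "(u ^ (2 ^ N)) ^ 2 = of_int 4 * ?o ^ 2" by (simp add: power2_eq_square)
  obtain f1 f2 where f: "tr ?o = of_int f1" "tr (?o ^ 2) = of_int (f1 ^ 2 - 2 * f2)" using newton[OF o] by metis
  have "tr (u ^ (2 ^ N)) = 2 * of_int f1" using tr_int_mult[of ?o 2] o f(1) v by auto
  moreover have "tr ((u ^ (2 ^ N)) ^ 2) = 4 * of_int (f1 ^ 2 - 2 * f2)"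
    unfolding sq f(2)[symmetric] using tr_int_mult[OF K_pow[OF O_K[OF o]], of 4 2] by simp
  ultimately have "E (u ^ (2 ^ N)) = of_int (4 * f2)" unfolding E_def by (simp add: power2_eq_square)
  then obtain k where k: "E u = of_int k" "even k" using all[of N] by (metis even_mult_iff even_numeral of_int_eq_iff)
  then obtain m where "k = 2 * m" by (elim evenE)
  then have "tr (u * u) / 4 = of_int (- m)" using k(1) tr0 unfolding E_def by (simp add: power2_eq_square field_simps)
  then show ?thesis by (metis Ints_of_int)
qed

end

section \<open>Isometries of trace forms\<close>

definition trace_isometry :: "'a::field_char_0 set \<Rightarrow> 'b::field_char_0 set \<Rightarrow> ('a \<Rightarrow> 'b) \<Rightarrow> bool" where
  "trace_isometry K L \<Phi> \<longleftrightarrow> (\<forall>x\<in>K. \<Phi> x \<in> L) \<and> (\<forall>x\<in>K. \<forall>y\<in>K. \<Phi> (x + y) = \<Phi> x + \<Phi> y) \<and>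
     (\<forall>q. \<forall>x\<in>K. \<Phi> (of_rat q * x) = of_rat q * \<Phi> x) \<and> \<Phi> 1 = 1 \<and>
     (\<forall>x\<in>K. \<forall>y\<in>K. field_trace L (\<Phi> x * \<Phi> y) = field_trace K (x * y)) \<and> (\<forall>y\<in>L. \<exists>x\<in>K. \<Phi> x = y)"

locale lattice_isometry = K: quartic K + L: numfield L for K :: "'a::field_char_0 set" and L :: "'b::field_char_0 set" +
  fixes \<phi> :: "'a \<Rightarrow> 'b"
  assumes bij: "bij_betw \<phi> (trace_zero_integers K) (trace_zero_integers L)"
    and additive: "x \<in> trace_zero_integers K \<Longrightarrow> y \<in> trace_zero_integers K \<Longrightarrow> \<phi> (x + y) = \<phi> x + \<phi> y"
    and form: "x \<in> trace_zero_integers K \<Longrightarrow> y \<in> trace_zero_integers K \<Longrightarrow> field_trace L (\<phi> x * \<phi> y) = field_trace K (x * y)"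
begin

lemma zero_iff: "x \<in> trace_zero_integers K \<longleftrightarrow> x \<in> integers_of K \<and> K.tr x = 0"
  "y \<in> trace_zero_integers L \<longleftrightarrow> y \<in> integers_of L \<and> L.tr y = 0"
  unfolding trace_zero_integers_def by auto

lemma \<phi>_in: "x \<in> trace_zero_integers K \<Longrightarrow> \<phi> x \<in> trace_zero_integers L"
  using bij by (auto simp: bij_betw_def)

lemma \<phi>_surj: "y \<in> trace_zero_integers L \<Longrightarrow> \<exists>x\<in>trace_zero_integers K. \<phi> x = y"
  using bij unfolding bij_betw_def by (metis imageE)

lemma zero_mult: "x \<in> trace_zero_integers K \<Longrightarrow> of_int n * x \<in> trace_zero_integers K"
  unfolding zero_iff using K.tr_int_mult[of x n] by auto

lemma \<phi>_0: "\<phi> 0 = 0"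
proof -
  have "0 \<in> trace_zero_integers K" unfolding zero_iff using K.tr_0 by simp
  then show ?thesis using additive[of 0 0] by simp
qed

lemma \<phi>_int:
  assumes x: "x \<in> trace_zero_integers K" shows "\<phi> (of_int n * x) = of_int n * \<phi> x"
proof -
  have nat: "\<phi> (of_nat k * x) = of_nat k * \<phi> x" for k
  proof (induction k)
    case (Suc k)
    have "\<phi> (of_nat k * x + x) = \<phi> (of_nat k * x) + \<phi> x" using zero_mult[OF x, of "int k"] x by (intro additive) simp_all
    then show ?case using Suc by (simp add: distrib_right add.commute)
  qed (simp add: \<phi>_0)
  have \<phi>_neg: "\<phi> (- y) = - \<phi> y" if y: "y \<in> trace_zero_integers K" for y
  proof -
    have "\<phi> (- y + y) = \<phi> (- y) + \<phi> y" using zero_mult[OF y, of "- 1"] y by (intro additive) simp_all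
    then show ?thesis by (simp add: \<phi>_0 eq_neg_iff_add_eq_0)
  qed
  show ?thesis
  proof (cases n rule: int_cases)
    case (nonneg k) then show ?thesis using nat by simp
  next
    case (neg k)
    have e: "of_int n * v = - (of_nat (Suc k) * v)" for v :: "'c::field_char_0"
      unfolding neg by (simp add: algebra_simps)
    have "\<phi> (- (of_nat (Suc k) * x)) = - \<phi> (of_nat (Suc k) * x)"
      using zero_mult[OF x, of "int (Suc k)"] by (intro \<phi>_neg) simp
    then show ?thesis unfolding e nat .
  qed
qed

lemma common_multiple:
  assumes "x \<in> K" "K.tr x = 0" "y \<in> K" "K.tr y = 0"
  shows "\<exists>N::int. N > 0 \<and> of_int N * x \<in> trace_zero_integers K \<and> of_int N * y \<in> trace_zero_integers K"
proof -
  obtain M N :: int where MN: "M > 0" "of_int M * x \<in> K.OK" "N > 0" "of_int N * y \<in> K.OK"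
    using K.integer_multiple assms(1,3) by metis
  have "of_int N * (of_int M * x) \<in> K.OK" "of_int M * (of_int N * y) \<in> K.OK" using MN by blast+
  then have "of_int (M * N) * x \<in> trace_zero_integers K" "of_int (M * N) * y \<in> trace_zero_integers K"
    unfolding zero_iff using K.tr_int_mult[of x "M * N"] K.tr_int_mult[of y "M * N"] assms by (simp_all add: ac_simps)
  then show ?thesis using MN by (intro exI[of _ "M * N"]) simp
qed

text \<open>Rational extension of \<open>\<phi>\<close> to the elements of trace zero, independent of the multiple chosen.\<close>

definition \<phi>0 :: "'a \<Rightarrow> 'b" where
  "\<phi>0 x = (let N = (SOME N::int. N > 0 \<and> of_int N * x \<in> trace_zero_integers K) in \<phi> (of_int N * x) / of_int N)"

lemma \<phi>0:
  assumes M: "M > 0" "of_int M * x \<in> trace_zero_integers K" shows "of_int M * \<phi>0 x = \<phi> (of_int M * x)"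
proof -
  define N where "N = (SOME N::int. N > 0 \<and> of_int N * x \<in> trace_zero_integers K)"
  have N: "N > 0" "of_int N * x \<in> trace_zero_integers K"
    using someI[of "\<lambda>N::int. N > 0 \<and> of_int N * x \<in> trace_zero_integers K" M] M unfolding N_def by auto
  have "of_int N * \<phi> (of_int M * x) = of_int M * \<phi> (of_int N * x)"
    unfolding \<phi>_int[OF M(2), symmetric] \<phi>_int[OF N(2), symmetric] by (simp only: ac_simps)
  then show ?thesis unfolding \<phi>0_def Let_def N_def[symmetric] using N(1) by (simp add: field_simps)
qed

lemma \<phi>0_eq: "x \<in> trace_zero_integers K \<Longrightarrow> \<phi>0 x = \<phi> x" using \<phi>0[of 1 x] by simp

lemma \<phi>0_L: assumes "x \<in> K" "K.tr x = 0" shows "\<phi>0 x \<in> L" "L.tr (\<phi>0 x) = 0"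
proof -
  obtain N :: int where N: "N > 0" "of_int N * x \<in> trace_zero_integers K" using common_multiple[OF assms assms] by blast
  have "\<phi> (of_int N * x) \<in> L" "L.tr (\<phi> (of_int N * x)) = 0" using \<phi>_in[OF N(2)] unfolding zero_iff by auto
  then have 1: "of_int N * \<phi>0 x \<in> L" "L.tr (of_int N * \<phi>0 x) = 0" unfolding \<phi>0[OF N] .
  have eq: "\<phi>0 x = of_rat (1 / of_int N) * (of_int N * \<phi>0 x)" using N(1) by (simp add: of_rat_divide)
  show "\<phi>0 x \<in> L" by (subst eq) (rule L.K_scale[OF 1(1)])
  show "L.tr (\<phi>0 x) = 0" by (subst eq) (simp only: L.tr_scale[OF 1(1)] 1(2) mult_zero_right)
qed

lemma \<phi>0_add:
  assumes "x \<in> K" "K.tr x = 0" "y \<in> K" "K.tr y = 0" shows "\<phi>0 (x + y) = \<phi>0 x + \<phi>0 y"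
proof -
  obtain N :: int where N: "N > 0" "of_int N * x \<in> trace_zero_integers K" "of_int N * y \<in> trace_zero_integers K"
    using common_multiple[OF assms] by blast
  have eq: "of_int N * (x + y) = of_int N * x + of_int N * y" by (simp only: distrib_left)
  have "of_int N * (x + y) \<in> trace_zero_integers K"
    using N(2,3) K.tr_add[of "of_int N * x" "of_int N * y"] unfolding eq zero_iff by auto
  then have "of_int N * \<phi>0 (x + y) = of_int N * (\<phi>0 x + \<phi>0 y)"
    using \<phi>0[OF N(1)] N(2,3) additive[OF N(2,3)] by (simp only: distrib_left)
  then show ?thesis using N(1) by simp
qed

lemma \<phi>0_scale:
  assumes "x \<in> K" "K.tr x = 0" shows "\<phi>0 (of_rat q * x) = of_rat q * \<phi>0 x"
proof -
  have q: "of_rat q * x \<in> K" "K.tr (of_rat q * x) = 0" using assms K.tr_scale[of x q] by auto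
  obtain N :: int where N: "N > 0" "of_int N * x \<in> trace_zero_integers K" "of_int N * (of_rat q * x) \<in> trace_zero_integers K"
    using common_multiple[OF assms q] by blast
  obtain a b where ab: "q = of_int a / of_int b" "b > 0" by (metis quotient_of_div quotient_of_denom_pos surj_pair)
  have qa: "of_int b * of_rat q = (of_int a :: 'c::field_char_0)" unfolding ab(1) using ab(2) by (simp add: of_rat_divide)
  have "of_int b * (of_int N * (of_rat q * x)) = of_int a * (of_int N * x)"
    unfolding qa[symmetric] by (simp only: ac_simps)
  then have "of_int b * \<phi> (of_int N * (of_rat q * x)) = of_int a * \<phi> (of_int N * x)"
    using \<phi>_int[OF N(2), of a] \<phi>_int[OF N(3), of b] by (simp only:)
  then have "of_int b * (of_int N * \<phi>0 (of_rat q * x)) = of_int b * (of_int N * (of_rat q * \<phi>0 x))"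
    unfolding \<phi>0[OF N(1,2), symmetric] \<phi>0[OF N(1,3), symmetric] qa[symmetric] by (simp only: ac_simps)
  then show ?thesis using N(1) ab(2) by simp
qed

lemma \<phi>0_form:
  assumes "x \<in> K" "K.tr x = 0" "y \<in> K" "K.tr y = 0" shows "L.tr (\<phi>0 x * \<phi>0 y) = K.tr (x * y)"
proof -
  obtain N :: int where N: "N > 0" "of_int N * x \<in> trace_zero_integers K" "of_int N * y \<in> trace_zero_integers K"
    using common_multiple[OF assms] by blast
  have "of_int (N * N) * (\<phi>0 x * \<phi>0 y) = \<phi> (of_int N * x) * \<phi> (of_int N * y)"
    unfolding \<phi>0[OF N(1,2), symmetric] \<phi>0[OF N(1,3), symmetric] by (simp add: ac_simps)
  then have "of_int (N * N) * L.tr (\<phi>0 x * \<phi>0 y) = K.tr ((of_int N * x) * (of_int N * y))"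
    using L.tr_int_mult[OF L.K_mult[OF \<phi>0_L(1)[OF assms(1,2)] \<phi>0_L(1)[OF assms(3,4)]], of "N * N"] form[OF N(2,3)] by simp
  also have "(of_int N * x) * (of_int N * y) = of_int (N * N) * (x * y)" by (simp add: ac_simps)
  also have "K.tr \<dots> = of_int (N * N) * K.tr (x * y)" by (rule K.tr_int_mult) (use assms in blast)
  finally show ?thesis using N(1) by simp
qed

lemma \<phi>0_surj:
  assumes y: "y \<in> L" "L.tr y = 0" shows "\<exists>x\<in>K. K.tr x = 0 \<and> \<phi>0 x = y"
proof -
  obtain N :: int where N: "N > 0" "of_int N * y \<in> L.OK" using L.integer_multiple[OF y(1)] by blast
  then have "of_int N * y \<in> trace_zero_integers L" unfolding zero_iff using y L.tr_int_mult[of y N] by simp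
  then obtain z where z: "z \<in> trace_zero_integers K" "\<phi> z = of_int N * y" using \<phi>_surj by blast
  have zK: "z \<in> K" "K.tr z = 0" using z(1) unfolding zero_iff by auto
  define x where "x = of_rat (1 / of_int N) * z"
  have Nx: "of_int N * x = z" unfolding x_def using N(1) by (simp add: of_rat_divide)
  have "of_int N * \<phi>0 x = of_int N * y" using \<phi>0[OF N(1), of x] z unfolding Nx by simp
  then have "\<phi>0 x = y" using N(1) by simp
  moreover have "x \<in> K" "K.tr x = 0" unfolding x_def using zK K.tr_scale[of z] by auto
  ultimately show ?thesis by blast
qed

definition n :: rat where "n = of_nat (card L.B)"

lemma n: "n > 0" "L.tr (of_rat q) = q * n"
proof -
  have "L.B \<noteq> {}"
  proof
    assume "L.B = {}"
    then have "L = {0}" using L.B(3) by simp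
    then show False using L.K_1 by simp
  qed
  then show "n > 0" unfolding n_def using L.B(1) by (simp add: card_gt_0_iff)
  show "L.tr (of_rat q) = q * n" unfolding n_def by (rule L.tr_rat)
qed

lemma splitL:
  assumes x: "x \<in> L"
  obtains z where "z \<in> K" "K.tr z = 0" "x = of_rat (L.tr x / n) + \<phi>0 z"
proof -
  have "x - of_rat (L.tr x / n) \<in> L" "L.tr (x - of_rat (L.tr x / n)) = 0"
    using x L.tr_diff[OF x L.K_rat] n by auto
  then obtain z where "z \<in> K" "K.tr z = 0" "\<phi>0 z = x - of_rat (L.tr x / n)" using \<phi>0_surj by blast
  then show ?thesis using that[of z] by simp
qed

lemma tr_split:
  assumes "z \<in> L" "L.tr z = 0" "w \<in> L" "L.tr w = 0"
  shows "L.tr ((of_rat p + z) * (of_rat q + w)) = p * q * n + L.tr (z * w)"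
proof -
  have "(of_rat p + z) * (of_rat q + w) = of_rat (p * q) + (of_rat p * w + of_rat q * z) + z * w"
    by (simp add: algebra_simps of_rat_mult)
  moreover have "L.tr (of_rat (p * q) + (of_rat p * w + of_rat q * z) + z * w) = L.tr (of_rat (p * q)) + (L.tr (of_rat p * w) + L.tr (of_rat q * z)) + L.tr (z * w)"
    using assms by (simp add: L.tr_add L.K_add L.K_mult L.K_scale)
  ultimately show ?thesis using assms n(2)[of "p * q"] by (simp add: L.tr_scale)
qed

lemma posfield_L: "posfield L"
proof (unfold_locales)
  fix x assume x: "x \<in> L" "x \<noteq> 0"
  obtain z where z: "z \<in> K" "K.tr z = 0" "x = of_rat (L.tr x / n) + \<phi>0 z" using splitL[OF x(1)] by blast
  note zL = \<phi>0_L[OF z(1,2)]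
  have "L.tr (x * x) = L.tr ((of_rat (L.tr x / n) + \<phi>0 z) * (of_rat (L.tr x / n) + \<phi>0 z))"
    using z(3) by simp
  also have "\<dots> = L.tr x / n * (L.tr x / n) * n + L.tr (\<phi>0 z * \<phi>0 z)"
    by (rule tr_split[OF zL zL])
  also have "\<dots> = L.tr x / n * (L.tr x / n) * n + K.tr (z * z)" unfolding \<phi>0_form[OF z(1,2,1,2)] ..
  finally have eq: "L.tr (x * x) = (L.tr x / n)\<^sup>2 * n + K.tr (z * z)" by (simp only: power2_eq_square)
  show "0 < L.tr (x * x)"
  proof (cases "z = 0")
    case True
    have "\<phi>0 0 = 0" using \<phi>0_eq[of 0] \<phi>_0 K.tr_0 unfolding zero_iff by simp
    then have "L.tr x / n \<noteq> 0" using z(3) x(2) True by auto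
    then show ?thesis unfolding eq using n(1) True K.tr_0 by simp
  next
    case False
    then have "K.tr (z * z) > 0" using K.pos z(1) by blast
    moreover have "(L.tr x / n)\<^sup>2 * n \<ge> 0" using n(1) by simp
    ultimately show ?thesis unfolding eq by linarith
  qed
qed

definition \<Phi> :: "'a \<Rightarrow> 'b" where "\<Phi> x = of_rat (K.tr x / 4) + \<phi>0 (x - of_rat (K.tr x / 4))"

lemma tr_K_rat: "K.tr (of_rat q) = q * 4" using K.tr_rat K.quartic by simp

lemma part: "x \<in> K \<Longrightarrow> x - of_rat (K.tr x / 4) \<in> K \<and> K.tr (x - of_rat (K.tr x / 4)) = 0"
  using K.tr_diff[of x "of_rat (K.tr x / 4)"] tr_K_rat by auto

lemma \<phi>0_part_form:
  assumes "x \<in> K" "y \<in> K"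
  shows "L.tr (\<phi>0 (x - of_rat (K.tr x / 4)) * \<phi>0 (y - of_rat (K.tr y / 4))) = K.tr (x * y) - K.tr x * K.tr y / 4"
proof -
  define p q where "p = K.tr x / 4" and "q = K.tr y / 4"
  have "(x - of_rat p) * (y - of_rat q) = x * y - of_rat p * y - of_rat q * x + of_rat (p * q)"
    by (simp add: algebra_simps of_rat_mult)
  moreover have "K.tr (x * y - of_rat p * y - of_rat q * x + of_rat (p * q)) = K.tr (x * y) - p * K.tr y - q * K.tr x + p * q * 4"
    using assms tr_K_rat[of "p * q"] by (simp add: K.tr_add K.tr_diff K.tr_scale K.K_add K.K_diff K.K_mult K.K_scale)
  ultimately have "K.tr ((x - of_rat p) * (y - of_rat q)) = K.tr (x * y) - p * K.tr y - q * K.tr x + p * q * 4" by (simp only:)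
  moreover have "L.tr (\<phi>0 (x - of_rat p) * \<phi>0 (y - of_rat q)) = K.tr ((x - of_rat p) * (y - of_rat q))"
    unfolding p_def q_def using part[OF assms(1)] part[OF assms(2)] by (intro \<phi>0_form) blast+
  ultimately show ?thesis unfolding p_def q_def by (simp add: field_simps)
qed

text \<open>The degree is the trace of 1, and the trace of an element is the contraction of multiplication
  by it along any frame. A frame of \<open>L\<close> is obtained from one of \<open>K\<close> by projecting to trace zero and adding 1.\<close>

lemma n_4: "n = 4"
proof -
  interpret L': posfield L by (rule posfield_L)
  obtain C where C: "K.frame C (\<lambda>c. c) (\<lambda>c. of_rat (1 / K.tr (c * c)) * c)" using K.orthogonal_basis .
  define d where "d c = of_rat (1 / K.tr (c * c)) * c" for c
  have F: "K.frame C (\<lambda>c. c) d" using C unfolding d_def .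
  note f = K.frameD[OF F]
  define p where "p x = x - of_rat (K.tr x / 4)" for x
  have pK: "x \<in> K \<Longrightarrow> p x \<in> K" "x \<in> K \<Longrightarrow> K.tr (p x) = 0" for x using part unfolding p_def by blast+
  have sumf: "\<phi>0 (\<Sum>c\<in>A. of_rat (q c) * p c) = (\<Sum>c\<in>A. of_rat (q c) * \<phi>0 (p c))" if "A \<subseteq> C" for A q
    using finite_subset[OF that f(1)] that
  proof (induction A rule: finite_induct)
    case empty then show ?case using \<phi>0_eq[of 0] \<phi>_0 K.tr_0 unfolding zero_iff by simp
  next
    case (insert a A)
    have K: "c \<in> K" if "c \<in> insert a A" for c using that insert.prems f(2) by blast
    have 1: "of_rat (q a) * p a \<in> K" "K.tr (of_rat (q a) * p a) = 0" using pK[OF K, of a] K.tr_scale[of "p a"] by auto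
    have 2: "(\<Sum>c\<in>A. of_rat (q c) * p c) \<in> K" using pK(1)[OF K] by auto
    have 3: "K.tr (\<Sum>c\<in>A. of_rat (q c) * p c) = 0"
    proof -
      have "K.tr (\<Sum>c\<in>A. of_rat (q c) * p c) = (\<Sum>c\<in>A. K.tr (of_rat (q c) * p c))"
        by (rule K.tr_sum) (use pK(1)[OF K] in auto)
      also have "\<dots> = 0" by (rule sum.neutral) (use pK[OF K] in \<open>simp add: K.tr_scale\<close>)
      finally show ?thesis .
    qed
    show ?case using insert \<phi>0_add[OF 1 2 3] \<phi>0_scale[OF pK[OF K], of a "q a"] by simp
  qed
  have "L'.frame (insert None (Some ` C)) (\<lambda>i. case i of None \<Rightarrow> 1 | Some c \<Rightarrow> \<phi>0 (p c))
      (\<lambda>i. case i of None \<Rightarrow> of_rat (1 / n) | Some c \<Rightarrow> \<phi>0 (p (d c)))" (is "L'.frame ?I ?b ?d")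
    unfolding L'.frame_def
  proof (intro conjI ballI)
    show "finite ?I" using f(1) by simp
    show "?b i \<in> L" "?d i \<in> L" if "i \<in> ?I" for i using that \<phi>0_L(1)[OF pK] f(2,3) by auto
    fix x assume x: "x \<in> L"
    obtain z where z: "z \<in> K" "K.tr z = 0" "x = of_rat (L.tr x / n) + \<phi>0 z" using splitL[OF x] by blast
    have pz: "p z = z" unfolding p_def z(2) by simp
    have t: "L.tr (x * \<phi>0 (p (d c))) = K.tr (z * d c)" if c: "c \<in> C" for c
    proof -
      note dL = \<phi>0_L[OF pK, OF f(3) f(3), OF c c]
      have "L.tr ((of_rat (L.tr x / n) + \<phi>0 z) * (of_rat 0 + \<phi>0 (p (d c)))) = L.tr x / n * 0 * n + L.tr (\<phi>0 z * \<phi>0 (p (d c)))"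
        by (rule tr_split[OF \<phi>0_L[OF z(1,2)] dL])
      then have "L.tr (x * \<phi>0 (p (d c))) = L.tr (\<phi>0 (p z) * \<phi>0 (p (d c)))" using z(3) pz by simp
      also have "\<dots> = K.tr (z * d c)" using \<phi>0_part_form[OF z(1) f(3)[OF c]] z(2) unfolding p_def by simp
      finally show ?thesis .
    qed
    have pl: "p z = (\<Sum>c\<in>C. of_rat (K.tr (z * d c)) * p c)"
    proof -
      have "(\<Sum>c\<in>C. of_rat (K.tr (z * d c)) * p c) =
          (\<Sum>c\<in>C. of_rat (K.tr (z * d c)) * c) - (\<Sum>c\<in>C. of_rat (K.tr (z * d c) * (K.tr c / 4)))"
        unfolding p_def by (simp only: right_diff_distrib sum_subtractf of_rat_mult)
      also have "(\<Sum>c\<in>C. of_rat (K.tr (z * d c) * (K.tr c / 4))) = of_rat ((\<Sum>c\<in>C. K.tr (z * d c) * K.tr (1 * c)) / 4)"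
        by (simp only: of_rat_sum sum_divide_distrib times_divide_eq_right mult_1)
      also have "(\<Sum>c\<in>C. K.tr (z * d c) * K.tr (1 * c)) = K.tr (z * 1)" by (rule K.parseval[OF F z(1) K.K_1])
      finally show ?thesis using f(4)[OF z(1)] z(2) pz by simp
    qed
    have "(\<Sum>i\<in>?I. of_rat (L.tr (x * ?d i)) * ?b i) = of_rat (L.tr (x * of_rat (1 / n))) + (\<Sum>c\<in>C. of_rat (K.tr (z * d c)) * \<phi>0 (p c))"
      using f(1) t by (simp add: sum.reindex)
    also have "L.tr (x * of_rat (1 / n)) = L.tr x / n" using L.tr_scale[OF x, of "1 / n"] by (simp add: mult.commute)
    also have "(\<Sum>c\<in>C. of_rat (K.tr (z * d c)) * \<phi>0 (p c)) = \<phi>0 z"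
      using sumf[of C "\<lambda>c. K.tr (z * d c)"] pl pz by simp
    finally show "x = (\<Sum>i\<in>?I. of_rat (L.tr (x * ?d i)) * ?b i)" using z(3) by simp
  qed
  then have "L.tr 1 = (\<Sum>i\<in>?I. L.tr (1 * ?b i * ?d i))" using L.K_1 by (rule L'.tr_frame)
  also have "\<dots> = L.tr (of_rat (1 / n)) + (\<Sum>c\<in>C. L.tr (\<phi>0 (p c) * \<phi>0 (p (d c))))"
    using f(1) by (simp add: sum.reindex)
  also have "(\<Sum>c\<in>C. L.tr (\<phi>0 (p c) * \<phi>0 (p (d c)))) = (\<Sum>c\<in>C. K.tr (1 * c * d c) - K.tr (1 * d c) * K.tr (1 * c) / 4)"
    unfolding p_def by (intro sum.cong refl) (simp add: \<phi>0_part_form f(2,3) mult.commute)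
  also have "\<dots> = (\<Sum>c\<in>C. K.tr (1 * c * d c)) - (\<Sum>c\<in>C. K.tr (1 * d c) * K.tr (1 * c)) / 4"
    by (simp only: sum_subtractf sum_divide_distrib)
  also have "\<dots> = K.tr 1 - K.tr (1 * 1) / 4"
    unfolding K.tr_frame[OF F K.K_1, symmetric] K.parseval[OF F K.K_1 K.K_1] ..
  also have "L.tr (of_rat (1 / n)) = 1" using n by simp
  finally show ?thesis using n(2)[of 1] tr_K_rat[of 1] by simp
qed

lemma quartic_L: "quartic L"
proof -
  interpret L': posfield L by (rule posfield_L)
  show ?thesis using n_4 unfolding n_def by unfold_locales simp
qed

lemma trace_isometry_\<Phi>: "trace_isometry K L \<Phi>" "\<Phi> ` trace_zero_integers K = trace_zero_integers L"
proof -
  have \<phi>00: "\<phi>0 0 = 0" using \<phi>0_eq[of 0] \<phi>_0 K.tr_0 unfolding zero_iff by simp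
  show "trace_isometry K L \<Phi>" unfolding trace_isometry_def
  proof (intro conjI ballI allI)
    show "\<Phi> x \<in> L" if "x \<in> K" for x unfolding \<Phi>_def using \<phi>0_L part[OF that] by blast
    show "\<Phi> 1 = 1" unfolding \<Phi>_def using tr_K_rat[of 1] \<phi>00 by simp
    fix x assume x: "x \<in> K"
    show "\<Phi> (of_rat q * x) = of_rat q * \<Phi> x" for q
    proof -
      have "of_rat q * x - of_rat (K.tr (of_rat q * x) / 4) = of_rat q * (x - of_rat (K.tr x / 4))"
        unfolding K.tr_scale[OF x] by (simp only: right_diff_distrib of_rat_mult times_divide_eq_right[symmetric])
      then show ?thesis unfolding \<Phi>_def using \<phi>0_scale[of "x - of_rat (K.tr x / 4)" q] part[OF x] K.tr_scale[OF x, of q]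
        by (simp add: distrib_left of_rat_mult[symmetric])
    qed
    fix y assume y: "y \<in> K"
    have eq: "x + y - of_rat (K.tr (x + y) / 4) = (x - of_rat (K.tr x / 4)) + (y - of_rat (K.tr y / 4))"
      unfolding K.tr_add[OF x y] add_divide_distrib of_rat_add by simp
    have "\<phi>0 (x + y - of_rat (K.tr (x + y) / 4)) = \<phi>0 (x - of_rat (K.tr x / 4)) + \<phi>0 (y - of_rat (K.tr y / 4))"
      unfolding eq using part[OF x] part[OF y] by (intro \<phi>0_add) blast+
    then show "\<Phi> (x + y) = \<Phi> x + \<Phi> y" unfolding \<Phi>_def K.tr_add[OF x y] add_divide_distrib of_rat_add by simp
    have "L.tr (\<Phi> x * \<Phi> y) = K.tr x / 4 * (K.tr y / 4) * n + L.tr (\<phi>0 (x - of_rat (K.tr x / 4)) * \<phi>0 (y - of_rat (K.tr y / 4)))"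
      unfolding \<Phi>_def using part[OF x] part[OF y] by (intro tr_split \<phi>0_L) blast+
    then show "L.tr (\<Phi> x * \<Phi> y) = K.tr (x * y)" unfolding \<phi>0_part_form[OF x y] n_4 by simp
  next
    fix y assume y: "y \<in> L"
    obtain z where z: "z \<in> K" "K.tr z = 0" "y = of_rat (L.tr y / n) + \<phi>0 z" using splitL[OF y] by blast
    define x where "x = of_rat (L.tr y / n) + z"
    have "K.tr x = L.tr y" unfolding x_def using K.tr_add[OF K.K_rat z(1)] tr_K_rat z(2) n_4 by simp
    then have "\<Phi> x = y" unfolding \<Phi>_def using z(3) n_4 by (simp add: x_def)
    moreover have "x \<in> K" unfolding x_def using z by blast
    ultimately show "\<exists>x\<in>K. \<Phi> x = y" by blast
  qed
  have "\<Phi> x = \<phi> x" if "x \<in> trace_zero_integers K" for x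
    using that \<phi>0_eq[OF that] unfolding \<Phi>_def zero_iff by simp
  then show "\<Phi> ` trace_zero_integers K = trace_zero_integers L"
    using bij unfolding bij_betw_def by (metis image_cong)
qed

end

lemma (in quartic) discriminant_int_gram:
  assumes b: "spans 4 b" shows "field_discriminant K = det (int_gram 4 b)"
proof -
  have "rat_of_int (field_discriminant K) = det (gram 4 b)" using discriminant_gram[unfolded quartic, OF b] .
  also have "\<dots> = of_int (det (int_gram 4 b))" by (rule int_gram(3)) (rule spansD(1)[OF b])
  finally show ?thesis by simp
qed

locale isometric_quartics = K: quartic K + L: quartic L for K :: "'a::field_char_0 set" and L :: "'b::field_char_0 set" +
  fixes \<Phi> :: "'a \<Rightarrow> 'b"
  assumes iso: "trace_isometry K L \<Phi>"
begin

lemma \<Phi>_L: "x \<in> K \<Longrightarrow> \<Phi> x \<in> L" and \<Phi>_add: "x \<in> K \<Longrightarrow> y \<in> K \<Longrightarrow> \<Phi> (x + y) = \<Phi> x + \<Phi> y"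
  and \<Phi>_scale: "x \<in> K \<Longrightarrow> \<Phi> (of_rat q * x) = of_rat q * \<Phi> x" and \<Phi>_1: "\<Phi> 1 = 1"
  and \<Phi>_form: "x \<in> K \<Longrightarrow> y \<in> K \<Longrightarrow> L.tr (\<Phi> x * \<Phi> y) = K.tr (x * y)"
  and \<Phi>_surj: "v \<in> L \<Longrightarrow> \<exists>x\<in>K. \<Phi> x = v"
  using iso unfolding trace_isometry_def by simp_all

lemma \<Phi>_int: "x \<in> K \<Longrightarrow> \<Phi> (of_int k * x) = of_int k * \<Phi> x" using \<Phi>_scale[of x "of_int k"] by simp
lemma \<Phi>_0: "\<Phi> 0 = 0" using \<Phi>_int[OF K.K_0, of 0] by simp
lemma \<Phi>_diff: "x \<in> K \<Longrightarrow> y \<in> K \<Longrightarrow> \<Phi> (x - y) = \<Phi> x - \<Phi> y"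
  using \<Phi>_add[of x "of_int (- 1) * y"] \<Phi>_int[of y "- 1"] K.K_minus[of y] by simp
lemma \<Phi>_sum: "(\<And>i. i \<in> A \<Longrightarrow> f i \<in> K) \<Longrightarrow> \<Phi> (sum f A) = (\<Sum>i\<in>A. \<Phi> (f i))"
  by (induction A rule: infinite_finite_induct) (auto simp: \<Phi>_0 \<Phi>_add K.K_sum)
lemma \<Phi>_tr: "x \<in> K \<Longrightarrow> L.tr (\<Phi> x) = K.tr x" using \<Phi>_form[of x 1] \<Phi>_1 by simp

lemma frame_image:
  assumes F: "K.frame I b d" shows "L.frame I (\<lambda>i. \<Phi> (b i)) (\<lambda>i. \<Phi> (d i))"
  unfolding L.frame_def
proof (intro conjI ballI)
  note f = K.frameD[OF F]
  show "finite I" by (rule f(1))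
  show "\<Phi> (b i) \<in> L" "\<Phi> (d i) \<in> L" if "i \<in> I" for i using f(2,3) that \<Phi>_L by blast+
  fix y assume "y \<in> L"
  then obtain x where x: "x \<in> K" "\<Phi> x = y" using \<Phi>_surj by blast
  have "\<Phi> x = \<Phi> (\<Sum>i\<in>I. of_rat (K.tr (x * d i)) * b i)" using f(4)[OF x(1)] by simp
  also have "\<dots> = (\<Sum>i\<in>I. \<Phi> (of_rat (K.tr (x * d i)) * b i))" by (rule \<Phi>_sum) (use f in auto)
  also have "\<dots> = (\<Sum>i\<in>I. of_rat (L.tr (y * \<Phi> (d i))) * \<Phi> (b i))"
    using f(2,3) x by (intro sum.cong refl) (auto simp: \<Phi>_scale \<Phi>_form)
  finally show "y = (\<Sum>i\<in>I. of_rat (L.tr (y * \<Phi> (d i))) * \<Phi> (b i))" using x(2) by simp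
qed

abbreviation tr3 :: "'a \<Rightarrow> 'a \<Rightarrow> 'a \<Rightarrow> rat" where "tr3 x y z \<equiv> K.tr (x * y * z)"

definition T' :: "'a \<Rightarrow> 'a \<Rightarrow> 'a \<Rightarrow> rat" where "T' x y z = L.tr (\<Phi> x * \<Phi> y * \<Phi> z)"

lemma T'_sym: "T' x y z = T' y x z" "T' x y z = T' x z y" unfolding T'_def by (simp_all only: ac_simps)

lemma rational_linear_\<Phi>:
  assumes w: "w \<in> L" shows "K.rational_linear (\<lambda>x. L.tr (\<Phi> x * w))"
  unfolding K.rational_linear_def
proof (intro conjI ballI allI)
  fix u v assume "u \<in> K" "v \<in> K"
  then show "L.tr (\<Phi> (u + v) * w) = L.tr (\<Phi> u * w) + L.tr (\<Phi> v * w)"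
    using w by (simp add: \<Phi>_add distrib_right L.tr_add \<Phi>_L L.K_mult)
next
  fix q u assume u: "u \<in> K"
  have "L.tr (of_rat q * (\<Phi> u * w)) = q * L.tr (\<Phi> u * w)" by (rule L.tr_scale[OF L.K_mult[OF \<Phi>_L[OF u] w]])
  then show "L.tr (\<Phi> (of_rat q * u) * w) = of_rat q * L.tr (\<Phi> u * w)" using \<Phi>_scale[OF u] by (simp add: mult.assoc)
qed

lemma trilinear_T': "K.trilinear T'"
proof -
  have "K.rational_linear (T' x y)" "K.rational_linear (\<lambda>z. T' x z y)" "K.rational_linear (\<lambda>z. T' z x y)"
    if "x \<in> K" "y \<in> K" for x y
  proof -
    have "T' x y = (\<lambda>z. L.tr (\<Phi> z * (\<Phi> x * \<Phi> y)))" "(\<lambda>z. T' x z y) = (\<lambda>z. L.tr (\<Phi> z * (\<Phi> x * \<Phi> y)))"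
      "(\<lambda>z. T' z x y) = (\<lambda>z. L.tr (\<Phi> z * (\<Phi> x * \<Phi> y)))" unfolding T'_def by (simp_all only: ac_simps)
    then show "K.rational_linear (T' x y)" "K.rational_linear (\<lambda>z. T' x z y)" "K.rational_linear (\<lambda>z. T' z x y)"
      using rational_linear_\<Phi>[OF L.K_mult[OF \<Phi>_L[OF that(1)] \<Phi>_L[OF that(2)]]] by simp_all
  qed
  then show ?thesis unfolding K.trilinear_def by blast
qed

lemma tr1: "K.tr 1 = 4" "L.tr 1 = 4" using K.tr_1 K.quartic L.tr_1 L.quartic by simp_all

lemma pairing_T'_T':
  assumes F: "K.frame I b d" shows "K.pairing I b d T' T' = 4"
  using L.pairing_tr_tr[OF frame_image[OF F]] tr1 unfolding K.pairing_def L.pairing_def T'_def by simp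

text \<open>Divisibility by \<open>D\<close> is inherited because the product of two images of integers is again the image of an integer.\<close>

lemma trace_like_T':
  assumes O: "\<Phi> ` integers_of K = integers_of L" shows "K.trace_like T'"
  unfolding K.trace_like_def
proof (intro conjI allI ballI impI)
  have OK: "\<Phi> x \<in> L.OK" if "x \<in> K.OK" for x using O that by blast
  show "K.trilinear T'" by (rule trilinear_T')
  show "T' x y z = T' y x z" "T' x y z = T' x z y" for x y z by (fact T'_sym)+
  show "T' x y z \<in> \<int>" if "x \<in> K.OK" "y \<in> K.OK" "z \<in> K.OK" for x y z
    unfolding T'_def using that by (intro L.tr_Ints L.O_mult OK)
  show "(T' x x x - K.tr x) / 3 \<in> \<int>" if x: "x \<in> K.OK" for x
    using L.tr_cube_mod_3[OF OK[OF x]] \<Phi>_tr[OF K.O_K[OF x]] unfolding T'_def by simp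
  show "T' z x y / of_int D \<in> \<int>" if z: "z \<in> K.OK" and Dz: "\<forall>w\<in>K.OK. K.tr (z * w) / of_int D \<in> \<int>" and xy: "x \<in> K.OK" "y \<in> K.OK" for z x y D
  proof -
    have "\<Phi> x * \<Phi> y \<in> \<Phi> ` integers_of K" unfolding O using xy by (intro L.O_mult OK)
    then obtain w where w: "\<Phi> x * \<Phi> y = \<Phi> w" "w \<in> K.OK" by blast
    have "T' z x y = K.tr (z * w)" unfolding T'_def mult.assoc w(1) using z w(2) by (intro \<Phi>_form) blast+
    then show ?thesis using Dz w(2) by simp
  qed
  show "(\<Sum>i<n. T' x (b i) (d i)) = K.tr x" if x: "x \<in> K" and F: "K.frame {..<n} b d" for x n b d
    using L.tr_frame[OF frame_image[OF F] \<Phi>_L[OF x]] \<Phi>_tr[OF x] unfolding T'_def by simp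
qed

text \<open>The extension of the negative of the isometry of trace zero lattices by \<open>1 \<mapsto> 1\<close>.\<close>

definition \<Psi> :: "'a \<Rightarrow> 'b" where "\<Psi> x = of_rat (K.tr x / 2) - \<Phi> x"

lemma tr_K_rat: "K.tr (of_rat q) = q * 4" and tr_L_rat: "L.tr (of_rat q) = q * 4"
  using K.tr_rat K.quartic L.tr_rat L.quartic by simp_all

lemma trace_isometry_\<Psi>: "trace_isometry K L \<Psi>"
  unfolding trace_isometry_def
proof (intro conjI ballI allI)
  show "\<Psi> x \<in> L" if "x \<in> K" for x unfolding \<Psi>_def using \<Phi>_L[OF that] by blast
  show "\<Psi> 1 = 1" unfolding \<Psi>_def tr1 \<Phi>_1 by simp
  fix x assume x: "x \<in> K"
  show "\<Psi> (of_rat q * x) = of_rat q * \<Psi> x" for q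
    unfolding \<Psi>_def K.tr_scale[OF x] \<Phi>_scale[OF x] times_divide_eq_right[symmetric] of_rat_mult right_diff_distrib ..
  fix y assume y: "y \<in> K"
  show "\<Psi> (x + y) = \<Psi> x + \<Psi> y"
    unfolding \<Psi>_def K.tr_add[OF x y] \<Phi>_add[OF x y] add_divide_distrib of_rat_add by simp
  define p q where "p = K.tr x / 2" and "q = K.tr y / 2"
  have "(of_rat p - \<Phi> x) * (of_rat q - \<Phi> y) = of_rat (p * q) - of_rat p * \<Phi> y - of_rat q * \<Phi> x + \<Phi> x * \<Phi> y"
    by (simp add: of_rat_mult algebra_simps)
  moreover have "L.tr (of_rat (p * q) - of_rat p * \<Phi> y - of_rat q * \<Phi> x + \<Phi> x * \<Phi> y) =
      L.tr (of_rat (p * q)) - p * L.tr (\<Phi> y) - q * L.tr (\<Phi> x) + L.tr (\<Phi> x * \<Phi> y)"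
    using \<Phi>_L[OF x] \<Phi>_L[OF y] by (simp add: L.tr_add L.tr_diff L.tr_scale L.K_diff L.K_mult L.K_scale)
  ultimately have "L.tr ((of_rat p - \<Phi> x) * (of_rat q - \<Phi> y)) = p * q * 4 - p * K.tr y - q * K.tr x + K.tr (x * y)"
    unfolding tr_L_rat \<Phi>_tr[OF x] \<Phi>_tr[OF y] \<Phi>_form[OF x y] by simp
  then show "L.tr (\<Psi> x * \<Psi> y) = K.tr (x * y)" unfolding \<Psi>_def p_def q_def by simp
next
  fix y assume "y \<in> L"
  then have "of_rat (L.tr y / 2) - y \<in> L" by blast
  then obtain x where x: "x \<in> K" "\<Phi> x = of_rat (L.tr y / 2) - y" using \<Phi>_surj by blast
  have "K.tr x = L.tr (of_rat (L.tr y / 2) - y)" using \<Phi>_tr[OF x(1)] x(2) by simp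
  also have "\<dots> = L.tr y" using L.tr_diff[OF L.K_rat \<open>y \<in> L\<close>, of "L.tr y / 2"] tr_L_rat by simp
  finally have "\<Psi> x = y" unfolding \<Psi>_def x(2) by simp
  then show "\<exists>x\<in>K. \<Psi> x = y" using x(1) by blast
qed

lemma \<Psi>_trace_zero: "K.tr x = 0 \<Longrightarrow> \<Psi> x = - \<Phi> x" unfolding \<Psi>_def by simp

lemma T'_reflected:
  assumes xyz: "x \<in> K" "y \<in> K" "z \<in> K"
  shows "T' x y z + L.tr (\<Psi> x * \<Psi> y * \<Psi> z) = - 1/4 * (K.tr x * K.tr y * K.tr z) +
    1/2 * (K.tr x * K.tr (y * z)) + 1/2 * (K.tr y * K.tr (x * z)) + 1/2 * (K.tr z * K.tr (x * y))"
proof -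
  define p q r where "p = K.tr x / 2" and "q = K.tr y / 2" and "r = K.tr z / 2"
  note X = \<Phi>_L[OF xyz(1)] \<Phi>_L[OF xyz(2)] \<Phi>_L[OF xyz(3)]
  have "(of_rat p - X) * (of_rat q - Y) * (of_rat r - Z) =
      of_rat (p * q * r) - of_rat (p * q) * Z - of_rat (p * r) * Y - of_rat (q * r) * X
      + of_rat p * (Y * Z) + of_rat q * (X * Z) + of_rat r * (X * Y) - X * Y * Z" for X Y Z :: 'b
    by (simp add: of_rat_mult algebra_simps)
  then have "L.tr ((of_rat p - \<Phi> x) * (of_rat q - \<Phi> y) * (of_rat r - \<Phi> z)) =
      L.tr (of_rat (p * q * r) - of_rat (p * q) * \<Phi> z - of_rat (p * r) * \<Phi> y - of_rat (q * r) * \<Phi> x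
      + of_rat p * (\<Phi> y * \<Phi> z) + of_rat q * (\<Phi> x * \<Phi> z) + of_rat r * (\<Phi> x * \<Phi> y) - \<Phi> x * \<Phi> y * \<Phi> z)"
    by (simp only:)
  also have "\<dots> = L.tr (of_rat (p * q * r)) - p * q * L.tr (\<Phi> z) - p * r * L.tr (\<Phi> y) - q * r * L.tr (\<Phi> x)
      + p * L.tr (\<Phi> y * \<Phi> z) + q * L.tr (\<Phi> x * \<Phi> z) + r * L.tr (\<Phi> x * \<Phi> y) - T' x y z"
    unfolding T'_def using X by (simp add: L.tr_add L.tr_diff L.tr_scale L.K_add L.K_diff L.K_mult L.K_scale)
  finally have "L.tr (\<Psi> x * \<Psi> y * \<Psi> z) = p * q * r * 4 - p * q * K.tr z - p * r * K.tr y - q * r * K.tr x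
      + p * K.tr (y * z) + q * K.tr (x * z) + r * K.tr (x * y) - T' x y z"
    unfolding \<Psi>_def p_def[symmetric] q_def[symmetric] r_def[symmetric] tr_L_rat
    using xyz by (simp only: \<Phi>_tr \<Phi>_form)
  then show ?thesis unfolding p_def q_def r_def by (simp add: field_simps)
qed

text \<open>The sum of the two transported forms does not involve \<open>\<Phi>\<close>, so its pairing with the trace form
  is a number that depends on the degree only.\<close>

lemma pairing_reflected:
  assumes F: "K.frame I b d"
  shows "K.pairing I b d tr3 T' + K.pairing I b d tr3 (\<lambda>x y z. L.tr (\<Psi> x * \<Psi> y * \<Psi> z)) = 5"
proof -
  note f = K.frameD(1-3)[OF F]
  let ?t = "\<lambda>i j k. tr3 (b i) (b j) (b k)"
  have c1: "(\<Sum>k\<in>I. K.tr (w * b k) * K.tr (d k)) = K.tr w" if w: "w \<in> K" for w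
    using K.parseval[OF F K.K_1 w] by (simp add: mult.commute)
  have c2: "(\<Sum>k\<in>I. K.tr (w * b k) * K.tr (y * d k)) = K.tr (w * y)" if "w \<in> K" "y \<in> K" for w y
    using K.parseval[OF F that(2,1)] by (simp add: mult.commute)
  have c3: "(\<Sum>j\<in>I. \<Sum>k\<in>I. K.tr (b j * b k) * K.tr (d j * d k)) = 4"
  proof -
    have "(\<Sum>j\<in>I. \<Sum>k\<in>I. K.tr (b j * b k) * K.tr (d j * d k)) = (\<Sum>j\<in>I. K.tr (1 * b j * d j))"
      by (intro sum.cong refl) (simp add: c2 f)
    also have "\<dots> = 4" using K.tr_frame[OF F K.K_1] tr1 by simp
    finally show ?thesis .
  qed
  have A: "(\<Sum>i\<in>I. \<Sum>j\<in>I. \<Sum>k\<in>I. ?t i j k * (K.tr (d i) * K.tr (d j) * K.tr (d k))) = 4"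
  proof -
    have "(\<Sum>i\<in>I. \<Sum>j\<in>I. \<Sum>k\<in>I. ?t i j k * (K.tr (d i) * K.tr (d j) * K.tr (d k))) =
      (\<Sum>i\<in>I. K.tr (d i) * (\<Sum>j\<in>I. K.tr (d j) * (\<Sum>k\<in>I. K.tr (b i * b j * b k) * K.tr (d k))))"
      by (simp only: sum_distrib_left ac_simps)
    also have "\<dots> = (\<Sum>i\<in>I. K.tr (d i) * (\<Sum>j\<in>I. K.tr (d j) * K.tr (b i * b j)))"
      by (intro sum.cong refl arg_cong2[of _ _ _ _ "(*)"] c1) (use f in blast)
    also have "\<dots> = (\<Sum>i\<in>I. K.tr (d i) * (\<Sum>j\<in>I. K.tr (b i * b j) * K.tr (d j)))" by (simp only: mult.commute)
    also have "\<dots> = (\<Sum>i\<in>I. K.tr (d i) * K.tr (b i))"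
      by (intro sum.cong refl arg_cong2[of _ _ _ _ "(*)"] c1) (use f in blast)
    also have "\<dots> = 4" using c1[OF K.K_1] tr1 by (simp add: mult.commute)
    finally show ?thesis .
  qed
  have B3: "(\<Sum>i\<in>I. \<Sum>j\<in>I. \<Sum>k\<in>I. ?t i j k * (K.tr (d k) * K.tr (d i * d j))) = 4"
  proof -
    have "(\<Sum>i\<in>I. \<Sum>j\<in>I. \<Sum>k\<in>I. ?t i j k * (K.tr (d k) * K.tr (d i * d j))) =
      (\<Sum>i\<in>I. \<Sum>j\<in>I. (\<Sum>k\<in>I. K.tr (b i * b j * b k) * K.tr (d k)) * K.tr (d i * d j))"
      by (simp only: sum_distrib_right mult.assoc)
    also have "\<dots> = (\<Sum>i\<in>I. \<Sum>j\<in>I. K.tr (b i * b j) * K.tr (d i * d j))"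
      by (intro sum.cong refl arg_cong2[of _ _ _ _ "(*)"] c1) (use f in blast)
    finally show ?thesis unfolding c3 .
  qed
  have B2: "(\<Sum>i\<in>I. \<Sum>j\<in>I. \<Sum>k\<in>I. ?t i j k * (K.tr (d j) * K.tr (d i * d k))) = 4"
  proof -
    have "(\<Sum>i\<in>I. \<Sum>j\<in>I. \<Sum>k\<in>I. ?t i j k * (K.tr (d j) * K.tr (d i * d k))) =
      (\<Sum>i\<in>I. \<Sum>k\<in>I. \<Sum>j\<in>I. ?t i k j * (K.tr (d j) * K.tr (d i * d k)))"
      by (subst sum.swap) (simp only: ac_simps)
    then show ?thesis using B3 by simp
  qed
  have B1: "(\<Sum>i\<in>I. \<Sum>j\<in>I. \<Sum>k\<in>I. ?t i j k * (K.tr (d i) * K.tr (d j * d k))) = 4"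
  proof -
    have "(\<Sum>i\<in>I. \<Sum>j\<in>I. \<Sum>k\<in>I. ?t i j k * (K.tr (d i) * K.tr (d j * d k))) =
      (\<Sum>j\<in>I. \<Sum>i\<in>I. \<Sum>k\<in>I. ?t j i k * (K.tr (d i) * K.tr (d j * d k)))"
      by (subst sum.swap) (simp only: ac_simps)
    then show ?thesis using B2 by simp
  qed
  have "K.pairing I b d tr3 T' + K.pairing I b d tr3 (\<lambda>x y z. L.tr (\<Psi> x * \<Psi> y * \<Psi> z)) =
    (\<Sum>i\<in>I. \<Sum>j\<in>I. \<Sum>k\<in>I. ?t i j k * (T' (d i) (d j) (d k) + L.tr (\<Psi> (d i) * \<Psi> (d j) * \<Psi> (d k))))"
    unfolding K.pairing_def by (simp only: sum.distrib distrib_left)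
  also have "\<dots> = (\<Sum>i\<in>I. \<Sum>j\<in>I. \<Sum>k\<in>I. - 1/4 * (?t i j k * (K.tr (d i) * K.tr (d j) * K.tr (d k))) +
    1/2 * (?t i j k * (K.tr (d i) * K.tr (d j * d k))) + 1/2 * (?t i j k * (K.tr (d j) * K.tr (d i * d k))) +
    1/2 * (?t i j k * (K.tr (d k) * K.tr (d i * d j))))"
  proof (intro sum.cong refl)
    fix i j k assume "i \<in> I" "j \<in> I" "k \<in> I"
    then have dK: "d i \<in> K" "d j \<in> K" "d k \<in> K" using f by blast+
    show "?t i j k * (T' (d i) (d j) (d k) + L.tr (\<Psi> (d i) * \<Psi> (d j) * \<Psi> (d k))) =
      - 1/4 * (?t i j k * (K.tr (d i) * K.tr (d j) * K.tr (d k))) +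
      1/2 * (?t i j k * (K.tr (d i) * K.tr (d j * d k))) + 1/2 * (?t i j k * (K.tr (d j) * K.tr (d i * d k))) +
      1/2 * (?t i j k * (K.tr (d k) * K.tr (d i * d j)))"
      unfolding T'_reflected[OF dK] by (simp only: distrib_left ac_simps)
  qed
  also have "\<dots> = - 1/4 * 4 + 1/2 * 4 + 1/2 * 4 + 1/2 * 4"
    by (simp only: sum.distrib sum_distrib_left[symmetric] A B1 B2 B3)
  finally show ?thesis by simp
qed

text \<open>Equality of the trilinear forms says that \<open>\<Phi> x * \<Phi> y - \<Phi> (x * y)\<close> is orthogonal to the image, which is \<open>L\<close>.\<close>

lemma multiplicative_iso:
  assumes T: "\<And>x y z. x \<in> K \<Longrightarrow> y \<in> K \<Longrightarrow> z \<in> K \<Longrightarrow> tr3 x y z = T' x y z"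
  shows "ring_on K \<simeq> ring_on L"
proof -
  have mult: "\<Phi> (x * y) = \<Phi> x * \<Phi> y" if xy: "x \<in> K" "y \<in> K" for x y
  proof -
    have "\<Phi> x * \<Phi> y - \<Phi> (x * y) = 0"
    proof (rule L.nondegenerate)
      show "\<Phi> x * \<Phi> y - \<Phi> (x * y) \<in> L" using xy \<Phi>_L by blast
      fix w assume "w \<in> L"
      then obtain z where z: "z \<in> K" "\<Phi> z = w" using \<Phi>_surj by blast
      have "L.tr ((\<Phi> x * \<Phi> y - \<Phi> (x * y)) * \<Phi> z) = T' x y z - L.tr (\<Phi> (x * y) * \<Phi> z)"
        unfolding T'_def left_diff_distrib using xy z(1) by (intro L.tr_diff L.K_mult \<Phi>_L K.K_mult)
      also have "\<dots> = 0" using T[OF xy z(1)] \<Phi>_form[OF K.K_mult[OF xy] z(1)] by simp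
      finally show "L.tr ((\<Phi> x * \<Phi> y - \<Phi> (x * y)) * w) = 0" unfolding z(2) .
    qed
    then show ?thesis by simp
  qed
  have inj: "inj_on \<Phi> K"
  proof (rule inj_onI)
    fix x y assume xy: "x \<in> K" "y \<in> K" "\<Phi> x = \<Phi> y"
    have "K.tr ((x - y) * (x - y)) = L.tr (\<Phi> (x - y) * \<Phi> (x - y))" using xy by (intro \<Phi>_form[symmetric]) blast+
    also have "\<dots> = 0" using \<Phi>_diff[OF xy(1,2)] xy(3) L.tr_0 by simp
    finally show "x = y" using K.pos[of "x - y"] xy by force
  qed
  have "\<Phi> ` K = L" using \<Phi>_surj \<Phi>_L by blast
  then have "\<Phi> \<in> ring_iso (ring_on K) (ring_on L)"
    unfolding ring_iso_def Ring.ring_hom_def bij_betw_def ring_on_def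
    using inj mult \<Phi>_add \<Phi>_1 \<Phi>_L by auto
  then show ?thesis unfolding is_ring_iso_def by blast
qed

text \<open>The pairing of the trace forms is an integer congruent to 1 modulo 3, and it is at most 4 both for
  \<open>\<Phi>\<close> and for its reflection, for which it is replaced by its difference from 5.
  Hence it is 4 or 1, and one of the two isometries is multiplicative.\<close>

theorem isomorphic:
  assumes O: "\<Phi> ` integers_of K = integers_of L" and sf: "squarefree (field_discriminant K)"
  shows "ring_on K \<simeq> ring_on L"
proof -
  interpret R: isometric_quartics K L \<Psi> by unfold_locales (rule trace_isometry_\<Psi>)
  note c4 = K.quartic
  obtain b where b: "K.spans 4 b" using K.exists_spans unfolding c4 by blast
  define D where "D = det (K.int_gram 4 b)"
  have D: "D \<noteq> 0" using K.gram_det_nonzero[unfolded c4, OF b] unfolding D_def .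
  have "squarefree D" using sf unfolding D_def K.discriminant_int_gram[OF b] .
  obtain C where F: "K.frame C (\<lambda>c. c) (\<lambda>c. of_rat (1 / K.tr (c * c)) * c)" using K.orthogonal_basis .
  let ?p = "K.pairing C (\<lambda>c. c) (\<lambda>c. of_rat (1 / K.tr (c * c)) * c)"
  have tt: "?p tr3 tr3 = 4" using K.pairing_tr_tr[OF F] tr1 by simp
  note pint = K.pairing_integral[OF K.trace_like_tr trace_like_T'[OF O] b D_def D \<open>squarefree D\<close> refl F]
  have "?p tr3 T' \<in> \<int>" "(?p tr3 tr3 - ?p tr3 T') / 3 \<in> \<int>" using pint tt by auto
  then obtain S m :: int where S: "?p tr3 T' = of_int S" "(?p tr3 tr3 - ?p tr3 T') / 3 = of_int m"
    by (auto elim!: Ints_cases)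
  have "rat_of_int (4 - S) = of_int (3 * m)" using S tt by simp
  then have Sm: "4 - S = 3 * m" by (simp only: of_int_eq_iff)
  have R: "?p tr3 R.T' = 5 - of_int S" using pairing_reflected[OF F] S(1) unfolding R.T'_def[abs_def] by simp
  note le = K.pairing_le[OF K.trilinear_tr trilinear_T' F tt pairing_T'_T'[OF F]]
  note leR = K.pairing_le[OF K.trilinear_tr R.trilinear_T' F tt R.pairing_T'_T'[OF F]]
  have "rat_of_int S \<le> of_int 4" "rat_of_int 1 \<le> of_int S" using le(1) leR(1) S(1) R by simp_all
  then have "S \<le> 4" "1 \<le> S" by (simp_all only: of_int_le_iff)
  then have "S = 4 \<or> S = 1" using Sm by presburger
  then show ?thesis
  proof
    assume "S = 4"
    then have "?p tr3 T' = 4" using S(1) by simp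
    then show ?thesis using le(2) by (intro multiplicative_iso) blast
  next
    assume "S = 1"
    then have "?p tr3 R.T' = 4" using R by simp
    then show ?thesis using leR(2) by (intro R.multiplicative_iso) blast
  qed
qed

end

section \<open>Elements of trace 1 and the alignment of the rings of integers\<close>

context quartic
begin

lemma tr_1_eq: "tr 1 = 4" using tr_1 quartic by simp
lemma tr_of_int: "tr (of_int k) = 4 * of_int k" using tr_rat[of "of_int k"] quartic by simp
lemma trace_zero_iff: "x \<in> trace_zero_integers K \<longleftrightarrow> x \<in> OK \<and> tr x = 0"
  unfolding trace_zero_integers_def by auto

text \<open>The trace takes the value 4 at 1 and an odd value, so it is onto the integers.\<close>

lemma exists_trace_one:
  assumes "\<not> even_trace 1" shows "\<exists>f\<in>OK. tr f = 1"
proof -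
  obtain w where w: "w \<in> OK" "tr w / 2 \<notin> \<int>" using assms unfolding even_trace_def by auto
  obtain k :: int where k: "tr w = of_int k" using tr_Ints[OF w(1)] by (auto elim: Ints_cases)
  have "odd k"
  proof
    assume "even k"
    then obtain m where "k = 2 * m" by (elim evenE)
    then have "tr w / 2 = of_int m" using k by simp
    then show False using w(2) by simp
  qed
  then consider j where "k = 4 * j + 1" | j where "k = 4 * j - 1"
  proof -
    have "k = 4 * (k div 4) + 1 \<or> k = 4 * (k div 4 + 1) - 1" using \<open>odd k\<close> by presburger
    then show ?thesis using that by blast
  qed
  then show ?thesis
  proof cases
    case 1
    have "tr (w - of_int j) = 1" using tr_diff[OF O_K[OF w(1)] K_int, of j] k 1 tr_of_int by simp
    then show ?thesis using w(1) by (intro bexI[of _ "w - of_int j"]) auto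
  next
    case 2
    have "tr (of_int j - w) = 1" using tr_diff[OF K_int O_K[OF w(1)], of j] k 2 tr_of_int by simp
    then show ?thesis using w(1) by (intro bexI[of _ "of_int j - w"]) auto
  qed
qed

text \<open>Otherwise the Gram matrix is divisible by 2 and the discriminant by 16.\<close>

lemma fundamental_odd_trace:
  assumes D: "fundamental_discriminant (field_discriminant K)" shows "\<not> even_trace 1"
proof
  assume e: "even_trace 1"
  obtain b where b: "spans 4 b" using exists_spans unfolding quartic by blast
  note sb = spansD[OF b]
  let ?G = "int_gram 4 b"
  have G: "?G \<in> carrier_mat 4 4" by (rule int_gram(1)) (rule sb(1))
  define M where "M = mat 4 4 (\<lambda>ij. ?G $$ ij div 2)"
  have "?G = 2 \<cdot>\<^sub>m M"
  proof (rule eq_matI)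
    fix i j assume "i < dim_row (2 \<cdot>\<^sub>m M)" "j < dim_col (2 \<cdot>\<^sub>m M)"
    then have ij: "i < 4" "j < 4" unfolding M_def by auto
    have "tr (1 * (b i * b j)) = of_int (?G $$ (i,j))" using int_gram(4)[OF sb(1) ij] by simp
    then have "even (?G $$ (i,j))" by (rule even_trace_int[OF e O_mult[OF sb(1) sb(1)], OF ij])
    then show "?G $$ (i,j) = (2 \<cdot>\<^sub>m M) $$ (i,j)" using ij unfolding M_def by simp
  qed (use G in \<open>auto simp: M_def\<close>)
  then have "det ?G = det (2 \<cdot>\<^sub>m M)" by (rule arg_cong)
  also have "\<dots> = 2 ^ 4 * det M" by (simp add: M_def)
  finally have 16: "field_discriminant K = 16 * det M" unfolding discriminant_int_gram[OF b] by simp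
  show False using D unfolding fundamental_discriminant_def
  proof
    assume "field_discriminant K mod 4 = 1 \<and> squarefree (field_discriminant K)"
    then have "(16 * det M) mod 4 = 1" unfolding 16 by (rule conjunct1)
    moreover have "(16 * det M) mod 4 = 0" using mod_mult_self1_is_0[of 4 "4 * det M"] by simp
    ultimately show False by simp
  next
    assume "\<exists>m. field_discriminant K = 4 * m \<and> squarefree m \<and> m mod 4 \<in> {2, 3}"
    then obtain m where m: "field_discriminant K = 4 * m" "m mod 4 = 2 \<or> m mod 4 = 3" by blast
    then have "m = 4 * det M" using 16 by simp
    then show False using m(2) by auto
  qed
qed

text \<open>The discriminant annihilates the dual lattice modulo the integers.\<close>

lemma dual_scale:
  assumes z: "z \<in> K" and int: "\<And>x. x \<in> OK \<Longrightarrow> tr (z * x) \<in> \<int>"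
  shows "of_int (field_discriminant K) * z \<in> OK"
proof -
  obtain b where b: "spans 4 b" using exists_spans unfolding quartic by blast
  note sb = spansD[OF b]
  define D where "D = det (int_gram 4 b)"
  have D0: "D \<noteq> 0" using gram_det_nonzero[unfolded quartic, OF b] unfolding D_def .
  define h where "h = (\<lambda>j i. adj_mat (int_gram 4 b) $$ (j,i))"
  from integral_dual_basis[OF b D_def D0 h_def] obtain d where d: "frame {..<4} b d"
    "\<forall>i<4. of_int D * d i = (\<Sum>j<4. of_int (h j i) * b j)" by blast
  have Dd: "of_int D * d i \<in> OK" if "i < 4" for i
    using d(2) that sb(1) by (auto intro!: O_sum O_mult)
  have "z = (\<Sum>i<4. of_rat (tr (z * b i)) * d i)" by (rule frameD(4)[OF frame_swap[OF d(1)] z])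
  then have "of_int D * z = of_int D * (\<Sum>i<4. of_rat (tr (z * b i)) * d i)" by (rule arg_cong)
  also have "\<dots> = (\<Sum>i<4. of_rat (tr (z * b i)) * (of_int D * d i))"
    by (simp only: sum_distrib_left mult.left_commute)
  also have "\<dots> \<in> OK"
  proof (rule O_sum)
    fix i :: nat assume "i \<in> {..<4}"
    then have i: "i < 4" by simp
    obtain n where "tr (z * b i) = of_int n" using int[OF sb(1)[OF i]] by (auto elim: Ints_cases)
    then show "of_rat (tr (z * b i)) * (of_int D * d i) \<in> OK" using O_mult[OF O_int[of n] Dd[OF i]] by simp
  qed
  finally show ?thesis unfolding D_def discriminant_int_gram[OF b] .
qed

lemma trace_zero_part:
  assumes f: "f \<in> OK" "tr f = 1" and x: "x \<in> OK"
  shows "\<exists>t w. x = of_int t * f + w \<and> tr x = of_int t \<and> w \<in> OK \<and> tr w = 0"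
proof -
  obtain t where t: "tr x = of_int t" using tr_Ints[OF x] by (auto elim: Ints_cases)
  have "of_int t * f \<in> OK" using f by blast
  moreover have "tr (x - of_int t * f) = 0"
    using tr_diff[OF O_K[OF x] O_K[OF \<open>of_int t * f \<in> OK\<close>]] tr_int_mult[OF O_K[OF f(1)], of t] t f(2) by simp
  ultimately show ?thesis using t x by (intro exI[of _ t] exI[of _ "x - of_int t * f"]) auto
qed

text \<open>The class of \<open>f\<close> modulo the trace zero lattice is recorded in the lattice itself by \<open>1 - 4 * f\<close>, whose pairings with the
  lattice are divisible by 4.\<close>

lemma distinguished:
  assumes f: "f \<in> OK" "tr f = 1"
  shows "1 - 4 * f \<in> OK" "tr (1 - 4 * f) = 0" "x \<in> K \<Longrightarrow> tr ((1 - 4 * f) * x) = tr x - 4 * tr (f * x)"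
    "tr ((1 - 4 * f) * (1 - 4 * f)) = - 4 + 16 * tr (f * f)" "tr ((1 - 4 * f) * f) = 1 - 4 * tr (f * f)"
proof -
  note fK = O_K[OF f(1)]
  show e: "1 - 4 * f \<in> OK" using f by blast
  show 3: "tr ((1 - 4 * f) * x) = tr x - 4 * tr (f * x)" if x: "x \<in> K" for x
  proof -
    have "(1 - 4 * f) * x = x - of_int 4 * (f * x)" by (simp add: algebra_simps)
    then show ?thesis using tr_diff[of x "of_int 4 * (f * x)"] tr_int_mult[OF K_mult[OF fK x], of 4] x fK by auto
  qed
  show t0: "tr (1 - 4 * f) = 0" using 3[OF K_1] f(2) tr_1_eq by simp
  show 5: "tr ((1 - 4 * f) * f) = 1 - 4 * tr (f * f)" using 3[OF fK] f(2) by simp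
  show "tr ((1 - 4 * f) * (1 - 4 * f)) = - 4 + 16 * tr (f * f)"
    using 3[OF O_K[OF e]] t0 5 by (simp add: mult.commute)
qed

text \<open>Either \<open>x\<close> or \<open>x + (1 - 4 * f)\<close> pairs evenly with \<open>f\<close> as well, and thus lies in the radical modulo 2; adding the second
  summand changes the norm by a multiple of 4.\<close>

lemma tame_even_square:
  assumes tame: "tamely_ramified K" and f: "f \<in> OK" "tr f = 1" and x: "x \<in> OK" "tr x = 0"
    and even: "\<And>w. w \<in> OK \<Longrightarrow> tr w = 0 \<Longrightarrow> tr (x * w) / 2 \<in> \<int>"
  shows "tr (x * x) / 4 \<in> \<int>"
proof -
  note fK = O_K[OF f(1)] and xK = O_K[OF x(1)]
  have crit: "even_trace u" if u: "u \<in> OK" "tr (u * f) / 2 \<in> \<int>" "\<And>w. w \<in> OK \<Longrightarrow> tr w = 0 \<Longrightarrow> tr (u * w) / 2 \<in> \<int>" for u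
    unfolding even_trace_def
  proof (intro conjI ballI u(1))
    fix z assume "z \<in> OK"
    then obtain t w where tw: "z = of_int t * f + w" "w \<in> OK" "tr w = 0" using trace_zero_part[OF f] by blast
    have uf: "u * f \<in> K" and uw: "u * w \<in> K" using u(1) f(1) tw(2) by blast+
    have "u * z = of_int t * (u * f) + u * w" unfolding tw(1) by (simp add: algebra_simps)
    then have "tr (u * z) = of_int t * tr (u * f) + tr (u * w)"
      using tr_add[OF K_mult[OF K_int uf] uw] tr_int_mult[OF uf] by (simp only:)
    then have "tr (u * z) / 2 = of_int t * (tr (u * f) / 2) + tr (u * w) / 2" by simp
    also have "\<dots> \<in> \<int>" using u(2) u(3)[OF tw(2,3)] by (intro Ints_add Ints_mult Ints_of_int)
    finally show "tr (u * z) / 2 \<in> \<int>" .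
  qed
  obtain a c :: int where ac: "tr (x * f) = of_int a" "tr (f * f) = of_int c"
    using tr_Ints[OF O_mult[OF x(1) f(1)]] tr_Ints[OF O_mult[OF f(1) f(1)]] by (auto elim!: Ints_cases)
  show ?thesis
  proof (cases "even a")
    case True
    then obtain k where "a = 2 * k" by (elim evenE)
    then have "tr (x * f) / 2 \<in> \<int>" using ac by simp
    then show ?thesis using tame_trace_square[OF tame crit[OF x(1) _ even] x(2)] by blast
  next
    case False
    then obtain k where k: "a = 2 * k + 1" by (elim oddE)
    let ?e = "1 - 4 * f"
    note e = distinguished[OF f]
    define u where "u = x + ?e"
    have uO: "u \<in> OK" unfolding u_def using x e by blast
    have u: "tr (u * w) = tr (x * w) + tr w - 4 * tr (f * w)" if "w \<in> K" for w
      using tr_add[OF K_mult[OF xK that] K_mult[OF O_K[OF e(1)] that]] e(3)[OF that]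
      unfolding u_def distrib_right by linarith
    have "tr (u * f) / 2 = of_int (k + 1 - 2 * c)" using u[OF fK] ac k f(2) by simp
    then have 1: "tr (u * f) / 2 \<in> \<int>" by (simp only: Ints_of_int)
    have 2: "tr (u * w) / 2 \<in> \<int>" if w: "w \<in> OK" "tr w = 0" for w
    proof -
      have "tr (u * w) / 2 = tr (x * w) / 2 - 2 * tr (f * w)" using u[OF O_K[OF w(1)]] w(2) by simp
      also have "\<dots> \<in> \<int>" using even[OF w] tr_Ints[OF O_mult[OF f(1) w(1)]] by (intro Ints_diff Ints_mult) auto
      finally show ?thesis .
    qed
    have "tr u = 0" unfolding u_def using tr_add[OF xK O_K[OF e(1)]] x e by simp
    moreover have "even_trace u" by (rule crit[OF uO 1]) (rule 2)
    ultimately have 3: "tr (u * u) / 4 \<in> \<int>" by (intro tame_trace_square[OF tame])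
    have "tr (x * u) = tr (x * x) - 4 * tr (f * x)"
      using u[OF xK] x(2) by (simp add: mult.commute)
    moreover have "tr (f * u) = tr (x * f) + 1 - 4 * tr (f * f)" using u[OF fK] f(2) by (simp add: mult.commute)
    ultimately have "tr (u * u) = tr (x * x) - 4 * tr (f * x) - 4 * (tr (x * f) + 1 - 4 * tr (f * f))"
      using u[OF O_K[OF uO]] \<open>tr u = 0\<close> by simp
    note eq = this
    have lin: "X / 4 = U / 4 + (2 * A + 1 - 4 * C)"
      if "U = X - 4 * F - 4 * (A + 1 - 4 * C)" "F = A" for U X F A C :: rat
      using that by (simp add: field_simps)
    have "tr (f * x) = of_int a" using ac(1) by (simp only: mult.commute)
    with eq[unfolded ac] have "tr (x * x) / 4 = tr (u * u) / 4 + (2 * of_int a + 1 - 4 * of_int c)" by (rule lin)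
    also have "\<dots> = tr (u * u) / 4 + of_int (2 * a + 1 - 4 * c)" by simp
    also have "\<dots> \<in> \<int>" using 3 by (intro Ints_add Ints_of_int)
    finally show ?thesis .
  qed
qed

end

context isometric_quartics
begin

lemma image_integers:
  assumes \<Lambda>: "\<Phi> ` trace_zero_integers K = trace_zero_integers L"
    and f: "f \<in> K.OK" "K.tr f = 1" "\<Phi> f \<in> L.OK"
  shows "\<Phi> ` integers_of K = integers_of L"
proof -
  have m: "\<Phi> (of_int t * f + w) = of_int t * \<Phi> f + \<Phi> w" if "w \<in> K.OK" for t w
    using \<Phi>_add[OF K.K_mult[OF K.K_int K.O_K[OF f(1)]] K.O_K[OF that]] \<Phi>_int[OF K.O_K[OF f(1)]] by (simp only:)
  have tf: "L.tr (\<Phi> f) = 1" using \<Phi>_tr f by auto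
  have 1: "\<Phi> x \<in> L.OK" if "x \<in> K.OK" for x
  proof -
    obtain t w where tw: "x = of_int t * f + w" "w \<in> K.OK" "K.tr w = 0" using K.trace_zero_part[OF f(1,2) \<open>x \<in> K.OK\<close>] by blast
    have "\<Phi> w \<in> L.OK" using \<Lambda> tw(2,3) K.trace_zero_iff[of w] L.trace_zero_iff[of "\<Phi> w"] by blast
    then show ?thesis unfolding tw(1) m[OF tw(2)] using f(3) by blast
  qed
  have 2: "y \<in> \<Phi> ` integers_of K" if "y \<in> L.OK" for y
  proof -
    obtain t v where tv: "y = of_int t * \<Phi> f + v" "v \<in> L.OK" "L.tr v = 0" using L.trace_zero_part[OF f(3) tf \<open>y \<in> L.OK\<close>] by blast
    then have "v \<in> \<Phi> ` trace_zero_integers K" using L.trace_zero_iff \<Lambda> by blast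
    then obtain w where w: "w \<in> trace_zero_integers K" "\<Phi> w = v" by blast
    then have wO: "w \<in> K.OK" using K.trace_zero_iff by blast
    have "y = \<Phi> (of_int t * f + w)" unfolding m[OF wO] w(2) tv(1) ..
    then show ?thesis using f(1) wO by blast
  qed
  from 1 2 show ?thesis by blast
qed

text \<open>The images of the distinguished elements of the two lattices agree up to sign modulo 4, because
  the discriminant is congruent to 1 modulo 4 and annihilates the quotient of the dual lattice.\<close>

lemma alignment:
  assumes \<Lambda>: "\<Phi> ` trace_zero_integers K = trace_zero_integers L"
    and f: "f \<in> K.OK" "K.tr f = 1" and g: "g \<in> L.OK" "L.tr g = 1"
    and D: "field_discriminant K mod 4 = 1"
  shows "\<Phi> ` integers_of K = integers_of L \<or> \<Psi> ` integers_of K = integers_of L"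
proof -
  interpret R: isometric_quartics K L \<Psi> by unfold_locales (rule trace_isometry_\<Psi>)
  note fK = K.O_K[OF f(1)] and gL = L.O_K[OF g(1)]
  let ?e = "1 - 4 * f" and ?e' = "1 - 4 * g"
  note e = K.distinguished[OF f] and e' = L.distinguished[OF g]
  have \<Phi>\<Lambda>: "\<Phi> w \<in> L.OK \<and> L.tr (\<Phi> w) = 0" if "w \<in> K.OK" "K.tr w = 0" for w
    using \<Lambda> that K.trace_zero_iff[of w] L.trace_zero_iff[of "\<Phi> w"] by blast
  obtain y where y: "y \<in> K.OK" "K.tr y = 0" "\<Phi> y = ?e'"
  proof -
    have "?e' \<in> \<Phi> ` trace_zero_integers K" using e'(1,2) L.trace_zero_iff \<Lambda> by blast
    then obtain y where "y \<in> trace_zero_integers K" "\<Phi> y = ?e'" by force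
    then show ?thesis using that K.trace_zero_iff by blast
  qed
  note yK = K.O_K[OF y(1)] and eK = K.O_K[OF e(1)]
  obtain r c c' :: int where r: "K.tr (y * f) = of_int r" "K.tr (f * f) = of_int c" "L.tr (g * g) = of_int c'"
    using K.tr_Ints[OF K.O_mult[OF y(1) f(1)]] K.tr_Ints[OF K.O_mult[OF f(1) f(1)]] L.tr_Ints[OF L.O_mult[OF g(1) g(1)]]
    by (auto elim!: Ints_cases)
  define z where "z = of_rat (1 / 4) * (y - of_int r * ?e)"
  have y_z: "y = of_int r * ?e + 4 * z"
  proof -
    have "4 * of_rat (1 / 4) = (1 :: 'a)" by (simp add: of_rat_divide)
    then have "4 * z = y - of_int r * ?e" unfolding z_def mult.assoc[symmetric] by (simp only: mult_1)
    then show ?thesis by simp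
  qed
  have reK: "of_int r * ?e \<in> K" using eK by blast
  have zK: "z \<in> K" unfolding z_def using yK reK by blast
  have trz: "4 * K.tr (z * x) = K.tr (y * x) - of_int r * K.tr (?e * x)" if x: "x \<in> K" for x
  proof -
    have "y * x = of_int r * (?e * x) + of_int 4 * (z * x)" by (subst y_z) (simp add: algebra_simps)
    then have "K.tr (y * x) = of_int r * K.tr (?e * x) + of_int 4 * K.tr (z * x)"
      using K.tr_add[of "of_int r * (?e * x)" "of_int 4 * (z * x)"] K.tr_int_mult[OF K.K_mult[OF eK x], of r]
        K.tr_int_mult[OF K.K_mult[OF zK x], of 4] eK x zK by auto
    then show ?thesis by simp
  qed
  have int: "K.tr (z * x) \<in> \<int>" if x: "x \<in> K.OK" for x
  proof -
    obtain t w where tw: "x = of_int t * f + w" "w \<in> K.OK" "K.tr w = 0" using K.trace_zero_part[OF f x] by blast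
    note wK = K.O_K[OF tw(2)]
    have "4 * K.tr (z * f) = 4 * of_int (r * c)" unfolding trz[OF fK] e(5) r by (simp add: algebra_simps)
    then have zf: "K.tr (z * f) = of_int (r * c)" by simp
    have "K.tr (y * w) = L.tr (?e' * \<Phi> w)" using \<Phi>_form[OF yK wK] y(3) by simp
    also have "\<dots> = - 4 * L.tr (g * \<Phi> w)" using e'(3)[OF \<Phi>_L[OF wK]] \<Phi>\<Lambda>[OF tw(2,3)] by simp
    finally have "4 * K.tr (z * w) = 4 * (of_int r * K.tr (f * w) - L.tr (g * \<Phi> w))"
      unfolding trz[OF wK] e(3)[OF wK] tw(3) by simp
    then have zw: "K.tr (z * w) = of_int r * K.tr (f * w) - L.tr (g * \<Phi> w)" by simp
    have "z * x = of_int t * (z * f) + z * w" unfolding tw(1) by (simp add: algebra_simps)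
    then have "K.tr (z * x) = of_int t * K.tr (z * f) + K.tr (z * w)"
      using K.tr_add[of "of_int t * (z * f)" "z * w"] K.tr_int_mult[OF K.K_mult[OF zK fK], of t] zK fK wK by auto
    also have "\<dots> \<in> \<int>" unfolding zf zw
      using K.tr_Ints[OF K.O_mult[OF f(1) tw(2)]] L.tr_Ints[OF L.O_mult[OF g(1) conjunct1[OF \<Phi>\<Lambda>[OF tw(2,3)]]]]
      by (intro Ints_add Ints_mult Ints_diff Ints_of_int)
    finally show ?thesis .
  qed
  define D where "D = field_discriminant K"
  obtain m where m: "D = 4 * m + 1"
  proof -
    have "D = 4 * (D div 4) + 1" using D unfolding D_def by presburger
    then show ?thesis using that by blast
  qed
  have Dz: "of_int D * z \<in> K.OK" unfolding D_def by (rule K.dual_scale[OF zK int])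
  have "z = of_int D * z - of_int m * (y - of_int r * ?e)"
  proof -
    have "y - of_int r * ?e = 4 * z" using y_z by simp
    then show ?thesis unfolding m by (simp add: algebra_simps)
  qed
  moreover have "of_int m * (y - of_int r * ?e) \<in> K.OK" by (rule K.O_mult[OF K.O_int K.O_diff[OF y(1) K.O_mult[OF K.O_int e(1)]]])
  ultimately have zO: "z \<in> K.OK" using Dz K.O_diff by metis
  have z0: "K.tr z = 0" using trz[OF K.K_1] y(2) e(2) by simp
  have "odd r"
  proof
    assume "even r"
    then obtain r' where r': "r = 2 * r'" by (elim evenE)
    obtain p q :: int where pq: "K.tr (?e * z) = of_int p" "K.tr (z * z) = of_int q"
      using K.tr_Ints[OF K.O_mult[OF e(1) zO]] K.tr_Ints[OF K.O_mult[OF zO zO]] by (auto elim!: Ints_cases)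
    have a1: "K.tr (y * y) = - 4 + 16 * of_int c'" using \<Phi>_form[OF yK yK] y(3) e'(4) r(3) by simp
    have a2: "K.tr (y * z) = 4 * of_int q + of_int r * of_int p" using trz[OF zK] pq by simp
    have a3: "K.tr (y * ?e) = 4 * of_int p + of_int r * (- 4 + 16 * of_int c)"
    proof -
      have lin: "Y = 4 * p + q * F" if "P = p" "E = F" "4 * P = Y - q * E" for P Y E F p q :: rat
        using that by simp
      have "K.tr (z * ?e) = of_int p" using pq(1) by (simp only: mult.commute)
      moreover have "K.tr (?e * ?e) = - 4 + 16 * of_int c" using e(4) r(2) by (simp only:)
      ultimately show ?thesis using trz[OF eK] by (rule lin)
    qed
    have "4 * K.tr (y * z) = K.tr (y * y) - of_int r * K.tr (y * ?e)"
      using trz[OF yK] by (simp only: mult.commute[of z y] mult.commute[of ?e y])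
    then have "- 4 + 16 * rat_of_int c' = 16 * of_int q + 8 * of_int r * of_int p + of_int r * of_int r * (- 4 + 16 * of_int c)"
      unfolding a1 a2 a3 by (simp add: algebra_simps)
    then have "rat_of_int (- 4 + 16 * c') = of_int (16 * q + 8 * r * p + r * r * (- 4 + 16 * c))" by simp
    then have "- 4 + 16 * c' = 16 * q + 8 * r * p + r * r * (- 4 + 16 * c)" by (simp only: of_int_eq_iff)
    then have "- 1 + 4 * c' = 4 * (q + r' * p + r' * r' * (- 1 + 4 * c))" unfolding r' by (simp add: algebra_simps)
    then have "even (- 1 + 4 * c')" by simp
    then show False by simp
  qed
  have gw: "g + \<Phi> w \<in> L.OK" if "w \<in> K.OK" "K.tr w = 0" for w using g(1) \<Phi>\<Lambda>[OF that] by blast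
  have "\<exists>s. r = 4 * s + 1 \<or> r = 4 * s - 1"
  proof -
    have "r = 4 * (r div 4) + 1 \<or> r = 4 * (r div 4 + 1) - 1" using \<open>odd r\<close> by presburger
    then show ?thesis by blast
  qed
  then obtain s where s: "r = 4 * s + 1 \<or> r = 4 * s - 1" by blast
  define w where "w = of_int s * ?e + z"
  have wO: "w \<in> K.OK" "K.tr w = 0" unfolding w_def
    using e zO z0 K.tr_add[of "of_int s * ?e" z] K.tr_int_mult[OF eK, of s] zK eK by auto
  have \<Phi>4: "\<Phi> (of_int 4 * w) = 4 * \<Phi> w" using \<Phi>_int[OF K.O_K[OF wO(1)], of 4] by simp
  have wK4: "of_int 4 * w \<in> K" using K.O_K[OF wO(1)] by blast
  have f4: "of_int 4 * f = 1 - ?e" by simp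
  show ?thesis using s
  proof
    assume s: "r = 4 * s + 1"
    have "y - of_int 4 * w = ?e" by (subst y_z) (simp add: w_def s algebra_simps)
    then have "\<Phi> ?e = ?e' - 4 * \<Phi> w" using \<Phi>_diff[OF yK wK4] \<Phi>4 y(3) by simp
    moreover have "of_int 4 * \<Phi> f = 1 - \<Phi> ?e" using \<Phi>_diff[OF K.K_1 eK] \<Phi>_1 \<Phi>_int[OF fK, of 4] f4 by (simp only:)
    ultimately have "4 * \<Phi> f = 4 * (g + \<Phi> w)" by simp
    then have "\<Phi> f = g + \<Phi> w" by (simp only: mult_cancel_left) simp
    then have "\<Phi> f \<in> L.OK" using gw[OF wO] by simp
    then show ?thesis using image_integers[OF \<Lambda> f] by blast
  next
    assume s: "r = 4 * s - 1"
    have "of_int 4 * w - y = ?e" by (subst y_z) (simp add: w_def s algebra_simps)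
    then have "\<Phi> ?e = 4 * \<Phi> w - ?e'" using \<Phi>_diff[OF wK4 yK] \<Phi>4 y(3) by simp
    then have "\<Psi> ?e = ?e' - 4 * \<Phi> w" using \<Psi>_trace_zero[OF e(2)] by simp
    moreover have "of_int 4 * \<Psi> f = 1 - \<Psi> ?e" using R.\<Phi>_diff[OF K.K_1 eK] R.\<Phi>_1 R.\<Phi>_int[OF fK, of 4] f4 by (simp only:)
    ultimately have "4 * \<Psi> f = 4 * (g + \<Phi> w)" by simp
    then have "\<Psi> f = g + \<Phi> w" by (simp only: mult_cancel_left) simp
    then have f': "\<Psi> f \<in> L.OK" using gw[OF wO] by simp
    have neg: "- v \<in> trace_zero_integers L" if "v \<in> trace_zero_integers L" for v
      using that L.tr_minus[of v] unfolding L.trace_zero_iff by auto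
    have "\<Psi> ` trace_zero_integers K = uminus ` \<Phi> ` trace_zero_integers K"
      unfolding image_image by (intro image_cong refl) (simp add: \<Psi>_trace_zero K.trace_zero_iff)
    also have "\<dots> = trace_zero_integers L" unfolding \<Lambda> using neg by (auto simp: image_iff) (metis neg add.inverse_inverse)
    finally show ?thesis using R.image_integers[OF _ f f'] by blast
  qed
qed

end

section \<open>Even discriminants\<close>

lemma det_Suc:
  fixes f :: "nat \<times> nat \<Rightarrow> 'a::comm_ring_1"
  shows "det (mat (Suc n) (Suc n) f) =
    (\<Sum>i<Suc n. f (i, 0) * ((- 1) ^ i * det (mat n n (\<lambda>(r, c). f (if r < i then r else Suc r, Suc c)))))"
proof -
  let ?A = "mat (Suc n) (Suc n) f"
  have "det ?A = (\<Sum>i<Suc n. ?A $$ (i,0) * cofactor ?A i 0)" by (rule laplace_expansion_column) simp_all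
  also have "\<dots> = (\<Sum>i<Suc n. f (i, 0) * ((- 1) ^ i * det (mat n n (\<lambda>(r, c). f (if r < i then r else Suc r, Suc c)))))"
  proof (intro sum.cong refl arg_cong2[of _ _ _ _ "(*)"])
    fix i assume i: "i \<in> {..<Suc n}"
    then show "?A $$ (i, 0) = f (i, 0)" by simp
    have "mat_delete ?A i 0 = mat n n (\<lambda>(r, c). f (if r < i then r else Suc r, Suc c))"
      unfolding mat_delete_def by (rule eq_matI) auto
    then show "cofactor ?A i 0 = (- 1) ^ i * det (mat n n (\<lambda>(r, c). f (if r < i then r else Suc r, Suc c)))"
      unfolding cofactor_def by simp
  qed
  finally show ?thesis .
qed

text \<open>The change of basis from \<open>f, t0, t1, t2\<close> to \<open>1, y, t1, t2\<close>, where \<open>1 = 4 * f + (1 - 4 * f)\<close>.\<close>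

lemma det_4_change:
  "det (mat 4 4 (\<lambda>(i, j). [[4, v0, v1, v2], [0, u0, u1, u2], [0, 0, 1, 0], [0, 0, 0, 1]] ! i ! j)) = 4 * (u0 :: int)"
  by (simp add: eval_nat_numeral det_Suc det_single)

lemma det_4_gram:
  fixes A B C a b c :: rat
  assumes "f (0,0) = 4" "f (0,1) = 0" "f (0,2) = 0" "f (0,3) = 0" "f (1,0) = 0" "f (2,0) = 0" "f (3,0) = 0"
    "f (1,1) = A" "f (1,2) = B" "f (2,1) = B" "f (1,3) = C" "f (3,1) = C" "f (2,2) = a" "f (2,3) = b" "f (3,2) = b" "f (3,3) = c"
  shows "det (mat 4 4 f) = 4 * (A * (a * c - b * b) - c * B * B + 2 * b * B * C - a * C * C)"
proof -
  have n: "4 = Suc (Suc (Suc (Suc 0)))" "3 = Suc (Suc (Suc 0))" "2 = Suc (Suc 0)" "1 = Suc 0" by simp_all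
  show ?thesis using assms unfolding n by (simp add: det_Suc det_single algebra_simps)
qed

context quartic
begin

text \<open>Adding \<open>f\<close> to a basis of the trace zero lattice gives an integral basis, which has 4 elements.\<close>

lemma trace_zero_basis:
  assumes f: "f \<in> OK" "tr f = 1"
  shows "\<exists>T. finite T \<and> card T = 3 \<and> int_mod.span T = trace_zero_integers K"
proof -
  let ?\<Lambda> = "trace_zero_integers K"
  have sub: "?\<Lambda> \<subseteq> OK" unfolding trace_zero_integers_def by blast
  have "0 \<in> ?\<Lambda>" unfolding trace_zero_iff using tr_0 by simp
  moreover have "x - y \<in> ?\<Lambda>" if "x \<in> ?\<Lambda>" "y \<in> ?\<Lambda>" for x y
    using that tr_diff[OF O_K O_K, of x y] unfolding trace_zero_iff by auto
  ultimately obtain T where T: "finite T" "int_mod.independent T" "int_mod.span T = ?\<Lambda>"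
    using integer_subgroup_basis[OF sub] by blast
  have T0: "x \<in> OK \<and> tr x = 0" if "x \<in> int_mod.span T" for x using that T(3) trace_zero_iff by blast
  have fT: "f \<notin> T" using T0[OF int_mod.span_base[of f T]] f(2) by auto
  have ind: "int_mod.independent (insert f T)"
    unfolding int_independent_insert[OF T(1) fT]
  proof (intro conjI allI impI T(2))
    fix n :: int assume "of_int n * f \<in> int_mod.span T"
    then have "tr (of_int n * f) = 0" using T0 by blast
    then show "n = 0" using tr_int_mult[OF O_K[OF f(1)], of n] f(2) by simp
  qed
  have span: "int_mod.span (insert f T) = OK"
  proof
    have "insert f T \<subseteq> OK" using f(1) T0 int_mod.span_superset[of T] by blast
    then show "int_mod.span (insert f T) \<subseteq> OK"
      by (rule int_mod.span_minimal) (unfold int_mod.subspace_def, auto)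
    show "OK \<subseteq> int_mod.span (insert f T)"
    proof
      fix x assume "x \<in> OK"
      then obtain t w where tw: "x = of_int t * f + w" "w \<in> OK" "tr w = 0" using trace_zero_part[OF f] by blast
      then have "w \<in> int_mod.span T" unfolding T(3) trace_zero_iff by blast
      then have w: "w \<in> int_mod.span (insert f T)" using int_mod.span_mono[of T "insert f T"] by blast
      have "of_int t * f \<in> int_mod.span (insert f T)" by (rule int_mod.span_scale[OF int_mod.span_base]) simp
      then show "x \<in> int_mod.span (insert f T)" unfolding tw(1) using w by (rule int_mod.span_add)
    qed
  qed
  obtain bs where bs: "set bs = insert f T" "distinct bs" using finite_distinct_list[of "insert f T"] T(1) by auto
  have "integral_basis K bs" unfolding integral_basis_def bs(1) using bs(2) ind span by simp
  then have "length bs = 4" using integral_basis_length quartic by simp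
  then have "card (insert f T) = 4" using distinct_card[OF bs(2)] bs(1) by simp
  then have "card T = 3" using T(1) fT by simp
  then show ?thesis using T by blast
qed

end

context isometric_quartics
begin

text \<open>Computing the discriminant from the distinguished element of \<open>L\<close> and two further elements shows that a quarter
  of it is a square modulo 4: by tameness the two further elements have norms divisible by 4.\<close>

lemma even_discriminant:
  assumes \<Lambda>: "\<Phi> ` trace_zero_integers K = trace_zero_integers L"
    and f: "f \<in> K.OK" "K.tr f = 1" and g: "g \<in> L.OK" "L.tr g = 1"
    and tame: "tamely_ramified L" and D: "field_discriminant K = 4 * m"
  shows "m mod 4 \<in> {0, 1}"
proof -
  note fK = K.O_K[OF f(1)] and gL = L.O_K[OF g(1)]
  let ?e = "1 - 4 * f" and ?e' = "1 - 4 * g"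
  note e = K.distinguished[OF f] and e' = L.distinguished[OF g]
  have \<Phi>\<Lambda>: "\<Phi> w \<in> L.OK" "L.tr (\<Phi> w) = 0" if "w \<in> K.OK" "K.tr w = 0" for w
    using \<Lambda> that K.trace_zero_iff[of w] L.trace_zero_iff[of "\<Phi> w"] by blast+
  have pre: "\<exists>w. w \<in> K.OK \<and> K.tr w = 0 \<and> \<Phi> w = v" if "v \<in> L.OK" "L.tr v = 0" for v
  proof -
    have "v \<in> \<Phi> ` trace_zero_integers K" using that L.trace_zero_iff \<Lambda> by blast
    then show ?thesis using K.trace_zero_iff by blast
  qed
  obtain y where y: "y \<in> K.OK" "K.tr y = 0" "\<Phi> y = ?e'" using pre[OF e'(1,2)] by blast
  note yK = K.O_K[OF y(1)]
  obtain T where T: "finite T" "card T = 3" "int_mod.span T = trace_zero_integers K" using K.trace_zero_basis[OF f] by blast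
  have T0: "x \<in> K.OK" "K.tr x = 0" if "x \<in> T" for x
    using int_mod.span_base[OF that] unfolding T(3) K.trace_zero_iff by blast+
  have coeffs: "\<exists>u. x = (\<Sum>v\<in>T. of_int (u v) * v)" if "x \<in> K.OK" "K.tr x = 0" for x
  proof -
    have "x \<in> int_mod.span T" unfolding T(3) K.trace_zero_iff using that by blast
    then show ?thesis unfolding int_mod.span_finite[OF T(1)] by auto
  qed
  obtain u where u: "y = (\<Sum>v\<in>T. of_int (u v) * v)" using coeffs[OF y(1,2)] by blast
  obtain c' :: int where c': "L.tr (g * g) = of_int c'" using L.tr_Ints[OF L.O_mult[OF g(1) g(1)]] by (auto elim: Ints_cases)
  have "\<exists>t\<in>T. odd (u t)"
  proof (rule ccontr)
    assume "\<not> (\<exists>t\<in>T. odd (u t))"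
    then have ev: "even (u t)" if "t \<in> T" for t using that by blast
    define y2 where "y2 = (\<Sum>v\<in>T. of_int (u v div 2) * v)"
    have "y2 \<in> int_mod.span T" unfolding y2_def by (intro int_mod.span_sum int_mod.span_scale int_mod.span_base)
    then have y2: "y2 \<in> K.OK" "K.tr y2 = 0" unfolding T(3) K.trace_zero_iff by blast+
    have "y = of_int 2 * y2" unfolding u y2_def sum_distrib_left
    proof (rule sum.cong[OF refl])
      fix v assume "v \<in> T"
      then have "u v = 2 * (u v div 2)" using ev by simp
      then have "of_int (u v) = (of_int (2 * (u v div 2)) :: 'a)" by (rule arg_cong)
      then show "of_int (u v) * v = of_int 2 * (of_int (u v div 2) * v)" by (simp only: of_int_mult mult.assoc)
    qed
    then have ey: "?e' = of_int 2 * \<Phi> y2" using \<Phi>_int[OF K.O_K[OF y2(1)], of 2] y(3) by simp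
    obtain k :: int where k: "L.tr (\<Phi> y2 * g) = of_int k"
      using L.tr_Ints[OF L.O_mult[OF \<Phi>\<Lambda>(1)[OF y2] g(1)]] by (auto elim: Ints_cases)
    have "L.tr (?e' * g) = of_int 2 * L.tr (\<Phi> y2 * g)"
      unfolding ey mult.assoc by (rule L.tr_int_mult[OF L.K_mult[OF \<Phi>_L[OF K.O_K[OF y2(1)]] gL]])
    then have "1 - 4 * rat_of_int c' = 2 * of_int k" unfolding e'(5) c' k by simp
    then have "rat_of_int (1 - 4 * c') = of_int (2 * k)" by simp
    then have "1 - 4 * c' = 2 * k" by (simp only: of_int_eq_iff)
    then show False by presburger
  qed
  then obtain t0 where t0: "t0 \<in> T" "odd (u t0)" by blast
  have "card (T - {t0}) = 2" using T t0(1) by simp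
  then obtain t1 t2 where "T - {t0} = {t1, t2}" "t1 \<noteq> t2" by (auto simp: card_2_iff)
  then have Te: "T = {t0, t1, t2}" and ne: "t0 \<noteq> t1" "t0 \<noteq> t2" "t1 \<noteq> t2" using t0(1) by auto
  have sT: "(\<Sum>v\<in>T. h v) = h t0 + h t1 + h t2" for h :: "'a \<Rightarrow> 'a" unfolding Te using ne by (simp add: add.assoc)
  have tO: "t0 \<in> K.OK" "t1 \<in> K.OK" "t2 \<in> K.OK" and tr0: "K.tr t0 = 0" "K.tr t1 = 0" "K.tr t2 = 0" using T0 Te by auto
  note tK = K.O_K[OF tO(1)] K.O_K[OF tO(2)] K.O_K[OF tO(3)]
  define b where "b i = [f, t0, t1, t2] ! i" for i
  define b' where "b' i = [1, y, t1, t2] ! i" for i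
  have lt4: "(\<forall>i<4. P i) \<longleftrightarrow> P 0 \<and> P 1 \<and> P 2 \<and> P 3" for P :: "nat \<Rightarrow> bool"
    by (auto simp: eval_nat_numeral less_Suc_eq)
  have s4: "(\<Sum>i<4. h i) = h 0 + h 1 + h 2 + h 3" for h :: "nat \<Rightarrow> 'a" by (simp add: eval_nat_numeral)
  have bb: "b 0 = f" "b 1 = t0" "b 2 = t1" "b 3 = t2" and bb': "b' 0 = 1" "b' 1 = y" "b' 2 = t1" "b' 3 = t2"
    unfolding b_def b'_def by simp_all
  have sp: "K.spans 4 b" unfolding K.spans_def lt4 bb
  proof (intro conjI ballI f(1) tO)
    fix x assume "x \<in> K.OK"
    then obtain t w where tw: "x = of_int t * f + w" "w \<in> K.OK" "K.tr w = 0" using K.trace_zero_part[OF f] by blast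
    obtain n where "w = (\<Sum>v\<in>T. of_int (n v) * v)" using coeffs[OF tw(2,3)] by blast
    then have "x = (\<Sum>i<4. of_int ([t, n t0, n t1, n t2] ! i) * b i)" unfolding s4 bb sT tw(1) by (simp add: add.assoc)
    then show "\<exists>c::nat \<Rightarrow> int. x = (\<Sum>i<4. of_int (c i) * b i)" by blast
  qed
  obtain v where v: "?e = (\<Sum>x\<in>T. of_int (v x) * x)" using coeffs[OF e(1,2)] by blast
  define U where "U i j = [[4, v t0, v t1, v t2], [0, u t0, u t1, u t2], [0, 0, 1, 0], [0, 0, 0, 1]] ! i ! j" for i j
  have ch: "\<forall>j<4. b' j = (\<Sum>i<4. of_int (U j i) * b i)"
    unfolding lt4 s4 bb bb'
  proof (intro conjI)
    have "1 = 4 * f + ?e" by simp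
    then show "1 = of_int (U 0 0) * f + of_int (U 0 1) * t0 + of_int (U 0 2) * t1 + of_int (U 0 3) * t2"
      unfolding v sT U_def by (simp add: add.assoc)
    show "y = of_int (U 1 0) * f + of_int (U 1 1) * t0 + of_int (U 1 2) * t1 + of_int (U 1 3) * t2"
      unfolding u sT U_def by (simp add: add.assoc)
  qed (simp_all add: U_def)
  have "det (K.gram 4 b') = of_int (det (mat 4 4 (\<lambda>(i,j). U i j))) ^ 2 * det (K.gram 4 b)"
    by (rule K.gram_change[OF K.spansD(2)[OF sp]]) (use ch in auto)
  also have "det (mat 4 4 (\<lambda>(i,j). U i j)) = 4 * u t0" unfolding U_def by (rule det_4_change)
  also have "det (K.gram 4 b) = of_int (4 * m)" using K.int_gram(3)[OF K.spansD(1)[OF sp]] K.discriminant_int_gram[OF sp] D by simp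
  finally have dg: "det (K.gram 4 b') = of_int (64 * m * (u t0 * u t0))" by (simp add: power2_eq_square)
  have ints: "\<exists>k::int. K.tr (x * z) = of_int k" if "x \<in> K.OK" "z \<in> K.OK" for x z
    using K.tr_Ints[OF K.O_mult[OF that]] by (auto elim: Ints_cases)
  have intsL: "\<exists>k::int. L.tr (x * z) = of_int k" if "x \<in> L.OK" "z \<in> L.OK" for x z
    using L.tr_Ints[OF L.O_mult[OF that]] by (auto elim: Ints_cases)
  have norm_even: "\<exists>k::int. K.tr (x * x) = of_int (2 * k)" if x: "x \<in> K.OK" "K.tr x = 0" for x
  proof -
    obtain e1 e2 :: int where "K.tr x = of_int e1" "K.tr (x ^ 2) = of_int (e1 ^ 2 - 2 * e2)" using K.newton[OF x(1)] by metis
    then have "K.tr (x * x) = of_int (2 * (- e2))" using x(2) by (simp add: power2_eq_square)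
    then show ?thesis by blast
  qed
  obtain \<alpha> \<gamma> \<beta> a1 a2 \<delta>1 \<delta>2 :: int where co: "K.tr (t1 * t1) = of_int (2 * \<alpha>)" "K.tr (t2 * t2) = of_int (2 * \<gamma>)" "K.tr (t1 * t2) = of_int \<beta>"
    "L.tr (g * \<Phi> t1) = of_int a1" "L.tr (g * \<Phi> t2) = of_int a2" "K.tr (t1 * t0) = of_int \<delta>1" "K.tr (t2 * t0) = of_int \<delta>2"
    using norm_even[OF tO(2) tr0(2)] norm_even[OF tO(3) tr0(3)] ints[OF tO(2,3)] ints[OF tO(2,1)] ints[OF tO(3,1)]
      intsL[OF g(1) \<Phi>\<Lambda>(1)[OF tO(2) tr0(2)]] intsL[OF g(1) \<Phi>\<Lambda>(1)[OF tO(3) tr0(3)]] by metis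
  have yt: "K.tr (y * t) = - 4 * L.tr (g * \<Phi> t)" if "t \<in> K.OK" "K.tr t = 0" for t
    using \<Phi>_form[OF yK K.O_K[OF that(1)]] y(3) e'(3)[OF \<Phi>_L[OF K.O_K[OF that(1)]]] \<Phi>\<Lambda>(2)[OF that] by simp
  have yt1: "K.tr (y * t1) = - 4 * of_int a1" "K.tr (y * t2) = - 4 * of_int a2"
    using yt[OF tO(2) tr0(2)] yt[OF tO(3) tr0(3)] co by simp_all
  have yy: "K.tr (y * y) = - 4 + 16 * of_int c'" using \<Phi>_form[OF yK yK] y(3) e'(4) c' by simp
  have "det (K.gram 4 b') = 4 * ((- 4 + 16 * of_int c') * (of_int (2 * \<alpha>) * of_int (2 * \<gamma>) - of_int \<beta> * of_int \<beta>)
      - of_int (2 * \<gamma>) * (- 4 * of_int a1) * (- 4 * of_int a1) + 2 * of_int \<beta> * (- 4 * of_int a1) * (- 4 * of_int a2)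
      - of_int (2 * \<alpha>) * (- 4 * of_int a2) * (- 4 * of_int a2))"
    unfolding K.gram_def
    by (rule det_4_gram)
      (simp_all only: split bb' mult_1 mult_1_right K.tr_1_eq y(2) tr0 co yt1 yy mult.commute[of t1 y] mult.commute[of t2 y] mult.commute[of t2 t1])
  also have "\<dots> = of_int (4 * ((- 4 + 16 * c') * (4 * \<alpha> * \<gamma> - \<beta> * \<beta>) - 32 * \<gamma> * a1 * a1 + 32 * \<beta> * a1 * a2 - 32 * \<alpha> * a2 * a2))"
    by simp
  finally have "4 * ((- 4 + 16 * c') * (4 * \<alpha> * \<gamma> - \<beta> * \<beta>) - 32 * \<gamma> * a1 * a1 + 32 * \<beta> * a1 * a2 - 32 * \<alpha> * a2 * a2) = 64 * m * (u t0 * u t0)"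
    unfolding dg by (simp only: of_int_eq_iff)
  then have eq: "(4 * c' - 1) * (4 * (\<alpha> * \<gamma>) - \<beta> * \<beta>) = 4 * (m * (u t0 * u t0) + 2 * (\<gamma> * a1 * a1 - \<beta> * a1 * a2 + \<alpha> * a2 * a2))"
    by (simp add: algebra_simps)
  have "even ((4 * c' - 1) * (4 * (\<alpha> * \<gamma>) - \<beta> * \<beta>))" unfolding eq by simp
  then have "even \<beta>" by simp
  then obtain \<beta>' where \<beta>': "\<beta> = 2 * \<beta>'" by (elim evenE)
  have expand: "K.tr (x * (of_int n0 * t0 + of_int n1 * t1 + of_int n2 * t2)) = of_int n0 * K.tr (x * t0) + of_int n1 * K.tr (x * t1) + of_int n2 * K.tr (x * t2)"
    if x: "x \<in> K" for x n0 n1 n2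
  proof -
    note k = K.K_mult[OF x tK(1)] K.K_mult[OF x tK(2)] K.K_mult[OF x tK(3)]
    have "x * (of_int n0 * t0 + of_int n1 * t1 + of_int n2 * t2) = of_int n0 * (x * t0) + of_int n1 * (x * t1) + of_int n2 * (x * t2)"
      by (simp only: distrib_left mult.left_commute)
    then show ?thesis
      using K.tr_add[OF K.K_add[OF K.K_mult[OF K.K_int k(1), of n0] K.K_mult[OF K.K_int k(2), of n1]] K.K_mult[OF K.K_int k(3), of n2]]
        K.tr_add[OF K.K_mult[OF K.K_int k(1), of n0] K.K_mult[OF K.K_int k(2), of n1]] K.tr_int_mult[OF k(1)] K.tr_int_mult[OF k(2)] K.tr_int_mult[OF k(3)]
      by (simp only:)
  qed
  have yex: "y = of_int (u t0) * t0 + of_int (u t1) * t1 + of_int (u t2) * t2" using u unfolding sT .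
  have square: "\<exists>k. \<alpha>' = 2 * k"
    if x: "x \<in> K.OK" "K.tr x = 0" and n: "K.tr (x * x) = of_int (2 * \<alpha>')" "K.tr (x * t0) = of_int p" "K.tr (x * t1) = of_int (2 * q)" "K.tr (x * t2) = of_int (2 * s)"
      and a: "K.tr (y * x) = - 4 * of_int a" for x and \<alpha>' p q s a :: int
  proof -
    have "- 4 * rat_of_int a = of_int (u t0) * of_int p + of_int (u t1) * of_int (2 * q) + of_int (u t2) * of_int (2 * s)"
      using expand[OF K.O_K[OF x(1)], of "u t0" "u t1" "u t2"] a unfolding yex[symmetric] n by (simp add: mult.commute)
    then have "rat_of_int (- 4 * a) = of_int (u t0 * p + u t1 * (2 * q) + u t2 * (2 * s))" by simp
    then have "- 4 * a = u t0 * p + u t1 * (2 * q) + u t2 * (2 * s)" by (simp only: of_int_eq_iff)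
    then have "u t0 * p = 2 * (- 2 * a - u t1 * q - u t2 * s)" by (simp add: algebra_simps)
    then have "even (u t0 * p)" by simp
    then have "even p" using t0(2) by simp
    then obtain p' where p': "p = 2 * p'" by (elim evenE)
    have "L.tr (\<Phi> x * \<Phi> x) / 4 \<in> \<int>"
    proof (rule L.tame_even_square[OF tame g \<Phi>\<Lambda>[OF x]])
      fix w assume "w \<in> L.OK" "L.tr w = 0"
      then obtain z where z: "z \<in> K.OK" "K.tr z = 0" "\<Phi> z = w" using pre by blast
      obtain n' where n': "z = (\<Sum>v\<in>T. of_int (n' v) * v)" using coeffs[OF z(1,2)] by blast
      have "L.tr (\<Phi> x * w) = K.tr (x * z)" using \<Phi>_form[OF K.O_K[OF x(1)] K.O_K[OF z(1)]] z(3) by simp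
      also have "\<dots> = of_int (2 * (n' t0 * p' + n' t1 * q + n' t2 * s))"
        unfolding n' sT expand[OF K.O_K[OF x(1)]] n p' by (simp add: algebra_simps)
      finally have "L.tr (\<Phi> x * w) / 2 = of_int (n' t0 * p' + n' t1 * q + n' t2 * s)" by simp
      then show "L.tr (\<Phi> x * w) / 2 \<in> \<int>" by (simp only: Ints_of_int)
    qed
    then obtain k where "L.tr (\<Phi> x * \<Phi> x) / 4 = of_int k" by (auto elim: Ints_cases)
    then have "rat_of_int (2 * \<alpha>') = of_int (4 * k)" using \<Phi>_form[OF K.O_K[OF x(1)] K.O_K[OF x(1)]] n(1) by simp
    then have "2 * \<alpha>' = 4 * k" by (simp only: of_int_eq_iff)
    then have "\<alpha>' = 2 * k" by simp
    then show ?thesis by blast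
  qed
  have "K.tr (t1 * t2) = of_int (2 * \<beta>')" "K.tr (t2 * t1) = of_int (2 * \<beta>')" using co(3) \<beta>' by (simp_all add: mult.commute)
  then obtain \<alpha>' \<gamma>' where \<alpha>\<gamma>: "\<alpha> = 2 * \<alpha>'" "\<gamma> = 2 * \<gamma>'"
    using square[OF tO(2) tr0(2) co(1) co(6) co(1) _ yt1(1)] square[OF tO(3) tr0(3) co(2) co(7) _ co(2) yt1(2)] by blast
  obtain h where h: "u t0 = 2 * h + 1" using t0(2) by (elim oddE)
  have "(4 * c' - 1) * (4 * \<alpha>' * \<gamma>' - \<beta>' * \<beta>') = m * (u t0 * u t0) + 4 * (\<gamma>' * a1 * a1 - \<beta>' * a1 * a2 + \<alpha>' * a2 * a2)"
    using eq unfolding \<alpha>\<gamma> \<beta>' by (simp add: algebra_simps)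
  then have "m = \<beta>' * \<beta>' + 4 * ((4 * c' - 1) * (\<alpha>' * \<gamma>') - c' * \<beta>' * \<beta>' - (\<gamma>' * a1 * a1 - \<beta>' * a1 * a2 + \<alpha>' * a2 * a2) - m * (h * h + h))"
    unfolding h by (simp add: algebra_simps)
  then have "m mod 4 = (\<beta>' * \<beta>') mod 4" by (metis mod_mult_self2)
  moreover have "(\<beta>' * \<beta>') mod 4 \<in> {0, 1}"
  proof (cases "even \<beta>'")
    case True
    then obtain k where "\<beta>' = 2 * k" by (elim evenE)
    then have "\<beta>' * \<beta>' = 4 * (k * k)" by simp
    then show ?thesis by simp
  next
    case False
    then obtain k where "\<beta>' = 2 * k + 1" by (elim oddE)
    then have "\<beta>' * \<beta>' = 1 + 4 * (k * k + k)" by (simp add: algebra_simps)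
    then have "(\<beta>' * \<beta>') mod 4 = 1 mod 4" by (metis mod_mult_self2)
    then show ?thesis by simp
  qed
  ultimately show ?thesis by simp
qed

end

theorem mainTheorem1:
  fixes K :: "'a::field_char_0 set" and L :: "'b::field_char_0 set"
  assumes "number_field K" and "degree_over_rat K = 4" and "totally_real K"
    and "fundamental_discriminant (field_discriminant K)"
    and "number_field L" and "tamely_ramified L"
    and "isometric (trace_zero_integers K) (trace_form K) (trace_zero_integers L) (trace_form L)"
  shows "ring_on K \<simeq> ring_on L"
proof -
  interpret nK: numfield K by unfold_locales (rule assms(1))
  interpret nL: numfield L by unfold_locales (rule assms(5))
  interpret qK: quartic K
    by unfold_locales (use nK.totally_real_positive[OF assms(3)] nK.card_B assms(2) in auto)
  obtain \<phi> where \<phi>: "bij_betw \<phi> (trace_zero_integers K) (trace_zero_integers L)"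
    "\<forall>x\<in>trace_zero_integers K. \<forall>y\<in>trace_zero_integers K. \<phi> (x + y) = \<phi> x + \<phi> y"
    "\<forall>x\<in>trace_zero_integers K. \<forall>y\<in>trace_zero_integers K. field_trace L (\<phi> x * \<phi> y) = field_trace K (x * y)"
    using assms(7) unfolding isometric_def trace_form_def by blast
  interpret LI: lattice_isometry K L \<phi> by unfold_locales (use \<phi> in auto)
  interpret qL: quartic L by (rule LI.quartic_L)
  interpret I: isometric_quartics K L LI.\<Phi> by unfold_locales (rule LI.trace_isometry_\<Phi>(1))
  interpret J: isometric_quartics K L I.\<Psi> by unfold_locales (rule I.trace_isometry_\<Psi>)
  obtain f where f: "f \<in> integers_of K" "field_trace K f = 1" using qK.exists_trace_one[OF qK.fundamental_odd_trace[OF assms(4)]] by blast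
  obtain g where g: "g \<in> integers_of L" "field_trace L g = 1" using qL.exists_trace_one[OF qL.tame_odd_trace[OF assms(6)]] by blast
  have "field_discriminant K mod 4 = 1 \<and> squarefree (field_discriminant K)"
    using assms(4) unfolding fundamental_discriminant_def
  proof
    assume "\<exists>m. field_discriminant K = 4 * m \<and> squarefree m \<and> m mod 4 \<in> {2, 3}"
    then obtain m where m: "field_discriminant K = 4 * m" "m mod 4 \<in> {2, 3}" by blast
    have "m mod 4 \<in> {0, 1}" by (rule I.even_discriminant[OF LI.trace_isometry_\<Phi>(2) f g assms(6) m(1)])
    then show ?thesis using m(2) by auto
  qed
  then have D: "field_discriminant K mod 4 = 1" "squarefree (field_discriminant K)" by blast+
  show ?thesis using I.alignment[OF LI.trace_isometry_\<Phi>(2) f g D(1)]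
  proof
    assume "LI.\<Phi> ` integers_of K = integers_of L"
    then show ?thesis using D(2) by (rule I.isomorphic)
  next
    assume "I.\<Psi> ` integers_of K = integers_of L"
    then show ?thesis using D(2) by (rule J.isomorphic)
  qed
qed

end
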